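(* Let $\alpha\in(0,1)$ be irrational, $p_\ell=\ell^{-\alpha}$ for $\ell>1$ and $p_1=2^{-\alpha}$. For $n\ge1$ let $\mathcal M^1_n=([n],R,S)$ where $R$ is the random graph on $[n]=\{1,\dots,n\}$ in which each pair $\{i,j\}$, $i\neq j$, is an edge independently with probability $p_{|i-j|}$, and $S=\{(\ell,\ell+1):1\le\ell<n\}$ is the successor relation. Then the convergence law holds: for every first-order sentence $\varphi$ in the vocabulary $\{R,S\}$ (two binary relation symbols), the limit $\lim_{n\to\infty}\Pr(\mathcal M^1_n\models\varphi)$ exists. *)

theory Defs
  imports "HOL-Probability.Probability" "HOL-Probability.Product_PMF"
begin

text \<open>First-order logic with equality over two binary relation symbols, with variables named
  by natural numbers. The remaining connectives and the universal quantifier are derivable.\<close>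

datatype fm =
    EqAt nat nat
  | RAt nat nat
  | SAt nat nat
  | Neg fm
  | Conj fm fm
  | Exi nat fm

fun free_vars :: "fm \<Rightarrow> nat set" where
  "free_vars (EqAt x y) = {x, y}"
| "free_vars (RAt x y) = {x, y}"
| "free_vars (SAt x y) = {x, y}"
| "free_vars (Neg f) = free_vars f"
| "free_vars (Conj f g) = free_vars f \<union> free_vars g"
| "free_vars (Exi x f) = free_vars f - {x}"

definition sentence :: "fm \<Rightarrow> bool" where
  "sentence f \<longleftrightarrow> free_vars f = {}"

record 'a struct =
  univ :: "'a set"
  rel_R :: "('a \<times> 'a) set"
  rel_S :: "('a \<times> 'a) set"

fun sat :: "'a struct \<Rightarrow> (nat \<Rightarrow> 'a) \<Rightarrow> fm \<Rightarrow> bool" where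
  "sat M v (EqAt x y) \<longleftrightarrow> v x = v y"
| "sat M v (RAt x y) \<longleftrightarrow> (v x, v y) \<in> rel_R M"
| "sat M v (SAt x y) \<longleftrightarrow> (v x, v y) \<in> rel_S M"
| "sat M v (Neg f) \<longleftrightarrow> \<not> sat M v f"
| "sat M v (Conj f g) \<longleftrightarrow> sat M v f \<and> sat M v g"
| "sat M v (Exi x f) \<longleftrightarrow> (\<exists>a\<in>univ M. sat M (v(x := a)) f)"

text \<open>For a sentence and a nonempty universe the choice of assignment is immaterial.\<close>

definition models :: "'a struct \<Rightarrow> fm \<Rightarrow> bool" (infix "\<Turnstile>" 50) where
  "M \<Turnstile> f \<longleftrightarrow> (\<forall>v. range v \<subseteq> univ M \<longrightarrow> sat M v f)"

definition edge_prob :: "real \<Rightarrow> nat \<Rightarrow> real" where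
  "edge_prob \<alpha> l = (if l = 1 then 2 powr (-\<alpha>) else real l powr (-\<alpha>))"

text \<open>An unordered pair of distinct elements of \<open>[n]\<close> is coded as \<open>(i, j)\<close> with \<open>i < j\<close>.\<close>

definition vertex_pairs :: "nat \<Rightarrow> (nat \<times> nat) set" where
  "vertex_pairs n = {(i, j). 1 \<le> i \<and> i < j \<and> j \<le> n}"

definition edge_indicators :: "real \<Rightarrow> nat \<Rightarrow> (nat \<times> nat \<Rightarrow> bool) pmf" where
  "edge_indicators \<alpha> n =
     Pi_pmf (vertex_pairs n) False (\<lambda>(i, j). bernoulli_pmf (edge_prob \<alpha> (j - i)))"

definition struct_of :: "nat \<Rightarrow> (nat \<times> nat \<Rightarrow> bool) \<Rightarrow> nat struct" where
  "struct_of n w =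
     \<lparr> univ = {1..n},
       rel_R = {(i, j). (i, j) \<in> vertex_pairs n \<and> w (i, j) \<or> (j, i) \<in> vertex_pairs n \<and> w (j, i)},
       rel_S = {(l, l + 1) | l. 1 \<le> l \<and> l < n} \<rparr>"

definition random_M1 :: "real \<Rightarrow> nat \<Rightarrow> nat struct pmf" where
  "random_M1 \<alpha> n = map_pmf (struct_of n) (edge_indicators \<alpha> n)"

end

theory Submission
  imports Defs "HOL-Real_Asymp.Real_Asymp"
begin

text \<open>
  Label the vertices of a finite set \<open>V\<close> by natural numbers so that neighbours in the successor
  relation get the same label; the weight of the labelling is the number of nonzero labels minus
  \<open>\<alpha>\<close> times the number of edges joining different labels (a symmetric relation lists each edge twice,
  hence the factor \<open>\<alpha> / 2\<close> below). An extension \<open>V\<close> of \<open>X\<close> is rigid if every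
  nonzero labelling of \<open>V\<close> vanishing on \<open>X\<close> has negative weight, and \<open>cl R U m X\<close> is the union of all rigid
  extensions of \<open>X\<close> by at most \<open>m\<close> vertices. As \<open>\<alpha>\<close> is irrational, weights are nonzero.

  An edge of length \<open>l\<close> has probability about \<open>l powr (-\<alpha>)\<close>, so summing over positions scale by scale shows
  that rigid extensions reaching distance \<open>s\<close> from \<open>X\<close> occur with probability \<open>O(s powr (-\<epsilon>))\<close>: closures
  are local. On the other hand, every pattern all of whose parts have positive weight over the base is
  realised, without creating new closure, around every base of bounded size, with probability tending
  to 1. The failure probability must beat the polynomially many bases; this comes from a second
  moment argument in polynomially many independent blocks, together with a high moment bound on the number of
  copies spoilt by an unwanted rigid extension.

  If the extension axioms hold, Duplicator wins the Ehrenfeucht-Fraisse game by keeping the closures of the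
  chosen tuples equivalent. Hence the truth of a sentence is decided by the closure of the two end points. Up to small
  probability this closure lives within bounded distance of the ends, where the law of the graph does not depend on
  \<open>n\<close>, so the probabilities form a Cauchy sequence.
\<close>

section \<open>Ehrenfeucht-Fraisse games\<close>

text \<open>The successor relation is the main obstacle. Successor neighbours always carry equal
  labels, so they extend every set rigidly and for free: whatever copy of a pattern is placed in the
  graph, its closure grows along the successor relation into vertices that were never chosen. Hence
  \<open>realizes\<close> tolerates runs of extra vertices hanging on a copy, and
  \<open>cl_placed\<close> removes them by comparison with the graph from which the pattern was read
  off. There both neighbours must exist, which is why the two end points belong to every position of
  the game.

  Closures have bounded depth but no bounded size, so a pattern cannot be read off a closure
  directly. Each piece of the closure is replaced by one of finitely many representatives of its
  type for a suitable number of rounds. This is the origin of the size bound \<open>N\<close> in the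
  extension axioms, and the reason why closures are compared by games rather than by isomorphisms.

  The exponent \<epsilon> in the bound on rigid extensions must not depend on the size of the base,
  because the moment method conditions on a vertex set whose size depends on \<epsilon>.\<close>

type_synonym edges = "(nat \<times> nat) set"

text \<open>Successor is read off the numbers instead of being a component of the structure, so
  every set of numbers with a graph is a structure and passing to a subset needs no restriction
  operator.\<close>

definition piso :: "edges => edges => edges => bool" where
 "piso R R' P \<longleftrightarrow> (\<forall>a b c d. (a, b) : P --> (c, d) : P -->
  (a = c \<longleftrightarrow> b = d) & ((a, c) : R \<longleftrightarrow> (b, d) : R') & (c = Suc a \<longleftrightarrow> d = Suc b))"

text \<open>A position is a relation, not a pair of tuples, so that positions can be cut down to
  parts, enlarged and composed by set operations.\<close>

fun ef :: "nat => nat set => edges => nat set => edges => edges => bool" where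
 "ef 0 U R U' R' P \<longleftrightarrow> P \<subseteq> U \<times> U' & piso R R' P"
| "ef (Suc q) U R U' R' P \<longleftrightarrow> P \<subseteq> U \<times> U' & piso R R' P &
  (\<forall>a\<in>U. \<exists>b\<in>U'. ef q U R U' R' (insert (a, b) P)) &
  (\<forall>b\<in>U'. \<exists>a\<in>U. ef q U R U' R' (insert (a, b) P))"

lemma pisoD:
 assumes "piso R R' P" "(a, b) : P" "(c, d) : P"
 shows "a = c \<longleftrightarrow> b = d" "(a, c) : R \<longleftrightarrow> (b, d) : R'" "c = Suc a \<longleftrightarrow> d = Suc b"
 using assms unfolding piso_def by simp_all

lemma piso_subset: "piso R R' P ==> P' \<subseteq> P ==> piso R R' P'"
 unfolding piso_def by blast

lemma ef_basic: "ef q U R U' R' P ==> P \<subseteq> U \<times> U' & piso R R' P"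
 by (cases q) auto

lemma ef_forth: "ef (Suc q) U R U' R' P ==> a : U ==> \<exists>b\<in>U'. ef q U R U' R' (insert (a, b) P)"
 by simp

lemma ef_back: "ef (Suc q) U R U' R' P ==> b : U' ==> \<exists>a\<in>U. ef q U R U' R' (insert (a, b) P)"
 by simp

lemma ef_subset: "ef q U R U' R' P ==> P' \<subseteq> P ==> ef q U R U' R' P'"
proof (induction q arbitrary: P P')
 case 0
 thus ?case by (auto intro: piso_subset)
next
 case (Suc q)
 have "\<exists>b\<in>U'. ef q U R U' R' (insert (a, b) P')" if "a : U" for a
  using ef_forth[OF Suc.prems(1) that] Suc.IH Set.insert_mono[OF Suc.prems(2)] by metis
 moreover have "\<exists>a\<in>U. ef q U R U' R' (insert (a, b) P')" if "b : U'" for b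
  using ef_back[OF Suc.prems(1) that] Suc.IH Set.insert_mono[OF Suc.prems(2)] by metis
 ultimately show ?case
  using Suc.prems by (auto intro: piso_subset)
qed

lemma ef_mono: "ef (q + k) U R U' R' P ==> ef q U R U' R' P"
proof (induction q arbitrary: P)
 case 0
 thus ?case using ef_basic by fastforce
next
 case (Suc q)
 thus ?case by simp (meson Suc.IH)
qed

lemma ef_le: "ef q U R U' R' P ==> q' <= q ==> ef q' U R U' R' P"
 using ef_mono le_add_diff_inverse by metis

lemma piso_converse: "piso R R' P ==> piso R' R (P\<inverse>)"
 unfolding piso_def by fastforce

lemma ef_converse: "ef q U R U' R' P ==> ef q U' R' U R (P\<inverse>)"
proof (induction q arbitrary: P)
 case 0
 thus ?case by (auto intro: piso_converse)
next
 case (Suc q)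
 have ins: "insert (b, a) (P\<inverse>) = (insert (a, b) P)\<inverse>" for a b by auto
 show ?case
  using Suc.prems by (auto simp: ins intro: piso_converse) (meson Suc.IH)+
qed

lemma ef_of_iso:
 assumes "bij_betw f U U'"
  and "!!a c. a : U ==> c : U ==> (a, c) : R \<longleftrightarrow> (f a, f c) : R'"
  and "!!a c. a : U ==> c : U ==> c = Suc a \<longleftrightarrow> f c = Suc (f a)"
  and "P \<subseteq> (%a. (a, f a)) ` U"
 shows "ef q U R U' R' P"
 using assms(4)
proof (induction q arbitrary: P)
 have sub: "P \<subseteq> U \<times> U' & piso R R' P" if "P \<subseteq> (%a. (a, f a)) ` U" for P
 proof
  show "P \<subseteq> U \<times> U'" using that assms(1) unfolding bij_betw_def by auto
  have "piso R R' ((%a. (a, f a)) ` U)"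
   unfolding piso_def using assms(1-3) unfolding bij_betw_def by (auto simp: inj_on_eq_iff)
  thus "piso R R' P" using that piso_subset by blast
 qed
 { case 0 thus ?case using sub by simp }
 case (Suc q)
 have "\<exists>b\<in>U'. ef q U R U' R' (insert (a, b) P)" if "a : U" for a
  using Suc.IH[of "insert (a, f a) P"] Suc.prems that assms(1) unfolding bij_betw_def by blast
 moreover have "\<exists>a\<in>U. ef q U R U' R' (insert (a, b) P)" if b: "b : U'" for b
 proof -
  obtain a where "a : U" "b = f a" using b assms(1) unfolding bij_betw_def by blast
  thus ?thesis using Suc.IH[of "insert (a, f a) P"] Suc.prems by blast
 qed
 ultimately show ?case using sub[OF Suc.prems] by simp
qed

fun qrank :: "fm => nat" where
 "qrank (EqAt x y) = 0"
| "qrank (RAt x y) = 0"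
| "qrank (SAt x y) = 0"
| "qrank (Neg f) = qrank f"
| "qrank (Conj f g) = max (qrank f) (qrank g)"
| "qrank (Exi x f) = Suc (qrank f)"

text \<open>Each quantifier costs one round, so \<open>q\<close> rounds suffice for quantifier rank
  at most \<open>q\<close>. This is the bridge from logic to games; formulas do not occur again
  before \<open>convergence\<close>.\<close>

lemma ef_sat:
 assumes "ef q (univ M) (rel_R M) (univ M') (rel_R M') P" "qrank \<phi> <= q"
  and "!!a b. a : univ M ==> b : univ M ==> (a, b) : rel_S M \<longleftrightarrow> b = Suc a"
  and "!!a b. a : univ M' ==> b : univ M' ==> (a, b) : rel_S M' \<longleftrightarrow> b = Suc a"
  and "!!x. x : free_vars \<phi> ==> (v x, w x) : P"
 shows "sat M v \<phi> \<longleftrightarrow> sat M' w \<phi>"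
 using assms(1,2,5)
proof (induction \<phi> arbitrary: q P v w)
 case (EqAt x y)
 hence "(v x, w x) : P" "(v y, w y) : P" by auto
 thus ?case using pisoD(1)[of "rel_R M" "rel_R M'" P] ef_basic[OF EqAt.prems(1)] by simp
next
 case (RAt x y)
 hence "(v x, w x) : P" "(v y, w y) : P" by auto
 thus ?case using pisoD(2)[of "rel_R M" "rel_R M'" P] ef_basic[OF RAt.prems(1)] by simp
next
 case (SAt x y)
 have P: "(v x, w x) : P" "(v y, w y) : P" using SAt.prems(3) by auto
 hence "v x : univ M" "v y : univ M" "w x : univ M'" "w y : univ M'"
  using ef_basic[OF SAt.prems(1)] by blast+
 moreover have "v y = Suc (v x) \<longleftrightarrow> w y = Suc (w x)"
  using ef_basic[OF SAt.prems(1)] pisoD(3) P by blast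
 ultimately show ?case using assms(3,4) by simp
next
 case (Neg \<phi>)
 thus ?case by simp
next
 case (Conj \<phi>1 \<phi>2)
 thus ?case by simp (metis UnCI)
next
 case (Exi x \<phi>)
 obtain q' where q: "q = Suc q'" "qrank \<phi> <= q'" using Exi.prems(2) by (cases q) auto
 have step: "sat M (v(x := a)) \<phi> \<longleftrightarrow> sat M' (w(x := b)) \<phi>"
  if "ef q' (univ M) (rel_R M) (univ M') (rel_R M') (insert (a, b) P)" for a b
  by (rule Exi.IH[OF that q(2)]) (use Exi.prems(3) in auto)
 show ?case
  using ef_forth[OF Exi.prems(1)[unfolded q(1)]] ef_back[OF Exi.prems(1)[unfolded q(1)]] step
  by simp metis
qed

text \<open>Duplicator follows the strategy of the large game. Each answer falls on the right side
  because \<open>s\<close> rounds are still in reserve and suffice to tell members of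
  \<open>B\<close> from nonmembers. It is applied with closures as \<open>B\<close> and
  \<open>B'\<close>.\<close>

lemma ef_relativize:
 assumes "ef (q + s) U R U' R' P" "B \<subseteq> U" "B' \<subseteq> U'" "P0 \<subseteq> P" "P0 \<subseteq> B \<times> B'"
  and "!!P' a b. P \<subseteq> P' ==> ef s U R U' R' P' ==> (a, b) : P' ==> a : B \<longleftrightarrow> b : B'"
 shows "ef q B R B' R' P0"
 using assms(1,4-)
proof (induction q arbitrary: P P0)
 case 0
 thus ?case using ef_basic piso_subset by (metis ef.simps(1))
next
 case (Suc q)
 have "\<exists>b\<in>B'. ef q B R B' R' (insert (a, b) P0)" if aB: "a : B" for a
 proof -
  obtain b where b: "b : U'" "ef (q + s) U R U' R' (insert (a, b) P)"
   using ef_forth[of "q + s"] Suc.prems(1) aB assms(2) by (metis add_Suc subset_eq)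
  have "ef s U R U' R' (insert (a, b) P)" using ef_le[OF b(2)] by simp
  hence bB: "b : B'" using Suc.prems(4) aB by blast
  have "ef q B R B' R' (insert (a, b) P0)"
   by (rule Suc.IH[OF b(2)]) (use Suc.prems bB aB in \<open>blast+\<close>)
  thus ?thesis using bB by blast
 qed
 moreover have "\<exists>a\<in>B. ef q B R B' R' (insert (a, b) P0)" if bB: "b : B'" for b
 proof -
  obtain a where a: "a : U" "ef (q + s) U R U' R' (insert (a, b) P)"
   using ef_back[of "q + s"] Suc.prems(1) bB assms(3) by (metis add_Suc subset_eq)
  have "ef s U R U' R' (insert (a, b) P)" using ef_le[OF a(2)] by simp
  hence aB: "a : B" using Suc.prems(4) bB by blast
  have "ef q B R B' R' (insert (a, b) P0)"
   by (rule Suc.IH[OF a(2)]) (use Suc.prems aB bB in \<open>blast+\<close>)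
  thus ?thesis using aB by blast
 qed
 moreover have "piso R R' P0" using ef_basic[OF Suc.prems(1)] piso_subset Suc.prems(2) by blast
 moreover have "P0 \<subseteq> B \<times> B'" using Suc.prems(3) .
 ultimately show ?case by simp
qed

lemma ef_extend:
 assumes "ef (q + k) U R U' R' P" "finite F" "F \<subseteq> U" "card F <= k"
 shows "\<exists>P'. P \<subseteq> P' & ef q U R U' R' P' & fst ` P' = fst ` P Un F"
 using assms(2,1,3,4)
proof (induction F arbitrary: k P rule: finite_induct)
 case empty
 thus ?case using ef_mono by auto
next
 case (insert a F)
 then obtain k' where k: "k = Suc k'" "card F <= k'" by (cases k) auto
 obtain b where b: "ef (q + k') U R U' R' (insert (a, b) P)"
  using ef_forth[of "q + k'"] insert.prems(1,2) k by auto
 obtain P' where "insert (a, b) P \<subseteq> P'" "ef q U R U' R' P'" "fst ` P' = fst ` (insert (a, b) P) Un F"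
  using insert.IH[OF b _ k(2)] insert.prems(2) by blast
 thus ?case by (intro exI[of _ P']) auto
qed

text \<open>Duplicator answers in the part in which Spoiler moved, by the strategy for that part.
  This is consistent since edges between parts only join points of \<open>P0\<close>, which are
  already on the board, and no successor step leads from one part to another.\<close>

lemma ef_parts:
 fixes A A' :: "'i => nat set"
 assumes "!!c. c : I ==> ef q (A c) R (A' c) R' (P Int (A c \<times> A' c))"
  and "P \<subseteq> (\<Union>c\<in>I. A c \<times> A' c)"
  and P0: "P0 \<subseteq> P" "piso R R' P0"
  and disj: "!!c d. c : I ==> d : I ==> c ~= d ==> A c Int A d = {}"
   "!!c d. c : I ==> d : I ==> c ~= d ==> A' c Int A' d = {}"
  and succ: "!!c d a b. c : I ==> d : I ==> c ~= d ==> a : A c ==> b : A d ==> b ~= Suc a"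
   "!!c d a b. c : I ==> d : I ==> c ~= d ==> a : A' c ==> b : A' d ==> b ~= Suc a"
  and cross: "!!c d a b. c : I ==> d : I ==> c ~= d ==> a : A c ==> b : A d ==> (a, b) : R ==>
    a : fst ` P0 & b : fst ` P0"
   "!!c d a b. c : I ==> d : I ==> c ~= d ==> a : A' c ==> b : A' d ==> (a, b) : R' ==>
    a : snd ` P0 & b : snd ` P0"
 shows "ef q (\<Union>c\<in>I. A c) R (\<Union>c\<in>I. A' c) R' P"
 using assms(1-3)
proof (induction q arbitrary: P)
 have part: "piso R R' P" if efs: "!!c. c : I ==> piso R R' (P Int (A c \<times> A' c))"
  and sub: "P \<subseteq> (\<Union>c\<in>I. A c \<times> A' c)" and P0P: "P0 \<subseteq> P" for P
  unfolding piso_def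
 proof (clarify)
  fix a b a' b' assume ab: "(a, b) : P" "(a', b') : P"
  obtain c c' where c: "c : I" "a : A c" "b : A' c" "c' : I" "a' : A c'" "b' : A' c'"
   using ab sub by blast
  show "(a = a' \<longleftrightarrow> b = b') & ((a, a') : R \<longleftrightarrow> (b, b') : R') & (a' = Suc a \<longleftrightarrow> b' = Suc b)"
  proof (cases "c = c'")
   case True
   thus ?thesis using pisoD[OF efs[OF c(1)], of a b a' b'] ab c by blast
  next
   case False
   have ne: "a ~= a'" "b ~= b'" using disj[OF c(1,4) False] c by blast+
   \<comment> \<open>Distinct parts are disjoint and \<open>P\<close> is one-to-one on each, so a
     pair of \<open>P\<close> with one coordinate occurring in \<open>P0\<close> lies in
     \<open>P0\<close> itself. An edge between parts, on either side, is thus an edge between pairs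
     of \<open>P0\<close>.\<close>
   have img: "x : fst ` P0 \<longleftrightarrow> (x, y) : P0" "y : snd ` P0 \<longleftrightarrow> (x, y) : P0"
    if xy: "(x, y) : P" for x y
   proof -
    obtain e where e: "e : I" "x : A e" "y : A' e" using xy sub by blast
    { fix y2 assume "(x, y2) : P0"
     then obtain e2 where e2: "e2 : I" "x : A e2" "y2 : A' e2" using sub P0P by blast
     hence "e2 = e" using disj(1) e by blast
     hence "y2 = y" using pisoD(1)[OF efs[OF e(1)], of x y x y2] xy e e2 \<open>(x, y2) : P0\<close> P0P by blast }
    thus "x : fst ` P0 \<longleftrightarrow> (x, y) : P0" by force
    { fix x2 assume "(x2, y) : P0"
     then obtain e2 where e2: "e2 : I" "x2 : A e2" "y : A' e2" using sub P0P by blast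
     hence "e2 = e" using disj(2) e by blast
     hence "x2 = x" using pisoD(1)[OF efs[OF e(1)], of x y x2 y] xy e e2 \<open>(x2, y) : P0\<close> P0P by blast }
    thus "y : snd ` P0 \<longleftrightarrow> (x, y) : P0" by force
   qed
   have "(a, a') : R \<longleftrightarrow> (b, b') : R'"
   proof
    assume "(a, a') : R"
    hence "(a, b) : P0" "(a', b') : P0" using cross(1)[OF c(1,4) False c(2,5)] img ab by blast+
    thus "(b, b') : R'" using pisoD(2)[OF P0(2)] \<open>(a, a') : R\<close> by blast
   next
    assume "(b, b') : R'"
    hence "(a, b) : P0" "(a', b') : P0" using cross(2)[OF c(1,4) False c(3,6)] img ab by blast+
    thus "(a, a') : R" using pisoD(2)[OF P0(2)] \<open>(b, b') : R'\<close> by blast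
   qed
   thus ?thesis using ne succ(1)[OF c(1,4) False c(2,5)] succ(2)[OF c(1,4) False c(3,6)] by blast
  qed
 qed
 { case 0
  have "piso R R' P" by (rule part[OF _ 0(2,3)]) (use ef_basic[OF 0(1)] in blast)
  thus ?case using 0(2) by auto }
 case (Suc q)
 have base: "P \<subseteq> (\<Union>c\<in>I. A c) \<times> (\<Union>c\<in>I. A' c)" "piso R R' P"
  using Suc.prems(2) part[OF _ Suc.prems(2,3)] ef_basic[OF Suc.prems(1)] by blast+
 have other: "insert (a, b) P Int (A d \<times> A' d) = P Int (A d \<times> A' d)"
  if "c : I" "d : I" "d ~= c" "a : A c" for a b c d
  using disj(1)[of c d] that by blast
 have step: "ef q (\<Union>c\<in>I. A c) R (\<Union>c\<in>I. A' c) R' (insert (a, b) P)"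
  if c: "c : I" "a : A c" "b : A' c" and e: "ef q (A c) R (A' c) R' (insert (a, b) (P Int (A c \<times> A' c)))" for a b c
 proof (rule Suc.IH)
  fix d assume d: "d : I"
  show "ef q (A d) R (A' d) R' (insert (a, b) P Int (A d \<times> A' d))"
  proof (cases "d = c")
   case True
   thus ?thesis using e c by auto
  next
   case False
   thus ?thesis using other[OF c(1) d False c(2)] Suc.prems(1)[OF d] ef_mono[of q 1] by simp
  qed
 qed (use Suc.prems c in blast)+
 have "\<exists>b\<in>\<Union>c\<in>I. A' c. ef q (\<Union>c\<in>I. A c) R (\<Union>c\<in>I. A' c) R' (insert (a, b) P)" if aU: "a : (\<Union>c\<in>I. A c)" for a
 proof -
  obtain c where c: "c : I" "a : A c" using aU by blast
  obtain b where "b : A' c" "ef q (A c) R (A' c) R' (insert (a, b) (P Int (A c \<times> A' c)))"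
   using ef_forth[OF Suc.prems(1)[OF c(1)] c(2)] by blast
  thus ?thesis using step c by blast
 qed
 moreover have "\<exists>a\<in>\<Union>c\<in>I. A c. ef q (\<Union>c\<in>I. A c) R (\<Union>c\<in>I. A' c) R' (insert (a, b) P)" if bU: "b : (\<Union>c\<in>I. A' c)" for b
 proof -
  obtain c where c: "c : I" "b : A' c" using bU by blast
  obtain a where "a : A c" "ef q (A c) R (A' c) R' (insert (a, b) (P Int (A c \<times> A' c)))"
   using ef_back[OF Suc.prems(1)[OF c(1)] c(2)] by blast
  thus ?thesis using step c by blast
 qed
 ultimately show ?case using base by simp
qed

section \<open>Types of finite rank\<close>

definition atp :: "edges => nat list => (nat \<times> nat \<times> nat) set" where
 "atp R xs = {(i, j, k). i < length xs & j < length xs &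
  (k = 0 & xs ! i = xs ! j \<or> k = 1 & (xs ! i, xs ! j) : R \<or> k = 2 & xs ! j = Suc (xs ! i))}"

text \<open>The Hintikka type of rank \<open>q\<close> of a tuple, coded as a number so that types
  over different vertex sets can be compared and counted.\<close>

fun tp :: "nat => nat set => edges => nat list => nat" where
 "tp 0 U R xs = set_encode (to_nat ` atp R xs)"
| "tp (Suc q) U R xs = prod_encode (set_encode (to_nat ` atp R xs), set_encode ((%a. tp q U R (xs @ [a])) ` U))"

lemma atp_sub: "atp R xs \<subseteq> {..<length xs} \<times> {..<length xs} \<times> {..<3}"
 unfolding atp_def by auto

lemma finite_atp: "finite (atp R xs)"
 by (rule finite_subset[OF atp_sub]) auto

text \<open>A type of rank \<open>Suc q\<close> is an atomic type together with a set of types of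
  rank \<open>q\<close> of tuples one longer, so finiteness passes from rank to rank although the
  structures are unbounded.\<close>

lemma finite_tp: "finite {tp q U R xs | U R xs. finite U & length xs = r}"
proof (induction q arbitrary: r)
 have A: "finite ((%A. set_encode (to_nat ` A)) ` Pow ({..<r} \<times> {..<r} \<times> {..<3::nat}))" for r :: nat
  by auto
 { case 0
  show ?case by (rule finite_subset[OF _ A[of r]]) (use atp_sub in fastforce) }
 case (Suc q)
 let ?T = "{tp q U R xs | U R xs. finite U & length xs = Suc r}"
 have "finite (prod_encode ` (((%A. set_encode (to_nat ` A)) ` Pow ({..<r} \<times> {..<r} \<times> {..<3::nat})) \<times> (set_encode ` Pow ?T)))"
  using A[of r] Suc.IH[of "Suc r"] by (intro finite_imageI finite_cartesian_product) auto
 thus ?case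
  by (rule finite_subset[rotated]) (use atp_sub in \<open>fastforce\<close>)
qed

lemma piso_of_atp:
 assumes "atp R xs = atp R' ys" "length xs = length ys"
 shows "piso R R' (set (zip xs ys))"
proof -
 have *: "(xs ! i = xs ! j \<longleftrightarrow> ys ! i = ys ! j) & ((xs ! i, xs ! j) : R \<longleftrightarrow> (ys ! i, ys ! j) : R') &
  (xs ! j = Suc (xs ! i) \<longleftrightarrow> ys ! j = Suc (ys ! i))" if "i < length xs" "j < length xs" for i j
 proof -
  have "(i, j, k) : atp R xs \<longleftrightarrow> (i, j, k) : atp R' ys" for k using assms(1) by simp
  from this[of 0] this[of 1] this[of 2] show ?thesis using that assms(2) by (simp add: atp_def)
 qed
 show ?thesis unfolding piso_def using * assms(2) by (auto simp: set_zip)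
qed

lemma ef_of_tp:
 assumes "tp q U R xs = tp q U' R' ys" "length xs = length ys" "set xs \<subseteq> U" "set ys \<subseteq> U'" "finite U" "finite U'"
 shows "ef q U R U' R' (set (zip xs ys))"
 using assms(1-4)
proof (induction q arbitrary: xs ys)
 have sub: "set (zip xs ys) \<subseteq> U \<times> U'" if "set xs \<subseteq> U" "set ys \<subseteq> U'" for xs ys
  using that by (auto dest: set_zip_leftD set_zip_rightD)
 have at: "atp R xs = atp R' ys" if "set_encode (to_nat ` atp R xs) = set_encode (to_nat ` atp R' ys)" for xs ys
  using that by (simp add: set_encode_eq finite_atp inj_image_eq_iff)
 { case 0
  thus ?case using sub piso_of_atp at by simp }
 case (Suc q)
 have 1: "atp R xs = atp R' ys" using Suc.prems(1) at by simp
 have 2: "(%a. tp q U R (xs @ [a])) ` U = (%a. tp q U' R' (ys @ [a])) ` U'"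
  using Suc.prems(1) assms(5,6) by (simp add: set_encode_eq)
 have ext: "ef q U R U' R' (insert (a, b) (set (zip xs ys)))"
  if "a : U" "b : U'" "tp q U R (xs @ [a]) = tp q U' R' (ys @ [b])" for a b
  using Suc.IH[OF that(3)] Suc.prems that by simp
 have "\<exists>b\<in>U'. ef q U R U' R' (insert (a, b) (set (zip xs ys)))" if "a : U" for a
 proof -
  have "tp q U R (xs @ [a]) : (%a. tp q U' R' (ys @ [a])) ` U'" using 2 that by blast
  thus ?thesis using ext that by blast
 qed
 moreover have "\<exists>a\<in>U. ef q U R U' R' (insert (a, b) (set (zip xs ys)))" if "b : U'" for b
 proof -
  have "tp q U' R' (ys @ [b]) : (%a. tp q U R (xs @ [a])) ` U" using 2 that by blast
  thus ?thesis using ext that by (metis (no_types, lifting) imageE)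
 qed
 ultimately show ?case using sub[OF Suc.prems(3,4)] piso_of_atp[OF 1 Suc.prems(2)] by simp
qed

section \<open>Weights and rigid extensions\<close>

definition compat :: "nat set => (nat => nat) => bool" where
 "compat V l \<longleftrightarrow> (\<forall>u\<in>V. Suc u : V --> l u = l (Suc u))"

definition classes :: "nat set => (nat => nat) => nat set" where
 "classes V l = l ` V - {0}"

definition cross :: "edges => nat set => (nat => nat) => edges" where
 "cross R V l = {(u, v). (u, v) : R & u : V & v : V & l u ~= l v}"

lemma finite_cross [simp]: "finite V ==> finite (cross R V l)"
 by (rule finite_subset[of _ "V \<times> V"]) (auto simp: cross_def)

lemma finite_classes [simp]: "finite V ==> finite (classes V l)"
 by (simp add: classes_def)

lemma compat_subset: "compat V l ==> V' \<subseteq> V ==> compat V' l"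
 unfolding compat_def by blast

lemma compat_cong: "(!!v. v : V ==> l v = l' v) ==> compat V l = compat V l'"
 unfolding compat_def by simp

locale irrational_exponent =
 fixes \<alpha> :: real
 assumes alpha: "0 < \<alpha>" "\<alpha> < 1" "\<alpha> ~: \<rat>"
begin

definition wt :: "edges => nat set => (nat => nat) => real" where
 "wt R V l = real (card (classes V l)) - \<alpha> / 2 * real (card (cross R V l))"

definition rigid :: "edges => nat set => nat set => bool" where
 "rigid R X V \<longleftrightarrow> finite V & X \<subseteq> V &
  (\<forall>l. compat V l --> (\<forall>x\<in>X. l x = 0) --> (\<exists>v\<in>V. l v ~= 0) --> wt R V l < 0)"

definition cl :: "edges => nat set => nat => nat set => nat set" where
 "cl R U m X = \<Union>{V. V \<subseteq> U & rigid R X V & card (V - X) <= m}"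

text \<open>If \<open>b\<close> and \<open>b'\<close> differed, \<alpha> would be a quotient of
  integers. Irrationality enters here: a weight determines both the number of classes and the number
  of crossing edges, which \<open>zero_loss\<close> exploits.\<close>

lemma comb_eq:
 assumes "real a - \<alpha> / 2 * real b = real a' - \<alpha> / 2 * real b'"
 shows "a = a'" "b = b'"
proof -
 have "b = b'"
 proof (rule ccontr)
  assume "b ~= b'"
  hence "\<alpha> = (2 * (real a - real a')) / (real b - real b')"
   using assms by (simp add: field_simps)
  also have "... : \<rat>" by simp
  finally show False using alpha(3) by simp
 qed
 thus "b = b'" "a = a'" using assms by auto
qed

lemma comb_zero: "real a - \<alpha> / 2 * real b = 0 ==> a = 0 & b = 0"
 using comb_eq[of a b 0 0] by simp

text \<open>For fixed \<open>a\<close> the values decrease as \<open>b\<close> grows, so the first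
  negative one is the largest. Only the number of classes has to be bounded, not the number of
  edges.\<close>

lemma neg_gap: "\<exists>\<epsilon>>0. \<forall>a\<le>c. \<forall>b. real a - \<alpha> / 2 * real b < 0 --> real a - \<alpha> / 2 * real b <= - \<epsilon>"
proof (induction c)
 have one: "\<exists>\<epsilon>>0. \<forall>b. real a - \<alpha> / 2 * real b < 0 --> real a - \<alpha> / 2 * real b <= - \<epsilon>" for a
 proof -
  define m where "m = nat \<lfloor>real a / (\<alpha> / 2)\<rfloor>"
  have m: "real m <= real a / (\<alpha> / 2)" "real a / (\<alpha> / 2) < real m + 1"
   unfolding m_def using alpha(1) by (auto simp: of_nat_nat)
  have "\<alpha> / 2 * (real m + 1) - real a > 0" using m(2) alpha(1) by (simp add: field_simps)
  moreover have "real a - \<alpha> / 2 * real b <= - (\<alpha> / 2 * (real m + 1) - real a)" if "real a - \<alpha> / 2 * real b < 0" for b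
  proof -
   have "real a / (\<alpha> / 2) < real b" using that alpha(1) by (simp add: field_simps)
   hence "real m < real b" using m(1) by linarith
   hence "real m + 1 <= real b" by simp
   hence "\<alpha> / 2 * (real m + 1) <= \<alpha> / 2 * real b" using alpha(1) by (intro mult_left_mono) auto
   thus ?thesis by simp
  qed
  ultimately show ?thesis by blast
 qed
 { case 0 show ?case using one[of 0] by simp }
 case (Suc c)
 then obtain e1 where e1: "e1 > 0" "\<forall>a\<le>c. \<forall>b. real a - \<alpha> / 2 * real b < 0 --> real a - \<alpha> / 2 * real b <= - e1" by blast
 obtain e2 where e2: "e2 > 0" "\<forall>b. real (Suc c) - \<alpha> / 2 * real b < 0 --> real (Suc c) - \<alpha> / 2 * real b <= - e2"
  using one by blast
 show ?case
 proof (intro exI[of _ "min e1 e2"] conjI allI impI)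
  fix a b assume "a <= Suc c" "real a - \<alpha> / 2 * real b < 0"
  thus "real a - \<alpha> / 2 * real b <= - min e1 e2"
   using e1(2) e2(2) by (cases "a = Suc c") (fastforce simp: le_Suc_eq)+
 qed (use e1 e2 in auto)
qed

lemma classes_cong: "(!!v. v : V ==> l v = l' v) ==> classes V l = classes V l'"
 unfolding classes_def by (metis image_cong)

lemma cross_cong: "(!!v. v : V ==> l v = l' v) ==> cross R V l = cross R V l'"
 unfolding cross_def by auto

lemma wt_cong: "(!!v. v : V ==> l v = l' v) ==> wt R V l = wt R V l'"
 unfolding wt_def using classes_cong[of V l l'] cross_cong[of V l l'] by simp

lemma wt_zero: "(!!v. v : V ==> l v = 0) ==> wt R V l = 0"
proof -
 assume "!!v. v : V ==> l v = 0"
 hence "classes V l = {}" "cross R V l = {}" unfolding classes_def cross_def by auto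
 thus ?thesis by (simp add: wt_def)
qed

lemma rigidI:
 assumes "finite V" "X \<subseteq> V"
  "!!l. compat V l ==> (!!x. x : X ==> l x = 0) ==> \<exists>v\<in>V. l v ~= 0 ==> wt R V l < 0"
 shows "rigid R X V"
 using assms unfolding rigid_def by blast

lemma rigidD:
 assumes "rigid R X V"
 shows "finite V" "X \<subseteq> V"
  "compat V l ==> (!!x. x : X ==> l x = 0) ==> \<exists>v\<in>V. l v ~= 0 ==> wt R V l < 0"
 using assms unfolding rigid_def by blast+

lemma rigid_refl: "finite X ==> rigid R X X"
 by (rule rigidI) auto

text \<open>Merging into label 0 every class that meets \<open>V\<close> leaves exactly the classes
  that avoid \<open>V\<close>. Edges inside \<open>V\<close> no longer cross afterwards, so the
  crossing edges of the two summands are disjoint; edges between merged classes that do not lie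
  inside \<open>V\<close> are dropped, which only helps.\<close>

lemma wt_split:
 assumes "finite U" "V \<subseteq> U" "compat U l"
 defines "l2 \<equiv> %u. if l u : l ` V then 0 else l u"
 shows "wt R U l <= wt R V l + wt R U l2" "compat U l2" "!!v. v : V ==> l2 v = 0"
  "card (classes U l) = card (classes V l) + card (classes U l2)"
  "card (classes U l2) <= card (U - V)"
proof -
 have fV: "finite V" using assms finite_subset by blast
 have cl: "classes U l = classes V l Un classes U l2" "classes V l Int classes U l2 = {}"
  using assms(2) unfolding classes_def l2_def by (auto split: if_splits) (metis image_eqI)
 thus card: "card (classes U l) = card (classes V l) + card (classes U l2)"
  using fV assms(1) by (simp add: card_Un_disjoint)
 have "cross R V l Un cross R U l2 \<subseteq> cross R U l" "cross R V l Int cross R U l2 = {}"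
  using assms(2) unfolding cross_def l2_def by (auto split: if_splits)
 hence "card (cross R V l) + card (cross R U l2) <= card (cross R U l)"
  using fV assms(1) by (metis card_Un_disjoint card_mono finite_cross)
 hence "\<alpha> / 2 * (real (card (cross R V l)) + real (card (cross R U l2))) <= \<alpha> / 2 * real (card (cross R U l))"
  using alpha(1) by (intro mult_left_mono) (auto simp flip: of_nat_add)
 thus "wt R U l <= wt R V l + wt R U l2"
  using card unfolding wt_def by (simp add: algebra_simps)
 show "compat U l2" using assms(3) unfolding compat_def l2_def by simp
 show "!!v. v : V ==> l2 v = 0" by (auto simp: l2_def)
 have "classes U l2 \<subseteq> l ` (U - V)" unfolding classes_def l2_def by auto
 thus "card (classes U l2) <= card (U - V)"
  using assms(1) by (meson card_image_le card_mono finite_Diff finite_imageI le_trans)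
qed

text \<open>The classes avoiding \<open>V\<close> form a labelling that vanishes on
  \<open>V\<close>, so by rigidity they contribute a negative amount or are absent. Along a chain of
  rigid extensions weights can therefore only decrease.\<close>

lemma rigid_wt_mono:
 assumes "rigid R V U" "compat U l"
 shows "wt R U l <= wt R V l"
proof -
 note U = rigidD[OF assms(1)]
 note s = wt_split[OF U(1,2) assms(2)]
 show ?thesis
 proof (cases "\<exists>v\<in>U. (if l v : l ` V then 0 else l v) ~= 0")
  case True
  hence "wt R U (%u. if l u : l ` V then 0 else l u) < 0" using U(3)[OF s(2)] s(3) by simp
  thus ?thesis using s(1)[of R] by linarith
 next
  case False
  thus ?thesis using s(1) wt_zero[of U "%u. if l u : l ` V then 0 else l u"] by fastforce
 qed
qed

lemma rigid_trans:
 assumes "rigid R X V" "rigid R V U"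
 shows "rigid R X U"
proof (rule rigidI)
 note V = rigidD[OF assms(1)] and U = rigidD[OF assms(2)]
 show "finite U" "X \<subseteq> U" using V U by auto
 fix l assume l: "compat U l" "!!x. x : X ==> l x = 0" "\<exists>v\<in>U. l v ~= 0"
 show "wt R U l < 0"
 proof (cases "\<exists>v\<in>V. l v ~= 0")
  case True
  thus ?thesis
   using V(3)[OF compat_subset[OF l(1) U(2)] l(2)] rigid_wt_mono[OF assms(2) l(1)] by fastforce
 next
  case False
  thus ?thesis using U(3)[OF l(1) _ l(3)] by blast
 qed
qed

text \<open>A labelling of \<open>V Un Y\<close> vanishing on \<open>Y\<close> has all its classes
  in \<open>V\<close>, and the points of \<open>Y\<close> can only add crossing edges.\<close>

lemma rigid_base:
 assumes "rigid R X V" "X \<subseteq> Y" "finite Y"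
 shows "rigid R Y (V Un Y)"
proof (rule rigidI)
 note V = rigidD[OF assms(1)]
 show fin: "finite (V Un Y)" "Y \<subseteq> V Un Y" using V assms by auto
 fix l assume l: "compat (V Un Y) l" "!!x. x : Y ==> l x = 0" "\<exists>v\<in>V Un Y. l v ~= 0"
 have "wt R V l < 0"
  by (rule V(3)) (use l compat_subset assms(2) in \<open>auto\<close>)
 moreover have "classes (V Un Y) l = classes V l" using l(2) by (auto simp: classes_def)
 moreover have "card (cross R V l) <= card (cross R (V Un Y) l)"
  using fin(1) by (intro card_mono finite_cross) (auto simp: cross_def)
 moreover have "\<alpha> / 2 * real (card (cross R V l)) <= \<alpha> / 2 * real (card (cross R (V Un Y) l))"
  using alpha(1) calculation(3) by (intro mult_left_mono) auto
 ultimately show "wt R (V Un Y) l < 0"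
  unfolding wt_def by simp
qed

lemma rigid_union:
 assumes "rigid R X V" "rigid R X V'"
 shows "rigid R X (V Un V')"
proof -
 have "rigid R V (V' Un V)" using rigid_base[OF assms(2)] rigidD[OF assms(1)] by blast
 thus ?thesis using rigid_trans[OF assms(1)] by (simp add: Un_commute)
qed

lemma rigid_iso:
 assumes "rigid R X V" "inj_on f V"
  and "!!u v. u : V ==> v : V ==> (u, v) : R \<longleftrightarrow> (f u, f v) : R'"
  and "!!u v. u : V ==> v : V ==> v = Suc u \<longleftrightarrow> f v = Suc (f u)"
 shows "rigid R' (f ` X) (f ` V)"
proof (rule rigidI)
 note V = rigidD[OF assms(1)]
 show "finite (f ` V)" "f ` X \<subseteq> f ` V" using V by auto
 fix l assume l: "compat (f ` V) l" "!!x. x : f ` X ==> l x = 0" "\<exists>v\<in>f ` V. l v ~= 0"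
 have "wt R V (l \<circ> f) < 0"
 proof (rule V(3))
  show "compat V (l \<circ> f)" using l(1) assms(4) unfolding compat_def by (auto, metis image_eqI)
 qed (use l in auto)
 moreover have "classes V (l \<circ> f) = classes (f ` V) l" unfolding classes_def by (simp add: image_comp)
 moreover have "card (cross R V (l \<circ> f)) = card (cross R' (f ` V) l)"
 proof (rule bij_betw_same_card[of "%(u, v). (f u, f v)"])
  have "cross R V (l \<circ> f) \<subseteq> V \<times> V" by (auto simp: cross_def)
  hence "inj_on (%(u, v). (f u, f v)) (cross R V (l \<circ> f))"
   using assms(2) by (auto simp: inj_on_def)
  moreover have "(%(u, v). (f u, f v)) ` cross R V (l \<circ> f) = cross R' (f ` V) l"
   using assms(3) by (auto simp: cross_def image_iff)
  ultimately show "bij_betw (%(u, v). (f u, f v)) (cross R V (l \<circ> f)) (cross R' (f ` V) l)"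
   unfolding bij_betw_def by blast
 qed
 ultimately show "wt R' (f ` V) l < 0" unfolding wt_def by simp
qed

lemma clI: "V \<subseteq> U ==> rigid R X V ==> card (V - X) <= m ==> V \<subseteq> cl R U m X"
 unfolding cl_def by blast

lemma cl_sub: "cl R U m X \<subseteq> U"
 unfolding cl_def by blast

lemma base_sub_cl: "finite X ==> X \<subseteq> U ==> X \<subseteq> cl R U m X"
 using clI[of X U R X m] rigid_refl by simp

text \<open>Rigidity looks only at edges inside the extension, so the closure does not see how large
  the ambient set is. This allows the game to be played on a closure instead of the whole
  graph.\<close>

lemma cl_restrict:
 assumes "cl R U m X \<subseteq> U'" "U' \<subseteq> U"
 shows "cl R U' m X = cl R U m X"
proof
 show "cl R U' m X \<subseteq> cl R U m X" using assms(2) unfolding cl_def by blast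
 show "cl R U m X \<subseteq> cl R U' m X"
 proof
  fix u assume "u : cl R U m X"
  then obtain V where "u : V" "V \<subseteq> U" "rigid R X V" "card (V - X) <= m" unfolding cl_def by blast
  moreover from this have "V \<subseteq> U'" using clI assms(1) by blast
  ultimately show "u : cl R U' m X" unfolding cl_def by blast
 qed
qed

text \<open>Rigidity is transitive and the budgets add up.\<close>

lemma cl_cl:
 assumes "rigid R X V" "V \<subseteq> U" "card (V - X) <= h" "Y \<subseteq> V" "X \<subseteq> Y"
 shows "cl R U k Y \<subseteq> cl R U (h + k) X"
proof
 fix u assume "u : cl R U k Y"
 then obtain W where W: "u : W" "W \<subseteq> U" "rigid R Y W" "card (W - Y) <= k" unfolding cl_def by blast
 note V = rigidD[OF assms(1)]
 have "rigid R V (W Un V)" using rigid_base[OF W(3) assms(4)] V by blast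
 hence r: "rigid R X (W Un V)" using rigid_trans assms(1) by blast
 have "W Un V - X \<subseteq> (V - X) Un (W - Y)" using assms(4) by blast
 hence "card (W Un V - X) <= card ((V - X) Un (W - Y))" using V(1) rigidD(1)[OF W(3)] by (intro card_mono) auto
 also have "... <= h + k" using card_Un_le[of "V - X" "W - Y"] W(4) assms(3) by linarith
 finally show "u : cl R U (h + k) X" using clI[OF _ r] W assms(2) by blast
qed

end

lemma wt_relabel_aux:
 assumes "inj_on h (insert 0 (l ` V))" "h 0 = (0::nat)"
 shows "cross R V (h \<circ> l) = cross R V l" "card (classes V (h \<circ> l)) = card (classes V l)"
proof -
 show "cross R V (h \<circ> l) = cross R V l"
  using assms(1) unfolding cross_def by (auto simp: inj_on_def)
 have "classes V (h \<circ> l) = h ` classes V l"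
  using assms unfolding classes_def by (auto simp: inj_on_def)
 moreover have "inj_on h (classes V l)" using assms(1) unfolding classes_def by (auto simp: inj_on_def)
 ultimately show "card (classes V (h \<circ> l)) = card (classes V l)" by (simp add: card_image)
qed

text \<open>Only the partition and the zero class of a labelling matter. With small labels a finite
  set has finitely many labellings, which \<open>not_good_step\<close> treats one by one.\<close>

lemma relabel_small:
 fixes A :: "nat set"
 assumes "finite A" "card A <= m"
 shows "\<exists>h::nat => nat. inj h & h 0 = 0 & h ` A \<subseteq> {..m}"
proof -
 obtain g where g: "bij_betw g (A - {0}) {..<card (A - {0})}"
  using ex_bij_betw_finite_nat[of "A - {0}"] assms(1) by (metis atLeast0LessThan finite_Diff)
 have c: "card (A - {0}) <= m" using assms by (meson card_Diff1_le le_trans)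
 define h where "h x = (if x = 0 then 0 else if x : A then Suc (g x) else x + m)" for x
 have gA: "g x < m" if "x : A" "x ~= 0" for x
 proof -
  have "g x : {..<card (A - {0})}" using g that unfolding bij_betw_def by blast
  thus ?thesis using c by simp
 qed
 have ginj: "g x = g y ==> x = y" if "x : A - {0}" "y : A - {0}" for x y
  using g that unfolding bij_betw_def by (auto dest: inj_onD)
 have "inj h"
 proof (rule injI)
  fix x y assume "h x = h y"
  thus "x = y"
   using gA[of x] gA[of y] ginj[of x y] unfolding h_def by (auto split: if_splits)
 qed
 moreover have "h ` A \<subseteq> {..m}" using gA unfolding h_def by (auto simp: Suc_le_eq)
 moreover have "h 0 = 0" by (simp add: h_def)
 ultimately show ?thesis by blast
qed

section \<open>Optimal labellings, and a potential that bounds their weight\<close>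

context irrational_exponent
begin

definition lab :: "nat set => nat set => (nat => nat) => bool" where
 "lab X V l \<longleftrightarrow> compat V l & (\<forall>x\<in>X. l x = 0)"

definition Wmax :: "edges => nat set => nat set => real" where
 "Wmax R X V = Max {wt R V l | l. lab X V l}"

lemma finite_weights: "finite V ==> finite {wt R V l | l. lab X V l}"
proof -
 assume f: "finite V"
 have "wt R V l : (%(a, b). real a - \<alpha> / 2 * real b) ` ({..card V} \<times> {..card (V \<times> V)})" for l
 proof -
  have "card (classes V l) <= card V"
   unfolding classes_def using f by (meson card_Diff1_le card_image_le le_trans)
  moreover have "card (cross R V l) <= card (V \<times> V)"
   using f by (intro card_mono) (auto simp: cross_def)
  ultimately show ?thesis unfolding wt_def by (intro image_eqI[of _ _ "(card (classes V l), card (cross R V l))"]) auto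
 qed
 hence "{wt R V l | l. lab X V l} \<subseteq> (%(a, b). real a - \<alpha> / 2 * real b) ` ({..card V} \<times> {..card (V \<times> V)})" by auto
 thus ?thesis by (rule finite_subset) auto
qed

lemma lab_zero: "lab X V (%_. 0)" by (simp add: lab_def compat_def)

lemma Wmax_ge: "finite V ==> lab X V l ==> wt R V l <= Wmax R X V"
 unfolding Wmax_def using finite_weights by (intro Max_ge) auto

lemma Wmax_attained: "finite V ==> \<exists>l. lab X V l & wt R V l = Wmax R X V"
proof -
 assume "finite V"
 hence "Wmax R X V : {wt R V l | l. lab X V l}"
  unfolding Wmax_def using finite_weights lab_zero by (intro Max_in) blast+
 thus ?thesis by auto
qed

lemma Wmax_nonneg: "finite V ==> 0 <= Wmax R X V"
 using Wmax_ge[OF _ lab_zero[of X V]] wt_zero[of V "%_. 0" R] by metis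

lemma wt_relabel: "inj h ==> h 0 = 0 ==> wt R V (h \<circ> l) = wt R V l"
 unfolding wt_def using wt_relabel_aux[of h l V] inj_on_subset[of h UNIV] by (metis subset_UNIV)

lemma lab_relabel: "h 0 = 0 ==> lab X V l ==> lab X V (h \<circ> l)"
 unfolding lab_def compat_def by auto

lemma lab_subset: "lab X U l ==> V \<subseteq> U ==> lab X V l"
 unfolding lab_def using compat_subset by blast

text \<open>A labelling of the zero set with nonnegative weight would in fact have positive weight,
  since weight 0 forces it to have no classes. With its labels shifted beyond those of
  \<open>l\<close> it could be added to \<open>l\<close> and would beat the optimum.\<close>

lemma optimum_zero_rigid:
 assumes "finite V" "X \<subseteq> V" "lab X V l" "wt R V l = Wmax R X V"
 shows "rigid R X {v : V. l v = 0}"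
proof (rule rigidI)
 let ?Z = "{v : V. l v = 0}"
 show "finite ?Z" "X \<subseteq> ?Z" using assms by (auto simp: lab_def)
 fix m assume m: "compat ?Z m" "!!x. x : X ==> m x = 0" "\<exists>v\<in>?Z. m v ~= 0"
 show "wt R ?Z m < 0"
 proof (rule ccontr)
  assume "~ wt R ?Z m < 0"
  moreover have "wt R ?Z m ~= 0"
  proof
   assume "wt R ?Z m = 0"
   hence "card (classes ?Z m) = 0" using comb_zero unfolding wt_def by blast
   hence "classes ?Z m = {}" using assms(1) by simp
   thus False using m(3) by (auto simp: classes_def)
  qed
  ultimately have pos: "wt R ?Z m > 0" by simp
  define s where "s = Suc (Max (insert 0 (l ` V)))"
  have s: "l v < s" if "v : V" for v unfolding s_def using assms(1) that by (simp add: le_imp_less_Suc)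
  define m' where "m' v = (if l v ~= 0 then l v else if m v = 0 then 0 else m v + s)" for v
  have "lab X V m'"
   unfolding lab_def
  proof
   show "compat V m'" unfolding compat_def
   proof (intro ballI impI)
    fix u assume u: "u : V" "Suc u : V"
    hence "l u = l (Suc u)" using assms(3) by (simp add: lab_def compat_def)
    moreover have "m u = m (Suc u)" if "l u = 0"
     using m(1) u that calculation by (simp add: compat_def)
    ultimately show "m' u = m' (Suc u)" unfolding m'_def by auto
   qed
   show "\<forall>x\<in>X. m' x = 0" using m(2) assms(3) by (simp add: lab_def m'_def)
  qed
  hence le: "wt R V m' <= wt R V l" using Wmax_ge assms by metis
  have c1: "classes V m' = classes V l Un (%x. x + s) ` classes ?Z m"
   unfolding classes_def m'_def by (auto split: if_splits)
  have "classes V l Int (%x. x + s) ` classes ?Z m = {}"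
   using s unfolding classes_def by fastforce
  hence c2: "card (classes V m') = card (classes V l) + card (classes ?Z m)"
   unfolding c1 using assms(1) by (subst card_Un_disjoint) (auto simp: card_image)
  have x1: "cross R V m' \<subseteq> cross R V l Un cross R ?Z m"
   unfolding cross_def m'_def by (auto split: if_splits)
  hence "card (cross R V m') <= card (cross R V l) + card (cross R ?Z m)"
   using card_mono[OF _ x1] card_Un_le[of "cross R V l" "cross R ?Z m"] assms(1) by simp
  hence "\<alpha> / 2 * real (card (cross R V m')) <= \<alpha> / 2 * (real (card (cross R V l)) + real (card (cross R ?Z m)))"
   using alpha(1) by (intro mult_left_mono) auto
  hence "wt R V m' \<ge> wt R V l + wt R ?Z m" unfolding wt_def c2 by (simp add: algebra_simps)
  thus False using le pos by simp
 qed
qed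

text \<open>Resetting the labels in \<open>L\<close> to 0 cannot raise an optimal weight; what is
  given up is \<open>card L\<close> classes and the crossing edges with both labels in
  \<open>insert 0 L\<close>. Their balance is nonzero by irrationality. This positivity becomes the
  safety condition of \<open>pat_ok\<close>.\<close>

lemma optimum_safe:
 assumes "finite V" "lab X V l" "wt R V l = Wmax R X V" "L \<subseteq> classes V l" "L ~= {}"
 shows "0 < real (card L) - \<alpha> / 2 * real (card {(u, v) : cross R V l. l u : insert 0 L & l v : insert 0 L})"
  (is "0 < _ - _ * real (card ?E)")
proof -
 define m where "m v = (if l v : L then 0 else l v)" for v
 have "lab X V m" using assms(2) unfolding lab_def compat_def m_def by simp
 hence le: "wt R V m <= wt R V l" using Wmax_ge assms by metis
 have fL: "finite L" using assms finite_subset by (metis finite_classes)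
 have "classes V l = classes V m Un L" "classes V m Int L = {}"
  using assms(4) unfolding classes_def m_def by (auto split: if_splits)
 hence c: "card (classes V l) = card (classes V m) + card L"
  using assms(1) fL by (simp add: card_Un_disjoint)
 have "cross R V l = cross R V m Un ?E" "cross R V m Int ?E = {}"
  using assms(4) unfolding cross_def m_def classes_def by (auto split: if_splits)
 moreover have "finite ?E" using assms(1) by (rule finite_subset[rotated, OF finite_cross]) auto
 ultimately have x: "card (cross R V l) = card (cross R V m) + card ?E"
  using assms(1) card_Un_disjoint[of "cross R V m" ?E] by (metis finite_cross)
 have "0 <= real (card L) - \<alpha> / 2 * real (card ?E)"
  using le unfolding wt_def c x by (simp add: algebra_simps)
 moreover have "real (card L) - \<alpha> / 2 * real (card ?E) ~= 0"
  using comb_zero[of "card L" "card ?E"] fL assms(5) by auto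
 ultimately show ?thesis by linarith
qed

text \<open>A bound that survives any number of small rigid extensions. Since it charges \<eta> for
  each class, a labelling of nonnegative weight has at most (1 + \<eta>) / \<eta> classes, however
  large \<open>V\<close> has become. This keeps the values of \<open>Wmax\<close> in a finite set
  fixed beforehand.\<close>

definition pot :: "real => edges => nat set => nat set => bool" where
 "pot \<eta> R X V \<longleftrightarrow> (\<forall>l. lab X V l --> wt R V l + \<eta> * real (card (classes V l)) <= 1 + \<eta>)"

lemma pot_base: "0 < \<eta> ==> pot \<eta> R X (insert z X)"
 unfolding pot_def
proof (intro allI impI)
 fix l assume "0 < \<eta>" "lab X (insert z X) l"
 hence "classes (insert z X) l \<subseteq> {l z}" by (auto simp: lab_def classes_def)
 hence "card (classes (insert z X) l) <= card {l z}" by (intro card_mono) auto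
 hence c: "real (card (classes (insert z X) l)) <= 1" by simp
 hence "\<eta> * real (card (classes (insert z X) l)) <= \<eta> * 1" using \<open>0 < \<eta>\<close> by (intro mult_left_mono) auto
 moreover have "wt R (insert z X) l <= 1" using c alpha(1) unfolding wt_def
  by (smt (verit) divide_nonneg_nonneg mult_nonneg_nonneg of_nat_0_le_iff)
 ultimately show "wt R (insert z X) l + \<eta> * real (card (classes (insert z X) l)) <= 1 + \<eta>" by simp
qed

text \<open>New classes avoid \<open>V\<close>. If there are any, rigidity costs at least \<eta>
  times \<open>c\<close>, which pays the charge \<eta> for each of the at most \<open>c\<close> new
  classes.\<close>

lemma pot_step:
 assumes eps: "\<forall>a\<le>c. \<forall>b. real a - \<alpha> / 2 * real b < 0 --> real a - \<alpha> / 2 * real b <= - (\<eta> * real c)"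
  and \<eta>: "0 < \<eta>" and "pot \<eta> R X V" "rigid R V U" "card (U - V) <= c"
 shows "pot \<eta> R X U"
 unfolding pot_def
proof (intro allI impI)
 fix l assume l: "lab X U l"
 note U = rigidD[OF assms(4)]
 have comp: "compat U l" using l by (simp add: lab_def)
 let ?l2 = "%u. if l u : l ` V then 0 else l u"
 note s = wt_split[OF U(1,2) comp]
 have V: "wt R V l + \<eta> * real (card (classes V l)) <= 1 + \<eta>"
  using assms(3) lab_subset[OF l U(2)] unfolding pot_def by blast
 have "wt R U ?l2 + \<eta> * real (card (classes U ?l2)) <= 0"
 proof (cases "\<exists>v\<in>U. ?l2 v ~= 0")
  case True
  hence neg: "wt R U ?l2 < 0" using U(3)[OF s(2)] s(3) by simp
  have cc: "card (classes U ?l2) <= c" using s(5) assms(5) by linarith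
  hence "wt R U ?l2 <= - (\<eta> * real c)" using eps neg unfolding wt_def by blast
  moreover have "\<eta> * real (card (classes U ?l2)) <= \<eta> * real c" using cc \<eta> by (intro mult_left_mono) auto
  ultimately show ?thesis by linarith
 next
  case False
  hence "classes U ?l2 = {}" by (auto simp: classes_def)
  thus ?thesis using False wt_zero[of U ?l2 R] by simp
 qed
 thus "wt R U l + \<eta> * real (card (classes U l)) <= 1 + \<eta>"
  using s(1)[of R] s(4) V by (simp add: algebra_simps)
qed

text \<open>An optimal labelling that every small rigid extension of \<open>V\<close> can absorb
  without loss of weight. The depth is \<open>2 * k\<close> because \<open>decomposition\<close>
  compares two extensions of depth \<open>k\<close> through their union; the bound on the labels
  makes the candidates finite in number.\<close>

definition good :: "nat => edges => nat set => nat set => nat set => (nat => nat) => bool" where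
 "good k R U X V l \<longleftrightarrow> lab X V l & wt R V l = Wmax R X V & l ` V \<subseteq> {..card V} &
  (\<forall>U'. U' \<subseteq> U --> rigid R V U' --> card (U' - V) <= 2 * k -->
    (\<exists>l'. compat U' l' & (\<forall>v\<in>V. l' v = l v) & wt R U' l' = wt R V l))"

text \<open>Adjoin to \<open>V\<close>, for every optimal labelling, an extension witnessing that it
  is not good. If the maximum did not drop, take an optimum on the result: weights decrease from
  \<open>V\<close> to the witness for its restriction and on to the whole, yet both ends are equal,
  so the witness absorbs that restriction without loss, a contradiction.\<close>

lemma not_good_step:
 assumes ng: "\<nexists>l. good k R U X V l" and fV: "finite V" "V \<subseteq> U" "X \<subseteq> V"
  and eps: "\<forall>a\<le>2 * k. \<forall>b. real a - \<alpha> / 2 * real b < 0 --> real a - \<alpha> / 2 * real b <= - (\<eta> * real (2 * k))"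
  and \<eta>: "0 < \<eta>" and pot: "pot \<eta> R X V"
 shows "\<exists>V'. V \<subseteq> V' & V' \<subseteq> U & rigid R V V' & pot \<eta> R X V' & Wmax R X V' < Wmax R X V &
  card V' <= card V + 2 * k * (card V + 1) ^ card V"
proof -
 define Opt where "Opt = {l : V \<rightarrow>\<^sub>E {..card V}. lab X V l & wt R V l = Wmax R X V}"
 have fO: "finite Opt" unfolding Opt_def using fV(1) by (simp add: finite_PiE)
 have "card Opt <= card (V \<rightarrow>\<^sub>E {..card V})"
  unfolding Opt_def using fV(1) by (intro card_mono) (auto simp: finite_PiE)
 hence cO: "card Opt <= (card V + 1) ^ card V" using fV(1) by (simp add: card_PiE)
 have "\<forall>l\<in>Opt. \<exists>U'. U' \<subseteq> U & rigid R V U' & card (U' - V) <= 2 * k &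
   ~ (\<exists>l'. compat U' l' & (\<forall>v\<in>V. l' v = l v) & wt R U' l' = wt R V l)"
 proof
  fix l assume "l : Opt"
  hence "lab X V l" "wt R V l = Wmax R X V" "l ` V \<subseteq> {..card V}" unfolding Opt_def by auto
  thus "\<exists>U'. U' \<subseteq> U & rigid R V U' & card (U' - V) <= 2 * k &
   ~ (\<exists>l'. compat U' l' & (\<forall>v\<in>V. l' v = l v) & wt R U' l' = wt R V l)"
   using ng[unfolded good_def not_ex, THEN spec[of _ l]] by simp
 qed
 then obtain K where K: "!!l. l : Opt ==> K l \<subseteq> U" "!!l. l : Opt ==> rigid R V (K l)"
  "!!l. l : Opt ==> card (K l - V) <= 2 * k"
  "!!l l'. l : Opt ==> compat (K l) l' ==> (!!v. v : V ==> l' v = l v) ==> wt R (K l) l' ~= wt R V l"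
  by metis
 \<comment> \<open>The extensions are adjoined one at a time: the gap \<open>eps\<close> covers a
   single step by at most \<open>2 * k\<close> vertices, and it is such steps that preserve the
   potential.\<close>
 have ind: "rigid R V (V Un (\<Union>l\<in>S. K l)) & pot \<eta> R X (V Un (\<Union>l\<in>S. K l)) &
   card (V Un (\<Union>l\<in>S. K l)) <= card V + 2 * k * card S" if "S \<subseteq> Opt" for S
 proof -
  have "finite S" using fO that finite_subset by blast
  thus ?thesis using that
  proof (induction S rule: finite_induct)
   case empty
   thus ?case using rigid_refl[OF fV(1)] pot by simp
  next
   case (insert l S)
   let ?A = "V Un (\<Union>l\<in>S. K l)"
   have A: "rigid R V ?A" "pot \<eta> R X ?A" "card ?A <= card V + 2 * k * card S" using insert by auto
   have eq: "V Un (\<Union>l\<in>insert l S. K l) = K l Un ?A" by blast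
   have r: "rigid R ?A (K l Un ?A)"
    by (rule rigid_base[OF K(2)]) (use insert.prems rigidD[OF A(1)] in auto)
   have "K l Un ?A - ?A \<subseteq> K l - V" by blast
   hence "card (K l Un ?A - ?A) <= card (K l - V)"
    using rigidD(1)[OF K(2)] insert.prems by (intro card_mono) auto
   hence d: "card (K l Un ?A - ?A) <= 2 * k" using K(3)[of l] insert.prems by simp
   have "card (K l Un ?A) <= card (K l Un ?A - ?A) + card ?A"
    using card_Un_le[of "K l Un ?A - ?A" ?A] by (simp add: Un_Diff_cancel2)
   hence "card (K l Un ?A) <= card V + 2 * k * card (insert l S)" using d A(3) insert.hyps by simp
   thus ?case unfolding eq using rigid_trans[OF A(1) r] pot_step[OF eps \<eta> A(2) r d] by blast
  qed
 qed
 define V' where "V' = V Un (\<Union>l\<in>Opt. K l)"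
 have V': "rigid R V V'" "pot \<eta> R X V'" "card V' <= card V + 2 * k * card Opt"
  using ind[of Opt] unfolding V'_def by auto
 have fV': "finite V'" using V'(1) rigidD by blast
 have "Wmax R X V' < Wmax R X V"
 proof (rule ccontr)
  assume nl: "~ ?thesis"
  obtain l where l: "lab X V' l" "wt R V' l = Wmax R X V'" using Wmax_attained[OF fV'] by blast
  obtain h where h: "inj h" "h 0 = 0" "h ` (l ` V) \<subseteq> {..card V}"
   using relabel_small[of "l ` V" "card V"] fV(1) card_image_le by blast
  define m where "m = h \<circ> l"
  have m: "lab X V' m" "wt R V' m = Wmax R X V'"
   using lab_relabel[of h X V' l] l(1) h(2) wt_relabel[OF h(1,2)] l(2) unfolding m_def by simp_all
  have VV': "V \<subseteq> V'" by (auto simp: V'_def)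
  have labV: "lab X V m" using lab_subset[OF m(1) VV'] .
  have "wt R V' m <= wt R V m" using rigid_wt_mono[OF V'(1)] m(1) by (simp add: lab_def)
  hence eqs: "wt R V m = Wmax R X V" "wt R V' m = Wmax R X V"
   using Wmax_ge[OF fV(1) labV, of R] nl m(2) by linarith+
  let ?r = "restrict m V"
  have c: "!!v. v : V ==> ?r v = m v" by simp
  have "lab X V ?r" using labV fV(3) compat_cong[of V ?r m] unfolding lab_def by auto
  moreover have "wt R V ?r = Wmax R X V" using wt_cong[of V ?r m R] eqs by simp
  moreover have "?r : V \<rightarrow>\<^sub>E {..card V}" using h(3) unfolding m_def by (auto simp: image_subset_iff)
  ultimately have O: "?r : Opt" unfolding Opt_def by simp
  have KV': "K ?r \<subseteq> V'" using O by (auto simp: V'_def)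
  have compK: "compat (K ?r) m" using m(1) KV' compat_subset unfolding lab_def by blast
  have "rigid R (K ?r) (V' Un K ?r)"
   by (rule rigid_base[OF V'(1)]) (use rigidD[OF K(2)[OF O]] in auto)
  hence "rigid R (K ?r) V'" using KV' by (simp add: Un_absorb2)
  hence "wt R V' m <= wt R (K ?r) m" using rigid_wt_mono m(1) unfolding lab_def by blast
  moreover have "wt R (K ?r) m <= wt R V m" using rigid_wt_mono[OF K(2)[OF O] compK] .
  ultimately have "wt R (K ?r) m = wt R V ?r" using eqs wt_cong[of V ?r m R] by simp
  thus False using K(4)[OF O compK] by simp
 qed
 moreover have "card V' <= card V + 2 * k * (card V + 1) ^ card V"
  using V'(3) cO by (meson add_left_mono le_trans mult_le_mono2)
 moreover have "V' \<subseteq> U" using fV(2) K(1) unfolding V'_def by blast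
 ultimately show ?thesis using V' by (intro exI[of _ V']) (auto simp: V'_def)
qed

text \<open>The potential confines \<open>Wmax\<close> to the finite set \<open>Vals\<close>, so the
  descent of \<open>not_good_step\<close> stops after at most \<open>d\<close> rounds, where
  \<open>d\<close> counts the values still below. The size bound \<open>H\<close> is therefore
  independent of the graph.\<close>

lemma exists_good_aux:
 assumes eps: "\<forall>a\<le>2 * k. \<forall>b. real a - \<alpha> / 2 * real b < 0 --> real a - \<alpha> / 2 * real b <= - (\<eta> * real (2 * k))"
  and \<eta>: "0 < \<eta>"
 defines "Vals \<equiv> (%(a, b). real a - \<alpha> / 2 * real b) `
   ({..nat \<lfloor>(1 + \<eta>) / \<eta>\<rfloor>} \<times> {..nat \<lfloor>(1 + \<eta>) / \<eta> * (2 / \<alpha>)\<rfloor>})"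
 shows "\<exists>H. \<forall>R U X V. finite V --> V \<subseteq> U --> X \<subseteq> V --> card V <= s --> pot \<eta> R X V -->
  card {x : Vals. x < Wmax R X V} <= d -->
  (\<exists>V' l. V \<subseteq> V' & V' \<subseteq> U & rigid R V V' & card V' <= H & good k R U X V' l)"
proof (induction d arbitrary: s)
 have fin: "finite Vals" unfolding Vals_def by auto
 have inV: "Wmax R X V : Vals" if "finite V" "pot \<eta> R X V" for R X V
 proof -
  obtain l where l: "lab X V l" "wt R V l = Wmax R X V" using Wmax_attained[OF \<open>finite V\<close>] by blast
  let ?a = "card (classes V l)" and ?b = "card (cross R V l)"
  have nn: "0 <= wt R V l" using l(2) Wmax_nonneg \<open>finite V\<close> by metis
  have "\<eta> * real ?a <= 1 + \<eta>" using that(2) l(1) nn unfolding pot_def by fastforce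
  hence a: "real ?a <= (1 + \<eta>) / \<eta>" using \<eta> by (simp add: field_simps)
  have "real ?b <= real ?a * (2 / \<alpha>)" using nn alpha(1) unfolding wt_def by (simp add: field_simps)
  also have "... <= (1 + \<eta>) / \<eta> * (2 / \<alpha>)" using a alpha(1) by (intro mult_right_mono) auto
  finally have b: "real ?b <= (1 + \<eta>) / \<eta> * (2 / \<alpha>)" .
  have "?a <= nat \<lfloor>(1 + \<eta>) / \<eta>\<rfloor>" "?b <= nat \<lfloor>(1 + \<eta>) / \<eta> * (2 / \<alpha>)\<rfloor>"
   using a b by (simp_all add: le_nat_floor)
  thus ?thesis unfolding Vals_def l(2)[symmetric] wt_def by (intro image_eqI[of _ _ "(?a, ?b)"]) auto
 qed
 have step: "\<exists>V' l. V \<subseteq> V' & V' \<subseteq> U & rigid R V V' & card V' <= max s H & good k R U X V' l"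
  if V: "finite V" "V \<subseteq> U" "X \<subseteq> V" "card V <= s" "pot \<eta> R X V"
   and cd: "card {x : Vals. x < Wmax R X V} <= d"
   and nxt: "!!V'. finite V' ==> V' \<subseteq> U ==> X \<subseteq> V' ==> card V' <= s + 2 * k * (s + 1) ^ s ==> pot \<eta> R X V' ==>
    card {x : Vals. x < Wmax R X V'} < d ==>
    \<exists>V'' l. V' \<subseteq> V'' & V'' \<subseteq> U & rigid R V' V'' & card V'' <= H & good k R U X V'' l"
  for R U X V d s H
 proof (cases "\<exists>l. good k R U X V l")
  case True
  thus ?thesis using rigid_refl[OF V(1)] V by (intro exI[of _ V]) (auto simp: le_max_iff_disj)
 next
  case False
  then obtain V' where V': "V \<subseteq> V'" "V' \<subseteq> U" "rigid R V V'" "pot \<eta> R X V'" "Wmax R X V' < Wmax R X V"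
   "card V' <= card V + 2 * k * (card V + 1) ^ card V"
   using not_good_step[OF False V(1-3) eps \<eta> V(5)] by blast
  have fV': "finite V'" using V'(3) rigidD by blast
  have "(card V + 1) ^ card V <= (s + 1) ^ s"
   by (rule order_trans[OF power_mono power_increasing]) (use V(4) in auto)
  hence "card V' <= s + 2 * k * (s + 1) ^ s" using V'(6) V(4) by (meson add_mono le_trans mult_le_mono2)
  moreover have "{x : Vals. x < Wmax R X V'} \<subset> {x : Vals. x < Wmax R X V}"
   using inV[OF fV' V'(4)] V'(5) by auto
  hence "card {x : Vals. x < Wmax R X V'} < d"
   by (rule less_le_trans[OF psubset_card_mono cd, rotated]) (simp add: fin)
  ultimately obtain V'' l where "V' \<subseteq> V''" "V'' \<subseteq> U" "rigid R V' V''" "card V'' <= H" "good k R U X V'' l"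
   using nxt[OF fV' V'(2) _ _ V'(4)] V'(1) V(3) by blast
  thus ?thesis using V' rigid_trans[OF V'(3)] by (intro exI[of _ V'']) auto
 qed
 { case 0
  show ?case by (intro exI[of _ "max s 0"] allI impI) (rule step[where d = 0], auto) }
 case (Suc d)
 obtain H where H: "\<forall>R U X V. finite V --> V \<subseteq> U --> X \<subseteq> V --> card V <= s + 2 * k * (s + 1) ^ s --> pot \<eta> R X V -->
  card {x : Vals. x < Wmax R X V} <= d -->
  (\<exists>V' l. V \<subseteq> V' & V' \<subseteq> U & rigid R V V' & card V' <= H & good k R U X V' l)"
  using Suc[of "s + 2 * k * (s + 1) ^ s"] by blast
 show ?case
  by (intro exI[of _ "max s H"] allI impI) (rule step[where d = "Suc d"], use H in \<open>auto simp: less_Suc_eq_le\<close>)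
qed

lemma exists_good:
 assumes k: "1 <= k"
 shows "\<exists>H. \<forall>R U X z. finite U --> X \<subseteq> U --> card X <= r --> z : U -->
  (\<exists>V l. insert z X \<subseteq> V & V \<subseteq> U & rigid R (insert z X) V & card V <= H & good k R U X V l)"
proof -
 obtain e where e: "e > 0" "\<forall>a\<le>2 * k. \<forall>b. real a - \<alpha> / 2 * real b < 0 --> real a - \<alpha> / 2 * real b <= - e"
  using neg_gap by blast
 \<comment> \<open>Chosen so that the gap \<open>e\<close>, valid for up to \<open>2 * k\<close>
   classes, is \<eta> times \<open>2 * k\<close>, as \<open>pot_step\<close> demands.\<close>
 define \<eta> where "\<eta> = e / real (2 * k)"
 have \<eta>: "\<eta> > 0" "\<eta> * real (2 * k) = e" using e k by (auto simp: \<eta>_def)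
 let ?Vals = "(%(a, b). real a - \<alpha> / 2 * real b) `
   ({..nat \<lfloor>(1 + \<eta>) / \<eta>\<rfloor>} \<times> {..nat \<lfloor>(1 + \<eta>) / \<eta> * (2 / \<alpha>)\<rfloor>})"
 obtain H where H: "\<forall>R U X V. finite V --> V \<subseteq> U --> X \<subseteq> V --> card V <= Suc r --> pot \<eta> R X V -->
  card {x : ?Vals. x < Wmax R X V} <= card ?Vals -->
  (\<exists>V' l. V \<subseteq> V' & V' \<subseteq> U & rigid R V V' & card V' <= H & good k R U X V' l)"
  using exists_good_aux[of k \<eta> "Suc r" "card ?Vals"] e(2) \<eta> by auto
 show ?thesis
 proof (intro exI[of _ H] allI impI)
  fix R U X z assume a: "finite U" "X \<subseteq> U" "card X <= r" "z : (U :: nat set)"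
  have "finite X" using a finite_subset by blast
  have "card {x : ?Vals. x < Wmax R X (insert z X)} <= card ?Vals"
   by (intro card_mono) auto
  thus "\<exists>V l. insert z X \<subseteq> V & V \<subseteq> U & rigid R (insert z X) V & card V <= H & good k R U X V l"
   using H[THEN spec[of _ R], THEN spec[of _ U], THEN spec[of _ X], THEN spec[of _ "insert z X"]] a \<open>finite X\<close>
    pot_base[OF \<eta>(1), of R X z] by (simp only: finite_insert card_insert_if) (auto split: if_splits)
 qed
qed

end

section \<open>Splitting the closure around a new vertex into independent pieces\<close>

context irrational_exponent
begin

text \<open>Equal weights force equal counts by \<open>comb_eq\<close>, and the classes and crossing
  edges over \<open>V\<close> are among those over \<open>U'\<close>.\<close>

lemma zero_loss:
 assumes "finite U'" "V \<subseteq> U'" "!!v. v : V ==> l' v = l v" "wt R U' l' = wt R V l"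
 shows "classes U' l' = classes V l" "cross R U' l' = cross R V l"
proof -
 have a: "classes V l \<subseteq> classes U' l'" "cross R V l \<subseteq> cross R U' l'"
  using assms(2,3) unfolding classes_def cross_def by (force, auto)
 have "card (classes U' l') = card (classes V l)" "card (cross R U' l') = card (cross R V l)"
  using comb_eq assms(4) unfolding wt_def by blast+
 thus "classes U' l' = classes V l" "cross R U' l' = cross R V l"
  using a assms(1) by (metis card_subset_eq finite_classes, metis card_subset_eq finite_cross)
qed

text \<open>Two extensions of \<open>l\<close> without loss cross only along edges inside
  \<open>V\<close>, where they agree. So no edge leaves the set on which they differ; as a class of
  its own it would have nonnegative weight, against rigidity.\<close>

lemma zero_loss_unique:
 assumes r: "rigid R V U'" and l1: "compat U' l1" "!!v. v : V ==> l1 v = l v" "wt R U' l1 = wt R V l"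
  and l2: "compat U' l2" "!!v. v : V ==> l2 v = l v" "wt R U' l2 = wt R V l" and u: "u : U'"
 shows "l1 u = l2 u"
proof (rule ccontr)
 assume ne: "l1 u ~= l2 u"
 note U = rigidD[OF r]
 note z1 = zero_loss[OF U(1,2) l1(2,3)] and z2 = zero_loss[OF U(1,2) l2(2,3)]
 define t where "t v = (if l1 v = l2 v then 0 else 1::nat)" for v
 have "compat U' t" using l1(1) l2(1) unfolding compat_def t_def by simp
 moreover have "t v = 0" if "v : V" for v using l1(2) l2(2) that by (simp add: t_def)
 ultimately have neg: "wt R U' t < 0" using U(3) ne u by (metis t_def zero_neq_one)
 have "cross R U' t = {}"
 proof (rule ccontr)
  assume "cross R U' t ~= {}"
  then obtain a b where ab: "(a, b) : R" "a : U'" "b : U'" "t a ~= t b" unfolding cross_def by auto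
  hence "l1 a ~= l1 b \<or> l2 a ~= l2 b" unfolding t_def by (auto split: if_splits)
  hence "(a, b) : cross R V l" using ab(1-3) z1(2) z2(2) unfolding cross_def by blast
  hence "t a = 0 & t b = 0" using l1(2) l2(2) by (auto simp: cross_def t_def)
  thus False using ab(4) by simp
 qed
 hence "wt R U' t \<ge> 0" by (simp add: wt_def)
 thus False using neg by simp
qed

text \<open>For the answer to a vertex \<open>z\<close> outside the closure of \<open>X\<close>. A
  good labelling spreads to \<Lambda> on the closure of \<open>V\<close> without new classes or
  crossing edges, so the closure falls into pieces that are joined only by edges inside the bounded
  set \<open>V\<close>. Piece 0 stays attached to \<open>X\<close>; the other pieces are as free as
  the safety inequality says and can be placed anew elsewhere.\<close>

lemma decomposition:
 assumes k: "1 <= k"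
 shows "\<exists>h. \<forall>R U X z. finite U --> X \<subseteq> U --> card X <= r --> z : U --> z ~: cl R U h X -->
  (\<exists>V l \<Lambda>. insert z X \<subseteq> V & V \<subseteq> U & card V <= h & compat V l & (\<forall>x\<in>X. l x = 0) & l z ~= 0 & l ` V \<subseteq> {..h} &
   rigid R X {v : V. l v = 0} &
   (\<forall>L. L \<subseteq> classes V l --> L ~= {} -->
    0 < real (card L) - \<alpha> / 2 * real (card {(u, v) : cross R V l. l u : insert 0 L & l v : insert 0 L})) &
   (\<forall>v\<in>V. \<Lambda> v = l v) & (\<forall>u\<in>cl R U k V. \<Lambda> u : insert 0 (l ` V)) & compat (cl R U k V) \<Lambda> &
   (\<forall>u v. (u, v) : R --> u : cl R U k V --> v : cl R U k V --> \<Lambda> u ~= \<Lambda> v --> u : V & v : V) &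
   {u : cl R U k V. \<Lambda> u = 0} = cl R U k {v : V. l v = 0})"
proof -
 obtain H where H: "!!R U X z. finite U ==> X \<subseteq> U ==> card X <= r ==> z : U ==>
  \<exists>V l. insert z X \<subseteq> V & V \<subseteq> U & rigid R (insert z X) V & card V <= H & good k R U X V l"
  using exists_good[OF k, of r] by blast
 show ?thesis
 proof (intro exI[of _ H] allI impI, goal_cases)
  case (1 R U X z)
  obtain V l where V: "insert z X \<subseteq> V" "V \<subseteq> U" "rigid R (insert z X) V" "card V <= H" "good k R U X V l"
   using H[OF 1(1-4)] by blast
  have fV: "finite V" using V(3) rigidD by blast
  have l: "compat V l" "\<forall>x\<in>X. l x = 0" "wt R V l = Wmax R X V" "l ` V \<subseteq> {..card V}" "lab X V l"
   using V(5) unfolding good_def lab_def by auto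
  have "~ rigid R X V"
  proof
   assume r: "rigid R X V"
   have "card (V - X) <= H" using V(4) fV by (meson Diff_subset card_mono le_trans)
   thus False using clI[OF V(2) r] V(1) 1(5) by blast
  qed
  then obtain l0 where l0: "compat V l0" "\<forall>x\<in>X. l0 x = 0" "\<exists>v\<in>V. l0 v ~= 0" "~ wt R V l0 < 0"
   using fV V(1) unfolding rigid_def by blast
  have "wt R V l0 ~= 0"
  proof
   assume "wt R V l0 = 0"
   hence "card (classes V l0) = 0" using comb_zero unfolding wt_def by blast
   thus False using fV l0(3) by (auto simp: classes_def)
  qed
  hence Wpos: "0 < wt R V l" using l0 Wmax_ge[OF fV, of X l0 R] l(3) by (simp add: lab_def)
  \<comment> \<open>\<open>V\<close> is rigid over \<open>insert z X\<close>, so a nonzero labelling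
    vanishing at \<open>z\<close> as well would have negative weight; but the optimum is positive
    because \<open>V\<close> is not rigid over \<open>X\<close>.\<close>
  have lz: "l z ~= 0"
  proof
   assume "l z = 0"
   moreover have "\<exists>v\<in>V. l v ~= 0" using Wpos wt_zero[of V l R] by fastforce
   ultimately show False using rigidD(3)[OF V(3) l(1)] l(2) Wpos by fastforce
  qed
  let ?V0 = "{v : V. l v = 0}" and ?G = "cl R U k V"
  have safe: "0 < real (card L) - \<alpha> / 2 * real (card {(u, v) : cross R V l. l u : insert 0 L & l v : insert 0 L})"
   if "L \<subseteq> classes V l" "L ~= {}" for L
   using optimum_safe[OF fV l(5,3) that] .
  define adm where "adm j U' \<longleftrightarrow> U' \<subseteq> U & rigid R V U' & card (U' - V) <= j" for j U'
  define ext where "ext U' l' \<longleftrightarrow> compat U' l' & (\<forall>v\<in>V. l' v = l v) & wt R U' l' = wt R V l" for U' l'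
  have exE: "\<exists>l'. ext U' l'" if "adm (2 * k) U'" for U'
   using V(5) that unfolding good_def adm_def ext_def by blast
  have uniq: "l' u = l'' u" if "adm j U'" "ext U' l'" "ext U' l''" "u : U'" for j U' l' l'' u
   using zero_loss_unique[of R V U' l' l l'' u] that unfolding adm_def ext_def by blast
  have restr: "ext U'' l'" if "adm j U'" "adm i U''" "U'' \<subseteq> U'" "ext U' l'" for i j U' U'' l'
  proof -
   have r: "rigid R V U'" "rigid R V U''" using that unfolding adm_def by auto
   have "rigid R U'' (U' Un U'')" using rigid_base[OF r(1)] rigidD[OF r(2)] by blast
   hence r': "rigid R U'' U'" using that(3) by (simp add: Un_absorb2)
   have c: "compat U' l'" "compat U'' l'" using that(3,4) compat_subset unfolding ext_def by blast+
   have "wt R V l' = wt R V l" using that(4) wt_cong[of V l' l R] unfolding ext_def by blast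
   hence "wt R U'' l' = wt R V l"
    using rigid_wt_mono[OF r' c(1)] rigid_wt_mono[OF r(2) c(2)] that(4) unfolding ext_def by simp
   thus ?thesis using c that(4) unfolding ext_def by blast
  qed
  have admU: "adm (2 * k) (U1 Un U2)" if "adm k U1" "adm k U2" for U1 U2
  proof -
   have "U1 Un U2 - V = (U1 - V) Un (U2 - V)" by blast
   hence "card (U1 Un U2 - V) <= card (U1 - V) + card (U2 - V)" by (simp add: card_Un_le)
   thus ?thesis using that rigid_union unfolding adm_def by auto
  qed
  have adm2: "adm (2 * k) U1" if "adm k U1" for U1 using that unfolding adm_def by auto
  \<comment> \<open>The label of \<open>u\<close> in any extension of depth \<open>k\<close>
    containing it. The choices agree: two such extensions have a union of depth
    \<open>2 * k\<close>, which \<open>good\<close> covers, and its lossless labelling restricts to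
    the unique one on each of them.\<close>
  define \<Lambda> where "\<Lambda> u = (SOME c. \<exists>U' l'. adm k U' & u : U' & ext U' l' & c = l' u)" for u
  have Lam: "\<Lambda> u = l' u" if "adm k U'" "u : U'" "ext U' l'" for u U' l'
  proof -
   have "\<exists>c. \<exists>U' l'. adm k U' & u : U' & ext U' l' & c = l' u" using that by blast
   hence "\<exists>U' l'. adm k U' & u : U' & ext U' l' & \<Lambda> u = l' u" unfolding \<Lambda>_def by (rule someI_ex)
   then obtain U2 l2 where 2: "adm k U2" "u : U2" "ext U2 l2" "\<Lambda> u = l2 u" by blast
   have "\<exists>m. ext (U' Un U2) m" by (rule exE[OF admU[OF that(1) 2(1)]])
   then obtain m where m: "ext (U' Un U2) m" by blast
   have "ext U' m" by (rule restr[OF admU[OF that(1) 2(1)] that(1) _ m]) simp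
   hence 3: "l' u = m u" using uniq[OF that(1) that(3)] that(2) by simp
   have "ext U2 m" by (rule restr[OF admU[OF that(1) 2(1)] 2(1) _ m]) simp
   hence "l2 u = m u" using uniq[OF 2(1) 2(3)] 2(2) by simp
   thus ?thesis using 2(4) 3 by simp
  qed
  have Gmem: "\<exists>U'. adm k U' & u : U'" if "u : ?G" for u
   using that unfolding cl_def adm_def by blast
  have pair: "\<exists>U' l'. adm (2 * k) U' & u : U' & v : U' & ext U' l' & \<Lambda> u = l' u & \<Lambda> v = l' v"
   if uv: "u : ?G" "v : ?G" for u v
  proof -
   obtain U1 U2 where 12: "adm k U1" "u : U1" "adm k U2" "v : U2" using Gmem uv by meson
   have "\<exists>m. ext (U1 Un U2) m" by (rule exE[OF admU[OF 12(1,3)]])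
   then obtain m where m: "ext (U1 Un U2) m" by blast
   have "ext U1 m" by (rule restr[OF admU[OF 12(1,3)] 12(1) _ m]) simp
   hence "\<Lambda> u = m u" by (rule Lam[OF 12(1,2)])
   moreover have "ext U2 m" by (rule restr[OF admU[OF 12(1,3)] 12(3) _ m]) simp
   hence "\<Lambda> v = m v" by (rule Lam[OF 12(3,4)])
   ultimately have "\<Lambda> u = m u" "\<Lambda> v = m v" by simp_all
   thus ?thesis using m admU[OF 12(1,3)] 12 by blast
  qed
  have admD: "finite U'" "V \<subseteq> U'" "rigid R V U'" if "adm j U'" for j U'
   using that rigidD unfolding adm_def by blast+
  have zl: "classes U' l' = classes V l" "cross R U' l' = cross R V l" if "adm j U'" "ext U' l'" for j U' l'
   using zero_loss[of U' V l' l R] admD[OF that(1)] that(2) unfolding ext_def by auto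
  have admV: "adm k V" using rigid_refl[OF fV] V(2) unfolding adm_def by simp
  have LV: "\<forall>v\<in>V. \<Lambda> v = l v" using Lam[OF admV] l(1) unfolding ext_def by blast
  have c1: "\<forall>u\<in>?G. \<Lambda> u : insert 0 (l ` V)"
  proof
   fix u assume "u : ?G"
   then obtain U' l' where "adm (2 * k) U'" "u : U'" "ext U' l'" "\<Lambda> u = l' u" using pair by blast
   hence "\<Lambda> u = 0 \<or> \<Lambda> u : classes V l" using zl(1) unfolding classes_def by blast
   thus "\<Lambda> u : insert 0 (l ` V)" unfolding classes_def by blast
  qed
  have c2: "compat ?G \<Lambda>" unfolding compat_def
  proof (intro ballI impI)
   fix u assume "u : ?G" "Suc u : ?G"
   then obtain U' l' where "u : U'" "Suc u : U'" "ext U' l'" "\<Lambda> u = l' u" "\<Lambda> (Suc u) = l' (Suc u)" using pair by blast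
   thus "\<Lambda> u = \<Lambda> (Suc u)" unfolding ext_def compat_def by auto
  qed
  have c3: "\<forall>u v. (u, v) : R --> u : ?G --> v : ?G --> \<Lambda> u ~= \<Lambda> v --> u : V & v : V"
  proof (intro allI impI)
   fix u v assume a: "(u, v) : R" "u : ?G" "v : ?G" "\<Lambda> u ~= \<Lambda> v"
   obtain U' l' where *: "adm (2 * k) U'" "u : U'" "v : U'" "ext U' l'" "\<Lambda> u = l' u" "\<Lambda> v = l' v"
    using pair[OF a(2,3)] by blast
   hence "(u, v) : cross R U' l'" using a(1,4) by (simp add: cross_def)
   moreover have "cross R U' l' = cross R V l" using zl(2)[OF *(1,4)] .
   ultimately have "(u, v) : cross R V l" by simp
   thus "u : V & v : V" unfolding cross_def by blast
  qed
  have fV0: "finite ?V0" using fV by simp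
  \<comment> \<open>Left to right, a labelling of the zero part of an extension is continued by 0;
    edges leaving that part lie inside \<open>V\<close>, so nothing new crosses. Right to left, a
    nonzero label on a rigid extension of the zero part of \<open>V\<close> would single out a set
    of classes of \<open>V\<close> with negative balance, against \<open>safe\<close>.\<close>
  have c4: "{u : ?G. \<Lambda> u = 0} = cl R U k ?V0"
  proof (intro equalityI subsetI)
   fix u assume "u : {u : ?G. \<Lambda> u = 0}"
   then obtain U' where U': "adm k U'" "u : U'" "\<Lambda> u = 0" using Gmem by blast
   obtain l' where l': "ext U' l'" using exE adm2 U'(1) by blast
   note U'f = admD[OF U'(1)]
   let ?Z = "{v : U'. l' v = 0}"
   have l'V: "l' v = l v" if "v : V" for v using l' that unfolding ext_def by blast
   have "rigid R ?V0 ?Z"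
   proof (rule rigidI)
    show "finite ?Z" "?V0 \<subseteq> ?Z" using U'f l'V by auto
    fix t assume t: "compat ?Z t" "!!x. x : ?V0 ==> t x = 0" "\<exists>v\<in>?Z. t v ~= 0"
    define t' where "t' v = (if l' v = 0 then t v else 0)" for v
    have "compat U' t'" using t(1) l' unfolding compat_def t'_def ext_def by auto
    moreover have "t' x = 0" if "x : V" for x using t(2) l'V that unfolding t'_def by simp
    moreover have "\<exists>v\<in>U'. t' v ~= 0" using t(3) unfolding t'_def by auto
    ultimately have neg: "wt R U' t' < 0" using rigidD(3)[OF U'f(3)] by blast
    have "classes U' t' = classes ?Z t" unfolding classes_def t'_def by (auto split: if_splits)
    moreover have "cross R U' t' = cross R ?Z t"
    proof
     show "cross R ?Z t \<subseteq> cross R U' t'" unfolding cross_def t'_def by auto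
     show "cross R U' t' \<subseteq> cross R ?Z t"
     proof clarify
      fix a b assume ab: "(a, b) : cross R U' t'"
      have "l' a = l' b"
      proof (rule ccontr)
       assume "l' a ~= l' b"
       hence "(a, b) : cross R U' l'" using ab unfolding cross_def by blast
       hence "(a, b) : cross R V l" using zl(2)[OF U'(1) l'] by simp
       hence "t' a = 0" "t' b = 0" using \<open>!!x. x : V ==> t' x = 0\<close> by (auto simp: cross_def)
       thus False using ab by (simp add: cross_def)
      qed
      thus "(a, b) : cross R ?Z t" using ab unfolding cross_def t'_def by (auto split: if_splits)
     qed
    qed
    ultimately show "wt R ?Z t < 0" using neg unfolding wt_def by simp
   qed
   moreover have "?Z - ?V0 \<subseteq> U' - V" using l'V by auto
   hence "card (?Z - ?V0) <= card (U' - V)" using U'f(1) by (intro card_mono) auto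
   hence "card (?Z - ?V0) <= k" using U'(1) unfolding adm_def by linarith
   moreover have "?Z \<subseteq> U" using U'(1) unfolding adm_def by auto
   moreover have "u : ?Z" using U' Lam[OF U'(1,2) l'] by simp
   ultimately show "u : cl R U k ?V0" using clI by blast
  next
   fix u assume "u : cl R U k ?V0"
   then obtain U0 where U0: "u : U0" "U0 \<subseteq> U" "rigid R ?V0 U0" "card (U0 - ?V0) <= k" unfolding cl_def by blast
   note U0f = rigidD[OF U0(3)]
   have r: "rigid R V (U0 Un V)" using rigid_base[OF U0(3) _ fV] by blast
   have "U0 Un V - V \<subseteq> U0 - ?V0" by blast
   hence "card (U0 Un V - V) <= card (U0 - ?V0)" using U0f(1) by (intro card_mono) auto
   hence a: "adm k (U0 Un V)" using r U0 V(2) unfolding adm_def by auto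
   obtain l' where l': "ext (U0 Un V) l'" using exE adm2 a by blast
   have l'V: "l' v = l v" if "v : V" for v using l' that unfolding ext_def by blast
   have "l' u = 0"
   proof (rule ccontr)
    assume "l' u ~= 0"
    moreover have "compat U0 l'" using l' compat_subset unfolding ext_def by blast
    ultimately have neg: "wt R U0 l' < 0"
     using U0f(3)[of l'] l'V U0(1) by auto
    let ?L = "classes U0 l'"
    have "?L \<subseteq> classes (U0 Un V) l'" by (auto simp: classes_def)
    hence "?L \<subseteq> classes V l" using zl(1)[OF a l'] by simp
    moreover have "l' u : ?L" using \<open>l' u ~= 0\<close> U0(1) by (simp add: classes_def)
    hence "?L ~= {}" by auto
    ultimately have pos: "0 < real (card ?L) - \<alpha> / 2 * real (card {(u, v) : cross R V l. l u : insert 0 ?L & l v : insert 0 ?L})"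
     by (rule safe)
    have "cross R U0 l' \<subseteq> {(u, v) : cross R V l. l u : insert 0 ?L & l v : insert 0 ?L}"
    proof clarify
     fix x y assume ab: "(x, y) : cross R U0 l'"
     hence "(x, y) : cross R (U0 Un V) l'" unfolding cross_def by blast
     hence *: "(x, y) : cross R V l" using zl(2)[OF a l'] by simp
     hence "l x = l' x" "l y = l' y" using l'V unfolding cross_def by auto
     thus "(x, y) : cross R V l & l x : insert 0 ?L & l y : insert 0 ?L"
      using * ab unfolding cross_def classes_def by auto
    qed
    hence "card (cross R U0 l') <= card {(u, v) : cross R V l. l u : insert 0 ?L & l v : insert 0 ?L}"
     using fV by (intro card_mono) (auto intro: finite_subset[OF _ finite_cross[of V R l]])
    hence "\<alpha> / 2 * real (card (cross R U0 l')) <= \<alpha> / 2 * real (card {(u, v) : cross R V l. l u : insert 0 ?L & l v : insert 0 ?L})"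
     using alpha(1) by (intro mult_left_mono) auto
    thus False using pos neg unfolding wt_def by linarith
   qed
   moreover have "\<Lambda> u = l' u" using Lam[OF a _ l'] U0(1) by blast
   moreover have "u : ?G" using a U0(1) unfolding adm_def cl_def by blast
   ultimately show "u : {u : ?G. \<Lambda> u = 0}" by simp
  qed
  have r0: "rigid R X ?V0" using optimum_zero_rigid[OF fV _ l(5,3)] V(1) by blast
  have lH: "l ` V \<subseteq> {..H}" using l(4) V(4) by auto
  have safe': "\<forall>L. L \<subseteq> classes V l --> L ~= {} -->
    0 < real (card L) - \<alpha> / 2 * real (card {(u, v) : cross R V l. l u : insert 0 L & l v : insert 0 L})"
   using safe by blast
  show ?case
   by (rule exI[of _ V], rule exI[of _ l], rule exI[of _ \<Lambda>])
    (intro conjI V(1) V(2) V(4) l(1) l(2) lz lH r0 safe' LV c1 c2 c3 c4)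
 qed
qed

end

section \<open>Games and closures\<close>

lemma piso_comp: "piso R R' P ==> piso R' R'' Q ==> piso R R'' (P O Q)"
 unfolding piso_def by (clarsimp)

lemma ef_trans:
 "ef q U R U' R' P ==> ef q U' R' U'' R'' Q ==> ef q U R U'' R'' (P O Q)"
proof (induction q arbitrary: P Q)
 case 0
 thus ?case using piso_comp by (auto simp: relcomp_def)
next
 case (Suc q)
 have sub: "insert (a, c) (P O Q) \<subseteq> insert (a, b) P O insert (b, c) Q" for a b c by auto
 have base: "P O Q \<subseteq> U \<times> U''" "piso R R'' (P O Q)"
  using ef_basic[OF Suc.prems(1)] ef_basic[OF Suc.prems(2)] piso_comp by blast+
 have "\<exists>c\<in>U''. ef q U R U'' R'' (insert (a, c) (P O Q))" if a: "a : U" for a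
 proof -
  obtain b where b: "b : U'" "ef q U R U' R' (insert (a, b) P)" using ef_forth[OF Suc.prems(1) a] by blast
  obtain c where c: "c : U''" "ef q U' R' U'' R'' (insert (b, c) Q)" using ef_forth[OF Suc.prems(2) b(1)] by blast
  show ?thesis using ef_subset[OF Suc.IH[OF b(2) c(2)] sub] c(1) by blast
 qed
 moreover have "\<exists>a\<in>U. ef q U R U'' R'' (insert (a, c) (P O Q))" if c: "c : U''" for c
 proof -
  obtain b where b: "b : U'" "ef q U' R' U'' R'' (insert (b, c) Q)" using ef_back[OF Suc.prems(2) c] by blast
  obtain a where a: "a : U" "ef q U R U' R' (insert (a, b) P)" using ef_back[OF Suc.prems(1) b(1)] by blast
  show ?thesis using ef_subset[OF Suc.IH[OF a(2) b(2)] sub] a(1) by blast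
 qed
 ultimately show ?case using base by simp
qed

lemma piso_fun:
 assumes "piso R R' P" "V \<subseteq> fst ` P"
 obtains f where "\<forall>v\<in>V. (v, f v) : P" "inj_on f V" "\<forall>X. X \<subseteq> V --> f ` X = P `` X"
  "\<forall>u\<in>V. \<forall>v\<in>V. (u, v) : R \<longleftrightarrow> (f u, f v) : R'" "\<forall>u\<in>V. \<forall>v\<in>V. v = Suc u \<longleftrightarrow> f v = Suc (f u)"
proof -
 have "\<forall>v\<in>V. \<exists>w. (v, w) : P" using assms(2) by force
 then obtain f where f: "\<forall>v\<in>V. (v, f v) : P" by metis
 have "inj_on f V" using pisoD(1)[OF assms(1)] f by (metis inj_onI)
 moreover have "\<forall>X. X \<subseteq> V --> f ` X = P `` X"
 proof (intro allI impI equalityI)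
  fix X assume that: "X \<subseteq> V"
  show "f ` X \<subseteq> P `` X" using f that by auto
  show "P `` X \<subseteq> f ` X"
  proof
   fix w assume "w : P `` X"
   then obtain x where "x : X" "(x, w) : P" by blast
   moreover from this have "w = f x" using pisoD(1)[OF assms(1), of x w x "f x"] f that by blast
   ultimately show "w : f ` X" by blast
  qed
 qed
 moreover have "\<forall>u\<in>V. \<forall>v\<in>V. (u, v) : R \<longleftrightarrow> (f u, f v) : R'"
  using pisoD(2)[OF assms(1)] f by blast
 moreover have "\<forall>u\<in>V. \<forall>v\<in>V. v = Suc u \<longleftrightarrow> f v = Suc (f u)"
 proof (intro ballI)
  fix u v assume "u : V" "v : V"
  thus "v = Suc u \<longleftrightarrow> f v = Suc (f u)" using pisoD(3)[OF assms(1), of u "f u" v "f v"] f by simp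
 qed
 ultimately show ?thesis using that[of f] f by simp
qed

text \<open>Wide gaps prevent a few extra vertices from forming a run of successors between two
  vertices of \<open>T\<close>; see \<open>no_bridge\<close>.\<close>

definition gapped :: "nat => nat set => bool" where
 "gapped g T \<longleftrightarrow> (\<forall>t\<in>T. \<forall>t'\<in>T. t < t' --> (\<forall>s. t < s --> s < t' --> s ~: T) --> t' = Suc t \<or> t + g < t')"

lemma stretch:
 assumes "finite U"
 shows "\<exists>f. inj_on f U & (\<forall>u\<in>U. \<forall>v\<in>U. v = Suc u \<longleftrightarrow> f v = Suc (f u)) & gapped g (f ` U) & (\<forall>u\<in>U. 1 <= f u)"
proof -
 \<comment> \<open>Every number missing from \<open>U\<close> is widened by \<open>g\<close>; the
   summand 1 keeps the image away from 0, which is not a vertex.\<close>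
 define f where "f t = 1 + t + g * card {s. s < t & s ~: U}" for t :: nat
 have fin: "finite {s. s < t & s ~: U}" for t :: nat by simp
 have mono: "f t + (t' - t) <= f t'" if "t <= t'" for t t'
 proof -
  have "card {s. s < t & s ~: U} <= card {s. s < t' & s ~: U}" using that by (intro card_mono) auto
  hence "g * card {s. s < t & s ~: U} <= g * card {s. s < t' & s ~: U}" by simp
  thus ?thesis using that unfolding f_def by linarith
 qed
 have strict: "f t < f t'" if "t < t'" for t t' using mono[of t t'] that by simp
 have inj: "inj f" by (rule injI) (metis strict linorder_neq_iff less_irrefl)
 have succ: "f (Suc u) = Suc (f u)" if "u : U" for u
 proof -
  have "{s. s < Suc u & s ~: U} = {s. s < u & s ~: U}" using that less_Suc_eq by auto
  thus ?thesis unfolding f_def by simp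
 qed
 have "v = Suc u \<longleftrightarrow> f v = Suc (f u)" if "u : U" for u v
  using succ[OF that] inj by (metis injD)
 moreover have "gapped g (f ` U)" unfolding gapped_def
 proof (clarify)
  fix t t' assume t: "t : U" "t' : U" "f t < f t'" "\<forall>s. f t < s --> s < f t' --> s ~: f ` U" "~ f t + g < f t'"
  have lt: "t < t'" using t(3) strict by (metis linorder_neqE_nat less_asym)
  show "f t' = Suc (f t)"
  proof (rule ccontr)
   assume "f t' ~= Suc (f t)"
   hence "t' ~= Suc t" using succ t(1) by blast
   hence l2: "Suc t < t'" using lt by simp
   have "Suc t ~: U" using t(4) strict[OF l2] strict[of t "Suc t"] by blast
   hence "insert (Suc t) {s. s < t & s ~: U} \<subseteq> {s. s < t' & s ~: U}" using l2 by auto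
   hence "card (insert (Suc t) {s. s < t & s ~: U}) <= card {s. s < t' & s ~: U}" by (intro card_mono) auto
   hence "Suc (card {s. s < t & s ~: U}) <= card {s. s < t' & s ~: U}" by simp
   hence "g * Suc (card {s. s < t & s ~: U}) <= g * card {s. s < t' & s ~: U}" by (rule mult_le_mono2)
   thus False using t(5) lt unfolding f_def by simp
  qed
 qed
 moreover have "\<forall>u\<in>U. 1 <= f u" by (simp add: f_def)
 moreover have "inj_on f U" using inj by (rule inj_on_subset) simp
 ultimately show ?thesis by (intro exI[of _ f] conjI ballI) simp_all
qed

text \<open>There are finitely many types of rank \<open>q\<close> with \<open>m\<close> marked
  points. Choose one structure for each type, stretch it, and let \<open>N\<close> bound them all;
  the graph that is represented may be arbitrarily large.\<close>

lemma finite_reps_aux: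
 "\<exists>N. \<forall>U R E. finite U --> E \<subseteq> U --> card E = m --> sym R --> irrefl R -->
  (\<exists>T G f. T \<subseteq> {1..N} & gapped g T & G \<subseteq> T \<times> T & sym G & irrefl G & ef q U R T G ((%e. (e, f e)) ` E))"
proof -
 define Q where "Q v x \<longleftrightarrow> (case x of (T, G, ts) => finite T & length ts = m & set ts \<subseteq> T & sym G & irrefl G & tp q T G ts = v)"
  for v and x :: "nat set \<times> edges \<times> nat list"
 define F where "F = {v. \<exists>x. Q v x}"
 have "F \<subseteq> {tp q U R xs | U R xs. finite U & length xs = m}" unfolding F_def Q_def by auto
 hence fF: "finite F" using finite_tp finite_subset by blast
 define rep where "rep v = (SOME x. Q v x)" for v
 have rep: "Q v (rep v)" if "v : F" for v
  unfolding rep_def using that[unfolded F_def mem_Collect_eq] by (rule someI_ex)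
 have fin: "finite (fst (rep v))" if "v : F" for v using rep[OF that] unfolding Q_def by (auto split: prod.splits)
 define st where "st v = (SOME f. inj_on f (fst (rep v)) & (\<forall>u\<in>fst (rep v). \<forall>w\<in>fst (rep v). w = Suc u \<longleftrightarrow> f w = Suc (f u)) &
   gapped g (f ` fst (rep v)) & (\<forall>u\<in>fst (rep v). 1 <= f u))" for v
 have st: "inj_on (st v) (fst (rep v))" "\<forall>u\<in>fst (rep v). \<forall>w\<in>fst (rep v). w = Suc u \<longleftrightarrow> st v w = Suc (st v u)"
   "gapped g (st v ` fst (rep v))" "\<forall>u\<in>fst (rep v). 1 <= st v u" if "v : F" for v
  using someI_ex[OF stretch[OF fin[OF that], of g]] unfolding st_def by blast+
 define N where "N = Max (insert 0 (\<Union>v\<in>F. st v ` fst (rep v)))"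
 have fU: "finite (insert 0 (\<Union>v\<in>F. st v ` fst (rep v)))" using fF fin by auto
 show ?thesis
 proof (intro exI[of _ N] allI impI)
  fix U E :: "nat set" and R :: "edges" assume a: "finite U" "E \<subseteq> U" "card E = m" "sym R" "irrefl R"
  have fE: "finite E" using a finite_subset by blast
  define es where "es = sorted_list_of_set E"
  have es: "set es = E" "distinct es" "length es = m" using fE a(3) unfolding es_def by auto
  define v where "v = tp q U R es"
  have "Q v (U, R, es)" unfolding Q_def v_def using a es by auto
  hence vF: "v : F" unfolding F_def by blast
  obtain T0 G0 ts where r: "rep v = (T0, G0, ts)" by (metis prod_cases3)
  have Q0: "finite T0" "length ts = m" "set ts \<subseteq> T0" "sym G0" "irrefl G0" "tp q T0 G0 ts = v"
   using rep[OF vF] unfolding Q_def r by auto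
  have e1: "ef q U R T0 G0 (set (zip es ts))"
   by (rule ef_of_tp) (use Q0 es a v_def in auto)
  let ?s = "st v"
  note s = st[OF vF, unfolded r fst_conv]
  define T where "T = ?s ` T0"
  define G where "G = (%(x, y). (?s x, ?s y)) ` (G0 Int T0 \<times> T0)"
  have mem: "(?s x, ?s y) : G \<longleftrightarrow> (x, y) : G0" if "x : T0" "y : T0" for x y
  proof
   assume "(?s x, ?s y) : G"
   then obtain x' y' where "(x', y') : G0" "x' : T0" "y' : T0" "?s x = ?s x'" "?s y = ?s y'" unfolding G_def by auto
   thus "(x, y) : G0" using inj_onD[OF s(1)] that by metis
  qed (use that in \<open>auto simp: G_def\<close>)
  have e2: "ef q T0 G0 T G ((%a. (a, ?s a)) ` T0)"
   by (rule ef_of_iso[where f = ?s]) (use s mem in \<open>auto simp: T_def bij_betw_def\<close>)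
  define f where "f e = (case map_of (zip es ts) e of Some t => ?s t | None => 0)" for e
  have "(%e. (e, f e)) ` E \<subseteq> set (zip es ts) O ((%a. (a, ?s a)) ` T0)"
  proof clarify
   fix e assume "e : E"
   hence "e : set es" using es by simp
   then obtain t where t: "map_of (zip es ts) e = Some t" using es(3) Q0(2) by (metis map_of_zip_is_Some)
   hence "(e, t) : set (zip es ts)" by (rule map_of_SomeD)
   moreover have "t : T0" using calculation Q0(3) by (auto dest: set_zip_rightD)
   ultimately show "(e, f e) : set (zip es ts) O ((%a. (a, ?s a)) ` T0)"
    unfolding f_def t by auto
  qed
  hence "ef q U R T G ((%e. (e, f e)) ` E)" using ef_subset[OF ef_trans[OF e1 e2]] by blast
  moreover have "T \<subseteq> {1..N}"
  proof
   fix x assume x: "x : T"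
   hence "x : insert 0 (\<Union>v\<in>F. st v ` fst (rep v))" using vF r unfolding T_def by force
   hence "x <= N" unfolding N_def using Max_ge[OF fU] by blast
   moreover have "1 <= x" using x s(4) unfolding T_def by auto
   ultimately show "x : {1..N}" by simp
  qed
  moreover have "sym G" using Q0(4) unfolding G_def sym_def by force
  moreover have "irrefl G"
  proof (rule irreflI)
   fix x show "(x, x) ~: G"
   proof
    assume "(x, x) : G"
    then obtain a b where "(a, b) : G0" "a : T0" "b : T0" "?s a = ?s b" unfolding G_def by auto
    thus False using inj_onD[OF s(1)] Q0(5) by (metis irrefl_def)
   qed
  qed
  moreover have "G \<subseteq> T \<times> T" unfolding G_def T_def by auto
  moreover have "gapped g T" using s(3) unfolding T_def .
  ultimately show "\<exists>T G f. T \<subseteq> {1..N} & gapped g T & G \<subseteq> T \<times> T & sym G & irrefl G & ef q U R T G ((%e. (e, f e)) ` E)"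
   by (intro exI[of _ T] exI[of _ G] exI[of _ f] conjI)
 qed
qed

text \<open>\<open>N \<ge> m\<close> is included so that \<open>N\<close> also bounds the labels,
  which range up to \<open>h\<close> in \<open>step\<close>.\<close>

lemma finite_reps:
 "\<exists>N\<ge>m. \<forall>U R E. finite U --> E \<subseteq> U --> card E <= m --> sym R --> irrefl R -->
  (\<exists>T G f. T \<subseteq> {1..N} & gapped g T & G \<subseteq> T \<times> T & sym G & irrefl G & ef q U R T G ((%e. (e, f e)) ` E))"
proof -
 define A where "A m N \<longleftrightarrow> (\<forall>U R E. finite U --> E \<subseteq> U --> card E = m --> sym R --> irrefl R -->
  (\<exists>T G f. T \<subseteq> {1..N} & gapped g T & G \<subseteq> T \<times> T & sym G & irrefl G & ef q U R T G ((%e. (e, f e)) ` E)))"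
  for m N
 have "\<forall>m. \<exists>N. A m N" unfolding A_def by (rule allI) (rule finite_reps_aux)
 then obtain N where NA: "\<forall>m. A m (N m)" by (rule choice[THEN exE])
 note N = NA[rule_format, unfolded A_def, rule_format]
 define M where "M = m + (\<Sum>i\<le>m. N i)"
 show ?thesis
 proof (intro exI[of _ M] conjI allI impI)
  fix U E :: "nat set" and R :: "edges" assume a: "finite U" "E \<subseteq> U" "card E <= m" "sym R" "irrefl R"
  have "N (card E) <= M" unfolding M_def using a(3) by (simp add: member_le_sum trans_le_add2)
  hence "{1..N (card E)} \<subseteq> {1..M}" by auto
  thus "\<exists>T G f. T \<subseteq> {1..M} & gapped g T & G \<subseteq> T \<times> T & sym G & irrefl G & ef q U R T G ((%e. (e, f e)) ` E)"
   using N[OF a(1,2) refl a(4,5)] by (meson subset_trans)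
 qed (simp add: M_def)
qed

context irrational_exponent
begin

text \<open>A rigid extension by at most \<open>k\<close> vertices can be played out in
  \<open>k\<close> rounds, and rigidity is invariant under partial isomorphism.\<close>

lemma cl_transfer:
 assumes "ef k U R U' R' P" "X \<subseteq> fst ` P" "(a, b) : P" "a : cl R U k X"
 shows "b : cl R' U' k (P `` X)"
proof -
 obtain V where V: "a : V" "V \<subseteq> U" "rigid R X V" "card (V - X) <= k" using assms(4) unfolding cl_def by blast
 note Vf = rigidD[OF V(3)]
 obtain P' where P': "P \<subseteq> P'" "ef 0 U R U' R' P'" "fst ` P' = fst ` P Un (V - X)"
  using ef_extend[of 0 k U R U' R' P "V - X"] assms(1) Vf(1) V(2,4) by fastforce
 have pi: "piso R R' P'" "P' \<subseteq> U \<times> U'" using P'(2) by auto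
 have "V \<subseteq> fst ` P'" using P'(3) assms(2) by blast
 then obtain f where f: "\<forall>v\<in>V. (v, f v) : P'" "inj_on f V" "\<forall>X. X \<subseteq> V --> f ` X = P' `` X"
  "\<forall>u\<in>V. \<forall>v\<in>V. (u, v) : R \<longleftrightarrow> (f u, f v) : R'" "\<forall>u\<in>V. \<forall>v\<in>V. v = Suc u \<longleftrightarrow> f v = Suc (f u)"
  by (rule piso_fun[OF pi(1)])
 have "P' `` X = P `` X"
 proof
  show "P `` X \<subseteq> P' `` X" using P'(1) by blast
  show "P' `` X \<subseteq> P `` X"
  proof
   fix w assume "w : P' `` X"
   then obtain x where x: "x : X" "(x, w) : P'" by blast
   then obtain w' where "(x, w') : P" using assms(2) by force
   hence "w = w'" using pisoD(1)[OF pi(1), of x w x w'] x P'(1) by blast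
   thus "w : P `` X" using x \<open>(x, w') : P\<close> by blast
  qed
 qed
 hence X: "f ` X = P `` X" using f(3) Vf(2) by simp
 have "rigid R' (f ` X) (f ` V)" by (rule rigid_iso[OF V(3) f(2)]) (use f in auto)
 moreover have "f ` V \<subseteq> U'" using f(1) pi(2) by blast
 moreover have "card (f ` V - f ` X) <= k"
 proof -
  have "f ` V - f ` X \<subseteq> f ` (V - X)" by blast
  hence "card (f ` V - f ` X) <= card (V - X)" using Vf(1) by (meson card_image_le card_mono finite_Diff finite_imageI le_trans)
  thus ?thesis using V(4) by simp
 qed
 moreover have "b = f a" using pisoD(1)[OF pi(1), of a b a "f a"] assms(3) P'(1) f(1) V(1) by blast
 ultimately show ?thesis using clI V(1) X by (metis imageI subsetD)
qed

lemma ef_Image_converse: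
 assumes "piso R R' P" "X \<subseteq> fst ` P" "P \<subseteq> P'" "piso R R' P'"
 shows "P'\<inverse> `` (P `` X) = X" "P' `` X = P `` X" "P `` X \<subseteq> fst ` (P\<inverse>)"
proof -
 have fu: "w = w'" if "(x, w) : P'" "(x, w') : P'" for x w w' using pisoD(1)[OF assms(4), of x w x w'] that by blast
 have inj: "x = x'" if "(x, w) : P'" "(x', w) : P'" for x x' w using pisoD(1)[OF assms(4), of x w x' w] that by blast
 show "P'\<inverse> `` (P `` X) = X"
 proof
  show "P'\<inverse> `` (P `` X) \<subseteq> X"
  proof
   fix x assume "x : P'\<inverse> `` (P `` X)"
   then obtain w x' where "(x, w) : P'" "x' : X" "(x', w) : P" by blast
   thus "x : X" using inj[of x w x'] assms(3) by blast
  qed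
  show "X \<subseteq> P'\<inverse> `` (P `` X)"
  proof
   fix x assume "x : X"
   then obtain w where "(x, w) : P" using assms(2) by force
   thus "x : P'\<inverse> `` (P `` X)" using \<open>x : X\<close> assms(3) by blast
  qed
 qed
 show "P' `` X = P `` X"
 proof
  show "P' `` X \<subseteq> P `` X"
  proof
   fix w assume "w : P' `` X"
   then obtain x where x: "x : X" "(x, w) : P'" by blast
   then obtain w' where "(x, w') : P" using assms(2) by force
   thus "w : P `` X" using fu[of x w w'] x assms(3) by blast
  qed
 qed (use assms(3) in blast)
 show "P `` X \<subseteq> fst ` (P\<inverse>)" by force
qed

text \<open>\<open>k\<close> rounds held in reserve decide membership in the closure of depth
  \<open>k\<close>, in both directions; this is the definability that \<open>ef_relativize\<close>
  requires.\<close>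

lemma ef_cl:
 assumes "ef (q + k) U R U' R' P" "X \<subseteq> fst ` P" "P0 \<subseteq> P" "P0 \<subseteq> cl R U k X \<times> cl R' U' k (P `` X)"
 shows "ef q (cl R U k X) R (cl R' U' k (P `` X)) R' P0"
proof (rule ef_relativize[OF assms(1) cl_sub cl_sub assms(3,4)])
 fix P' a b assume P': "P \<subseteq> P'" "ef k U R U' R' P'" "(a, b) : P'"
 have pi: "piso R R' P" "piso R R' P'" using ef_basic assms(1) P'(2) by blast+
 note im = ef_Image_converse[OF pi(1) assms(2) P'(1) pi(2)]
 have "X \<subseteq> fst ` P'" using assms(2) P'(1) by blast
 hence "b : cl R' U' k (P `` X)" if "a : cl R U k X"
  using cl_transfer[OF P'(2) _ P'(3) that] im(2) by simp
 moreover have "a : cl R U k X" if "b : cl R' U' k (P `` X)"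
 proof -
  have "P `` X \<subseteq> fst ` (P'\<inverse>)" using P'(1) by force
  thus ?thesis using cl_transfer[OF ef_converse[OF P'(2)] _ _ that, of a] P'(3) im(1) by simp
 qed
 ultimately show "a : cl R U k X \<longleftrightarrow> b : cl R' U' k (P `` X)" by blast
qed

end

section \<open>Patterns and Duplicator's strategy\<close>

definition lft :: "nat set => nat => nat" where
 "lft Z z = Max {x. x < z & x ~: Z}"

definition rgt :: "nat set => nat => nat" where
 "rgt Z z = (LEAST x. z < x & x ~: Z)"

lemma lft_props:
 assumes "0 ~: Z" "z : Z"
 shows "lft Z z < z" "lft Z z ~: Z" "!!x. lft Z z < x ==> x <= z ==> x : Z"
proof -
 have ne: "{x. x < z & x ~: Z} ~= {}" using assms by (metis (mono_tags, lifting) bot_nat_0.not_eq_extremum empty_Collect_eq)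
 have fin: "finite {x. x < z & x ~: Z}" by simp
 have "lft Z z : {x. x < z & x ~: Z}" unfolding lft_def using Max_in[OF fin ne] .
 thus "lft Z z < z" "lft Z z ~: Z" by auto
 show "x : Z" if "lft Z z < x" "x <= z" for x
 proof (rule ccontr)
  assume "x ~: Z"
  hence "x : {x. x < z & x ~: Z}" using that assms(2) by (auto simp: le_less)
  hence "x <= lft Z z" unfolding lft_def using Max_ge[OF fin] by blast
  thus False using that by simp
 qed
qed

lemma rgt_props:
 assumes "finite Z" "z : Z"
 shows "z < rgt Z z" "rgt Z z ~: Z" "!!x. z <= x ==> x < rgt Z z ==> x : Z"
proof -
 have "finite (Z Un {..z})" using assms(1) by simp
 then obtain x where x: "x ~: Z Un {..z}" using ex_new_if_finite infinite_UNIV_nat by blast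
 hence *: "z < x & x ~: Z" by auto
 show "z < rgt Z z" "rgt Z z ~: Z"
  using LeastI[of "%x. z < x & x ~: Z", OF *] unfolding rgt_def by auto
 show "x : Z" if "z <= x" "x < rgt Z z" for x
  using not_less_Least[of x "%x. z < x & x ~: Z"] that assms(2) unfolding rgt_def by (auto simp: le_less)
qed

lemma lft_Suc: "0 ~: Z ==> z : Z ==> lft Z (Suc z) = lft Z z"
 unfolding lft_def by (rule arg_cong[of _ _ Max]) (auto simp: less_Suc_eq)

lemma rgt_Suc: "finite Z ==> z : Z ==> Suc z : Z ==> rgt Z (Suc z) = rgt Z z"
 unfolding rgt_def by (rule arg_cong[of _ _ Least]) (auto simp: fun_eq_iff, metis Suc_lessI)

lemma lft_eq: "w ~: Z ==> lft Z (Suc w) = w"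
 unfolding lft_def by (rule Max_eqI) auto

lemma rgt_eq: "Suc z ~: Z ==> rgt Z z = Suc z"
 unfolding rgt_def by (rule Least_equality) auto

lemma rgt_lft_le:
 assumes "finite Z" "0 ~: Z" "z : Z"
 shows "rgt Z z <= lft Z z + card Z + 1"
proof -
 have "{lft Z z<..<rgt Z z} \<subseteq> Z"
 proof
  fix x assume "x : {lft Z z<..<rgt Z z}"
  thus "x : Z" using lft_props(3)[OF assms(2,3), of x] rgt_props(3)[OF assms(1,3), of x] by (cases "x <= z") auto
 qed
 hence "card {lft Z z<..<rgt Z z} <= card Z" using assms(1) card_mono by blast
 thus ?thesis by simp
qed

text \<open>The label that a run of consecutive vertices of \<open>Z\<close> has to take from its
  surroundings: that of its neighbour in \<open>D\<close>, on the left if possible, and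
  \<open>e\<close> if the run touches \<open>D\<close> on neither side.\<close>

definition attl :: "nat set => nat set => (nat => nat) => nat => nat => nat" where
 "attl Z D g e z = (if lft Z z : D then g (lft Z z) else if rgt Z z : D then g (rgt Z z) else e)"

lemma attl_compat:
 assumes Z: "finite Z" "0 ~: Z" "Z \<subseteq> U"
  and nb: "!!z. z : Z ==> lft Z z : D ==> rgt Z z ~: D"
  and adj: "!!z w. z : Z ==> w : U - Z ==> w = Suc z \<or> z = Suc w ==> w : D"
  and t: "compat (U - Z) t" "!!d. d : D ==> d : U - Z ==> g d = t d"
 shows "compat U (%u. if u : Z then attl Z D g e u else t u)"
 unfolding compat_def
proof (intro ballI impI)
 fix u assume u: "u : U" "Suc u : U"
 let ?f = "%u. if u : Z then attl Z D g e u else t u"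
 consider "u : Z" "Suc u : Z" | "u : Z" "Suc u ~: Z" | "u ~: Z" "Suc u : Z" | "u ~: Z" "Suc u ~: Z" by blast
 thus "?f u = ?f (Suc u)"
 proof cases
  case 1
  thus ?thesis using lft_Suc[OF Z(2) 1(1)] rgt_Suc[OF Z(1) 1] by (simp add: attl_def)
 next
  case 2
  have "rgt Z u = Suc u" using rgt_eq[OF 2(2)] .
  moreover have D: "Suc u : D" using adj[OF 2(1), of "Suc u"] u 2 by blast
  ultimately show ?thesis using nb[OF 2(1)] 2 t(2)[OF D] u by (auto simp: attl_def)
 next
  case 3
  have "lft Z (Suc u) = u" using lft_eq[OF 3(1)] .
  moreover have D: "u : D" using adj[OF 3(2), of u] u 3 by blast
  ultimately show ?thesis using 3 t(2)[OF D] u by (auto simp: attl_def)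
 next
  case 4
  thus ?thesis using t(1) u unfolding compat_def by simp
 qed
qed

definition vset :: "(nat => nat) => (nat => nat set) => nat => nat set" where
 "vset y T c = (%t. y c + t) ` T c"

context irrational_exponent
begin

text \<open>The data read off a decomposition: parts of shape \<open>T c\<close> with graph
  \<open>G c\<close>, a base \<open>T 0\<close> that already sits in the graph, and the edges
  \<open>J\<close> between parts, listed in both directions and addressed by part and offset. The
  last clause is the safety inequality of \<open>optimum_safe\<close>; \<open>gapped (k + 1)\<close>
  serves \<open>no_bridge\<close>.\<close>

definition pat_ok :: "nat => nat => nat => nat set => (nat => nat set) => (nat => edges) =>
  ((nat \<times> nat) \<times> nat \<times> nat) set => bool" where
 "pat_ok N k n Cs T G J \<longleftrightarrow> Cs \<subseteq> {1..N} & T 0 \<subseteq> {1..n} &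
  (\<forall>c\<in>Cs. T c \<subseteq> {1..N} & gapped (k + 1) (T c) & G c \<subseteq> T c \<times> T c & sym (G c) & irrefl (G c)) &
  J \<subseteq> {((c, t), (d, s)). c : insert 0 Cs & d : insert 0 Cs & c ~= d & t : T c & s : T d} & sym J &
  (\<forall>L. L \<subseteq> Cs --> L ~= {} -->
    0 < real (card L) - \<alpha> / 2 * real (card {((c, t), (d, s)) : J. c : insert 0 L & d : insert 0 L}))"

text \<open>The base stays put, every other part is translated. The last clause limits what may be
  rigid over the placed pattern. Successor neighbours of the copies are always rigid, so they cannot
  be excluded; they go into \<open>Z\<close>, which has no edges and touches only the copies. The
  rest of \<open>C\<close> must not touch the copies at all.\<close>

definition realizes :: "nat => nat => edges => nat set => (nat => nat set) => (nat => edges) =>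
  ((nat \<times> nat) \<times> nat \<times> nat) set => (nat => nat) => bool" where
 "realizes k n R Cs T G J y \<longleftrightarrow> y 0 = 0 &
  (\<forall>c\<in>Cs. vset y T c \<subseteq> {1..n} & (\<forall>t\<in>T c. \<forall>s\<in>T c. (y c + t, y c + s) : R \<longleftrightarrow> (t, s) : G c)) &
  (\<forall>c\<in>insert 0 Cs. \<forall>d\<in>insert 0 Cs. c ~= d --> (\<forall>t\<in>T c. \<forall>s\<in>T d.
    ((y c + t, y d + s) : R \<longleftrightarrow> ((c, t), (d, s)) : J) & (y c + t + k + 1 < y d + s \<or> y d + s + k + 1 < y c + t))) &
  (\<forall>C. C \<subseteq> {1..n} --> C Int (\<Union>c\<in>insert 0 Cs. vset y T c) = {} --> card C <= k -->
    rigid R (\<Union>c\<in>insert 0 Cs. vset y T c) ((\<Union>c\<in>insert 0 Cs. vset y T c) Un C) -->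
    (\<exists>Z\<subseteq>C. (\<forall>z\<in>Z. \<forall>w\<in>(\<Union>c\<in>insert 0 Cs. vset y T c) Un C. (z, w) ~: R) &
     (\<forall>z\<in>Z. \<forall>w\<in>(C - Z) Un T 0. w ~= Suc z & z ~= Suc w) &
     (\<forall>v\<in>C - Z. \<forall>w\<in>(\<Union>c\<in>Cs. vset y T c). (v, w) ~: R & w ~= Suc v & v ~= Suc w)))"

end

section \<open>Closures around a realised pattern\<close>

locale placement = irrational_exponent +
 fixes N k n :: nat and R :: "edges" and Cs T G J y
 assumes symR: "sym R" and pat: "pat_ok N k n Cs T G J" and real: "realizes k n R Cs T G J y"
begin

abbreviation "V0 \<equiv> T 0"
abbreviation "D c \<equiv> vset y T c"
definition "DD = (\<Union>c\<in>Cs. D c)"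

lemma pat_parts:
 "Cs \<subseteq> {1..N}" "T 0 \<subseteq> {1..n}"
 "\<forall>c\<in>Cs. T c \<subseteq> {1..N} & gapped (k + 1) (T c) & G c \<subseteq> T c \<times> T c & sym (G c) & irrefl (G c)"
 "J \<subseteq> {((c, t), (d, s)). c : insert 0 Cs & d : insert 0 Cs & c ~= d & t : T c & s : T d}" "sym J"
 "\<forall>L. L \<subseteq> Cs --> L ~= {} -->
  0 < real (card L) - \<alpha> / 2 * real (card {((c, t), (d, s)) : J. c : insert 0 L & d : insert 0 L})"
 using pat[unfolded pat_ok_def] by - (elim conjE, assumption)+

lemma real_parts:
 "y 0 = 0"
 "\<forall>c\<in>Cs. vset y T c \<subseteq> {1..n} & (\<forall>t\<in>T c. \<forall>s\<in>T c. (y c + t, y c + s) : R \<longleftrightarrow> (t, s) : G c)"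
 "\<forall>c\<in>insert 0 Cs. \<forall>d\<in>insert 0 Cs. c ~= d --> (\<forall>t\<in>T c. \<forall>s\<in>T d.
  ((y c + t, y d + s) : R \<longleftrightarrow> ((c, t), (d, s)) : J) & (y c + t + k + 1 < y d + s \<or> y d + s + k + 1 < y c + t))"
 "(\<forall>C. C \<subseteq> {1..n} --> C Int (\<Union>c\<in>insert 0 Cs. vset y T c) = {} --> card C <= k -->
    rigid R (\<Union>c\<in>insert 0 Cs. vset y T c) ((\<Union>c\<in>insert 0 Cs. vset y T c) Un C) -->
    (\<exists>Z\<subseteq>C. (\<forall>z\<in>Z. \<forall>w\<in>(\<Union>c\<in>insert 0 Cs. vset y T c) Un C. (z, w) ~: R) &
     (\<forall>z\<in>Z. \<forall>w\<in>(C - Z) Un T 0. w ~= Suc z & z ~= Suc w) &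
     (\<forall>v\<in>C - Z. \<forall>w\<in>(\<Union>c\<in>Cs. vset y T c). (v, w) ~: R & w ~= Suc v & v ~= Suc w)))"
 using real[unfolded realizes_def] by - (elim conjE, assumption)+

lemmas y0 = real_parts(1)

lemma D0: "D 0 = V0" unfolding vset_def y0 by simp

lemma Wset: "(\<Union>c\<in>insert 0 Cs. D c) = V0 Un DD" unfolding DD_def using D0 by simp

lemma zero_notin: "0 ~: Cs" using pat_parts(1) by auto

lemma fins: "finite Cs" "finite V0" "c : Cs ==> finite (D c)" "finite DD"
proof -
 show "finite Cs" "finite V0" using pat_parts(1,2) finite_subset by auto
 show c: "finite (D c)" if "c : Cs" for c
  unfolding vset_def using finite_subset[of "T c" "{1..N}"] pat_parts(3) that by simp
 show "finite DD" unfolding DD_def using \<open>finite Cs\<close> c by simp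
qed

lemma DDsub: "DD \<subseteq> {1..n}" unfolding DD_def using real_parts(2) by fast

lemma far:
 assumes "c : insert 0 Cs" "d : insert 0 Cs" "c ~= d" "u : D c" "v : D d"
 shows "u + k + 1 < v \<or> v + k + 1 < u"
proof -
 obtain t s where ts: "t : T c" "s : T d" "u = y c + t" "v = y d + s" using assms(4,5) unfolding vset_def by auto
 show ?thesis using real_parts(3)[rule_format, OF assms(1-3) ts(1,2)] ts by simp
qed

lemma edgeJ:
 assumes "c : insert 0 Cs" "d : insert 0 Cs" "c ~= d" "t : T c" "s : T d"
 shows "(y c + t, y d + s) : R \<longleftrightarrow> ((c, t), (d, s)) : J"
 using real_parts(3)[rule_format, OF assms] by simp

lemma edgeG: "c : Cs ==> t : T c ==> s : T c ==> (y c + t, y c + s) : R \<longleftrightarrow> (t, s) : G c"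
 using real_parts(2) by simp

lemma D_disj: "c : insert 0 Cs ==> d : insert 0 Cs ==> c ~= d ==> D c Int D d = {}"
proof (rule ccontr)
 assume a: "c : insert 0 Cs" "d : insert 0 Cs" "c ~= d" "D c Int D d ~= {}"
 then obtain x where "x : D c" "x : D d" by blast
 thus False using far[OF a(1-3), of x x] by simp
qed

lemma V0_DD: "V0 Int DD = {}"
proof (rule ccontr)
 assume "V0 Int DD ~= {}"
 then obtain x c where x: "x : D 0" "c : Cs" "x : D c" unfolding DD_def D0 by blast
 moreover have "c ~= 0" using x(2) zero_notin by metis
 ultimately show False using D_disj[of 0 c] by auto
qed

lemma V0_DD_succ: "v : V0 ==> d : DD ==> v ~= Suc d & d ~= Suc v"
proof -
 assume v: "v : V0" and "d : DD"
 then obtain c where c: "c : Cs" "d : D c" unfolding DD_def by blast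
 hence "c ~= 0" using zero_notin by metis
 thus ?thesis using far[of 0 c v d] c v D0 by auto
qed

lemma split_C:
 assumes "C \<subseteq> {1..n}" "C Int (V0 Un DD) = {}" "card C <= k" "rigid R (V0 Un DD) (V0 Un DD Un C)"
 obtains Z where "Z \<subseteq> C" "!!z w. z : Z ==> w : V0 Un DD Un C ==> (z, w) ~: R"
  "!!z w. z : Z ==> w : (C - Z) Un V0 ==> w ~= Suc z & z ~= Suc w"
  "!!v w. v : C - Z ==> w : DD ==> (v, w) ~: R & w ~= Suc v & v ~= Suc w"
proof -
 note r = real_parts(4)[unfolded Wset DD_def[symmetric], rule_format, OF assms]
 from r obtain Z where "Z \<subseteq> C" "\<forall>z\<in>Z. \<forall>w\<in>(V0 Un DD) Un C. (z, w) ~: R"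
  "\<forall>z\<in>Z. \<forall>w\<in>(C - Z) Un T 0. w ~= Suc z & z ~= Suc w"
  "\<forall>v\<in>C - Z. \<forall>w\<in>DD. (v, w) ~: R & w ~= Suc v & v ~= Suc w" by (elim exE conjE)
 thus ?thesis using that[of Z] by simp
qed

text \<open>A run of at most \<open>k\<close> vertices bridges a distance of at most
  \<open>k + 1\<close>. Different copies are farther apart, and inside one copy two consecutive
  vertices are successors or farther apart by \<open>gapped\<close>.\<close>

lemma no_bridge:
 assumes "Z Int DD = {}" "finite Z" "0 ~: Z" "card Z <= k" "z : Z" "lft Z z : DD"
 shows "rgt Z z ~: DD"
proof
 assume r: "rgt Z z : DD"
 note lp = lft_props[OF assms(3,5)] and rp = rgt_props[OF assms(2,5)]
 have le: "rgt Z z <= lft Z z + k + 1" using rgt_lft_le[OF assms(2,3,5)] assms(4) by simp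
 obtain c d where cd: "c : Cs" "lft Z z : D c" "d : Cs" "rgt Z z : D d" using assms(6) r unfolding DD_def by blast
 show False
 proof (cases "c = d")
  case False
  thus False using far[of c d "lft Z z" "rgt Z z"] cd le lp(1) rp(1) by auto
 next
  case True
  obtain t s where ts: "t : T c" "s : T c" "lft Z z = y c + t" "rgt Z z = y c + s"
   using cd True unfolding vset_def by auto
  have lt: "t < s" using lp(1) rp(1) ts by linarith
  have "x ~: T c" if "t < x" "x < s" for x
  proof
   assume "x : T c"
   hence "y c + x : DD" using cd(1) unfolding DD_def vset_def by blast
   moreover have "y c + x : Z" using lp(3)[of "y c + x"] rp(3)[of "y c + x"] that ts by (cases "y c + x <= z") auto
   ultimately show False using assms(1) by blast
  qed
  moreover have "gapped (k + 1) (T c)" using pat_parts(3) cd(1) by simp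
  ultimately have "s = Suc t \<or> t + (k + 1) < s" using ts(1,2) lt unfolding gapped_def by blast
  moreover have "s ~= Suc t" using lp(1) rp(1) ts by linarith
  ultimately show False using le ts by linarith
 qed
qed

definition cls :: "nat => nat" where
 "cls d = (THE c. c : Cs & d : D c)"

lemma cls: "c : Cs ==> d : D c ==> cls d = c"
 unfolding cls_def using D_disj by (intro the_equality) blast+

lemma cls_in: "d : DD ==> cls d : Cs & d : D (cls d)"
 unfolding DD_def using cls by auto

text \<open>Label each copy by its part, the runs of \<open>Z\<close> by what they hang on, and all
  else by 0. The crossing edges of this labelling come from \<open>J\<close>, so by the safety
  inequality its weight is nonnegative. Rigidity of \<open>U0\<close> over the base therefore leaves
  it no nonzero value.\<close>

lemma cl_base_avoids:
 assumes "rigid R V0 U0" "card (U0 - V0) <= k" "U0 \<subseteq> {1..n}"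
 shows "U0 Int DD = {}" "!!u d. u : U0 - V0 ==> d : DD ==> (u, d) ~: R & d ~= Suc u & u ~= Suc d"
proof -
 note U0 = rigidD[OF assms(1)]
 define C where "C = U0 - (V0 Un DD)"
 have "card C <= card (U0 - V0)" unfolding C_def using U0(1) by (intro card_mono) auto
 hence cC: "card C <= k" using assms(2) by simp
 have "rigid R (V0 Un DD) (U0 Un (V0 Un DD))" using rigid_base[OF assms(1)] fins by simp
 moreover have "U0 Un (V0 Un DD) = V0 Un DD Un C" unfolding C_def by blast
 ultimately have rC: "rigid R (V0 Un DD) (V0 Un DD Un C)" by simp
 obtain Z where Z: "Z \<subseteq> C" "!!z w. z : Z ==> w : V0 Un DD Un C ==> (z, w) ~: R"
  "!!z w. z : Z ==> w : (C - Z) Un V0 ==> w ~= Suc z & z ~= Suc w"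
  "!!v w. v : C - Z ==> w : DD ==> (v, w) ~: R & w ~= Suc v & v ~= Suc w"
  by (rule split_C[OF _ _ cC rC]) (use assms(3) in \<open>auto simp: C_def\<close>)
 have CU: "C \<subseteq> U0" "C Int DD = {}" "C Int V0 = {}" unfolding C_def by auto
 have ZU: "Z \<subseteq> U0" "finite Z" "0 ~: Z" "Z Int DD = {}" "card Z <= k"
  using Z(1) CU U0(1) cC finite_subset[of Z U0] card_mono[of C Z] finite_subset[of C U0] subsetD[OF assms(3), of 0] by auto
 define t where "t u = (if u : DD then cls u else 0)" for u
 \<comment> \<open>A label outside \<open>Cs\<close> for runs that touch no copy. Such a run has no
   edges, so its class can only raise the weight.\<close>
 define e where "e = Suc N"
 define t' where "t' u = (if u : Z then attl Z DD cls e u else t u)" for u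
 have Upart: "u : V0 \<or> u : DD \<or> u : C" if "u : U0" for u using that unfolding C_def by blast
 have comp: "compat U0 t'"
  unfolding t'_def
 proof (rule attl_compat[OF ZU(2,3,1)])
  show "rgt Z z ~: DD" if "z : Z" "lft Z z : DD" for z using no_bridge[OF ZU(4,2,3,5)] that by blast
  show "w : DD" if "z : Z" "w : U0 - Z" "w = Suc z \<or> z = Suc w" for z w
   using Z(3)[OF that(1), of w] Upart[of w] that by blast
  show "compat (U0 - Z) t" unfolding compat_def
  proof (intro ballI impI)
   fix u assume u: "u : U0 - Z" "Suc u : U0 - Z"
   have one: "v : DD" if "w : DD" "v : U0 - Z" "w = Suc v \<or> v = Suc w" for v w
    using V0_DD_succ[of v w] Z(4)[of v w] Upart[of v] that by blast
   show "t u = t (Suc u)"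
   proof (cases "u : DD \<or> Suc u : DD")
    case True
    hence d: "u : DD" "Suc u : DD" using one u by blast+
    hence "cls u = cls (Suc u)"
     using far[of "cls u" "cls (Suc u)" u "Suc u"] cls_in[OF d(1)] cls_in[OF d(2)] by auto
    thus ?thesis using d by (simp add: t_def)
   qed (simp add: t_def)
  qed
 qed (simp add: t_def)
 have lab0: "t' x = 0" if "x : V0" for x
 proof -
  have "x ~: Z" "x ~: DD" using that Z(1) CU V0_DD by blast+
  thus ?thesis by (simp add: t'_def t_def)
 qed
 have edge: "(w, z) ~: R" if "z : Z" "w : U0" for z w
  using Z(2)[OF that(1), of w] that(2) Upart[OF that(2)] symR unfolding sym_def by blast
 have tval: "t' u : insert 0 (insert e Cs)" if "u : U0" for u
  unfolding t'_def t_def attl_def using cls_in by auto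
 define L where "L = classes U0 t' - {e}"
 have LC: "L \<subseteq> Cs" unfolding L_def classes_def using tval by auto
 let ?JL = "{((c, t), (d, s)) : J. c : insert 0 L & d : insert 0 L}"
 have eN: "e ~: Cs" "e ~= 0" using pat_parts(1) unfolding e_def by auto
 note J = pat_parts(4)
 have finJ: "finite J"
 proof (rule finite_subset[OF J])
  have "finite (T c)" if "c : insert 0 Cs" for c
   using that fins(2) pat_parts(3) finite_subset[of "T c" "{1..N}"] by auto
  hence "finite (SIGMA c:insert 0 Cs. T c)" using fins(1) by (intro finite_SigmaI) auto
  hence "finite ((SIGMA c:insert 0 Cs. T c) \<times> (SIGMA c:insert 0 Cs. T c))" by simp
  thus "finite {((c, t), (d, s)). c : insert 0 Cs & d : insert 0 Cs & c ~= d & t : T c & s : T d}"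
   by (rule finite_subset[rotated]) auto
 qed
 have crossJ: "cross R U0 t' \<subseteq> (%((c, t), (d, s)). (y c + t, y d + s)) ` ?JL"
 proof clarify
  fix u v assume uv: "(u, v) : cross R U0 t'"
  hence uv': "(u, v) : R" "u : U0" "v : U0" "t' u ~= t' v" unfolding cross_def by auto
  have vu: "(v, u) : R" using uv'(1) symR unfolding sym_def by blast
  have nZ: "u ~: Z" "v ~: Z" using edge[of u v] edge[of v u] uv' vu by blast+
  have nC: "u ~: C \<or> v ~: DD" "v ~: C \<or> u ~: DD" using Z(4)[of u v] Z(4)[of v u] nZ uv'(1) vu by blast+
  have tt: "t' u = t u" "t' v = t v" using nZ by (simp_all add: t'_def)
  hence dd: "u : DD \<or> v : DD" using uv'(4) by (auto simp: t_def split: if_splits)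
  have mem: "\<exists>s. x = y (t x) + s & s : T (t x) & t x : insert 0 L" if "x : V0 Un DD" "x : U0" "t' x = t x" for x
  proof (cases "x : DD")
   case True
   hence "t x = cls x" "cls x : Cs" "x : D (cls x)" using cls_in by (auto simp: t_def)
   moreover have "cls x : L" using calculation that zero_notin eN unfolding L_def classes_def by (metis DiffI image_eqI singletonD)
   ultimately show ?thesis unfolding vset_def by auto
  next
   case False
   thus ?thesis using that y0 by (auto simp: t_def)
  qed
  have "u : V0 Un DD" "v : V0 Un DD" using Upart[OF uv'(2)] Upart[OF uv'(3)] dd nC by blast+
  then obtain s1 s2 where s: "u = y (t u) + s1" "s1 : T (t u)" "t u : insert 0 L" "v = y (t v) + s2" "s2 : T (t v)" "t v : insert 0 L"
   using mem[of u] mem[of v] uv'(2,3) tt by blast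
  have "((t u, s1), (t v, s2)) : J"
   using edgeJ[of "t u" "t v" s1 s2] s LC uv'(1,4) tt by auto
  hence "((t u, s1), (t v, s2)) : ?JL" using s by simp
  thus "(u, v) : (%((c, t), (d, s)). (y c + t, y d + s)) ` ?JL" using s(1,4) by (auto intro!: image_eqI[of _ _ "((t u, s1), (t v, s2))"])
 qed
 have finJL: "finite ?JL" using finJ by (rule finite_subset[rotated]) auto
 have "card (cross R U0 t') <= card ?JL"
  using card_mono[OF finite_imageI[OF finJL] crossJ] card_image_le[OF finJL] le_trans by blast
 hence cr: "\<alpha> / 2 * real (card (cross R U0 t')) <= \<alpha> / 2 * real (card ?JL)" using alpha(1) by (intro mult_left_mono) auto
 have allz: "t' u = 0" if "u : U0" for u
 proof (rule ccontr)
  assume nz: "t' u ~= 0"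
  have neg: "wt R U0 t' < 0" using U0(3)[OF comp lab0] nz that by blast
  have fc: "finite (classes U0 t')" using U0(1) by simp
  show False
  proof (cases "L = {}")
   case True
   hence "?JL = {}" using J by auto
   hence "cross R U0 t' = {}" using crossJ by (simp only: image_empty subset_empty)
   hence "card (cross R U0 t') = 0" by simp
   thus False using neg unfolding wt_def by simp
  next
   case False
   hence "0 < real (card L) - \<alpha> / 2 * real (card ?JL)" using pat_parts(6) LC by simp
   moreover have "card L <= card (classes U0 t')" unfolding L_def using fc by (intro card_mono) auto
   ultimately show False using neg cr unfolding wt_def by simp
  qed
 qed
 have "u ~: DD" if "u : U0" for u
 proof
  assume d: "u : DD"
  hence "t' u = cls u" using ZU(4) by (auto simp: t'_def t_def)
  thus False using allz[OF that] cls_in[OF d] zero_notin by auto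
 qed
 thus dis: "U0 Int DD = {}" by blast
 have Z0: "Z = {}"
 proof (rule ccontr)
  assume "Z ~= {}"
  then obtain z where z: "z : Z" by blast
  hence "attl Z DD cls e z = 0" using allz[of z] ZU(1) by (auto simp: t'_def)
  thus False unfolding attl_def using cls_in zero_notin eN by (auto split: if_splits) metis+
 qed
 show "(u, d) ~: R & d ~= Suc u & u ~= Suc d" if "u : U0 - V0" "d : DD" for u d
  using Z(4)[of u d] Z0 that dis unfolding C_def by blast
qed

text \<open>The runs \<open>Z\<close> are the danger: they are rigid but lie in no copy. The
  hypothesis \<open>TP\<close>, proved in \<open>step\<close> by comparison with the original graph,
  says that a vertex reached rigidly inside a copy with budget to spare has both successor
  neighbours inside the copy; but a run hanging on such a vertex would contain one of these
  neighbours. Once \<open>Z\<close> is empty, the part outside the copies is rigid over the base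
  alone.\<close>

lemma cl_placed:
 assumes E: "E \<subseteq> DD" and JE: "!!c t p. ((c, t), p) : J ==> c : Cs ==> y c + t : E"
  and TP: "!!c K d. c : Cs ==> K \<subseteq> D c ==> rigid R (E Int D c) (K Un (E Int D c)) ==> card (K - E) < k ==> d : K ==>
    Suc d : D c & (\<exists>d'\<in>D c. d = Suc d')"
  and U1: "rigid R (V0 Un E) U1" "card (U1 - (V0 Un E)) <= k" "U1 \<subseteq> {1..n}"
 shows "U1 \<subseteq> cl R {1..n} k V0 Un DD"
proof -
 note Uf = rigidD[OF U1(1)]
 define C where "C = U1 - (V0 Un DD)"
 have fE: "finite E" using E fins(4) finite_subset by blast
 have "card C <= card (U1 - (V0 Un E))" unfolding C_def using Uf(1) E by (intro card_mono) auto
 hence cC: "card C <= k" using U1(2) by simp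
 have "rigid R (V0 Un DD) (U1 Un (V0 Un DD))" using rigid_base[OF U1(1), of "V0 Un DD"] E fins by auto
 moreover have "U1 Un (V0 Un DD) = V0 Un DD Un C" unfolding C_def by blast
 ultimately have rC: "rigid R (V0 Un DD) (V0 Un DD Un C)" by simp
 obtain Z where Z: "Z \<subseteq> C" "!!z w. z : Z ==> w : V0 Un DD Un C ==> (z, w) ~: R"
  "!!z w. z : Z ==> w : (C - Z) Un V0 ==> w ~= Suc z & z ~= Suc w"
  "!!v w. v : C - Z ==> w : DD ==> (v, w) ~: R & w ~= Suc v & v ~= Suc w"
  by (rule split_C[OF _ _ cC rC]) (use U1(3) in \<open>auto simp: C_def\<close>)
 have CU: "C \<subseteq> U1" "C Int DD = {}" "C Int V0 = {}" unfolding C_def by auto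
 have ZU: "Z \<subseteq> U1" "finite Z" "0 ~: Z" "Z Int DD = {}" "card Z <= k"
  using Z(1) CU Uf(1) cC finite_subset[of Z U1] card_mono[of C Z] finite_subset[of C U1] subsetD[OF U1(3), of 0] by auto
 have Upart: "u : V0 \<or> u : DD \<or> u : C" if "u : U1" for u using that unfolding C_def by blast
 have ZV: "Z Int (V0 Un E) = {}" using Z(1) CU E by blast
 have edge: "(z, w) ~: R" "(w, z) ~: R" if "z : Z" "w : U1" for z w
  using Z(2)[OF that(1), of w] that(2) Upart[OF that(2)] symR unfolding sym_def by blast+
 have nb: "rgt Z z ~: DD" if "z : Z" "lft Z z : DD" for z using no_bridge[OF ZU(4,2,3,5)] that by blast
 have adj: "w : DD" if "z : Z" "w : U1 - Z" "w = Suc z \<or> z = Suc w" for z w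
  using Z(3)[OF that(1), of w] Upart[of w] that by blast
 define U2 where "U2 = U1 - Z"
 have DD_adj: "v : DD" if "w : DD" "v : U2" "w = Suc v \<or> v = Suc w" for v w
  using V0_DD_succ[of v w] Z(4)[of v w] Upart[of v] that unfolding U2_def by blast
 have DD_edge: "v : V0 Un DD" if "w : DD" "v : U2" "(w, v) : R \<or> (v, w) : R" for v w
  using Z(4)[of v w] Upart[of v] that symR unfolding U2_def sym_def by blast
 have "Z = {}"
 proof (rule ccontr)
  assume ne: "Z ~= {}"
  \<comment> \<open>Every run of \<open>Z\<close> hangs on a vertex of \<open>U1\<close>: otherwise it would be an isolated class of weight 1.\<close>
  have att: "attl Z DD (%d. if d : U1 then 0 else 1) 1 z = 0" if zZ: "z : Z" for z
  proof (rule ccontr)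
   let ?t = "%u. if u : Z then attl Z DD (%d. if d : U1 then 0 else 1) 1 u else 0"
   assume "attl Z DD (%d. if d : U1 then 0 else 1) 1 z ~= 0"
   hence "?t z ~= 0" using zZ by simp
   moreover have "compat U1 ?t"
    by (rule attl_compat[OF ZU(2,3,1) nb adj]) (auto simp: compat_def)
   moreover have "?t x = 0" if "x : V0 Un E" for x using that ZV by auto
   ultimately have "wt R U1 ?t < 0" using Uf(3)[of ?t] zZ ZU(1) by blast
   moreover have "cross R U1 ?t = {}" using edge unfolding cross_def by (auto split: if_splits)
   ultimately show False unfolding wt_def by simp
  qed
  have VU2: "V0 Un E \<subseteq> U2" using Uf(2) ZV unfolding U2_def by blast
  \<comment> \<open>A labelling of \<open>U2\<close> extends over the runs of \<open>Z\<close>, each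
    taking the label of the vertex of \<open>U1\<close> it hangs on. As runs have no edges, neither
    classes nor crossing edges are added.\<close>
  have r2: "rigid R (V0 Un E) U2"
  proof (rule rigidI)
   show "finite U2" "V0 Un E \<subseteq> U2" using Uf(1) VU2 unfolding U2_def by auto
   fix t assume t: "compat U2 t" "!!x. x : V0 Un E ==> t x = 0" "\<exists>v\<in>U2. t v ~= 0"
   let ?t = "%u. if u : Z then attl Z DD t 0 u else t u"
   have c: "compat U1 ?t"
    by (rule attl_compat[OF ZU(2,3,1) nb adj]) (use t(1) in \<open>auto simp: U2_def\<close>)
   have z: "?t x = 0" if "x : V0 Un E" for x using that ZV t(2) by auto
   have nz: "\<exists>v\<in>U1. ?t v ~= 0" using t(3) unfolding U2_def by auto
   have neg: "wt R U1 ?t < 0" by (rule Uf(3)[OF c z nz])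
   have "?t u : insert 0 (t ` U2)" if "u : Z" for u
   proof -
    have "attl Z DD (%d. if d : U1 then 0 else 1) 1 u = 0" using att[OF that] .
    moreover have "lft Z u ~: Z" "rgt Z u ~: Z" using lft_props(2)[OF ZU(3) that] rgt_props(2)[OF ZU(2) that] .
    ultimately have "attl Z DD t 0 u : insert 0 (t ` U2)" unfolding attl_def U2_def by (auto split: if_splits)
    thus ?thesis using that by simp
   qed
   hence "?t u : insert 0 (t ` U2)" if "u : U1" for u using that by (cases "u : Z") (auto simp: U2_def)
   hence "?t ` U1 \<subseteq> insert 0 (t ` U2)" by (rule image_subsetI)
   hence "classes U1 ?t \<subseteq> classes U2 t" 
    unfolding classes_def by (simp only: subset_insert_iff[symmetric] Diff_subset_conv Un_Diff_cancel insert_is_Un[symmetric] insert_Diff_single)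
   moreover have "classes U2 t \<subseteq> classes U1 ?t" unfolding classes_def U2_def by force
   ultimately have "classes U1 ?t = classes U2 t" by blast
   moreover have "cross R U1 ?t = cross R U2 t" using edge unfolding cross_def U2_def by (auto split: if_splits)
   ultimately show "wt R U2 t < 0" using neg unfolding wt_def by simp
  qed
  \<comment> \<open>Strict, because vertices of \<open>Z\<close> were dropped. The budget gained is
    what the proof of \<open>TP\<close> spends on a successor neighbour.\<close>
  have c2: "card (U2 - (V0 Un E)) < k"
  proof -
   have "U2 - (V0 Un E) \<subset> U1 - (V0 Un E)" using ne ZU(1) ZV unfolding U2_def by blast
   hence "card (U2 - (V0 Un E)) < card (U1 - (V0 Un E))" using Uf(1) by (intro psubset_card_mono) auto
   thus ?thesis using U1(2) by simp
  qed
  \<comment> \<open>Restrict to one copy: by \<open>JE\<close> every edge from the copy into the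
    rest of \<open>U2\<close> starts in \<open>E\<close>, where labels vanish, so the trace of
    \<open>U2\<close> on the copy is rigid over the trace of \<open>E\<close>.\<close>
  have key: "Suc d : DD & (\<exists>d'\<in>DD. d = Suc d')" if d: "d : DD" "d : U1" for d
  proof -
   obtain c where c: "c : Cs" "d : D c" using d(1) unfolding DD_def by blast
   let ?K = "U2 Int D c" and ?Ec = "E Int D c"
   have Dc: "D c \<subseteq> DD" using c(1) unfolding DD_def by blast
   have dZ: "d ~: Z" using ZU(4) d(1) by blast
   have KE: "?K Un ?Ec = ?K" using VU2 by blast
   have "rigid R ?Ec ?K"
   proof (rule rigidI)
    show "finite ?K" "?Ec \<subseteq> ?K" using rigidD(1)[OF r2] KE by auto
    fix t assume t: "compat ?K t" "!!x. x : ?Ec ==> t x = 0" "\<exists>v\<in>?K. t v ~= 0"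
    let ?t = "%u. if u : D c then t u else 0"
    have sameD: "v : D c" if "u : D c" "v : DD" "u = Suc v \<or> v = Suc u" for u v
     using far[of c "cls v" u v] cls_in[OF that(2)] that c(1) by (cases "cls v = c") auto
    have comp: "compat U2 ?t" unfolding compat_def
    proof (intro ballI impI)
     fix u assume u: "u : U2" "Suc u : U2"
     have "u : D c \<longleftrightarrow> Suc u : D c"
      using DD_adj[of u "Suc u"] DD_adj[of "Suc u" u] sameD[of u "Suc u"] sameD[of "Suc u" u] u Dc by blast
     thus "?t u = ?t (Suc u)" using t(1) u unfolding compat_def by auto
    qed
    have z: "?t x = 0" if "x : V0 Un E" for x
     using that t(2) V0_DD Dc by auto
    have nz: "\<exists>v\<in>U2. ?t v ~= 0" using t(3) by auto
    have neg: "wt R U2 ?t < 0" by (rule rigidD(3)[OF r2 comp z nz])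
    have "cross R U2 ?t \<subseteq> cross R ?K t"
    proof clarify
     fix u v assume uv: "(u, v) : cross R U2 ?t"
     hence uv': "(u, v) : R" "u : U2" "v : U2" "?t u ~= ?t v" unfolding cross_def by auto
     have vu: "(v, u) : R" using uv'(1) symR unfolding sym_def by blast
     have in_E: "a : E" if ab: "a : D c" "b : U2" "b ~: D c" "(a, b) : R" for a b
     proof -
      have "b : V0 Un DD" using DD_edge[of a b] ab Dc by blast
      then obtain d where dd: "d : insert 0 Cs" "b : D d" "d ~= c"
       using ab(3) D0 cls_in[of b] by (cases "b : DD") auto
      obtain t1 s1 where "t1 : T c" "a = y c + t1" "s1 : T d" "b = y d + s1" using ab(1) dd(2) unfolding vset_def by auto
      hence "((c, t1), (d, s1)) : J" using edgeJ[of c d t1 s1] c(1) dd ab(4) by auto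
      thus "a : E" using JE c(1) \<open>a = y c + t1\<close> by blast
     qed
     have "u : D c \<longleftrightarrow> v : D c"
     proof (rule ccontr)
      assume "~ ?thesis"
      hence "(u : D c & v ~: D c) \<or> (v : D c & u ~: D c)" by blast
      thus False
      proof
       assume a: "u : D c & v ~: D c"
       hence "u : E" using in_E[of u v] uv' by blast
       thus False using a t(2)[of u] uv'(4) by simp
      next
       assume a: "v : D c & u ~: D c"
       hence "v : E" using in_E[of v u] uv' vu by blast
       thus False using a t(2)[of v] uv'(4) by simp
      qed
     qed
     thus "(u, v) : cross R ?K t" using uv' unfolding cross_def by (auto split: if_splits)
    qed
    moreover have "cross R ?K t \<subseteq> cross R U2 ?t" unfolding cross_def by auto
    ultimately have "cross R U2 ?t = cross R ?K t" by blast
    moreover have "classes U2 ?t = classes ?K t" unfolding classes_def by (auto split: if_splits)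
    ultimately show "wt R ?K t < 0" using neg unfolding wt_def by simp
   qed
   moreover have "card (?K - E) < k"
   proof -
    have "?K - E \<subseteq> U2 - (V0 Un E)" using V0_DD Dc by blast
    hence "card (?K - E) <= card (U2 - (V0 Un E))" using rigidD(1)[OF r2] by (intro card_mono) auto
    thus ?thesis using c2 by simp
   qed
   ultimately have "Suc d : D c & (\<exists>d'\<in>D c. d = Suc d')"
    using TP[OF c(1), of ?K d] KE c(2) d(2) dZ unfolding U2_def by auto
   thus ?thesis using Dc by blast
  qed
  obtain z where z: "z : Z" using ne by blast
  note lp = lft_props[OF ZU(3) z] and rp = rgt_props[OF ZU(2) z]
  have "(lft Z z : DD & lft Z z : U1) \<or> (rgt Z z : DD & rgt Z z : U1)"
   using att[OF z] unfolding attl_def by (auto split: if_splits)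
  thus False
  proof
   assume a: "lft Z z : DD & lft Z z : U1"
   have "Suc (lft Z z) : Z" using lp(1) lp(3)[of "Suc (lft Z z)"] by simp
   thus False using key[of "lft Z z"] a ZU(4) by blast
  next
   assume a: "rgt Z z : DD & rgt Z z : U1"
   then obtain d' where "d' : DD" "rgt Z z = Suc d'" using key[of "rgt Z z"] by blast
   moreover from this have "d' : Z" using rp(1) rp(3)[of d'] by simp
   ultimately show False using ZU(4) by blast
  qed
 qed
 hence U2: "U2 = U1" unfolding U2_def by simp
 let ?Y = "U1 - DD"
 have "rigid R V0 ?Y"
 proof (rule rigidI)
  show "finite ?Y" "V0 \<subseteq> ?Y" using Uf V0_DD by auto
  fix t assume t: "compat ?Y t" "!!x. x : V0 ==> t x = 0" "\<exists>v\<in>?Y. t v ~= 0"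
  let ?t = "%u. if u : DD then 0 else t u"
  have comp: "compat U1 ?t" unfolding compat_def
  proof (intro ballI impI)
   fix u assume u: "u : U1" "Suc u : U1"
   hence "u : DD \<longleftrightarrow> Suc u : DD" using DD_adj[of u "Suc u"] DD_adj[of "Suc u" u] unfolding U2 by blast
   thus "?t u = ?t (Suc u)" using t(1) u unfolding compat_def by auto
  qed
  have z: "?t x = 0" if "x : V0 Un E" for x using that t(2) E by auto
  have nz: "\<exists>v\<in>U1. ?t v ~= 0" using t(3) by auto
  have neg: "wt R U1 ?t < 0" by (rule Uf(3)[OF comp z nz])
  have "cross R U1 ?t = cross R ?Y t"
  proof
   show "cross R ?Y t \<subseteq> cross R U1 ?t" unfolding cross_def by auto
   show "cross R U1 ?t \<subseteq> cross R ?Y t"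
   proof clarify
    fix u v assume "(u, v) : cross R U1 ?t"
    hence uv: "(u, v) : R" "u : U1" "v : U1" "?t u ~= ?t v" unfolding cross_def by auto
    have "u : DD ==> v : V0 Un DD" "v : DD ==> u : V0 Un DD"
     using DD_edge[of u v] DD_edge[of v u] uv unfolding U2 by blast+
    hence "u ~: DD" "v ~: DD" using uv(4) t(2) by (auto split: if_splits)
    thus "(u, v) : cross R ?Y t" using uv unfolding cross_def by auto
   qed
  qed
  moreover have "classes U1 ?t = classes ?Y t" unfolding classes_def by (auto split: if_splits)
  ultimately show "wt R ?Y t < 0" using neg unfolding wt_def by simp
 qed
 moreover have "card (?Y - V0) <= k"
 proof -
  have "?Y - V0 \<subseteq> U1 - (V0 Un E)" using E by blast
  hence "card (?Y - V0) <= card (U1 - (V0 Un E))" using Uf(1) by (intro card_mono) auto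
  thus ?thesis using U1(2) by simp
 qed
 moreover have "?Y \<subseteq> {1..n}" using U1(3) by blast
 ultimately have "?Y \<subseteq> cl R {1..n} k V0" using clI by blast
 thus ?thesis by blast
qed

end

context irrational_exponent
begin

text \<open>Over each base there are finitely many patterns with parameter \<open>N\<close>, while
  the base ranges over all sets of at most \<open>h\<close> vertices containing both ends; the
  latter is what makes the union bound polynomial in \<open>n\<close>.\<close>

definition ext_ax :: "nat => nat => nat => nat => edges => bool" where
 "ext_ax h k N n R \<longleftrightarrow> (\<forall>Cs T G J. pat_ok N k n Cs T G J --> card (T 0) <= h --> {1, n} \<subseteq> T 0 -->
  (\<exists>y. realizes k n R Cs T G J y))"

definition graph_on :: "nat => edges => bool" where
 "graph_on n R \<longleftrightarrow> 1 <= n & R \<subseteq> {1..n} \<times> {1..n} & sym R & irrefl R"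

text \<open>The label of the new vertex is forced to equal that of its neighbour, which is 0. So
  successor neighbours come for free, whatever the edges are.\<close>

lemma rigid_insert_adjacent:
 assumes "finite V" "d : V" "w = Suc d \<or> d = Suc w"
 shows "rigid R V (insert w V)"
proof (rule rigidI)
 fix l assume l: "compat (insert w V) l" "!!x. x : V ==> l x = 0" "\<exists>v\<in>insert w V. l v ~= 0"
 hence "l w ~= 0" by auto
 moreover have "l w = l d" using l(1) assms(2,3) unfolding compat_def by auto
 ultimately show "wt R (insert w V) l < 0" using l(2)[OF assms(2)] by simp
qed (use assms in auto)

lemma cl_adjacent:
 assumes "rigid R V K" "K \<subseteq> U" "card (K - V) < k" "d : K" "w = Suc d \<or> d = Suc w" "w : U"
 shows "w : cl R U k V"
proof -
 note K = rigidD[OF assms(1)]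
 have r: "rigid R V (insert w K)" using rigid_trans[OF assms(1) rigid_insert_adjacent[OF K(1) assms(4,5)]] .
 have "card (insert w K - V) <= card (insert w (K - V))" using K(1) by (intro card_mono) auto
 also have "... <= Suc (card (K - V))" by (rule card_insert_le_m1) auto
 finally have "card (insert w K - V) <= k" using assms(3) by simp
 thus ?thesis using clI[OF _ r] assms(2,6) by blast
qed

text \<open>One move of Spoiler. If \<open>a\<close> lies in the closure of depth \<open>h\<close>,
  it is answered inside the larger closure on the board. Otherwise \<open>decomposition\<close>
  splits the closure: piece 0 is copied by the game on the board, the other pieces are replaced by
  bounded representatives and placed by the extension axiom, and \<open>ef_parts\<close> glues the
  games. By \<open>cl_placed\<close> nothing else enters the closure of the answer.\<close>

lemma step:
 assumes k: "1 <= k"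
 shows "\<exists>h N q'. \<forall>n R n' R' P a. graph_on n R --> graph_on n' R' --> ext_ax h k N n' R' -->
  finite P --> card (fst ` P) <= r --> (1, 1) : P --> (n, n') : P -->
  ef q' (cl R {1..n} (h + k) (fst ` P)) R (cl R' {1..n'} (h + k) (snd ` P)) R' P --> a : {1..n} -->
  (\<exists>b\<in>{1..n'}. ef q (cl R {1..n} k (insert a (fst ` P))) R (cl R' {1..n'} k (insert b (snd ` P))) R' (insert (a, b) P))"
proof -
 obtain h where h0: "\<forall>R U X z. finite U --> X \<subseteq> U --> card X <= r --> z : U --> z ~: cl R U h X -->
  (\<exists>V l \<Lambda>. insert z X \<subseteq> V & V \<subseteq> U & card V <= h & compat V l & (\<forall>x\<in>X. l x = 0) & l z ~= 0 & l ` V \<subseteq> {..h} &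
   rigid R X {v : V. l v = 0} &
   (\<forall>L. L \<subseteq> classes V l --> L ~= {} -->
    0 < real (card L) - \<alpha> / 2 * real (card {(u, v) : cross R V l. l u : insert 0 L & l v : insert 0 L})) &
   (\<forall>v\<in>V. \<Lambda> v = l v) & (\<forall>u\<in>cl R U k V. \<Lambda> u : insert 0 (l ` V)) & compat (cl R U k V) \<Lambda> &
   (\<forall>u v. (u, v) : R --> u : cl R U k V --> v : cl R U k V --> \<Lambda> u ~= \<Lambda> v --> u : V & v : V) &
   {u : cl R U k V. \<Lambda> u = 0} = cl R U k {v : V. l v = 0})"
  using decomposition[OF k, of r] by (rule exE)
 note h = h0[rule_format]
 \<comment> \<open>Rounds on a single piece: \<open>q\<close> to continue, and \<open>k + 1\<close>
   to cut down to a closure or, for \<open>TP\<close>, to play a rigid extension and then one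
   neighbour.\<close>
 define qq where "qq = q + k + 1"
 obtain N where N0: "N \<ge> h" "\<forall>U R E. finite U --> E \<subseteq> U --> card E <= h --> sym R --> irrefl R -->
  (\<exists>T G f. T \<subseteq> {1..N} & gapped (k + 1) T & G \<subseteq> T \<times> T & sym G & irrefl G & ef qq U R T G ((%e. (e, f e)) ` E))"
  using finite_reps[of h "k + 1" qq] by (elim exE conjE)
 note N = N0(1) N0(2)[rule_format]
 \<comment> \<open>One round for \<open>a\<close>, \<open>h\<close> rounds to copy the zero part of
   \<open>V\<close>, and \<open>k\<close> to cut down to its closure.\<close>
 define q' where "q' = Suc (qq + k + h)"
 show ?thesis
 proof (rule exI[of _ h], rule exI[of _ N], rule exI[of _ q'], intro allI impI, goal_cases)
  case (1 n R n' R' P a)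
  note gR = 1(1)[unfolded graph_on_def] and gR' = 1(2)[unfolded graph_on_def]
  let ?U = "{1..n}" and ?U' = "{1..n'}"
  define X where "X = fst ` P"
  define X' where "X' = snd ` P"
  define A where "A = cl R ?U (h + k) X"
  define A' where "A' = cl R' ?U' (h + k) X'"
  have efA: "ef q' A R A' R' P" using 1(8) unfolding A_def A'_def X_def X'_def .
  have PA: "P \<subseteq> A \<times> A'" "piso R R' P" using ef_basic[OF efA] by auto
  have AU: "A \<subseteq> ?U" "A' \<subseteq> ?U'" unfolding A_def A'_def by (rule cl_sub)+
  have XU: "X \<subseteq> A" "X' \<subseteq> A'" using PA(1) unfolding X_def X'_def by auto
  have fX: "finite X" "finite X'" using 1(4) unfolding X_def X'_def by auto
  have PX: "P `` X = X'" unfolding X_def X'_def by force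
  show ?case
  proof (cases "a : cl R ?U h X")
   case True
   obtain V1 where V1: "a : V1" "V1 \<subseteq> ?U" "rigid R X V1" "card (V1 - X) <= h" using True unfolding cl_def by blast
   have V1A: "V1 \<subseteq> A" unfolding A_def using clI[OF V1(2,3)] V1(4) by simp
   obtain b where b: "b : A'" "ef (qq + k + h) A R A' R' (insert (a, b) P)"
    using ef_forth[OF efA[unfolded q'_def]] V1(1) V1A by blast
   let ?P = "insert (a, b) P" and ?X = "insert a X" and ?X' = "insert b X'"
   have pi: "piso R R' ?P" "?P \<subseteq> A \<times> A'" using ef_basic[OF b(2)] by auto
   have XP: "?X \<subseteq> fst ` ?P" "X \<subseteq> fst ` ?P" unfolding X_def by auto
   have im: "?P `` ?X = ?X'"
   proof
    show "?P `` ?X \<subseteq> ?X'" unfolding X'_def by force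
    show "?X' \<subseteq> ?P `` ?X" unfolding X_def X'_def by force
   qed
   have imX: "?P `` X = X'"
   proof (rule trans[OF ef_Image_converse(2)[OF PA(2) _ _ pi(1)] PX])
   qed (auto simp: X_def)
   have "a : cl R A h X" using clI[OF V1A V1(3,4)] V1(1) by blast
   hence "b : cl R' A' h X'" using cl_transfer[OF ef_le[OF b(2), of h] XP(2), of a b] imX by auto
   then obtain V1' where V1': "b : V1'" "V1' \<subseteq> A'" "rigid R' X' V1'" "card (V1' - X') <= h" unfolding cl_def by blast
   have c1: "cl R A k ?X = cl R ?U k ?X"
   proof (rule cl_restrict[OF _ AU(1)])
    show "cl R ?U k ?X \<subseteq> A" unfolding A_def
     using cl_cl[OF V1(3,2,4), of ?X k] V1(1) rigidD(2)[OF V1(3)] by blast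
   qed
   have c2: "cl R' A' k ?X' = cl R' ?U' k ?X'"
   proof (rule cl_restrict[OF _ AU(2)])
    show "cl R' ?U' k ?X' \<subseteq> A'" unfolding A'_def
     using cl_cl[OF V1'(3) _ V1'(4), of ?U' ?X' k] V1'(1,2) rigidD(2)[OF V1'(3)] AU(2) by blast
   qed
   have "?X \<subseteq> cl R A k ?X" by (rule base_sub_cl) (use fX XU V1(1) V1A in auto)
   moreover have "?X' \<subseteq> cl R' A' k ?X'" by (rule base_sub_cl) (use fX XU b(1) in auto)
   moreover have "?P \<subseteq> ?X \<times> ?X'" unfolding X_def X'_def by force
   ultimately have "?P \<subseteq> cl R A k ?X \<times> cl R' A' k (?P `` ?X)" unfolding im by blast
   moreover have "ef (q + k) A R A' R' ?P" using ef_le[OF b(2)] unfolding qq_def by simp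
   ultimately have "ef q (cl R A k ?X) R (cl R' A' k (?P `` ?X)) R' ?P" using ef_cl[OF _ XP(1) subset_refl] by blast
   hence "ef q (cl R ?U k ?X) R (cl R' ?U' k ?X') R' ?P" unfolding im c1 c2 .
   thus ?thesis using b(1) AU(2) unfolding X_def X'_def by blast
  next
   case False
   have "\<exists>V l \<Lambda>. insert a X \<subseteq> V & V \<subseteq> ?U & card V <= h & compat V l & (\<forall>x\<in>X. l x = 0) & l a ~= 0 & l ` V \<subseteq> {..h} &
    rigid R X {v : V. l v = 0} &
    (\<forall>L. L \<subseteq> classes V l --> L ~= {} -->
     0 < real (card L) - \<alpha> / 2 * real (card {(u, v) : cross R V l. l u : insert 0 L & l v : insert 0 L})) &
    (\<forall>v\<in>V. \<Lambda> v = l v) & (\<forall>u\<in>cl R ?U k V. \<Lambda> u : insert 0 (l ` V)) & compat (cl R ?U k V) \<Lambda> &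
    (\<forall>u v. (u, v) : R --> u : cl R ?U k V --> v : cl R ?U k V --> \<Lambda> u ~= \<Lambda> v --> u : V & v : V) &
    {u : cl R ?U k V. \<Lambda> u = 0} = cl R ?U k {v : V. l v = 0}"
    by (rule h) (use 1(5,9) XU(1) AU(1) False in \<open>auto simp: X_def\<close>)
   then obtain V l \<Lambda> where V: "insert a X \<subseteq> V" "V \<subseteq> ?U" "card V <= h" "compat V l" "\<forall>x\<in>X. l x = 0" "l a ~= 0" "l ` V \<subseteq> {..h}"
    and r0: "rigid R X {v : V. l v = 0}"
    and safe: "\<forall>L. L \<subseteq> classes V l --> L ~= {} -->
     0 < real (card L) - \<alpha> / 2 * real (card {(u, v) : cross R V l. l u : insert 0 L & l v : insert 0 L})"
    and Lam: "\<forall>v\<in>V. \<Lambda> v = l v" "\<forall>u\<in>cl R ?U k V. \<Lambda> u : insert 0 (l ` V)" "compat (cl R ?U k V) \<Lambda>"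
     "\<forall>u v. (u, v) : R --> u : cl R ?U k V --> v : cl R ?U k V --> \<Lambda> u ~= \<Lambda> v --> u : V & v : V"
     "{u : cl R ?U k V. \<Lambda> u = 0} = cl R ?U k {v : V. l v = 0}"
    by (elim exE conjE)
   define V0 where "V0 = {v : V. l v = 0}"
   define Gm where "Gm = cl R ?U k V"
   define Cs where "Cs = classes V l"
   have fV: "finite V" using V(2) finite_subset by blast
   have fV0: "finite V0" "X \<subseteq> V0" "V0 \<subseteq> V" using fV V(1,5) unfolding V0_def by auto
   have Cs: "Cs \<subseteq> {1..N}" "finite Cs" "0 ~: Cs" using V(7) N(1) fV unfolding Cs_def classes_def by auto
   have VG: "V \<subseteq> Gm" unfolding Gm_def using base_sub_cl[OF fV V(2)] .
   have GU: "Gm \<subseteq> ?U" "finite Gm" unfolding Gm_def using cl_sub[of R ?U k V] finite_subset by auto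
   have cV0: "card (V0 - X) <= h" using V(3) fV fV0 card_mono[of V "V0 - X"] by fastforce
   have V0A: "V0 \<subseteq> A" unfolding A_def using clI[OF _ r0[folded V0_def], of ?U "h + k"] fV0(3) V(2) cV0 by simp
   \<comment> \<open>Copy the label-0 part of \<open>V\<close> inside the closure.\<close>
   have "\<exists>P2. P \<subseteq> P2 & ef (qq + k) A R A' R' P2 & fst ` P2 = fst ` P Un (V0 - X)"
    by (rule ef_extend[of _ h]) (use ef_le[OF efA] fV0 V0A cV0 in \<open>auto simp: q'_def\<close>)
   then obtain P2 where P2: "P \<subseteq> P2" "ef (qq + k) A R A' R' P2" "fst ` P2 = fst ` P Un (V0 - X)" by blast
   have fP2: "fst ` P2 = V0" using P2(3) fV0(2) unfolding X_def by blast
   have pi2: "P2 \<subseteq> A \<times> A'" "piso R R' P2" using ef_basic[OF P2(2)] by auto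
   obtain f0 where f0: "\<forall>v\<in>V0. (v, f0 v) : P2" "inj_on f0 V0" "\<forall>Y. Y \<subseteq> V0 --> f0 ` Y = P2 `` Y"
    "\<forall>u\<in>V0. \<forall>v\<in>V0. (u, v) : R \<longleftrightarrow> (f0 u, f0 v) : R'" "\<forall>u\<in>V0. \<forall>v\<in>V0. v = Suc u \<longleftrightarrow> f0 v = Suc (f0 u)"
    by (rule piso_fun[OF pi2(2), of V0]) (use fP2 in auto)
   have P2eq: "P2 = (%v. (v, f0 v)) ` V0"
   proof
    show "(%v. (v, f0 v)) ` V0 \<subseteq> P2" using f0(1) by auto
    show "P2 \<subseteq> (%v. (v, f0 v)) ` V0"
    proof clarify
     fix v w assume vw: "(v, w) : P2"
     hence "v : V0" using fP2 by force
     moreover from this have "w = f0 v" using pisoD(1)[OF pi2(2), of v w v "f0 v"] f0(1) vw by blast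
     ultimately show "(v, w) : (%v. (v, f0 v)) ` V0" by blast
    qed
   qed
   define V0' where "V0' = f0 ` V0"
   have V0'A: "V0' \<subseteq> A'" "finite V0'" using f0(1) pi2(1) fV0(1) unfolding V0'_def by auto
   have X': "X' = f0 ` X"
   proof -
    have "P2 `` X = P `` X" using ef_Image_converse(2)[OF PA(2) _ P2(1) pi2(2), of X] unfolding X_def by blast
    thus ?thesis using f0(3) fV0(2) PX by simp
   qed
   have X'V: "X' \<subseteq> V0'" unfolding X' V0'_def using fV0(2) by blast
   have r0': "rigid R' X' V0'" unfolding X' V0'_def
    by (rule rigid_iso[OF r0[folded V0_def] f0(2)]) (use f0(4,5) in auto)
   have cV0': "card (V0' - X') <= h"
   proof -
    have "V0' - X' \<subseteq> f0 ` (V0 - X)" unfolding V0'_def X' by blast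
    hence "card (V0' - X') <= card (f0 ` (V0 - X))" using fV0 by (intro card_mono) auto
    also have "... <= card (V0 - X)" using fV0 by (intro card_image_le) auto
    finally show ?thesis using cV0 by simp
   qed
   have cA: "cl R A k V0 = cl R ?U k V0"
    by (rule cl_restrict[OF _ AU(1)]) (use cl_cl[OF r0[folded V0_def], of ?U h V0 k] fV0 V(2) cV0 in \<open>auto simp: A_def\<close>)
   have cA': "cl R' A' k V0' = cl R' ?U' k V0'"
    by (rule cl_restrict[OF _ AU(2)]) (use cl_cl[OF r0', of ?U' h V0' k] V0'A AU(2) cV0' X'V in \<open>auto simp: A'_def\<close>)
   define G0 where "G0 = cl R ?U k V0"
   define G0' where "G0' = cl R' ?U' k V0'"
   have V0G0: "V0 \<subseteq> G0" "V0' \<subseteq> G0'" unfolding G0_def G0'_def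
    using base_sub_cl[OF fV0(1), of ?U R k] base_sub_cl[OF V0'A(2), of ?U' R' k] fV0(3) V(2) V0'A(1) AU(2) by auto
   have ef0: "ef qq G0 R G0' R' P2"
   proof -
    have im: "P2 `` V0 = V0'" using f0(3) unfolding V0'_def by simp
    have sub: "P2 \<subseteq> cl R A k V0 \<times> cl R' A' k (P2 `` V0)"
    proof -
     have "P2 \<subseteq> V0 \<times> V0'" unfolding P2eq V0'_def by auto
     thus ?thesis unfolding im cA cA' using V0G0[unfolded G0_def G0'_def] by blast
    qed
    have "ef qq (cl R A k V0) R (cl R' A' k (P2 `` V0)) R' P2"
     by (rule ef_cl[OF P2(2) _ subset_refl sub]) (simp add: fP2)
    thus ?thesis unfolding im cA cA' G0_def G0'_def .
   qed
   define Gc where "Gc c = {u : Gm. \<Lambda> u = c}" for c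
   define Ec where "Ec c = {v : V. l v = c}" for c
   have EG: "Ec c \<subseteq> Gc c" for c using VG Lam(1) unfolding Ec_def Gc_def by auto
   \<comment> \<open>The pieces of the closure may be arbitrarily large; each is replaced by a
     representative with its vertices of \<open>V\<close> as marked points.\<close>
   have "\<forall>c. \<exists>T G f. T \<subseteq> {1..N} & gapped (k + 1) T & G \<subseteq> T \<times> T & sym G & irrefl G & ef qq (Gc c) R T G ((%e. (e, f e)) ` Ec c)"
   proof
    fix c
    have "card (Ec c) <= card V" unfolding Ec_def using fV by (intro card_mono) auto
    thus "\<exists>T G f. T \<subseteq> {1..N} & gapped (k + 1) T & G \<subseteq> T \<times> T & sym G & irrefl G & ef qq (Gc c) R T G ((%e. (e, f e)) ` Ec c)"
     by (intro N(2)) (use GU(2) EG V(3) gR in \<open>auto simp: Gc_def\<close>)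
   qed
   then obtain Tr where "\<forall>c. \<exists>G f. Tr c \<subseteq> {1..N} & gapped (k + 1) (Tr c) & G \<subseteq> Tr c \<times> Tr c & sym G & irrefl G & ef qq (Gc c) R (Tr c) G ((%e. (e, f e)) ` Ec c)"
    by (rule choice[THEN exE])
   then obtain G where "\<forall>c. \<exists>f. Tr c \<subseteq> {1..N} & gapped (k + 1) (Tr c) & G c \<subseteq> Tr c \<times> Tr c & sym (G c) & irrefl (G c) & ef qq (Gc c) R (Tr c) (G c) ((%e. (e, f e)) ` Ec c)"
    by (rule choice[THEN exE])
   then obtain fr where "\<forall>c. Tr c \<subseteq> {1..N} & gapped (k + 1) (Tr c) & G c \<subseteq> Tr c \<times> Tr c & sym (G c) & irrefl (G c) & ef qq (Gc c) R (Tr c) (G c) ((%e. (e, fr c e)) ` Ec c)"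
    by (rule choice[THEN exE])
   hence rp: "!!c. Tr c \<subseteq> {1..N}" "!!c. gapped (k + 1) (Tr c)" "!!c. G c \<subseteq> Tr c \<times> Tr c"
    "!!c. sym (G c)" "!!c. irrefl (G c)" "!!c. ef qq (Gc c) R (Tr c) (G c) ((%e. (e, fr c e)) ` Ec c)" by simp_all
   \<comment> \<open>Piece 0 keeps an actual position: its place is taken by the copy
     \<open>V0'\<close> inside the closure on the board, not by a representative.\<close>
   define T where "T = Tr(0 := V0')"
   have Tc: "T c = Tr c" if "c : Cs" for c using that Cs(3) unfolding T_def by auto
   have T0: "T 0 = V0'" unfolding T_def by simp
   define \<tau> where "\<tau> v = (if l v = 0 then f0 v else fr (l v) v)" for v
   have \<tau>T: "\<tau> v : T (l v)" if "v : V" for v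
   proof (cases "l v = 0")
    case True
    thus ?thesis using that T0 unfolding \<tau>_def V0'_def V0_def by simp
   next
    case False
    hence "(v, fr (l v) v) : (%e. (e, fr (l v) e)) ` Ec (l v)" using that unfolding Ec_def by simp
    hence "fr (l v) v : Tr (l v)" using ef_basic[OF rp(6)[of "l v"]] by blast
    thus ?thesis using False unfolding \<tau>_def T_def by simp
   qed
   have \<tau>inj: "u = v" if "u : V" "v : V" "l u = l v" "\<tau> u = \<tau> v" for u v
   proof (cases "l u = 0")
    case True
    thus ?thesis using that inj_onD[OF f0(2), of u v] unfolding \<tau>_def V0_def by simp
   next
    case False
    have p: "piso R (G (l u)) ((%e. (e, fr (l u) e)) ` Ec (l u))" using ef_basic[OF rp(6)[of "l u"]] by blast
    have "(u, fr (l u) u) : (%e. (e, fr (l u) e)) ` Ec (l u)" "(v, fr (l u) v) : (%e. (e, fr (l u) e)) ` Ec (l u)"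
     using that unfolding Ec_def by auto
    from pisoD(1)[OF p this] show ?thesis using that False unfolding \<tau>_def by simp
   qed
   define J where "J = (%(u, v). ((l u, \<tau> u), (l v, \<tau> v))) ` cross R V l"
   have J_iff: "((l u, \<tau> u), (l v, \<tau> v)) : J \<longleftrightarrow> (u, v) : R" if uv: "u : V" "v : V" "l u ~= l v" for u v
   proof
    assume "((l u, \<tau> u), (l v, \<tau> v)) : J"
    then obtain u' v' where *: "(u', v') : cross R V l" "l u = l u'" "\<tau> u = \<tau> u'" "l v = l v'" "\<tau> v = \<tau> v'" unfolding J_def by auto
    hence "u = u'" "v = v'" using \<tau>inj[of u u'] \<tau>inj[of v v'] uv unfolding cross_def by auto
    thus "(u, v) : R" using *(1) unfolding cross_def by simp
   next
    assume "(u, v) : R"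
    hence "(u, v) : cross R V l" using uv unfolding cross_def by simp
    thus "((l u, \<tau> u), (l v, \<tau> v)) : J" unfolding J_def by force
   qed
   have lCs: "l v : insert 0 Cs" if "v : V" for v using that unfolding Cs_def classes_def by auto
   have fcross: "finite (cross R V l)" using fV by simp
   have pat: "pat_ok N k n' Cs T G J"
    unfolding pat_ok_def
   proof (intro conjI)
    show "Cs \<subseteq> {1..N}" by (rule Cs(1))
    show "T 0 \<subseteq> {1..n'}" unfolding T0 using V0'A AU(2) by blast
    show "\<forall>c\<in>Cs. T c \<subseteq> {1..N} & gapped (k + 1) (T c) & G c \<subseteq> T c \<times> T c & sym (G c) & irrefl (G c)"
     using rp Tc by simp
    show "J \<subseteq> {((c, t), (d, s)). c : insert 0 Cs & d : insert 0 Cs & c ~= d & t : T c & s : T d}"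
     unfolding J_def using lCs \<tau>T by (auto simp: cross_def)
    show "sym J"
    proof (rule symI)
     fix p q assume "(p, q) : J"
     then obtain u v where "(u, v) : cross R V l" "p = (l u, \<tau> u)" "q = (l v, \<tau> v)" unfolding J_def by auto
     moreover from this have "(v, u) : cross R V l" using gR unfolding cross_def sym_def by auto
     ultimately show "(q, p) : J" unfolding J_def by force
    qed
    show "\<forall>L. L \<subseteq> Cs --> L ~= {} -->
     0 < real (card L) - \<alpha> / 2 * real (card {((c, t), (d, s)) : J. c : insert 0 L & d : insert 0 L})"
    proof (intro allI impI)
     fix L assume L: "L \<subseteq> Cs" "L ~= {}"
     let ?E = "{(u, v) : cross R V l. l u : insert 0 L & l v : insert 0 L}"
     have fE: "finite ?E" using fcross by (rule finite_subset[rotated]) auto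
     have "{((c, t), (d, s)) : J. c : insert 0 L & d : insert 0 L} \<subseteq> (%(u, v). ((l u, \<tau> u), (l v, \<tau> v))) ` ?E"
      unfolding J_def by auto
     hence "card {((c, t), (d, s)) : J. c : insert 0 L & d : insert 0 L} <= card ((%(u, v). ((l u, \<tau> u), (l v, \<tau> v))) ` ?E)"
      using fE by (intro card_mono) auto
     also have "... <= card ?E" using fE by (rule card_image_le)
     finally have "\<alpha> / 2 * real (card {((c, t), (d, s)) : J. c : insert 0 L & d : insert 0 L}) <= \<alpha> / 2 * real (card ?E)"
      using alpha(1) by (intro mult_left_mono) auto
     moreover have "0 < real (card L) - \<alpha> / 2 * real (card ?E)" using safe L unfolding Cs_def by simp
     ultimately show "0 < real (card L) - \<alpha> / 2 * real (card {((c, t), (d, s)) : J. c : insert 0 L & d : insert 0 L})" by linarith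
    qed
   qed
   have "card (T 0) <= h"
   proof -
    have "card (f0 ` V0) <= card V0" using fV0(1) by (rule card_image_le)
    also have "... <= card V" using fV fV0 by (intro card_mono)
    finally show ?thesis unfolding T0 V0'_def using V(3) by simp
   qed
   moreover have "{1, n'} \<subseteq> T 0" unfolding T0 using X'V 1(6,7) unfolding X'_def by force
   ultimately obtain y where real: "realizes k n' R' Cs T G J y" using 1(3) pat unfolding ext_ax_def by blast
   interpret placement \<alpha> N k n' R' Cs T G J y
    by unfold_locales (use gR' pat real in auto)
   define pos where "pos v = y (l v) + \<tau> v" for v
   define PP where "PP = (%v. (v, pos v)) ` V"
   have pos0: "pos v = f0 v" if "v : V0" for v using that y0 unfolding pos_def \<tau>_def V0_def by simp
   have posD: "pos v : vset y T (l v)" if "v : V" for v using \<tau>T[OF that] unfolding pos_def vset_def by blast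
   define A1 where "A1 c = (if c = 0 then G0 else Gc c)" for c
   define A2 where "A2 c = (if c = 0 then G0' else vset y T c)" for c
   have A1: "A1 c = Gc c" for c unfolding A1_def Gc_def G0_def Gm_def V0_def using Lam(5) by auto
   have posA2: "pos v : A2 (l v)" if "v : V" for v
    using posD[OF that] V0G0(2) T0 D0 unfolding A2_def by (cases "l v = 0") auto
   have base_av: "u ~: DD & (u ~: V0' --> d : DD --> (u, d) ~: R') & (d : DD --> d ~= Suc u & u ~= Suc d)" if u: "u : G0'" for u d
   proof -
    obtain U0 where U0: "u : U0" "U0 \<subseteq> ?U'" "rigid R' V0' U0" "card (U0 - V0') <= k" using u unfolding G0'_def cl_def by blast
    note av = cl_base_avoids[unfolded T0, OF U0(3,4,2)]
    show ?thesis using av(1) av(2)[of u d] U0(1) V0_DD_succ[unfolded T0, of u d] by blast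
   qed
   have A2sub: "A2 c \<subseteq> DD" if "c : Cs" for c using that Cs(3) unfolding A2_def DD_def by auto
   have far2: "u + 1 < v \<or> v + 1 < u" if "c : Cs" "d : Cs" "c ~= d" "u : A2 c" "v : A2 d" for c d u v
    using far[of c d u v] that Cs(3) unfolding A2_def by (auto split: if_splits)
   have A2_cross: "u ~= v & v ~= Suc u & u ~= Suc v" if cd: "c : insert 0 Cs" "d : insert 0 Cs" "c ~= d" "u : A2 c" "v : A2 d" for c d u v
   proof (cases "c = 0 \<or> d = 0")
    case True
    then consider "c = 0" "d : Cs" | "d = 0" "c : Cs" using cd by blast
    thus ?thesis
    proof cases
     case 1
     hence "u : G0'" "v : DD" using cd A2sub[of d] unfolding A2_def by auto
     thus ?thesis using base_av[of u v] by auto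
    next
     case 2
     hence "v : G0'" "u : DD" using cd A2sub[of c] unfolding A2_def by auto
     thus ?thesis using base_av[of v u] by auto
    qed
   next
    case False
    thus ?thesis using far2[of c d u v] cd by auto
   qed
   have PPA: "PP Int (A1 c \<times> A2 c) = (%v. (v, pos v)) ` Ec c" if "c : insert 0 Cs" for c
   proof
    show "PP Int (A1 c \<times> A2 c) \<subseteq> (%v. (v, pos v)) ` Ec c"
     unfolding PP_def A1 Gc_def Ec_def using Lam(1) by auto
    show "(%v. (v, pos v)) ` Ec c \<subseteq> PP Int (A1 c \<times> A2 c)"
     using EG[of c] posA2 unfolding PP_def A1 Ec_def by auto
   qed
   have efc: "ef qq (A1 c) R (A2 c) R' (PP Int (A1 c \<times> A2 c))" if c: "c : insert 0 Cs" for c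
   proof (cases "c = 0")
    case True
    have "(%v. (v, pos v)) ` Ec 0 = P2" unfolding P2eq using pos0 unfolding Ec_def V0_def by auto
    thus ?thesis unfolding PPA[OF c] using ef0 True unfolding A1_def A2_def by simp
   next
    case False
    hence cC: "c : Cs" using c by simp
    have bij: "bij_betw (%t. y c + t) (T c) (vset y T c)" unfolding vset_def by (auto simp: bij_betw_def inj_on_def)
    have e2: "ef qq (T c) (G c) (vset y T c) R' ((%t. (t, y c + t)) ` T c)"
     by (rule ef_of_iso[OF bij]) (use edgeG[OF cC] in auto)
    have "(%v. (v, pos v)) ` Ec c \<subseteq> ((%e. (e, fr c e)) ` Ec c) O ((%t. (t, y c + t)) ` T c)"
    proof clarify
     fix v assume v: "v : Ec c"
     have "\<tau> v = fr c v" "l v = c" "v : V" using v False unfolding \<tau>_def Ec_def by auto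
     thus "(v, pos v) : ((%e. (e, fr c e)) ` Ec c) O ((%t. (t, y c + t)) ` T c)"
      using \<tau>T[of v] v unfolding pos_def by auto
    qed
    thus ?thesis unfolding PPA[OF c]
     using ef_subset[OF ef_trans[OF rp(6)[of c, folded Tc[OF cC]] e2]] False unfolding A1 A2_def by simp
   qed
   have ind_cross: "(u, v) : R \<longleftrightarrow> (pos u, pos v) : R'" if "u : V" "v : V" "l u ~= l v" for u v
    using edgeJ[of "l u" "l v" "\<tau> u" "\<tau> v"] lCs \<tau>T J_iff that unfolding pos_def by simp
   have piPP: "piso R R' PP"
    unfolding piso_def
   proof (intro allI impI)
    fix u u' v v' assume uv: "(u, u') : PP" "(v, v') : PP"
    hence e: "u : V" "u' = pos u" "v : V" "v' = pos v" unfolding PP_def by auto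
    show "(u = v \<longleftrightarrow> u' = v') & ((u, v) : R \<longleftrightarrow> (u', v') : R') & (v = Suc u \<longleftrightarrow> v' = Suc u')"
    proof (cases "l u = l v")
     case True
     have p: "piso R R' (PP Int (A1 (l u) \<times> A2 (l u)))" using ef_basic[OF efc[OF lCs[OF e(1)]]] by blast
     have "(u, u') : PP Int (A1 (l u) \<times> A2 (l u))" "(v, v') : PP Int (A1 (l u) \<times> A2 (l u))"
      unfolding PPA[OF lCs[OF e(1)]] Ec_def using e True by auto
     thus ?thesis using pisoD[OF p, of u u' v v'] by blast
    next
     case False
     have "pos u ~= pos v & pos v ~= Suc (pos u)"
      using A2_cross[OF lCs[OF e(1)] lCs[OF e(3)] False posA2[OF e(1)] posA2[OF e(3)]] by blast
     moreover have "v ~= Suc u" using V(4) e(1,3) False unfolding compat_def by auto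
     ultimately show ?thesis using ind_cross[OF e(1,3) False] False e by auto
    qed
   qed
   have fstPP: "fst ` PP = V" unfolding PP_def by force
   define GG' where "GG' = (\<Union>c\<in>insert 0 Cs. A2 c)"
   have Gm: "(\<Union>c\<in>insert 0 Cs. A1 c) = Gm"
   proof
    show "(\<Union>c\<in>insert 0 Cs. A1 c) \<subseteq> Gm" unfolding A1 Gc_def by blast
    show "Gm \<subseteq> (\<Union>c\<in>insert 0 Cs. A1 c)"
    proof
     fix u assume u: "u : Gm"
     hence "\<Lambda> u : insert 0 (l ` V)" using Lam(2) unfolding Gm_def by blast
     hence "\<Lambda> u : insert 0 Cs" unfolding Cs_def classes_def by blast
     thus "u : (\<Union>c\<in>insert 0 Cs. A1 c)" using u unfolding A1 Gc_def by blast
    qed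
   qed
   have cross2: "(u : snd ` PP) & (v : snd ` PP)" if c: "c : insert 0 Cs" and d: "d : insert 0 Cs" and ne: "c ~= d"
     and u: "u : A2 c" and v: "v : A2 d" and uv: "(u, v) : R'" for c d u v
   proof -
    have vu: "(v, u) : R'" using uv symR unfolding sym_def by blast
    have "u : vset y T c"
    proof (cases "c = 0")
     case True
     hence "v : DD" "u : G0'" using d ne v A2sub[of d] u unfolding A2_def by auto
     thus ?thesis using base_av[of u v] uv T0 D0 True by auto
    qed (use u in \<open>simp add: A2_def\<close>)
    moreover have "v : vset y T d"
    proof (cases "d = 0")
     case True
     hence "u : DD" "v : G0'" using c ne u A2sub[of c] v unfolding A2_def by auto
     thus ?thesis using base_av[of v u] vu T0 D0 True by auto
    qed (use v in \<open>simp add: A2_def\<close>)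
    ultimately obtain t s where ts: "t : T c" "s : T d" "u = y c + t" "v = y d + s" unfolding vset_def by auto
    hence "((c, t), (d, s)) : J" using edgeJ[OF c d ne ts(1,2)] uv by simp
    then obtain u1 v1 where "u1 : V" "v1 : V" "c = l u1" "t = \<tau> u1" "d = l v1" "s = \<tau> v1" unfolding J_def cross_def by auto
    hence "u = pos u1" "v = pos v1" "u1 : V" "v1 : V" using ts unfolding pos_def by auto
    thus ?thesis unfolding PP_def by force
   qed
   \<comment> \<open>All edges between parts have both ends among the marked points: on the left by
     the decomposition, on the right because such edges come from \<open>J\<close>.\<close>
   have efG: "ef qq Gm R GG' R' PP"
    unfolding GG'_def Gm[symmetric]
   proof (rule ef_parts[where P0 = PP])
    show "PP \<subseteq> (\<Union>c\<in>insert 0 Cs. A1 c \<times> A2 c)"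
    proof clarify
     fix u u' assume "(u, u') : PP"
     hence "u : V" "u' = pos u" unfolding PP_def by auto
     thus "(u, u') : (\<Union>c\<in>insert 0 Cs. A1 c \<times> A2 c)"
      using lCs[of u] posA2[of u] EG[of "l u"] unfolding A1 Ec_def by blast
    qed
    show "A1 c Int A1 d = {}" if "c ~= d" for c d using that unfolding A1 Gc_def by auto
    show "A2 c Int A2 d = {}" if "c : insert 0 Cs" "d : insert 0 Cs" "c ~= d" for c d
     using A2_cross[OF that] by fastforce
    show "v ~= Suc u" if "c ~= d" "u : A1 c" "v : A1 d" for c d u v
     using that Lam(3) unfolding A1 Gc_def compat_def Gm_def by auto
    show "v ~= Suc u" if "c : insert 0 Cs" "d : insert 0 Cs" "c ~= d" "u : A2 c" "v : A2 d" for c d u v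
     using A2_cross[OF that] by blast
    show "u : fst ` PP & v : fst ` PP" if "c ~= d" "u : A1 c" "v : A1 d" "(u, v) : R" for c d u v
    proof -
     have "\<Lambda> u = c" "\<Lambda> v = d" "u : Gm" "v : Gm" using that(2,3) unfolding A1 Gc_def by auto
     thus ?thesis using Lam(4)[rule_format, of u v] that(1,4) unfolding fstPP Gm_def by simp
    qed
    show "u : snd ` PP & v : snd ` PP" if "c : insert 0 Cs" "d : insert 0 Cs" "c ~= d" "u : A2 c" "v : A2 d" "(u, v) : R'" for c d u v
     using cross2[OF that] .
   qed (use efc piPP in auto)
   define E where "E = pos ` (V - V0)"
   have lV0: "l v : Cs" if "v : V - V0" for v using that lCs[of v] unfolding V0_def by auto
   have EDD: "E \<subseteq> DD" unfolding E_def DD_def using posD lV0 by blast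
   have snE: "snd ` PP = V0' Un E"
   proof -
    have "snd ` PP = pos ` V" unfolding PP_def by force
    also have "... = pos ` V0 Un pos ` (V - V0)" using fV0(3) by blast
    also have "pos ` V0 = V0'" unfolding V0'_def using pos0 by auto
    finally show ?thesis unfolding E_def .
   qed
   have E_D: "E Int vset y T c = pos ` Ec c" if c: "c : Cs" for c
   proof
    show "pos ` Ec c \<subseteq> E Int vset y T c" using posD Cs(3) c unfolding E_def Ec_def V0_def by auto
    show "E Int vset y T c \<subseteq> pos ` Ec c"
    proof
     fix u assume "u : E Int vset y T c"
     then obtain v where v: "v : V - V0" "u = pos v" "u : vset y T c" unfolding E_def by blast
     hence "l v = c" using D_disj[of "l v" c] posD[of v] lV0[of v] c by auto
     thus "u : pos ` Ec c" using v unfolding Ec_def by blast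
    qed
   qed
   \<comment> \<open>For \<open>TP\<close>, play \<open>K\<close> back into the original piece,
     where, having fewer than \<open>k\<close> new vertices, it lies in the closure of
     \<open>V\<close> together with its successor neighbours. These carry the same label, hence lie
     in the same piece, and one more round brings them back into the copy.\<close>
   have placed: "U1 \<subseteq> GG'" if U1: "rigid R' (V0' Un E) U1" "card (U1 - (V0' Un E)) <= k" "U1 \<subseteq> ?U'" for U1
   proof -
    have "U1 \<subseteq> cl R' ?U' k (T 0) Un DD"
    proof (rule cl_placed[OF EDD])
     show "y c + t : E" if ct: "((c, t), p) : J" "c : Cs" for c t p
     proof -
      obtain u where "u : V" "c = l u" "t = \<tau> u" using ct(1) unfolding J_def cross_def by auto
      thus ?thesis using ct(2) Cs(3) unfolding E_def pos_def V0_def by auto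
     qed
     fix c K d assume c: "c : Cs" and K: "K \<subseteq> vset y T c" "rigid R' (E Int vset y T c) (K Un (E Int vset y T c))" "card (K - E) < k" and d: "d : K"
     let ?Ec' = "E Int vset y T c"
     let ?Pc = "(%v. (v, pos v)) ` Ec c"
     have c0: "c ~= 0" using c Cs(3) by metis
     have e1: "ef qq (Gc c) R (vset y T c) R' ?Pc"
      using efc[of c] PPA[of c] c c0 unfolding A1 A2_def by simp
     note e2 = ef_converse[OF e1]
     have fK: "finite (K Un ?Ec')" using rigidD(1)[OF K(2)] .
     have "\<exists>Q. ?Pc\<inverse> \<subseteq> Q & ef 1 (vset y T c) R' (Gc c) R Q & fst ` Q = fst ` (?Pc\<inverse>) Un (K - E)"
      by (rule ef_extend[of _ "k"]) (use ef_le[OF e2, of "1 + k"] fK K in \<open>auto simp: qq_def\<close>)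
     then obtain Q where Q: "?Pc\<inverse> \<subseteq> Q" "ef 1 (vset y T c) R' (Gc c) R Q" "fst ` Q = fst ` (?Pc\<inverse>) Un (K - E)" by blast
     have fPc: "fst ` (?Pc\<inverse>) = ?Ec'" unfolding E_D[OF c] by force
     have fQ: "fst ` Q = K Un ?Ec'" unfolding Q(3) fPc using K(1) by blast
     have piQ: "piso R' R Q" "Q \<subseteq> vset y T c \<times> Gc c" using ef_basic[OF Q(2)] by auto
     obtain g where g: "\<forall>v\<in>K Un ?Ec'. (v, g v) : Q" "inj_on g (K Un ?Ec')" "\<forall>Y. Y \<subseteq> K Un ?Ec' --> g ` Y = Q `` Y"
      "\<forall>u\<in>K Un ?Ec'. \<forall>v\<in>K Un ?Ec'. (u, v) : R' \<longleftrightarrow> (g u, g v) : R" "\<forall>u\<in>K Un ?Ec'. \<forall>v\<in>K Un ?Ec'. v = Suc u \<longleftrightarrow> g v = Suc (g u)"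
      by (rule piso_fun[OF piQ(1), of "K Un ?Ec'"]) (use fQ in auto)
     have gE: "g ` ?Ec' = Ec c"
     proof -
      have "g (pos v) = v" if v: "v : Ec c" for v
      proof -
       have "(pos v, v) : Q" using Q(1) v by auto
       moreover have "(pos v, g (pos v)) : Q" using g(1) v E_D[OF c] by blast
       ultimately show ?thesis using pisoD(1)[OF piQ(1), of "pos v" v "pos v" "g (pos v)"] by simp
      qed
      thus ?thesis unfolding E_D[OF c] by (force simp: image_iff)
     qed
     have rg: "rigid R (Ec c) (g ` (K Un ?Ec'))"
      using rigid_iso[OF K(2) g(2)] g(4,5) gE by simp
     let ?K = "g ` (K Un ?Ec')"
     have KG: "?K \<subseteq> Gc c" using g(1) piQ(2) by blast
     have EcV: "Ec c \<subseteq> V" unfolding Ec_def by blast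
     have rKV: "rigid R V (?K Un V)" using rigid_base[OF rg EcV fV] .
     have cK: "card (?K Un V - V) < k"
     proof -
      have "?K Un V - V \<subseteq> g ` (K - E)"
      proof
       fix x assume x: "x : ?K Un V - V"
       then obtain z where z: "z : K Un ?Ec'" "x = g z" by blast
       have "z ~: ?Ec'" using x z gE EcV by blast
       hence "z : K - E" using z K(1) by blast
       thus "x : g ` (K - E)" using z by blast
      qed
      hence "card (?K Un V - V) <= card (g ` (K - E))" using fK by (intro card_mono) auto
      also have "... <= card (K - E)" using fK by (intro card_image_le) auto
      finally show ?thesis using K(3) by simp
     qed
     have KU: "?K Un V \<subseteq> ?U" using KG GU(1) V(2) unfolding Gc_def by blast
     have gd: "g d : ?K" "(d, g d) : Q" using g(1) d by blast+
     have gdc: "g d : Gm" "\<Lambda> (g d) = c" using gd(1) KG unfolding Gc_def by blast+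
     \<comment> \<open>The ends have label 0, so \<open>g d\<close> is neither of them and both of
       its successor neighbours exist. This is why positions contain \<open>(1, 1)\<close> and
       \<open>(n, n')\<close>.\<close>
     have ends: "\<Lambda> 1 = 0" "\<Lambda> n = 0"
     proof -
      have "1 : X" "n : X" using 1(6,7) unfolding X_def by force+
      thus "\<Lambda> 1 = 0" "\<Lambda> n = 0" using V(1,5) Lam(1) by auto
     qed
     have adj: "w : Gc c" if w: "w = Suc (g d) \<or> g d = Suc w" "w : ?U" for w
     proof -
      have wG: "w : Gm" unfolding Gm_def by (rule cl_adjacent[OF rKV KU cK _ w]) (use gd(1) in blast)
      have "\<Lambda> w = \<Lambda> (g d)" using Lam(3) w(1) wG gdc(1) unfolding compat_def Gm_def[symmetric] by metis
      thus ?thesis using wG gdc(2) unfolding Gc_def by simp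
     qed
     have gU: "g d : ?U" using gdc(1) GU(1) by blast
     have "g d ~= n" "g d ~= 1" using ends gdc(2) c0 by metis+
     hence ge: "2 <= g d" "g d < n" using gU by auto
     have s: "Suc (g d) : Gc c" "g d - 1 : Gc c" "g d = Suc (g d - 1)"
     proof -
      show "Suc (g d) : Gc c" by (rule adj) (use ge in auto)
      show "g d - 1 : Gc c" by (rule adj) (use ge in auto)
     qed (use ge in auto)
     have Q1: "ef (Suc 0) (vset y T c) R' (Gc c) R Q" using Q(2) by simp
     obtain b1 where b1: "b1 : vset y T c" "ef 0 (vset y T c) R' (Gc c) R (insert (b1, Suc (g d)) Q)" using ef_back[OF Q1 s(1)] by blast
     have "b1 = Suc d" using pisoD(3)[of R' R "insert (b1, Suc (g d)) Q" d "g d" b1 "Suc (g d)"] b1(2) gd(2) by simp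
     moreover obtain b2 where b2: "b2 : vset y T c" "ef 0 (vset y T c) R' (Gc c) R (insert (b2, g d - 1) Q)" using ef_back[OF Q1 s(2)] by blast
     have "d = Suc b2" using pisoD(3)[of R' R "insert (b2, g d - 1) Q" b2 "g d - 1" d "g d"] b2(2) gd(2) s(3) by simp
     ultimately show "Suc d : vset y T c & (\<exists>d'\<in>vset y T c. d = Suc d')" using b1(1) b2(1) by blast
    qed (use U1 in \<open>auto simp: T0\<close>)
    also have "... \<subseteq> GG'"
    proof
     fix x assume "x : cl R' ?U' k (T 0) Un DD"
     then consider "x : G0'" | c where "c : Cs" "x : vset y T c" unfolding T0 G0'_def DD_def by blast
     thus "x : GG'"
     proof cases
      case 1
      thus ?thesis unfolding GG'_def A2_def by simp
     next
      case 2
      hence "c ~= 0" using Cs(3) by metis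
      hence "x : A2 c" using 2 unfolding A2_def by simp
      thus ?thesis using 2 unfolding GG'_def by blast
     qed
    qed
    finally show ?thesis .
   qed
   define b where "b = pos a"
   have aV: "a : V" using V(1) by blast
   have GGU: "GG' \<subseteq> ?U'"
   proof -
    have "G0' \<subseteq> ?U'" unfolding G0'_def by (rule cl_sub)
    thus ?thesis unfolding GG'_def A2_def using DDsub unfolding DD_def by (auto split: if_splits)
   qed
   have bG: "b : GG'" unfolding b_def GG'_def using posA2[OF aV] lCs[OF aV] by blast
   let ?X = "insert a X" and ?X' = "insert b X'"
   have XV: "?X \<subseteq> V" using V(1) .
   have X'V': "?X' \<subseteq> V0' Un E" using X'V aV V(6) unfolding b_def E_def V0_def by auto
   have fV': "finite (V0' Un E)" using V0'A(2) fV unfolding E_def by simp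
   have c1: "cl R Gm k ?X = cl R ?U k ?X"
   proof (rule cl_restrict[OF _ GU(1)])
    show "cl R ?U k ?X \<subseteq> Gm"
    proof
     fix u assume "u : cl R ?U k ?X"
     then obtain W where W: "u : W" "W \<subseteq> ?U" "rigid R ?X W" "card (W - ?X) <= k" unfolding cl_def by blast
     have "rigid R V (W Un V)" using rigid_base[OF W(3) XV fV] .
     moreover have "card (W Un V - V) <= card (W - ?X)" using rigidD(1)[OF W(3)] XV by (intro card_mono) auto
     ultimately show "u : Gm" unfolding Gm_def using clI[of "W Un V" ?U R V k] W V(2) by auto
    qed
   qed
   have c2: "cl R' GG' k ?X' = cl R' ?U' k ?X'"
   proof (rule cl_restrict[OF _ GGU])
    show "cl R' ?U' k ?X' \<subseteq> GG'"
    proof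
     fix u assume "u : cl R' ?U' k ?X'"
     then obtain W where W: "u : W" "W \<subseteq> ?U'" "rigid R' ?X' W" "card (W - ?X') <= k" unfolding cl_def by blast
     have "rigid R' (V0' Un E) (W Un (V0' Un E))" using rigid_base[OF W(3) X'V' fV'] .
     moreover have "card (W Un (V0' Un E) - (V0' Un E)) <= card (W - ?X')" using rigidD(1)[OF W(3)] X'V' by (intro card_mono) auto
     moreover have "W Un (V0' Un E) \<subseteq> ?U'" using W(2) V0'A(1) AU(2) EDD DDsub by blast
     ultimately have "W Un (V0' Un E) \<subseteq> GG'" using placed[of "W Un (V0' Un E)"] W(4) by simp
     thus "u : GG'" using W(1) by blast
    qed
   qed
   have abP: "insert (a, b) P \<subseteq> PP"
   proof -
    have "P \<subseteq> PP" using P2(1) pos0 fV0(3) unfolding P2eq PP_def by force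
    thus ?thesis using aV unfolding PP_def b_def by blast
   qed
   have im: "PP `` ?X = ?X'"
   proof -
    have "PP `` X = P `` X" using ef_Image_converse(2)[OF PA(2) _ _ piPP, of X] abP unfolding X_def by blast
    moreover have "PP `` {a} = {b}" using aV unfolding PP_def b_def by auto
    ultimately show ?thesis using PX by auto
   qed
   have "?X \<subseteq> cl R Gm k ?X" "?X' \<subseteq> cl R' GG' k ?X'"
   proof -
    show "?X \<subseteq> cl R Gm k ?X" by (rule base_sub_cl) (use fX XV VG in auto)
    have "X' \<subseteq> GG'" using X'V V0G0(2) unfolding GG'_def A2_def by auto
    thus "?X' \<subseteq> cl R' GG' k ?X'" by (intro base_sub_cl) (use fX bG in auto)
   qed
   moreover have "insert (a, b) P \<subseteq> ?X \<times> ?X'" unfolding X_def X'_def by force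
   ultimately have sub: "insert (a, b) P \<subseteq> cl R Gm k ?X \<times> cl R' GG' k (PP `` ?X)" unfolding im by blast
   have "ef q (cl R Gm k ?X) R (cl R' GG' k (PP `` ?X)) R' (insert (a, b) P)"
    by (rule ef_cl[OF ef_le[OF efG] _ abP sub]) (use XV fstPP in \<open>auto simp: qq_def\<close>)
   hence "ef q (cl R ?U k ?X) R (cl R' ?U' k ?X') R' (insert (a, b) P)" unfolding im c1 c2 .
   thus ?thesis using bG GGU unfolding X_def X'_def by blast
  qed
 qed
qed

text \<open>\<open>step\<close> is iterated backwards: the depth and the rounds required now are
  those of the remaining game fed through \<open>step\<close>, and each level contributes one
  extension axiom. The axioms are demanded of both graphs since Spoiler may move in either.\<close>

lemma strategy:
 "\<exists>A m q'. finite A & 1 <= m & (\<forall>(h, k, N)\<in>A. 1 <= k) & (\<forall>n R n' R' P. graph_on n R --> graph_on n' R' -->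
  (\<forall>(h, k, N)\<in>A. ext_ax h k N n R & ext_ax h k N n' R') -->
  finite P --> card (fst ` P) <= r --> (1, 1) : P --> (n, n') : P -->
  ef q' (cl R {1..n} m (fst ` P)) R (cl R' {1..n'} m (snd ` P)) R' P --> ef q {1..n} R {1..n'} R' P)"
proof (induction q arbitrary: r)
 case 0
 show ?case
 proof (rule exI[of _ "{}"], rule exI[of _ 1], rule exI[of _ 0], intro conjI allI impI)
  fix n R n' R' P assume "ef 0 (cl R {1..n} 1 (fst ` P)) R (cl R' {1..n'} 1 (snd ` P)) R' P"
  thus "ef 0 {1..n} R {1..n'} R' P"
   using cl_sub[of R "{1..n}" 1 "fst ` P"] cl_sub[of R' "{1..n'}" 1 "snd ` P"] by auto
 qed auto
next
 case (Suc q)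
 obtain A1 m1 q1 where 1: "finite A1" "1 <= m1" "\<forall>(h, k, N)\<in>A1. 1 <= k" and
  H0: "\<forall>n R n' R' P. graph_on n R --> graph_on n' R' -->
  (\<forall>(h, k, N)\<in>A1. ext_ax h k N n R & ext_ax h k N n' R') -->
  finite P --> card (fst ` P) <= Suc r --> (1, 1) : P --> (n, n') : P -->
  ef q1 (cl R {1..n} m1 (fst ` P)) R (cl R' {1..n'} m1 (snd ` P)) R' P --> ef q {1..n} R {1..n'} R' P"
  using Suc.IH[of "Suc r"] by (elim exE conjE)
 note H = H0[rule_format]
 obtain h N q' where S0: "\<forall>n R n' R' P a. graph_on n R --> graph_on n' R' --> ext_ax h m1 N n' R' -->
  finite P --> card (fst ` P) <= r --> (1, 1) : P --> (n, n') : P -->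
  ef q' (cl R {1..n} (h + m1) (fst ` P)) R (cl R' {1..n'} (h + m1) (snd ` P)) R' P --> a : {1..n} -->
  (\<exists>b\<in>{1..n'}. ef q1 (cl R {1..n} m1 (insert a (fst ` P))) R (cl R' {1..n'} m1 (insert b (snd ` P))) R' (insert (a, b) P))"
  using step[OF 1(2), of r q1] by (elim exE)
 note S = S0[rule_format]
 show ?case
 proof (rule exI[of _ "insert (h, m1, N) A1"], rule exI[of _ "h + m1"], rule exI[of _ q'], intro conjI allI impI)
  show "finite (insert (h, m1, N) A1)" "1 <= h + m1" "\<forall>(h, k, N)\<in>insert (h, m1, N) A1. 1 <= k" using 1 by auto
  fix n R n' R' P
  assume a: "graph_on n R" "graph_on n' R'"
   "\<forall>(h, k, N)\<in>insert (h, m1, N) A1. ext_ax h k N n R & ext_ax h k N n' R'" "finite P" "card (fst ` P) <= r" "(1, 1) : P" "(n, n') : P"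
   "ef q' (cl R {1..n} (h + m1) (fst ` P)) R (cl R' {1..n'} (h + m1) (snd ` P)) R' P"
  have piP: "piso R R' P" using ef_basic[OF a(8)] by blast
  have PU: "P \<subseteq> {1..n} \<times> {1..n'}"
   using ef_basic[OF a(8)] cl_sub[of R "{1..n}" "h + m1" "fst ` P"] cl_sub[of R' "{1..n'}" "h + m1" "snd ` P"] by blast
  have ax: "\<forall>(h, k, N)\<in>A1. ext_ax h k N n R & ext_ax h k N n' R'" "ext_ax h m1 N n R" "ext_ax h m1 N n' R'" using a(3) by auto
  have inj: "inj_on fst P" using pisoD(1)[OF piP] by (auto intro!: inj_onI)
  have inj2: "inj_on snd P" using pisoD(1)[OF piP] by (auto intro!: inj_onI)
  have cs: "card (snd ` P) <= r" using a(5) card_image[OF inj] card_image[OF inj2] by simp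
  have fin: "ef q {1..n} R {1..n'} R' (insert (x, z) P)"
   if "ef q1 (cl R {1..n} m1 (insert x (fst ` P))) R (cl R' {1..n'} m1 (insert z (snd ` P))) R' (insert (x, z) P)" for x z
  proof (rule H[OF a(1,2)])
   show "case x of (h, k, N) => ext_ax h k N n R & ext_ax h k N n' R'" if "x : A1" for x
    using ax(1) that by (rule bspec)
   show "card (fst ` insert (x, z) P) <= Suc r" using a(4,5) by (simp add: card_insert_if)
   show "ef q1 (cl R {1..n} m1 (fst ` insert (x, z) P)) R (cl R' {1..n'} m1 (snd ` insert (x, z) P)) R' (insert (x, z) P)"
    using that by simp
  qed (use a in auto)
  have "\<exists>b\<in>{1..n'}. ef q {1..n} R {1..n'} R' (insert (x, b) P)" if x: "x : {1..n}" for x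
   using S[OF a(1,2) ax(3) a(4-8) x] fin by blast
  moreover have "\<exists>x\<in>{1..n}. ef q {1..n} R {1..n'} R' (insert (x, b) P)" if b: "b : {1..n'}" for b
  proof -
   have fs: "fst ` (P\<inverse>) = snd ` P" "snd ` (P\<inverse>) = fst ` P" by force+
   have "\<exists>x\<in>{1..n}. ef q1 (cl R' {1..n'} m1 (insert b (fst ` (P\<inverse>)))) R' (cl R {1..n} m1 (insert x (snd ` (P\<inverse>)))) R (insert (b, x) (P\<inverse>))"
    by (rule S[OF a(2,1) ax(2)]) (use a(4,6,7) cs b ef_converse[OF a(8)] in \<open>auto simp: fs\<close>)
   then obtain x where x: "x : {1..n}" "ef q1 (cl R' {1..n'} m1 (insert b (snd ` P))) R' (cl R {1..n} m1 (insert x (fst ` P))) R (insert (b, x) (P\<inverse>))"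
    unfolding fs by blast
   have "(insert (b, x) (P\<inverse>))\<inverse> = insert (x, b) P" by auto
   thus ?thesis using fin[of x b] ef_converse[OF x(2)] x(1) by auto
  qed
  ultimately show "ef (Suc q) {1..n} R {1..n'} R' P" using PU piP by simp
 qed
qed

end

section \<open>Rigid extensions at all scales\<close>

definition ad :: "nat => nat => nat" where "ad x y = (x - y) + (y - x)"

lemma ad_sym: "ad x y = ad y x" by (simp add: ad_def)

lemma ad_pos: "x ~= y ==> 0 < ad x y" by (auto simp: ad_def)

lemma ad_tri: "ad x z <= ad x y + ad y z" by (auto simp: ad_def)

lemma ad_less: "x < y ==> ad x y = y - x" by (simp add: ad_def)

definition nd :: "nat => nat set => nat" where "nd x S = Min (ad x ` S)"

lemma nd_le: "finite S ==> y : S ==> nd x S <= ad x y"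
 unfolding nd_def by simp

lemma nd_attained: "finite S ==> S ~= {} ==> \<exists>y\<in>S. nd x S = ad x y"
proof -
 assume "finite S" "S ~= {}"
 hence "nd x S : ad x ` S" unfolding nd_def by (intro Min_in) auto
 thus ?thesis by blast
qed

lemma nd_pos: "finite S ==> S ~= {} ==> x ~: S ==> 0 < nd x S"
 using nd_attained[of S x] ad_pos[of x] by metis

text \<open>The order in which Prim's algorithm, started from \<open>X\<close>, collects the
  vertices; \<open>lens\<close> lists the lengths of the links of the resulting spanning
  tree.\<close>

fun prim :: "nat set => nat list => bool" where
 "prim X [] \<longleftrightarrow> True"
| "prim X (c # cs) \<longleftrightarrow> c ~: X & c ~: set cs & (\<forall>d\<in>set cs. nd c X <= nd d X) & prim (insert c X) cs"

fun lens :: "nat set => nat list => nat list" where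
 "lens X [] = []"
| "lens X (c # cs) = nd c X # lens (insert c X) cs"

lemma length_lens [simp]: "length (lens X cs) = length cs"
 by (induction cs arbitrary: X) auto

lemma prim_exists: "finite C ==> C Int X = {} ==> \<exists>cs. set cs = C & distinct cs & prim X cs"
proof (induction "card C" arbitrary: C X)
 case 0
 thus ?case by (intro exI[of _ "[]"]) auto
next
 case (Suc m)
 hence "C ~= {}" by auto
 then obtain c where c: "c : C" "!!d. d : C ==> nd c X <= nd d X"
  using ex_min_if_finite[of "(%d. nd d X) ` C"] Suc.prems(1)
  by (metis (no_types, lifting) arg_min_if_finite(1) arg_min_least)
 have "m = card (C - {c})" using Suc.hyps(2) c(1) Suc.prems(1) by simp
 moreover have "(C - {c}) Int insert c X = {}" using Suc.prems(2) by blast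
 ultimately obtain cs where "set cs = C - {c}" "distinct cs" "prim (insert c X) cs"
  using Suc.hyps(1)[of "C - {c}" "insert c X"] Suc.prems(1) by blast
 thus ?case using c Suc.prems(2) by (intro exI[of _ "c # cs"]) auto
qed

lemma prim_distinct: "prim X cs ==> distinct cs & set cs Int X = {}"
 by (induction cs arbitrary: X) auto

text \<open>At time \<open>t\<close> a nearest outside vertex is taken, so all vertices still
  outside are at least that far from everything collected before.\<close>

lemma prim_dist:
 assumes "prim X cs" "finite X" "t <= j" "j < length cs" "y : X Un set (take t cs)"
 shows "lens X cs ! t <= ad (cs ! j) y"
 using assms
proof (induction cs arbitrary: X t j)
 case (Cons c cs)
 show ?case
 proof (cases t)
  case 0
  hence y: "y : X" using Cons.prems(5) by simp
  have "nd c X <= nd ((c # cs) ! j) X" using Cons.prems(1,4) by (cases j) auto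
  also have "... <= ad ((c # cs) ! j) y" using nd_le[OF Cons.prems(2) y] .
  finally show ?thesis using 0 by simp
 next
  case (Suc t')
  then obtain j' where j: "j = Suc j'" using Cons.prems(3) by (cases j) auto
  show ?thesis using Cons.IH[of "insert c X" t' j'] Cons.prems Suc j by auto
 qed
qed simp

lemma lens_pos: "prim X cs ==> finite X ==> X ~= {} ==> x : set (lens X cs) ==> 1 <= x"
proof (induction cs arbitrary: X)
 case (Cons c cs)
 thus ?case using nd_pos[of X c] Cons.IH[of "insert c X"] by auto
qed simp

lemma nd_insert_bound: "finite X ==> X ~= {} ==> nd d X <= nd d (insert c X) + nd c X"
proof -
 assume X: "finite X" "X ~= {}"
 then obtain y where y: "y : insert c X" "nd d (insert c X) = ad d y" using nd_attained[of "insert c X" d] by auto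
 show ?thesis
 proof (cases "y : X")
  case True
  thus ?thesis using nd_le[OF X(1), of y d] y by simp
 next
  case False
  obtain x where x: "x : X" "nd c X = ad c x" using nd_attained X by blast
  have "nd d X <= ad d x" using nd_le[OF X(1) x(1)] .
  also have "... <= ad d c + ad c x" by (rule ad_tri)
  finally show ?thesis using False y x by auto
 qed
qed

lemma lens_far:
 assumes "finite X" "X ~= {}" "d : set cs" "\<forall>x\<in>set (lens X cs). x < s"
 shows "nd d X <= length cs * (s - 1)"
 using assms
proof (induction cs arbitrary: X)
 case (Cons c cs)
 have c: "nd c X <= s - 1" using Cons.prems(4) by auto
 show ?case
 proof (cases "d = c")
  case True
  thus ?thesis using c by simp
 next
  case False
  hence "nd d (insert c X) <= length cs * (s - 1)"
   using Cons.IH[of "insert c X"] Cons.prems by auto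
  thus ?thesis using nd_insert_bound[of X d c] c Cons.prems by simp
 qed
qed simp

text \<open>Integrate the hypothesis over \<open>s\<close> from 0 to \<open>M\<close>: the number of
  \<open>i\<close> with \<open>s <= a i\<close> integrates to the sum of the
  \<open>a i\<close>.\<close>

lemma layer_cake:
 fixes a :: "'i => real" and b :: "'k => real"
 assumes fin: "finite I" "finite K" and a: "!!i. i : I ==> 0 <= a i & a i <= M" and b: "!!k. k : K ==> 0 <= b k"
  and M: "0 <= M" and \<alpha>: "0 <= \<alpha>"
  and le: "!!s. 0 < s ==> s <= M ==> real (card {i : I. s <= a i}) + e <= \<alpha> * real (card {k : K. s <= b k})"
 shows "(\<Sum>i\<in>I. a i) + e * M <= \<alpha> * (\<Sum>k\<in>K. b k)"
proof -
 have one: "((%s. if s : {0..x} then 1 else 0) has_integral x) {0..M}" if "0 <= x" "x <= M" for x :: real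
 proof -
  have "((%s::real. 1::real) has_integral x) {0..x}" using has_integral_const_real[of "1::real" 0 x] that by simp
  thus ?thesis using has_integral_restrict[of "{0..x}" "{0..M}" "%s. 1::real" x] that by simp
 qed
 have f: "((%s. (\<Sum>i\<in>I. if s : {0..a i} then 1 else 0) + e) has_integral ((\<Sum>i\<in>I. a i) + e * M)) {0..M}"
  using has_integral_const_real[of e 0 M] M
  by (intro has_integral_add has_integral_sum fin one) (use a in \<open>auto simp: mult.commute\<close>)
 have g: "((%s. \<alpha> * (\<Sum>k\<in>K. if s : {0..min (b k) M} then 1 else 0)) has_integral (\<alpha> * (\<Sum>k\<in>K. min (b k) M))) {0..M}"
  by (intro has_integral_mult_right has_integral_sum fin one) (use b M in auto)
 define f' where "f' s = (if s = 0 then \<alpha> * (\<Sum>k\<in>K. if s : {0..min (b k) M} then 1 else 0) else (\<Sum>i\<in>I. if s : {0..a i} then 1 else 0) + e)" for s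
 have f': "(f' has_integral ((\<Sum>i\<in>I. a i) + e * M)) {0..M}"
  by (rule has_integral_spike_finite[OF _ _ f, of "{0}"]) (auto simp: f'_def)
 have "(\<Sum>i\<in>I. a i) + e * M <= \<alpha> * (\<Sum>k\<in>K. min (b k) M)"
 proof (rule has_integral_le[OF f' g])
  fix s assume s: "s : {0..M}"
  show "f' s <= \<alpha> * (\<Sum>k\<in>K. if s : {0..min (b k) M} then 1 else 0)"
  proof (cases "s = 0")
   case False
   have 1: "(\<Sum>i\<in>I. if s : {0..a i} then 1 else 0) = real (card {i : I. s <= a i})"
    using s fin(1) by (simp add: sum.If_cases Int_def)
   have 2: "(\<Sum>k\<in>K. if s : {0..min (b k) M} then 1 else 0) = real (card {k : K. s <= b k})"
    using s fin(2) by (simp add: sum.If_cases Int_def)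
   show ?thesis unfolding f'_def using False 1 2 le[of s] s by simp
  qed (simp add: f'_def)
 qed
 also have "... <= \<alpha> * (\<Sum>k\<in>K. b k)" using \<alpha> by (intro mult_left_mono sum_mono) auto
 finally show ?thesis .
qed

context irrational_exponent
begin

text \<open>Cut the tree at its links of length at least \<open>s\<close> and label a vertex by the
  number of long links up to its turn. By \<open>prim_dist\<close> vertices with different labels
  are at distance at least \<open>s\<close>, so the labelling respects successor and its crossing
  edges are long. Every long link opens a new class, and rigidity makes the weight at most
  \<open>- \<epsilon>\<close>.\<close>

lemma threshold_cut:
 assumes X: "finite X" "X ~= {}" and cs: "prim X cs" and r: "rigid R X (X Un set cs)"
  and eps: "\<forall>a\<le>length cs. \<forall>b. real a - \<alpha> / 2 * real b < 0 --> real a - \<alpha> / 2 * real b <= - \<epsilon>"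
  and s: "1 < s" and ne: "\<exists>t<length cs. s <= real (lens X cs ! t)"
 shows "real (card {t. t < length cs & s <= real (lens X cs ! t)}) + \<epsilon> <=
  \<alpha> / 2 * real (card {(u, v). (u, v) : R & u : X Un set cs & v : X Un set cs & ~ (u : X & v : X) & s <= real (ad u v)})"
proof -
 let ?L = "%t. real (lens X cs ! t)" and ?n = "length cs" and ?V = "X Un set cs"
 define A where "A j = {t. t <= j & s <= ?L t}" for j
 have dc: "distinct cs" "set cs Int X = {}" using prim_distinct[OF cs] by auto
 define ix where "ix u = (THE j. j < ?n & cs ! j = u)" for u
 have ix: "ix (cs ! j) = j" if "j < ?n" for j
  unfolding ix_def using dc(1) that by (intro the_equality) (auto simp: nth_eq_iff_index_eq)
 define l where "l u = (if u : set cs then card (A (ix u)) else 0)" for u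
 have finA: "finite (A j)" for j unfolding A_def by simp
 have lj: "l (cs ! j) = card (A j)" if "j < ?n" for j unfolding l_def using ix[OF that] that by simp
 have lX: "l x = 0" if "x : X" for x unfolding l_def using dc(2) that by auto
 have far1: "s <= real (ad u v)" if uv: "u : ?V" "v : ?V" "l u < l v" for u v
 proof -
  have "v : set cs" using uv lX[of v] by auto
  then obtain j where j: "j < ?n" "v = cs ! j" by (metis in_set_conv_nth)
  have "\<exists>t\<le>j. s <= ?L t & u : X Un set (take t cs)"
  proof (cases "u : X")
   case True
   hence "A j ~= {}" using uv(3) lj[OF j(1)] j(2) by auto
   thus ?thesis using True unfolding A_def by blast
  next
   case False
   then obtain i where i: "i < ?n" "u = cs ! i" using uv(1) by (metis UnE in_set_conv_nth)
   have "card (A i) < card (A j)" using uv(3) lj i j by simp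
   hence "~ A j \<subseteq> A i" using card_mono[OF finA, of "A j" i] by linarith
   then obtain t where "t : A j" "t ~: A i" by blast
   hence t: "t <= j" "s <= ?L t" "i < t" unfolding A_def by auto
   hence "u : set (take t cs)" using i by (auto simp: in_set_conv_nth intro!: exI[of _ i])
   thus ?thesis using t by blast
  qed
  then obtain t where t: "t <= j" "s <= ?L t" "u : X Un set (take t cs)" by blast
  have "lens X cs ! t <= ad v u" using prim_dist[OF cs X(1) t(1) j(1) t(3)] j(2) by simp
  hence "?L t <= real (ad u v)" by (simp add: ad_sym)
  thus ?thesis using t(2) by linarith
 qed
 have far2: "s <= real (ad u v)" if "u : ?V" "v : ?V" "l u ~= l v" for u v
  using far1[of u v] far1[of v u] that ad_sym[of u v] by (metis linorder_neqE_nat)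
 have comp: "compat ?V l" unfolding compat_def
 proof (intro ballI impI, rule ccontr)
  fix u assume "u : ?V" "Suc u : ?V" "l u ~= l (Suc u)"
  hence "s <= real (ad u (Suc u))" using far2 by blast
  thus False using s by (simp add: ad_def)
 qed
 define B where "B = {t. t < ?n & s <= ?L t}"
 have strict: "card (A t) < card (A t')" if "t : B" "t' : B" "t < t'" for t t'
 proof -
  have "A t \<subseteq> A t'" "t' : A t'" "t' ~: A t" using that unfolding A_def B_def by auto
  hence "A t \<subset> A t'" by blast
  thus ?thesis using psubset_card_mono[OF finA] by blast
 qed
 have inj: "inj_on (%t. card (A t)) B"
  by (rule linorder_inj_onI') (use strict in fastforce)
 have sub: "(%t. card (A t)) ` B \<subseteq> classes ?V l"
 proof
  fix x assume "x : (%t. card (A t)) ` B"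
  then obtain t where t: "t < ?n" "s <= ?L t" "x = card (A t)" unfolding B_def by blast
  hence "t : A t" unfolding A_def by simp
  hence "x ~= 0" using t finA by auto
  moreover have "x = l (cs ! t)" using lj t by simp
  ultimately show "x : classes ?V l" unfolding classes_def using t by auto
 qed
 have finV: "finite ?V" using X(1) by simp
 have "card B <= card (classes ?V l)" using card_mono[OF _ sub] card_image[OF inj] finV by simp
 obtain t0 where "t0 : B" using ne unfolding B_def by blast
 hence "card (A t0) : classes ?V l" using sub by blast
 hence "\<exists>v\<in>?V. l v ~= 0" unfolding classes_def by auto
 hence neg: "wt R ?V l < 0" using rigidD(3)[OF r comp] lX by blast
 have "card (classes ?V l) <= ?n"
 proof -
  have "classes ?V l \<subseteq> l ` set cs" unfolding classes_def using lX by auto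
  hence "card (classes ?V l) <= card (l ` set cs)" by (intro card_mono) auto
  also have "... <= ?n" using card_image_le[of "set cs" l] card_length[of cs] by simp
  finally show ?thesis .
 qed
 hence w: "wt R ?V l <= - \<epsilon>" using eps neg unfolding wt_def by blast
 let ?E = "{(u, v). (u, v) : R & u : ?V & v : ?V & ~ (u : X & v : X) & s <= real (ad u v)}"
 have "cross R ?V l \<subseteq> ?E" using far2 lX unfolding cross_def by auto
 moreover have "finite ?E" by (rule finite_subset[of _ "?V \<times> ?V"]) (use finV in auto)
 ultimately have "card (cross R ?V l) <= card ?E" by (intro card_mono)
 hence "\<alpha> / 2 * real (card (cross R ?V l)) <= \<alpha> / 2 * real (card ?E)" using alpha(1) by (intro mult_left_mono) auto
 thus ?thesis using w \<open>card B <= card (classes ?V l)\<close> unfolding wt_def B_def by linarith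
qed

definition symc :: "edges => edges" where "symc Q = Q Un Q\<inverse>"

text \<open>\<open>threshold_cut\<close> holds at every scale; integrated over the logarithm of the
  scale it compares the logarithms of the edge lengths with those of the link lengths. The saving
  \<epsilon> accumulates over all scales up to the longest link, whence the last factor.\<close>

lemma rigid_prod_bound:
 assumes X: "finite X" "X ~= {}" and cs: "prim X cs" "cs ~= []" and r: "rigid (symc Q) X (X Un set cs)"
  and Q: "Q \<subseteq> {(u, v). u < v & u : X Un set cs & v : X Un set cs}"
  and eps: "\<forall>a\<le>length cs. \<forall>b. real a - \<alpha> / 2 * real b < 0 --> real a - \<alpha> / 2 * real b <= - \<epsilon>"
 shows "(\<Prod>(u, v)\<in>Q. real (v - u) powr - \<alpha>) <= (\<Prod>t<length cs. real (lens X cs ! t) powr - 1) * real (Max (set (lens X cs))) powr - \<epsilon>"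
proof -
 let ?L = "%t. real (lens X cs ! t)" and ?n = "length cs"
 let ?M = "Max (set (lens X cs))"
 have ne: "set (lens X cs) ~= {}" using cs(2) by (metis length_lens length_0_conv set_empty)
 have L1: "1 <= ?L t" if "t < ?n" for t
  using lens_pos[OF cs(1) X, of "lens X cs ! t"] that by simp
 have LM: "?L t <= real ?M" if "t < ?n" for t using that by simp
 have M1: "1 <= real ?M" using lens_pos[OF cs(1) X] Max_in[OF _ ne] by fastforce
 have fQ: "finite Q" by (rule finite_subset[OF Q]) (use X in \<open>auto intro: finite_subset[of _ "(X Un set cs) \<times> (X Un set cs)"]\<close>)
 have "(\<Sum>t<?n. ln (?L t)) + \<epsilon> * ln (real ?M) <= \<alpha> * (\<Sum>p\<in>Q. ln (real (snd p - fst p)))"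
 proof (rule layer_cake)
  show "0 <= ln (?L t) & ln (?L t) <= ln (real ?M)" if "t : {..<?n}" for t
  proof -
   have "1 <= ?L t" "?L t <= real ?M" using L1[of t] LM[of t] that by auto
   thus ?thesis by (auto simp del: of_nat_le_iff)
  qed
  show "0 <= ln (real (snd p - fst p))" if "p : Q" for p using that Q by (auto intro!: ln_ge_zero)
  show "0 <= ln (real ?M)" using M1 by simp
  fix s :: real assume s: "0 < s" "s <= ln (real ?M)"
  have es: "1 < exp s" "exp s <= real ?M" using s M1 by (auto simp: ln_ge_iff)
  have "?M : set (lens X cs)" using Max_in[OF _ ne] by simp
  then obtain t0 where "t0 < ?n" "lens X cs ! t0 = ?M" by (metis in_set_conv_nth length_lens)
  hence "\<exists>t<?n. exp s <= ?L t" using es by auto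
  note cut = threshold_cut[OF X cs(1) r eps es(1) this]
  have eqA: "{t. t < ?n & exp s <= ?L t} = {t : {..<?n}. s <= ln (?L t)}"
  proof -
   have "exp s <= ?L t \<longleftrightarrow> s <= ln (?L t)" if "t < ?n" for t using L1[OF that] by (simp add: ln_ge_iff)
   thus ?thesis by auto
  qed
  let ?K = "{p : Q. s <= ln (real (snd p - fst p))}"
  have fK: "finite ?K" using fQ by simp
  have "{(u, v). (u, v) : symc Q & u : X Un set cs & v : X Un set cs & ~ (u : X & v : X) & exp s <= real (ad u v)} \<subseteq> ?K Un ?K\<inverse>"
  proof
   fix p assume p: "p : {(u, v). (u, v) : symc Q & u : X Un set cs & v : X Un set cs & ~ (u : X & v : X) & exp s <= real (ad u v)}"
   obtain u v where uv: "p = (u, v)" by fastforce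
   have a: "(u, v) : symc Q" "exp s <= real (ad u v)" using p uv by auto
   have key: "(x, y) : ?K" if "(x, y) : Q" "exp s <= real (ad x y)" for x y
   proof -
    have "x < y" using that Q by auto
    hence "s <= ln (real (y - x))" using that(2) by (simp add: ad_less ln_ge_iff)
    thus ?thesis using that(1) by simp
   qed
   show "p : ?K Un ?K\<inverse>"
    using a key[of u v] key[of v u] ad_sym[of u v] unfolding symc_def uv by auto
  qed
  hence "card {(u, v). (u, v) : symc Q & u : X Un set cs & v : X Un set cs & ~ (u : X & v : X) & exp s <= real (ad u v)} <= card (?K Un ?K\<inverse>)"
   using fK by (intro card_mono) auto
  also have "... <= card ?K + card (?K\<inverse>)" by (rule card_Un_le)
  also have "card (?K\<inverse>) = card ?K" by (rule card_inverse)
  finally have "real (card {(u, v). (u, v) : symc Q & u : X Un set cs & v : X Un set cs & ~ (u : X & v : X) & exp s <= real (ad u v)}) <= 2 * real (card ?K)" by simp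
  hence "\<alpha> / 2 * real (card {(u, v). (u, v) : symc Q & u : X Un set cs & v : X Un set cs & ~ (u : X & v : X) & exp s <= real (ad u v)}) <= \<alpha> / 2 * (2 * real (card ?K))"
   using alpha(1) by (intro mult_left_mono) auto
  thus "real (card {t : {..<?n}. s <= ln (?L t)}) + \<epsilon> <= \<alpha> * real (card ?K)"
   using cut unfolding eqA by simp
 qed (use fQ alpha in auto)
 hence le: "- (\<alpha> * (\<Sum>p\<in>Q. ln (real (snd p - fst p)))) <= - (\<Sum>t<?n. ln (?L t)) - \<epsilon> * ln (real ?M)" by simp
 have "(\<Prod>(u, v)\<in>Q. real (v - u) powr - \<alpha>) = (\<Prod>p\<in>Q. exp (- \<alpha> * ln (real (snd p - fst p))))"
  by (rule prod.cong) (use Q in \<open>auto simp: powr_def\<close>)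
 also have "... = exp (\<Sum>p\<in>Q. - \<alpha> * ln (real (snd p - fst p)))" using fQ by (simp add: exp_sum)
 also have "(\<Sum>p\<in>Q. - \<alpha> * ln (real (snd p - fst p))) = - (\<alpha> * (\<Sum>p\<in>Q. ln (real (snd p - fst p))))"
  by (simp add: sum_distrib_left sum_negf)
 also have "exp ... <= exp (- (\<Sum>t<?n. ln (?L t)) - \<epsilon> * ln (real ?M))" using le by simp
 also have "... = exp (\<Sum>t<?n. - ln (?L t)) * exp (- \<epsilon> * ln (real ?M))" by (simp add: exp_diff exp_minus sum_negf field_simps)
 also have "exp (\<Sum>t<?n. - ln (?L t)) = (\<Prod>t<?n. ?L t powr - 1)"
  unfolding exp_sum[OF finite_lessThan] by (rule prod.cong) (use L1 in \<open>force simp: powr_def\<close>)+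
 also have "exp (- \<epsilon> * ln (real ?M)) = real ?M powr - \<epsilon>" using M1 by (simp add: powr_def)
 finally show ?thesis .
qed

end

section \<open>Summing over all positions of a rigid extension\<close>

fun Ls :: "nat => nat set => nat => nat list set" where
 "Ls n X 0 = {[]}"
| "Ls n X (Suc c) = (\<Union>x\<in>{..n} - X. (#) x ` Ls n (insert x X) c)"

lemma finite_Ls: "finite (Ls n X c)"
 by (induction c arbitrary: X) auto

lemma Ls_length: "cs : Ls n X c ==> length cs = c"
 by (induction c arbitrary: X cs) auto

lemma prim_in_Ls: "prim X cs ==> set cs \<subseteq> {..n} ==> cs : Ls n X (length cs)"
 by (induction cs arbitrary: X) auto

lemma summable_powr: "0 < \<delta> ==> summable (%d. real (Suc d) powr - (1 + \<delta>))"
 using summable_real_powr_iff[of "- (1 + \<delta>)"] summable_Suc_iff[of "%n. real n powr - (1 + \<delta>)"] by simp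

definition Zs :: "real => real" where "Zs \<delta> = (\<Sum>d. real (Suc d) powr - (1 + \<delta>))"

lemma inj_sum_le_Zs:
 assumes "0 < \<delta>" "finite A" "inj_on g A"
 shows "(\<Sum>x\<in>A. real (Suc (g x)) powr - (1 + \<delta>)) <= Zs \<delta>"
proof -
 have "(\<Sum>x\<in>A. real (Suc (g x)) powr - (1 + \<delta>)) = (\<Sum>d\<in>g ` A. real (Suc d) powr - (1 + \<delta>))"
  using assms(3) by (simp add: sum.reindex)
 also have "... <= Zs \<delta>" unfolding Zs_def using assms by (intro sum_le_suminf summable_powr) auto
 finally show ?thesis .
qed

lemma Zs_nonneg: "0 < \<delta> ==> 0 <= Zs \<delta>"
 using inj_sum_le_Zs[of \<delta> "{}" id] by simp

lemma ad_sum_le: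
 assumes "0 < \<delta>"
 shows "(\<Sum>x\<in>{..n} - {y}. real (ad x y) powr - (1 + \<delta>)) <= 2 * Zs \<delta>"
proof -
 have "(\<Sum>x\<in>{..n} - {y}. real (ad x y) powr - (1 + \<delta>)) <=
  (\<Sum>x\<in>{x. x <= n & x < y} Un {x. x <= n & y < x}. real (ad x y) powr - (1 + \<delta>))"
  by (rule sum_mono2) auto
 also have "... = (\<Sum>x\<in>{x. x <= n & x < y}. real (ad x y) powr - (1 + \<delta>)) + (\<Sum>x\<in>{x. x <= n & y < x}. real (ad x y) powr - (1 + \<delta>))"
  by (rule sum.union_disjoint) auto
 also have "(\<Sum>x\<in>{x. x <= n & x < y}. real (ad x y) powr - (1 + \<delta>)) = (\<Sum>x\<in>{x. x <= n & x < y}. real (Suc (y - x - 1)) powr - (1 + \<delta>))"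
  by (rule sum.cong) (auto simp: ad_def)
 also have "... <= Zs \<delta>" by (rule inj_sum_le_Zs[OF assms]) (auto simp: inj_on_def)
 also have "(\<Sum>x\<in>{x. x <= n & y < x}. real (ad x y) powr - (1 + \<delta>)) = (\<Sum>x\<in>{x. x <= n & y < x}. real (Suc (x - y - 1)) powr - (1 + \<delta>))"
  by (rule sum.cong) (auto simp: ad_def)
 also have "... <= Zs \<delta>" by (rule inj_sum_le_Zs[OF assms]) (auto simp: inj_on_def)
 finally show ?thesis by simp
qed

lemma nd_sum_le:
 assumes "0 < \<delta>" "finite X" "X ~= {}"
 shows "(\<Sum>x\<in>{..n} - X. real (nd x X) powr - (1 + \<delta>)) <= 2 * real (card X) * Zs \<delta>"
proof -
 have "(\<Sum>x\<in>{..n} - X. real (nd x X) powr - (1 + \<delta>)) <= (\<Sum>x\<in>{..n} - X. \<Sum>y\<in>X. real (ad x y) powr - (1 + \<delta>))"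
 proof (rule sum_mono)
  fix x
  obtain y where y: "y : X" "nd x X = ad x y" using nd_attained[OF assms(2,3)] by blast
  show "real (nd x X) powr - (1 + \<delta>) <= (\<Sum>y\<in>X. real (ad x y) powr - (1 + \<delta>))"
   unfolding y(2) by (rule member_le_sum[OF y(1)]) (use assms in auto)
 qed
 also have "... = (\<Sum>y\<in>X. \<Sum>x\<in>{..n} - X. real (ad x y) powr - (1 + \<delta>))" by (rule sum.swap)
 also have "... <= (\<Sum>y\<in>X. 2 * Zs \<delta>)"
 proof (rule sum_mono)
  fix y assume "y : X"
  hence "(\<Sum>x\<in>{..n} - X. real (ad x y) powr - (1 + \<delta>)) <= (\<Sum>x\<in>{..n} - {y}. real (ad x y) powr - (1 + \<delta>))"
   by (intro sum_mono2) auto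
  thus "(\<Sum>x\<in>{..n} - X. real (ad x y) powr - (1 + \<delta>)) <= 2 * Zs \<delta>" using ad_sum_le[OF assms(1), of y n] by linarith
 qed
 finally show ?thesis by (simp add: mult.assoc mult.left_commute)
qed

text \<open>Each new vertex has at most \<open>2 * B\<close> places at a given distance from a
  vertex collected before, so every step contributes a convergent sum over distances. The exponent
  has to exceed 1; the surplus \<delta> comes from the saving in
  \<open>rigid_prod_bound\<close>.\<close>

lemma list_sum_bound:
 assumes "0 < \<delta>" "finite X" "X ~= {}" "card X + c <= B"
 shows "(\<Sum>cs\<in>Ls n X c. \<Prod>x\<leftarrow>lens X cs. real x powr - (1 + \<delta>)) <= (2 * real B * Zs \<delta>) ^ c"
 using assms(2-4)
proof (induction c arbitrary: X)
 case 0
 thus ?case by simp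
next
 case (Suc c)
 have "(\<Sum>cs\<in>Ls n X (Suc c). \<Prod>x\<leftarrow>lens X cs. real x powr - (1 + \<delta>)) =
  (\<Sum>x\<in>{..n} - X. \<Sum>cs\<in>(#) x ` Ls n (insert x X) c. \<Prod>x\<leftarrow>lens X cs. real x powr - (1 + \<delta>))"
  unfolding Ls.simps by (rule sum.UNION_disjoint) (auto simp: finite_Ls)
 also have "... = (\<Sum>x\<in>{..n} - X. \<Sum>cs\<in>Ls n (insert x X) c. real (nd x X) powr - (1 + \<delta>) * (\<Prod>x\<leftarrow>lens (insert x X) cs. real x powr - (1 + \<delta>)))"
  by (rule sum.cong) (auto simp: sum.reindex)
 also have "... = (\<Sum>x\<in>{..n} - X. real (nd x X) powr - (1 + \<delta>) * (\<Sum>cs\<in>Ls n (insert x X) c. (\<Prod>x\<leftarrow>lens (insert x X) cs. real x powr - (1 + \<delta>))))"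
  by (simp add: sum_distrib_left)
 also have "... <= (\<Sum>x\<in>{..n} - X. real (nd x X) powr - (1 + \<delta>) * (2 * real B * Zs \<delta>) ^ c)"
 proof (intro sum_mono mult_left_mono)
  fix x assume "x : {..n} - X"
  thus "(\<Sum>cs\<in>Ls n (insert x X) c. \<Prod>x\<leftarrow>lens (insert x X) cs. real x powr - (1 + \<delta>)) <= (2 * real B * Zs \<delta>) ^ c"
   using Suc.prems by (intro Suc.IH) auto
 qed simp
 also have "... = (\<Sum>x\<in>{..n} - X. real (nd x X) powr - (1 + \<delta>)) * (2 * real B * Zs \<delta>) ^ c"
  by (simp add: sum_distrib_right)
 also have "... <= (2 * real B * Zs \<delta>) * (2 * real B * Zs \<delta>) ^ c"
 proof (rule mult_right_mono)
  have "2 * real (card X) * Zs \<delta> <= 2 * real B * Zs \<delta>"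
   using Suc.prems(3) Zs_nonneg[OF assms(1)] by (intro mult_right_mono) auto
  thus "(\<Sum>x\<in>{..n} - X. real (nd x X) powr - (1 + \<delta>)) <= 2 * real B * Zs \<delta>"
   using nd_sum_le[OF assms(1) Suc.prems(1,2), of n] by linarith
 qed (use Zs_nonneg[OF assms(1)] in auto)
 finally show ?case by simp
qed

lemma edge_prob_le: "0 < \<alpha> ==> 1 <= d ==> edge_prob \<alpha> d <= real d powr - \<alpha>"
 unfolding edge_prob_def using powr_mono[of "-\<alpha>" 0 2] by auto

lemma edge_prob_bounds: "0 < \<alpha> ==> 0 <= edge_prob \<alpha> d" "0 < \<alpha> ==> edge_prob \<alpha> d <= 1"
proof -
 assume a: "0 < \<alpha>"
 show "0 <= edge_prob \<alpha> d" unfolding edge_prob_def by simp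
 show "edge_prob \<alpha> d <= 1"
 proof (cases "d = 0")
  case True thus ?thesis by (simp add: edge_prob_def)
 next
  case False
  hence "edge_prob \<alpha> d <= real d powr - \<alpha>" using edge_prob_le a by simp
  also have "... <= real d powr 0" using a False by (intro powr_mono) auto
  finally show ?thesis using False by simp
 qed
qed

context irrational_exponent
begin

definition econf :: "nat => nat set => nat set => edges" where
 "econf k X C = {(u, v). u < v & u : X Un C & v : X Un C & ~ (u : X & v : X)}"

text \<open>Rigid extensions by new vertices \<open>C\<close>, with rigidity witnessed by an edge
  set \<open>Q\<close> each of whose edges has a new end. A vertex at distance \<open>k * s0\<close>
  forces a tree link of length at least \<open>s0\<close>, since at most \<open>k\<close> shorter
  links do not reach that far. \<open>s0 = 1\<close> waives the condition on distance.\<close>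

definition rconf :: "nat => nat => nat set => nat => (nat set \<times> edges) set" where
 "rconf n k X s0 = {(C, Q). C \<subseteq> {1..n} & C Int X = {} & C ~= {} & card C <= k & Q \<subseteq> econf k X C &
  rigid (symc Q) X (X Un C) & (s0 = 1 \<or> (\<exists>c\<in>C. k * s0 <= nd c X))}"

lemma finite_econf: "finite X ==> finite C ==> finite (econf k X C)"
 by (rule finite_subset[of _ "(X Un C) \<times> (X Un C)"]) (auto simp: econf_def)

lemma finite_rconf: "finite X ==> finite (rconf n k X s0)"
proof -
 assume X: "finite X"
 have "rconf n k X s0 \<subseteq> Pow {1..n} \<times> Pow ((X Un {1..n}) \<times> (X Un {1..n}))"
  unfolding rconf_def econf_def by blast
 thus ?thesis by (rule finite_subset) (use X in auto)
qed

abbreviation "rsum n k X s0 \<equiv> (\<Sum>(C, Q)\<in>rconf n k X s0. \<Prod>(u, v)\<in>Q. edge_prob \<alpha> (v - u))"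

definition small_sums :: "nat => nat => real => real => bool" where
 "small_sums k b K \<epsilon> \<longleftrightarrow> (\<forall>n X s0. finite X --> X ~= {} --> card X <= b --> 1 <= s0 --> rsum n k X s0 <= K * real s0 powr - \<epsilon>)"

lemma small_sumsD:
 "small_sums k b K \<epsilon> ==> finite X ==> X ~= {} ==> card X <= b ==> 1 <= s0 ==> rsum n k X s0 <= K * real s0 powr - \<epsilon>"
 unfolding small_sums_def by blast

text \<open>Half of the saving in \<open>rigid_prod_bound\<close> gives the decay in
  \<open>s0\<close>; the other half is shared among the at most \<open>k\<close> links to make the
  sums over positions converge. \<epsilon> comes from the gap for at most \<open>k\<close> classes
  and hence precedes the base size \<open>b\<close>; only \<open>K\<close> depends on
  \<open>b\<close>.\<close>

lemma multi_scale:
 assumes k: "1 <= k"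
 shows "\<exists>\<epsilon>>0. \<forall>b. \<exists>K>0. small_sums k b K \<epsilon>"
proof -
 obtain e where e: "e > 0" "\<forall>a\<le>k. \<forall>b. real a - \<alpha> / 2 * real b < 0 --> real a - \<alpha> / 2 * real b <= - e"
  using neg_gap by blast
 define \<delta> where "\<delta> = e / (2 * real k)"
 have \<delta>: "\<delta> > 0" "\<delta> * real k = e / 2" using e(1) k unfolding \<delta>_def by (auto simp: field_simps)
 have main: "\<exists>K>0. small_sums k b K (e / 2)" for b
 proof -
 define A where "A = 2 * real (b + k) * Zs \<delta>"
 \<comment> \<open>\<open>2 ^ q\<close> bounds the number of edge sets on at most
   \<open>b + k\<close> vertices.\<close>
 define q where "q = (b + k) * (b + k)"
 define K where "K = 2 ^ q * (\<Sum>c\<le>k. A ^ c) + 1"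
 have A0: "0 <= A" unfolding A_def using Zs_nonneg[OF \<delta>(1)] by simp
 have K: "K > 0" unfolding K_def using A0 by (intro add_nonneg_pos mult_nonneg_nonneg sum_nonneg) auto
 show ?thesis
 proof (rule exI[of _ K], rule conjI[OF K])
  show "small_sums k b K (e / 2)" unfolding small_sums_def
  proof (intro allI impI)
   fix n s0 :: nat and X :: "nat set" assume X: "finite X" "X ~= {}" "card X <= b" and s0: "1 <= s0"
   define CC where "CC = {C. C \<subseteq> {1..n} & C Int X = {} & C ~= {} & card C <= k}"
   have fCC: "finite CC" unfolding CC_def by (rule finite_subset[of _ "Pow {1..n}"]) auto
   have "\<forall>C. \<exists>cs. C : CC --> set cs = C & distinct cs & prim X cs"
   proof
    fix C
    show "\<exists>cs. C : CC --> set cs = C & distinct cs & prim X cs"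
    proof (cases "C : CC")
     case True
     hence "finite C" "C Int X = {}" unfolding CC_def using finite_subset[of C "{1..n}"] by auto
     thus ?thesis using prim_exists[of C X] by simp
    qed simp
   qed
   then obtain pl where pl0: "\<forall>C. C : CC --> set (pl C) = C & distinct (pl C) & prim X (pl C)" by (rule choice[THEN exE])
   hence pl: "set (pl C) = C" "distinct (pl C)" "prim X (pl C)" "length (pl C) = card C" if "C : CC" for C
    using that distinct_card[of "pl C"] by auto
   define g where "g C = real s0 powr - (e / 2) * (\<Prod>x\<leftarrow>lens X (pl C). real x powr - (1 + \<delta>))" for C
   have one: "(\<Prod>(u, v)\<in>Q. edge_prob \<alpha> (v - u)) <= g C" if CQ: "(C, Q) : rconf n k X s0" for C Q
   proof -
    have C: "C : CC" and Q: "Q \<subseteq> econf k X C" and r: "rigid (symc Q) X (X Un C)" and far: "s0 = 1 \<or> (\<exists>c\<in>C. k * s0 <= nd c X)"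
     using CQ unfolding rconf_def CC_def by auto
    let ?cs = "pl C"
    let ?M = "Max (set (lens X ?cs))"
    have ne: "?cs ~= []" using pl(1)[OF C] C unfolding CC_def by auto
    have nel: "lens X ?cs ~= []" using ne by (metis length_0_conv length_lens)
    have len: "length ?cs <= k" using pl(4)[OF C] C unfolding CC_def by simp
    have L1: "1 <= lens X ?cs ! t" if "t < length ?cs" for t
     using lens_pos[OF pl(3)[OF C] X(1,2), of "lens X ?cs ! t"] that by simp
    have LM: "lens X ?cs ! t <= ?M" if "t < length ?cs" for t using that by simp
    have Min: "?M : set (lens X ?cs)" using nel by simp
    have M1: "1 <= ?M" using lens_pos[OF pl(3)[OF C] X(1,2) Min] .
    have Ms0: "s0 <= ?M"
    proof (rule ccontr)
     assume ns: "~ s0 <= ?M"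
     hence "\<forall>x\<in>set (lens X ?cs). x < s0" by (metis List.finite_set Max_ge le_less_trans not_le)
     hence nd: "nd c X <= length ?cs * (s0 - 1)" if "c : C" for c
      using lens_far[OF X(1,2), of c ?cs s0] pl(1)[OF C] that by simp
     from far show False
     proof
      assume "s0 = 1" thus False using ns M1 by simp
     next
      assume "\<exists>c\<in>C. k * s0 <= nd c X"
      then obtain c where "k * s0 <= length ?cs * (s0 - 1)" using nd le_trans by blast
      also have "... <= k * (s0 - 1)" using len by simp
      also have "... < k * s0" using k s0 by simp
      finally show False by simp
     qed
    qed
    have eps: "\<forall>a\<le>length ?cs. \<forall>b. real a - \<alpha> / 2 * real b < 0 --> real a - \<alpha> / 2 * real b <= - e"
     using e(2) len by auto
    have "(\<Prod>(u, v)\<in>Q. edge_prob \<alpha> (v - u)) <= (\<Prod>(u, v)\<in>Q. real (v - u) powr - \<alpha>)"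
    proof (rule prod_mono)
     fix p assume "p : Q"
     then obtain u v where uv: "p = (u, v)" "u < v" using Q unfolding econf_def by auto
     thus "0 <= (case p of (u, v) => edge_prob \<alpha> (v - u)) &
       (case p of (u, v) => edge_prob \<alpha> (v - u)) <= (case p of (u, v) => real (v - u) powr - \<alpha>)"
      using edge_prob_le[OF alpha(1), of "v - u"] edge_prob_bounds(1)[OF alpha(1), of "v - u"] by simp
    qed
    also have "... <= (\<Prod>t<length ?cs. real (lens X ?cs ! t) powr - 1) * real ?M powr - e"
     by (rule rigid_prod_bound[OF X(1,2) pl(3)[OF C] ne _ _ eps]) (use r Q pl(1)[OF C] in \<open>auto simp: econf_def\<close>)
    also have "real ?M powr - e = real ?M powr - (e / 2) * real ?M powr - (e / 2)"
     by (simp add: powr_add[symmetric])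
    also have "... <= real s0 powr - (e / 2) * (\<Prod>t<length ?cs. real (lens X ?cs ! t) powr - \<delta>)"
    proof (rule mult_mono)
     show "real ?M powr - (e / 2) <= real s0 powr - (e / 2)" using Ms0 s0 e(1) by (intro powr_mono2') auto
     have "real ?M powr - (e / 2) <= real ?M powr (- \<delta> * real (length ?cs))"
     proof (rule powr_mono)
      have "\<delta> * real (length ?cs) <= \<delta> * real k" using len \<delta>(1) by simp
      thus "- (e / 2) <= - \<delta> * real (length ?cs)" using \<delta>(2) by simp
     qed (use M1 in simp)
     also have "... = (real ?M powr - \<delta>) ^ length ?cs" 
      using M1 by (subst powr_realpow[symmetric]) (auto simp: powr_powr)
     also have "... = (\<Prod>t<length ?cs. real ?M powr - \<delta>)" by simp
     also have "... <= (\<Prod>t<length ?cs. real (lens X ?cs ! t) powr - \<delta>)"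
     proof (rule prod_mono)
      fix t assume "t : {..<length ?cs}"
      hence "0 < real (lens X ?cs ! t)" "real (lens X ?cs ! t) <= real ?M" using L1[of t] LM[of t] by auto
      thus "0 <= real ?M powr - \<delta> & real ?M powr - \<delta> <= real (lens X ?cs ! t) powr - \<delta>"
       using \<delta>(1) by (auto intro!: powr_mono2' simp del: of_nat_le_iff)
     qed
     finally show "real ?M powr - (e / 2) <= (\<Prod>t<length ?cs. real (lens X ?cs ! t) powr - \<delta>)" .
    qed auto
    also have "(\<Prod>t<length ?cs. real (lens X ?cs ! t) powr - 1) * (real s0 powr - (e / 2) * (\<Prod>t<length ?cs. real (lens X ?cs ! t) powr - \<delta>)) =
      real s0 powr - (e / 2) * (\<Prod>t<length ?cs. real (lens X ?cs ! t) powr - 1 * real (lens X ?cs ! t) powr - \<delta>)"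
     unfolding prod.distrib by (rule mult.left_commute)
    also have "(\<Prod>t<length ?cs. real (lens X ?cs ! t) powr - 1 * real (lens X ?cs ! t) powr - \<delta>) = (\<Prod>x\<leftarrow>lens X ?cs. real x powr - (1 + \<delta>))"
     unfolding powr_add[symmetric] by (simp add: prod.list_conv_set_nth atLeast0LessThan)
    also
    note calc = calculation
    show ?thesis unfolding g_def by (rule calc) (intro mult_left_mono prod_nonneg, auto)
   qed
   have gn: "0 <= g C" for C unfolding g_def by (intro mult_nonneg_nonneg prod_list_nonneg) auto
   have "rsum n k X s0 <= (\<Sum>(C, Q)\<in>rconf n k X s0. g C)"
    by (rule sum_mono) (use one in auto)
   also have "... <= (\<Sum>(C, Q)\<in>(SIGMA C:CC. Pow (econf k X C)). g C)"
   proof (rule sum_mono2)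
    show "finite (SIGMA C:CC. Pow (econf k X C))"
    proof (rule finite_SigmaI[OF fCC])
     fix C assume "C : CC"
     hence "finite C" unfolding CC_def using finite_subset by auto
     thus "finite (Pow (econf k X C))" using finite_econf[OF X(1)] by simp
    qed
    show "rconf n k X s0 \<subseteq> (SIGMA C:CC. Pow (econf k X C))" unfolding rconf_def CC_def by auto
   qed (use gn in auto)
   also have "... = (\<Sum>C\<in>CC. \<Sum>Q\<in>Pow (econf k X C). g C)"
   proof (rule sum.Sigma[symmetric, OF fCC], intro ballI)
    fix C assume "C : CC"
    hence "finite C" unfolding CC_def using finite_subset by auto
    thus "finite (Pow (econf k X C))" using finite_econf[OF X(1)] by simp
   qed
   also have "... <= (\<Sum>C\<in>CC. 2 ^ q * g C)"
   proof (rule sum_mono)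
    fix C assume C: "C : CC"
    hence fC: "finite C" "card C <= k" unfolding CC_def using finite_subset by auto
    have sub: "econf k X C \<subseteq> (X Un C) \<times> (X Un C)" unfolding econf_def by auto
    have fin: "finite (econf k X C)" by (rule finite_subset[OF sub]) (use X fC in auto)
    have "card (X Un C) <= b + k" using card_Un_le[of X C] X(3) fC(2) by linarith
    hence "card ((X Un C) \<times> (X Un C)) <= q" unfolding q_def card_cartesian_product by (intro mult_le_mono)
    hence "card (econf k X C) <= q" using card_mono[OF _ sub] X fC by fastforce
    hence "(2::real) ^ card (econf k X C) <= 2 ^ q" by (intro power_increasing) auto
    thus "(\<Sum>Q\<in>Pow (econf k X C). g C) <= 2 ^ q * g C"
     using gn[of C] fin by (simp add: card_Pow mult_right_mono)
   qed
   also have "... = 2 ^ q * real s0 powr - (e / 2) * (\<Sum>C\<in>CC. \<Prod>x\<leftarrow>lens X (pl C). real x powr - (1 + \<delta>))"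
    unfolding g_def by (simp add: sum_distrib_left mult.assoc)
   also have "... <= 2 ^ q * real s0 powr - (e / 2) * (\<Sum>c\<le>k. A ^ c)"
   proof (rule mult_left_mono)
    have inj: "inj_on pl CC" using pl(1) by (auto intro!: inj_onI) metis+
    have "(\<Sum>C\<in>CC. \<Prod>x\<leftarrow>lens X (pl C). real x powr - (1 + \<delta>)) = (\<Sum>cs\<in>pl ` CC. \<Prod>x\<leftarrow>lens X cs. real x powr - (1 + \<delta>))"
     using inj by (simp add: sum.reindex)
    also have "... <= (\<Sum>cs\<in>(\<Union>c\<in>{..k}. Ls n X c). \<Prod>x\<leftarrow>lens X cs. real x powr - (1 + \<delta>))"
    proof (rule sum_mono2)
     show "finite (\<Union>c\<in>{..k}. Ls n X c)" using finite_Ls by auto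
     show "pl ` CC \<subseteq> (\<Union>c\<in>{..k}. Ls n X c)"
     proof clarify
      fix C assume C: "C : CC"
      have "pl C : Ls n X (length (pl C))"
       by (rule prim_in_Ls[OF pl(3)[OF C]]) (use pl(1)[OF C] C in \<open>auto simp: CC_def\<close>)
      thus "pl C : (\<Union>c\<in>{..k}. Ls n X c)" using pl(4)[OF C] C unfolding CC_def by auto
     qed
     show "0 <= (\<Prod>x\<leftarrow>lens X cs. real x powr - (1 + \<delta>))" for cs by (intro prod_list_nonneg) auto
    qed
    also have "... = (\<Sum>c\<le>k. \<Sum>cs\<in>Ls n X c. \<Prod>x\<leftarrow>lens X cs. real x powr - (1 + \<delta>))"
     by (rule sum.UNION_disjoint) (use finite_Ls Ls_length in \<open>auto, blast?\<close>)
    also have "... <= (\<Sum>c\<le>k. A ^ c)"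
     unfolding A_def by (intro sum_mono list_sum_bound[OF \<delta>(1) X(1,2)]) (use X(3) in auto)
    finally show "(\<Sum>C\<in>CC. \<Prod>x\<leftarrow>lens X (pl C). real x powr - (1 + \<delta>)) <= (\<Sum>c\<le>k. A ^ c)" .
   qed simp
   also have "... <= K * real s0 powr - (e / 2)" unfolding K_def by (simp add: algebra_simps)
   finally show "rsum n k X s0 <= K * real s0 powr - (e / 2)" .
  qed
 qed
 qed
 show ?thesis by (rule exI[of _ "e / 2"]) (use e(1) main in simp)
qed

end

section \<open>Moment bounds for the random graph\<close>

abbreviation pe :: "real => nat \<times> nat => real" where "pe \<alpha> e \<equiv> edge_prob \<alpha> (snd e - fst e)"

lemma finite_vertex_pairs [simp]: "finite (vertex_pairs n)"
 by (rule finite_subset[of _ "{..n} \<times> {..n}"]) (auto simp: vertex_pairs_def)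

definition dep :: "('a => bool) set => 'a set => bool" where
 "dep A S \<longleftrightarrow> (\<forall>w w'. (\<forall>e\<in>S. w e = w' e) --> (w : A \<longleftrightarrow> w' : A))"

lemma depD: "dep A S ==> (!!e. e : S ==> w e = w' e) ==> w : A \<longleftrightarrow> w' : A"
 unfolding dep_def by simp

lemma depI: "(!!w w'. (!!e. e : S ==> w e = w' e) ==> w : A ==> w' : A) ==> dep A S"
 unfolding dep_def by (metis (mono_tags, lifting))

lemma dep_mono: "dep A S ==> S \<subseteq> S' ==> dep A S'"
 unfolding dep_def by blast

lemma dep_Compl: "dep A S ==> dep (- A) S"
 unfolding dep_def by simp

lemma dep_INT: "(!!i. i : I ==> dep (A i) (S i)) ==> dep (\<Inter>i\<in>I. A i) (\<Union>i\<in>I. S i)"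
proof (rule depI)
 fix w w' assume a: "!!i. i : I ==> dep (A i) (S i)" "!!e. e : (\<Union>i\<in>I. S i) ==> w e = w' e" "w : (\<Inter>i\<in>I. A i)"
 have "w' : A i" if i: "i : I" for i
 proof -
  have "!!e. e : S i ==> w e = w' e" using a(2) i by blast
  thus ?thesis using depD[OF a(1)[OF i], of w w'] a(3) i by blast
 qed
 thus "w' : (\<Inter>i\<in>I. A i)" by blast
qed

lemma dep_all: "Q \<subseteq> S ==> dep {w. \<forall>e\<in>Q. w e} S"
 unfolding dep_def by auto

lemma finite_Pi_bool: "finite A ==> finite (set_pmf (Pi_pmf A False (p :: _ => bool pmf)))"
 by (rule finite_subset[OF set_Pi_pmf_subset'], assumption, rule finite_PiE_dflt) simp_all

lemma Pi_pmf_indep2: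
 assumes "finite E" "S \<subseteq> E" "S' \<subseteq> E" "S Int S' = {}" "dep A S" "dep B S'"
 shows "measure_pmf.prob (Pi_pmf E False p) (A Int B) =
  measure_pmf.prob (Pi_pmf E False p) A * measure_pmf.prob (Pi_pmf E False p) B"
proof -
 let ?F = "Pi_pmf S False p" and ?G = "Pi_pmf (E - S) False p"
 let ?m = "%(f, g) x. if x : S then f x else g x"
 have E: "E = S Un (E - S)" using assms(2) by blast
 have fin: "finite S" "finite (E - S)" using assms(1,2) finite_subset by auto
 have eq: "Pi_pmf E False p = map_pmf ?m (pair_pmf ?F ?G)"
  using Pi_pmf_union[OF fin, of False p] E by auto
 define A' where "A' = {f. (%x. x : S & f x) : A}"
 define B' where "B' = {g. (%x. x ~: S & g x) : B}"
 have a: "?m (f, g) : A \<longleftrightarrow> f : A'" for f g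
  unfolding A'_def mem_Collect_eq by (rule assms(5)[unfolded dep_def, rule_format]) simp
 have b: "?m (f, g) : B \<longleftrightarrow> g : B'" for f g
  unfolding B'_def mem_Collect_eq by (rule assms(6)[unfolded dep_def, rule_format]) (use assms(4) in auto)
 have pre: "?m -` (A Int B) = A' \<times> B'" "?m -` A = A' \<times> UNIV" "?m -` B = UNIV \<times> B'"
  by (rule set_eqI, case_tac x, simp only: vimage_eq Int_iff mem_Sigma_iff a b UNIV_I simp_thms)+
 have cF: "finite (set_pmf ?F)" "finite (set_pmf ?G)"
  using finite_Pi_bool fin by blast+
 have prod: "measure_pmf.prob (pair_pmf ?F ?G) (X \<times> Y) = measure_pmf.prob ?F X * measure_pmf.prob ?G Y" for X Y
 proof -
  have "measure_pmf.prob (pair_pmf ?F ?G) (X \<times> Y) = measure_pmf.prob (pair_pmf ?F ?G) ((X Int set_pmf ?F) \<times> (Y Int set_pmf ?G))"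
   by (intro measure_pmf.finite_measure_eq_AE) (auto simp: AE_measure_pmf_iff)
  also have "... = measure_pmf.prob ?F (X Int set_pmf ?F) * measure_pmf.prob ?G (Y Int set_pmf ?G)"
   by (rule measure_pmf_prob_product) (use cF in \<open>auto intro: countable_finite\<close>)
  finally show ?thesis by (simp add: measure_Int_set_pmf)
 qed
 show ?thesis unfolding eq measure_map_pmf pre prod by simp
qed

lemma Pi_pmf_indep:
 assumes "finite E" "finite I" "!!i. i : I ==> S i \<subseteq> E" "!!i j. i : I ==> j : I ==> i ~= j ==> S i Int S j = {}"
  "!!i. i : I ==> dep (A i) (S i)"
 shows "measure_pmf.prob (Pi_pmf E False p) (\<Inter>i\<in>I. A i) = (\<Prod>i\<in>I. measure_pmf.prob (Pi_pmf E False p) (A i))"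
 using assms(2-)
proof (induction I rule: finite_induct)
 case empty
 thus ?case by simp
next
 case (insert i I)
 have "measure_pmf.prob (Pi_pmf E False p) (A i Int (\<Inter>i\<in>I. A i)) =
  measure_pmf.prob (Pi_pmf E False p) (A i) * measure_pmf.prob (Pi_pmf E False p) (\<Inter>i\<in>I. A i)"
 proof (rule Pi_pmf_indep2[OF assms(1)])
  show "S i \<subseteq> E" "(\<Union>j\<in>I. S j) \<subseteq> E" using insert.prems(1) by auto
  have "S i Int S j = {}" if "j : I" for j using insert.prems(2)[of i j] insert.hyps(2) that by auto
  thus "S i Int (\<Union>j\<in>I. S j) = {}" by auto
  show "dep (A i) (S i)" using insert.prems(3) by simp
  show "dep (\<Inter>i\<in>I. A i) (\<Union>j\<in>I. S j)" using insert.prems(3) by (intro dep_INT) simp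
 qed
 thus ?case using insert by simp
qed

context irrational_exponent
begin

abbreviation "EI \<equiv> edge_indicators \<alpha>"
abbreviation Pr :: "nat => (nat \<times> nat => bool) set => real" where "Pr n A \<equiv> measure_pmf.prob (EI n) A"

lemma pe_bounds: "0 <= pe \<alpha> e" "pe \<alpha> e <= 1"
 using edge_prob_bounds[OF alpha(1)] by auto

lemma finite_EI: "finite (set_pmf (EI n))"
 unfolding edge_indicators_def
 by (rule finite_Pi_bool) simp

lemma integrable_EI [simp]: "integrable (measure_pmf (EI n)) (f :: _ => real)"
 by (rule integrable_measure_pmf_finite[OF finite_EI])

lemma prob_edges:
 assumes "Q \<subseteq> vertex_pairs n"
 shows "Pr n {w. \<forall>e\<in>Q. w e} = (\<Prod>e\<in>Q. pe \<alpha> e)"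
proof -
 let ?p = "%(i, j). bernoulli_pmf (edge_prob \<alpha> (j - i))"
 have "{w. \<forall>e\<in>Q. w e} = Pi (vertex_pairs n) (%e. if e : Q then {True} else UNIV)"
  using assms by (auto simp: Pi_def)
 hence "Pr n {w. \<forall>e\<in>Q. w e} = (\<Prod>e\<in>vertex_pairs n. measure_pmf.prob (?p e) (if e : Q then {True} else UNIV))"
  unfolding edge_indicators_def by (simp add: measure_Pi_pmf_Pi)
 also have "... = (\<Prod>e\<in>vertex_pairs n. if e : Q then pe \<alpha> e else 1)"
  by (rule prod.cong) (auto simp: measure_pmf_single edge_prob_bounds[OF alpha(1)])
 also have "... = (\<Prod>e\<in>Q. pe \<alpha> e)" using assms by (simp add: prod.If_cases Int_absorb1 Int_def[symmetric])
 finally show ?thesis .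
qed

lemma prob_indep2:
 assumes "S \<subseteq> vertex_pairs n" "S' \<subseteq> vertex_pairs n" "S Int S' = {}" "dep A S" "dep B S'"
 shows "Pr n (A Int B) = Pr n A * Pr n B"
 unfolding edge_indicators_def by (rule Pi_pmf_indep2[OF _ assms]) simp

lemma prob_indep:
 assumes "finite I" "!!i. i : I ==> S i \<subseteq> vertex_pairs n" "!!i j. i : I ==> j : I ==> i ~= j ==> S i Int S j = {}"
  "!!i. i : I ==> dep (A i) (S i)"
 shows "Pr n (\<Inter>i\<in>I. A i) = (\<Prod>i\<in>I. Pr n (A i))"
 unfolding edge_indicators_def by (rule Pi_pmf_indep[OF _ assms]) simp

text \<open>The bound \<open>\<Lambda>\<close> controls the expected number of configurations even after all pairs
 inside an arbitrary small vertex set \<open>F\<close> have been revealed as edges.\<close>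

lemma moment_bound:
 fixes es :: "'h => edges" and vs :: "'h => nat set"
 assumes H: "finite H" "!!x. x : H ==> es x \<subseteq> vertex_pairs n" "!!x. x : H ==> es x \<subseteq> vs x \<times> vs x"
   "!!x. x : H ==> finite (vs x) & card (vs x) <= v"
  and \<Lambda>: "0 <= \<Lambda>" "!!F. finite F ==> card F <= p * v ==> (\<Sum>x\<in>H. \<Prod>e\<in>es x - F \<times> F. pe \<alpha> e) <= \<Lambda>"
  and t: "0 < t"
 shows "Pr n {w. t <= real (card {x : H. \<forall>e\<in>es x. w e})} <= (\<Lambda> / t) ^ p"
proof -
 let ?E = "measure_pmf.expectation (EI n)"
 define X where "X w = real (card {x : H. \<forall>e\<in>es x. w e})" for w
 have Xsum: "X w = (\<Sum>x\<in>H. indicator {w. \<forall>e\<in>es x. w e} w)" for w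
  unfolding X_def indicator_def using H(1) by (simp add: sum.If_cases Int_def)
 have X0: "0 <= X w" for w unfolding X_def by simp
 \<comment> \<open>Induction on the power: one factor of \<open>X\<close> is expanded into its
   configurations, whose edges join the set \<open>E0\<close> already revealed. The indicator under
   the expectation carries this conditioning, and \<open>F\<close> grows by at most \<open>v\<close>
   vertices each time, hence to at most \<open>p * v\<close> in all.\<close>
 have main: "?E (%w. X w ^ q * indicator {w. \<forall>e\<in>E0. w e} w) <= \<Lambda> ^ q * Pr n {w. \<forall>e\<in>E0. w e}"
  if "E0 \<subseteq> vertex_pairs n" "E0 \<subseteq> F \<times> F" "finite F" "card F + q * v <= p * v" for q E0 F
  using that
 proof (induction q arbitrary: E0 F)
  case 0
  thus ?case by simp
 next
  case (Suc q)
  have "?E (%w. X w ^ Suc q * indicator {w. \<forall>e\<in>E0. w e} w) =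
   ?E (%w. \<Sum>x\<in>H. X w ^ q * indicator {w. \<forall>e\<in>E0 Un es x. w e} w)"
  proof (rule Bochner_Integration.integral_cong[OF refl])
   fix w
   have "X w ^ Suc q * indicator {w. \<forall>e\<in>E0. w e} w = X w ^ q * (\<Sum>x\<in>H. indicator {w. \<forall>e\<in>es x. w e} w) * indicator {w. \<forall>e\<in>E0. w e} w"
    using Xsum[of w] by simp
   also have "... = (\<Sum>x\<in>H. X w ^ q * indicator {w. \<forall>e\<in>E0 Un es x. w e} w)"
    unfolding sum_distrib_left sum_distrib_right by (rule sum.cong) (auto simp: indicator_def)
   finally show "X w ^ Suc q * indicator {w. \<forall>e\<in>E0. w e} w = (\<Sum>x\<in>H. X w ^ q * indicator {w. \<forall>e\<in>E0 Un es x. w e} w)" .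
  qed
  also have "... = (\<Sum>x\<in>H. ?E (%w. X w ^ q * indicator {w. \<forall>e\<in>E0 Un es x. w e} w))" by simp
  also have "... <= (\<Sum>x\<in>H. \<Lambda> ^ q * Pr n {w. \<forall>e\<in>E0 Un es x. w e})"
  proof (rule sum_mono)
   fix x assume x: "x : H"
   have c: "card (F Un vs x) <= card F + v" using H(4)[OF x] card_Un_le[of F "vs x"] by linarith
   show "?E (%w. X w ^ q * indicator {w. \<forall>e\<in>E0 Un es x. w e} w) <= \<Lambda> ^ q * Pr n {w. \<forall>e\<in>E0 Un es x. w e}"
    by (rule Suc.IH[of _ "F Un vs x"]) (use Suc.prems H(2,3,4)[OF x] c in auto)
  qed
  also have "... <= (\<Sum>x\<in>H. \<Lambda> ^ q * (Pr n {w. \<forall>e\<in>E0. w e} * (\<Prod>e\<in>es x - F \<times> F. pe \<alpha> e)))"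
  proof (intro sum_mono mult_left_mono)
   fix x assume x: "x : H"
   have f: "finite E0" "finite (es x)" using Suc.prems(1) H(2)[OF x] finite_subset[OF _ finite_vertex_pairs] by auto
   have "Pr n {w. \<forall>e\<in>E0 Un es x. w e} = (\<Prod>e\<in>E0 Un (es x - E0). pe \<alpha> e)"
    using prob_edges[of "E0 Un es x" n] Suc.prems(1) H(2)[OF x] by (simp add: Un_Diff_cancel)
   also have "... = (\<Prod>e\<in>E0. pe \<alpha> e) * (\<Prod>e\<in>es x - E0. pe \<alpha> e)" using f by (intro prod.union_disjoint) auto
   also have "... <= (\<Prod>e\<in>E0. pe \<alpha> e) * (\<Prod>e\<in>es x - F \<times> F. pe \<alpha> e)"
   proof (rule mult_left_mono)
    have "(\<Prod>e\<in>es x - E0. pe \<alpha> e) = (\<Prod>e\<in>es x - F \<times> F. pe \<alpha> e) * (\<Prod>e\<in>(es x - E0) - (es x - F \<times> F). pe \<alpha> e)"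
     using f Suc.prems(2) by (subst prod.subset_diff[of "es x - F \<times> F"]) (auto simp: mult.commute)
    also have "... <= (\<Prod>e\<in>es x - F \<times> F. pe \<alpha> e) * 1"
     using pe_bounds by (intro mult_left_mono prod_le_1 prod_nonneg) auto
    finally show "(\<Prod>e\<in>es x - E0. pe \<alpha> e) <= (\<Prod>e\<in>es x - F \<times> F. pe \<alpha> e)" by simp
   qed (use pe_bounds in \<open>auto intro: prod_nonneg\<close>)
   finally show "Pr n {w. \<forall>e\<in>E0 Un es x. w e} <= Pr n {w. \<forall>e\<in>E0. w e} * (\<Prod>e\<in>es x - F \<times> F. pe \<alpha> e)"
    using prob_edges[OF Suc.prems(1)] by simp
  qed (use \<Lambda>(1) in simp)
  also have "... = \<Lambda> ^ q * Pr n {w. \<forall>e\<in>E0. w e} * (\<Sum>x\<in>H. \<Prod>e\<in>es x - F \<times> F. pe \<alpha> e)"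
   by (simp add: sum_distrib_left mult.assoc)
  also have "... <= \<Lambda> ^ q * Pr n {w. \<forall>e\<in>E0. w e} * \<Lambda>"
   using Suc.prems(3,4) \<Lambda>(1) by (intro mult_left_mono \<Lambda>(2)) auto
  finally show ?case by (simp add: mult_ac)
 qed
 have "?E (%w. X w ^ p) <= \<Lambda> ^ p" using main[of "{}" "{}" p] by simp
 moreover have "t ^ p * Pr n {w. t <= X w} <= ?E (%w. X w ^ p)"
 proof -
  have "t ^ p * Pr n {w. t <= X w} = ?E (%w. t ^ p * indicator {w. t <= X w} w)" by simp
  also have "... <= ?E (%w. X w ^ p)"
   by (rule integral_mono) (use t X0 in \<open>auto simp: indicator_def intro: power_mono\<close>)
  finally show ?thesis .
 qed
 ultimately have "t ^ p * Pr n {w. t <= X w} <= \<Lambda> ^ p" by simp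
 hence "Pr n {w. t <= X w} <= \<Lambda> ^ p / t ^ p" using t by (simp add: field_simps)
 thus ?thesis unfolding X_def by (simp add: power_divide)
qed

text \<open>A Paley-Zygmund bound from a pointwise inequality: where \<open>X w\<close> is at least
  \<open>\<mu> / 2\<close>, it is at most \<open>X w ^ 2 / (2 * s) + s / 2\<close>. With
  \<open>s = 2 * c * \<mu>\<close> the square term costs a quarter of \<mu>, which leaves another
  quarter for the probability.\<close>

lemma second_moment:
 fixes X :: "(nat \<times> nat => bool) => real"
 assumes "!!w. 0 <= X w" "0 < \<mu>" "\<mu> <= measure_pmf.expectation (EI n) X"
  "measure_pmf.expectation (EI n) (%w. X w ^ 2) <= c * \<mu> ^ 2" "0 < c"
 shows "1 / (4 * c) <= Pr n {w. \<mu> / 2 <= X w}"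
proof -
 let ?E = "measure_pmf.expectation (EI n)"
 define s where "s = 2 * c * \<mu>"
 have s: "0 < s" using assms unfolding s_def by simp
 have pw: "X w <= \<mu> / 2 + X w ^ 2 / (2 * s) + s / 2 * indicator {w. \<mu> / 2 <= X w} w" for w
 proof (cases "\<mu> / 2 <= X w")
  case True
  have "0 <= (X w - s) ^ 2" by simp
  hence "X w * (2 * s) <= X w ^ 2 + s ^ 2" by (simp add: power2_eq_square algebra_simps)
  hence "X w <= (X w ^ 2 + s ^ 2) / (2 * s)" using s by (simp add: field_simps)
  also have "... = X w ^ 2 / (2 * s) + s / 2" using s by (simp add: field_simps power2_eq_square)
  finally show ?thesis using True assms(2) by simp
 next
  case False
  have "0 <= X w ^ 2 / (2 * s)" using s by simp
  thus ?thesis using False by simp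
 qed
 have "\<mu> <= ?E (%w. \<mu> / 2 + X w ^ 2 / (2 * s) + s / 2 * indicator {w. \<mu> / 2 <= X w} w)"
  by (rule order_trans[OF assms(3) integral_mono[OF integrable_EI integrable_EI]]) (rule pw)
 also have "... = \<mu> / 2 + ?E (%w. X w ^ 2) / (2 * s) + s / 2 * Pr n {w. \<mu> / 2 <= X w}" by simp
 also have "... <= \<mu> / 2 + c * \<mu> ^ 2 / (2 * s) + s / 2 * Pr n {w. \<mu> / 2 <= X w}"
  using assms(4) s by (simp add: divide_right_mono)
 also have "c * \<mu> ^ 2 / (2 * s) = \<mu> / 4" using assms(2,5) unfolding s_def by (simp add: power2_eq_square field_simps)
 finally have "\<mu> / 4 <= c * \<mu> * Pr n {w. \<mu> / 2 <= X w}" unfolding s_def by simp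
 thus ?thesis using assms(2,5) by (simp add: field_simps)
qed

end

section \<open>Realising patterns\<close>

text \<open>The \<open>k + 1\<close> annuli of width \<rho> around \<open>x\<close> are disjoint and
  \<open>C\<close> has at most \<open>k\<close> points. The empty annulus serves as a moat between
  the part of \<open>C\<close> near a copy and the rest.\<close>

lemma ad_pigeonhole:
 assumes "finite C" "card C <= k"
 shows "\<exists>j\<in>{1..k + 1}. \<forall>z\<in>C. ~ (j * \<rho> < ad z x & ad z x <= (j + 1) * \<rho>)"
proof (rule ccontr)
 assume "~ ?thesis"
 hence "\<forall>j\<in>{1..k + 1}. \<exists>z. z : C & j * \<rho> < ad z x & ad z x <= (j + 1) * \<rho>" by blast
 then obtain f where f: "\<forall>j\<in>{1..k + 1}. f j : C & j * \<rho> < ad (f j) x & ad (f j) x <= (j + 1) * \<rho>" by (rule bchoice[THEN exE])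
 have "inj_on f {1..k + 1}"
 proof (rule linorder_inj_onI')
  fix i j assume ij: "i : {1..k + 1}" "j : {1..k + 1}" "i < j"
  have "(i + 1) * \<rho> <= j * \<rho>" using ij(3) by (intro mult_le_mono1) simp
  hence "ad (f i) x < ad (f j) x" using bspec[OF f ij(1)] bspec[OF f ij(2)] by linarith
  thus "f i ~= f j" by auto
 qed
 moreover have "f ` {1..k + 1} \<subseteq> C" using f by blast
 ultimately have "card {1..k + 1} <= card C" using card_inj_on_le assms(1) by blast
 thus False using assms(2) by simp
qed

context irrational_exponent
begin

text \<open>Labels vanish on \<open>X\<close>, so edges inside \<open>X\<close> never cross.\<close>

lemma rigid_edges_cong:
 assumes "rigid R X V" "!!u v. u : V ==> v : V ==> ~ (u : X & v : X) ==> (u, v) : R \<longleftrightarrow> (u, v) : R'"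
 shows "rigid R' X V"
proof (rule rigidI)
 note V = rigidD[OF assms(1)]
 show "finite V" "X \<subseteq> V" using V by auto
 fix l assume l: "compat V l" "!!x. x : X ==> l x = 0" "\<exists>v\<in>V. l v ~= 0"
 have "cross R' V l = cross R V l" unfolding cross_def using assms(2) l(2) by (auto, metis+)
 thus "wt R' V l < 0" using V(3)[OF l] unfolding wt_def by simp
qed

text \<open>A labelling of \<open>D Un Z\<close> vanishing on \<open>D\<close>, continued by 0,
  keeps its classes and crossing edges, since \<open>Z\<close> touches nothing outside
  \<open>D Un Z\<close>.\<close>

lemma rigid_part:
 assumes r: "rigid R W (W Un C)" and D: "D \<subseteq> W" and Z: "Z \<subseteq> C"
  and e: "!!z w. z : Z ==> w : (W Un C) - (D Un Z) ==> (z, w) ~: R & (w, z) ~: R & w ~= Suc z & z ~= Suc w"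
  and dis: "C Int W = {}"
 shows "rigid R D (D Un Z)"
proof (rule rigidI)
 note f = rigidD[OF r]
 show "finite (D Un Z)" "D \<subseteq> D Un Z" using f(1) D Z finite_subset[of "D Un Z" "W Un C"] by auto
 fix l assume l: "compat (D Un Z) l" "!!x. x : D ==> l x = 0" "\<exists>v\<in>D Un Z. l v ~= 0"
 let ?l = "%u. if u : Z then l u else 0"
 have c: "compat (W Un C) ?l" unfolding compat_def
 proof (intro ballI impI)
  fix u assume u: "u : W Un C" "Suc u : W Un C"
  show "?l u = ?l (Suc u)"
  proof (cases "u : Z \<or> Suc u : Z")
   case True
   hence "u : D Un Z" "Suc u : D Un Z" using e[of u "Suc u"] e[of "Suc u" u] u by blast+
   moreover from this have "l u = l (Suc u)" using l(1) unfolding compat_def by blast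
   ultimately show ?thesis using l(2) by auto
  qed simp
 qed
 have z: "?l x = 0" if "x : W" for x using that Z dis by auto
 have nz: "\<exists>v\<in>W Un C. ?l v ~= 0" using l(2,3) Z by auto
 have neg: "wt R (W Un C) ?l < 0" by (rule f(3)[OF c z nz])
 have "cross R (W Un C) ?l = cross R (D Un Z) l"
 proof
  show "cross R (W Un C) ?l \<subseteq> cross R (D Un Z) l"
  proof clarify
   fix u v assume "(u, v) : cross R (W Un C) ?l"
   hence uv: "(u, v) : R" "u : W Un C" "v : W Un C" "?l u ~= ?l v" unfolding cross_def by auto
   hence "u : Z \<or> v : Z" by (auto split: if_splits)
   hence "u : D Un Z" "v : D Un Z" using e[of u v] e[of v u] uv by blast+
   thus "(u, v) : cross R (D Un Z) l" using uv l(2) unfolding cross_def by (auto split: if_splits)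
  qed
  show "cross R (D Un Z) l \<subseteq> cross R (W Un C) ?l"
  proof clarify
   fix u v assume "(u, v) : cross R (D Un Z) l"
   hence uv: "(u, v) : R" "u : D Un Z" "v : D Un Z" "l u ~= l v" unfolding cross_def by auto
   have "?l u = l u" "?l v = l v" using uv(2,3) l(2) by auto
   thus "(u, v) : cross R (W Un C) ?l" using uv D Z unfolding cross_def by auto
  qed
 qed
 moreover have "classes (W Un C) ?l = classes (D Un Z) l"
  unfolding classes_def using l(2) Z by (auto split: if_splits)
 ultimately show "wt R (D Un Z) l < 0" using neg unfolding wt_def by simp
qed

definition Wv :: "nat set => (nat => nat set) => (nat => nat) => nat set" where
 "Wv Cs T y = (\<Union>c\<in>insert 0 Cs. vset y T c)"

definition des :: "((nat \<times> nat) \<times> nat \<times> nat) set => (nat => nat) => edges" where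
 "des J y = {(u, v). u < v & (\<exists>c t d s. ((c, t), (d, s)) : J & u = y c + t & v = y d + s)}"

text \<open>What can spoil a placement: a rigid extension with its edges, none of them intended, at
  least one of which jumps across an annulus around a copy. \<open>C\<close> may be empty, which
  covers an unintended edge between two parts.\<close>

definition bad :: "nat => nat => nat => nat set => (nat => nat set) => ((nat \<times> nat) \<times> nat \<times> nat) set => (nat => nat) =>
  (nat set \<times> edges) set" where
 "bad k n \<rho> Cs T J y = {(C, Q). C \<subseteq> {1..n} & C Int Wv Cs T y = {} & card C <= k &
  Q \<subseteq> {(u, v). u < v & u : Wv Cs T y Un C & v : Wv Cs T y Un C} - des J y &
  rigid (symc Q) (Wv Cs T y) (Wv Cs T y Un C) &
  (\<exists>c\<in>Cs. \<exists>j\<in>{1..k + 1}. \<exists>a b. (a, b) : symc Q & ad a (y c) <= j * \<rho> & (j + 1) * \<rho> < ad b (y c))}"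

text \<open>Conditions on the window of radius \<open>r\<close> around \<open>x\<close> alone, so
  that disjoint windows are independent: the ball of radius \<open>b0\<close> contains the edges of
  the copy and no others, and small rigid extensions within the window stay in that ball.\<close>

definition wgood :: "nat => nat => nat => nat set => edges => nat => edges => bool" where
 "wgood k r b0 Tc Gc x R \<longleftrightarrow>
  (\<forall>a b. ad a x <= b0 --> ad b x <= b0 --> ((a, b) : R \<longleftrightarrow> (\<exists>t s. a = x + t & b = x + s & (t, s) : Gc))) &
  (\<forall>Z. (\<forall>z\<in>Z. ad z x <= r) --> Z Int (%t. x + t) ` Tc = {} --> card Z <= k --> rigid R ((%t. x + t) ` Tc) ((%t. x + t) ` Tc Un Z) -->
    (\<forall>z\<in>Z. ad z x <= b0))"

text \<open>For a rigid \<open>C\<close>, an empty annulus around each copy separates the near part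
  \<open>Zc c\<close>; no edge crosses it, for such an edge would make a bad configuration. The near
  part is then rigid over its copy alone, so it stays in the ball of radius \<open>b0\<close>, where
  all edges belong to the copy. The union of the near parts is the \<open>Z\<close> demanded by
  \<open>realizes\<close>.\<close>

lemma realizes_if_good:
 assumes pat: "pat_ok N k n Cs T G J" and symR: "sym R"
  and y0: "y 0 = 0"
  and g1: "!!c. c : Cs ==> r < y c & y c + r <= n"
  and g2: "!!c d. c : Cs ==> d : Cs ==> c ~= d ==> 3 * r < ad (y c) (y d)"
  and g3: "!!c v. c : Cs ==> v : T 0 ==> 3 * r < ad v (y c)"
  and par: "N + k + 2 <= \<rho>" "(k + 3) * \<rho> <= r" "N <= b0"
  and wg: "!!c. c : Cs ==> wgood k r b0 (T c) (G c) (y c) R"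
  and desR: "des J y \<subseteq> R"
  and nb: "!!C Q. (C, Q) : bad k n \<rho> Cs T J y ==> ~ Q \<subseteq> R"
 shows "realizes k n R Cs T G J y"
proof -
 let ?I = "insert 0 Cs"
 define W where "W = Wv Cs T y"
 define DD where "DD = (\<Union>c\<in>Cs. vset y T c)"
 have pp: "Cs \<subseteq> {1..N}" "T 0 \<subseteq> {1..n}"
  "!!c. c : Cs ==> T c \<subseteq> {1..N}" "!!c. c : Cs ==> G c \<subseteq> T c \<times> T c"
  "J \<subseteq> {((c, t), (d, s)). c : insert 0 Cs & d : insert 0 Cs & c ~= d & t : T c & s : T d}" "sym J"
  using pat unfolding pat_ok_def by auto
 have rr: "\<rho> <= r" "3 * \<rho> <= r"
 proof -
  have "3 * \<rho> <= (k + 3) * \<rho>" by simp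
  thus "3 * \<rho> <= r" using par(2) by linarith
  thus "\<rho> <= r" by linarith
 qed
 have fC: "finite Cs" using pp(1) finite_subset by auto
 have D0: "vset y T 0 = T 0" unfolding vset_def y0 by simp
 have W: "W = T 0 Un DD" unfolding W_def Wv_def DD_def using D0 by simp
 have fT0: "finite (T 0)" using pp(2) finite_subset by auto
 have fDc: "finite (vset y T c)" if "c : Cs" for c
  unfolding vset_def using pp(3)[OF that] finite_subset by auto
 have fW: "finite W" unfolding W DD_def using fC fDc fT0 by auto
 have inD: "ad u (y c) <= N" "y c < u" if "c : Cs" "u : vset y T c" for c u
 proof -
  obtain t where t: "t : T c" "u = y c + t" using \<open>u : vset y T c\<close> unfolding vset_def by blast
  hence "1 <= t" "t <= N" using pp(3)[OF \<open>c : Cs\<close>] by auto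
  thus "ad u (y c) <= N" "y c < u" using t unfolding ad_def by auto
 qed
 have outD: "2 * r < ad u (y c)" if "c : Cs" "d : ?I" "c ~= d" "u : vset y T d" for c d u
 proof (cases "d = 0")
  case True
  thus ?thesis using g3[of c u] that D0 by auto
 next
  case False
  hence "d : Cs" using that by simp
  hence "3 * r < ad (y c) (y d)" "ad u (y d) <= N" using g2[of c d] inD(1)[of d u] that by auto
  moreover have "ad (y c) (y d) <= ad u (y c) + ad u (y d)" using ad_tri[of "y c" "y d" u] by (simp add: ad_sym)
  ultimately show ?thesis using par(1) rr by linarith
 qed
 have far: "u + k + 1 < v \<or> v + k + 1 < u" if cd: "c : ?I" "d : ?I" "c ~= d" "u : vset y T c" "v : vset y T d" for c d u v
 proof -
  have "k + 1 < ad u v" if "c : Cs" "d : ?I" "c ~= d" "u : vset y T c" "v : vset y T d" for c d u v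
  proof -
   have "2 * r < ad v (y c)" "ad u (y c) <= N" using outD[of c d v] inD(1)[of c u] that by auto
   moreover have "ad v (y c) <= ad u v + ad u (y c)" using ad_tri[of v "y c" u] by (simp add: ad_sym)
   ultimately show ?thesis using par(1) rr by linarith
  qed
  from this[of c d u v] this[of d c v u] have "k + 1 < ad u v"
   using cd ad_sym[of u v] by (cases "c = 0") auto
  thus ?thesis unfolding ad_def by auto
 qed
 have uniq: "c = c' & t = t'" if "c : ?I" "c' : ?I" "t : T c" "t' : T c'" "y c + t = y c' + t'" for c c' t t'
 proof (cases "c = c'")
  case False
  have "y c + t : vset y T c" "y c' + t' : vset y T c'" using that unfolding vset_def by blast+
  thus ?thesis using far[of c c' "y c + t" "y c' + t'"] that False by simp
 qed (use that in simp)
 have symmem: "(v, u) : R" if "(u, v) : R" for u v using that symR unfolding sym_def by blast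
 have wg1: "(a, b) : R \<longleftrightarrow> (\<exists>t s. a = y c + t & b = y c + s & (t, s) : G c)" if "c : Cs" "ad a (y c) <= b0" "ad b (y c) <= b0" for a b c
  using wg[OF that(1)] that(2,3) unfolding wgood_def by blast
 \<comment> \<open>A single unintended edge near a copy is a bad configuration with \<open>C\<close>
   empty.\<close>
 have one_edge: False if e: "(a, b) : R" "a : W" "b : W" "a ~= b" "(a, b) ~: des J y" "(b, a) ~: des J y"
   "c : Cs" "ad a (y c) <= \<rho>" "2 * \<rho> < ad b (y c)" for a b c
 proof -
  define Q where "Q = {(min a b, max a b)}"
  have QR: "Q \<subseteq> R" "symc Q = {(a, b), (b, a)}" using e(1) symmem unfolding Q_def symc_def by (auto simp: min_def max_def)
  have "rigid (symc Q) W (W Un {})" using rigid_refl[OF fW] by simp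
  moreover have "Q \<subseteq> {(u, v). u < v & u : W Un {} & v : W Un {}} - des J y"
   using e unfolding Q_def by (auto simp: min_def max_def)
  moreover have "\<exists>c\<in>Cs. \<exists>j\<in>{1..k + 1}. \<exists>a b. (a, b) : symc Q & ad a (y c) <= j * \<rho> & (j + 1) * \<rho> < ad b (y c)"
   using e unfolding QR(2) by (intro bexI[of _ c] bexI[of _ 1] exI[of _ a] exI[of _ b]) auto
  ultimately have "({}, Q) : bad k n \<rho> Cs T J y" unfolding bad_def W_def by auto
  thus False using nb QR by blast
 qed
 have J_R: "(y c + t, y d + s) : R" if "((c, t), (d, s)) : J" for c t d s
 proof -
  have m: "c : ?I" "d : ?I" "c ~= d" "t : T c" "s : T d" using pp(5) that by auto
  have "y c + t ~= y d + s" using uniq[of c d t s] m by blast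
  moreover have "((d, s), (c, t)) : J" using pp(6) that unfolding sym_def by blast
  ultimately have "(y c + t, y d + s) : des J y \<or> (y d + s, y c + t) : des J y"
   using that unfolding des_def by (cases "y c + t < y d + s") auto
  thus ?thesis using desR symmem by blast
 qed
 have R_J: "((c, t), (d, s)) : J" if m: "c : ?I" "d : ?I" "c ~= d" "t : T c" "s : T d" and e: "(y c + t, y d + s) : R" for c t d s
 proof (rule ccontr)
  assume nJ: "((c, t), (d, s)) ~: J"
  let ?a = "y c + t" and ?b = "y d + s"
  have ab: "?a : vset y T c" "?b : vset y T d" using m unfolding vset_def by auto
  have abW: "?a : W" "?b : W" using ab m unfolding W_def Wv_def by blast+
  have ne: "?a ~= ?b" using uniq[of c d t s] m by blast
  have nd: "(?a, ?b) ~: des J y" "(?b, ?a) ~: des J y"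
  proof -
   have "((c, t), (d, s)) : J" if "((c', t'), (d', s')) : J" "?a = y c' + t'" "?b = y d' + s'" for c' t' d' s'
   proof -
    have "c' : ?I" "d' : ?I" "t' : T c'" "s' : T d'" using pp(5) that(1) by auto
    thus ?thesis using uniq[of c c' t t'] uniq[of d d' s s'] m that by simp
   qed
   hence no: "\<nexists>c' t' d' s'. ((c', t'), (d', s')) : J & ?a = y c' + t' & ?b = y d' + s'" using nJ by blast
   thus "(?a, ?b) ~: des J y" unfolding des_def by auto
   show "(?b, ?a) ~: des J y"
   proof
    assume "(?b, ?a) : des J y"
    then obtain c' t' d' s' where "((d', s'), (c', t')) : J" "?b = y d' + s'" "?a = y c' + t'" unfolding des_def by auto
    moreover from this have "((c', t'), (d', s')) : J" using pp(6) unfolding sym_def by blast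
    ultimately show False using no by blast
   qed
  qed
  show False
  proof (cases "c = 0")
   case False
   hence c: "c : Cs" using m by simp
   have "ad ?a (y c) <= \<rho>" using inD(1)[OF c ab(1)] par(1) by linarith
   moreover have "2 * \<rho> < ad ?b (y c)" using outD[OF c m(2,3) ab(2)] rr by linarith
   ultimately show False using one_edge[OF e abW ne nd c] by blast
  next
   case True
   hence d: "d : Cs" using m by simp
   have "ad ?b (y d) <= \<rho>" using inD(1)[OF d ab(2)] par(1) by linarith
   moreover have "2 * \<rho> < ad ?a (y d)" using outD[OF d m(1) _ ab(1)] m(3) rr by fastforce
   ultimately show False using one_edge[OF symmem[OF e] abW(2,1) ne[symmetric] nd(2,1) d] by blast
  qed
 qed
 have last: "\<exists>Z\<subseteq>C. (\<forall>z\<in>Z. \<forall>w\<in>W Un C. (z, w) ~: R) &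
     (\<forall>z\<in>Z. \<forall>w\<in>(C - Z) Un T 0. w ~= Suc z & z ~= Suc w) &
     (\<forall>v\<in>C - Z. \<forall>w\<in>DD. (v, w) ~: R & w ~= Suc v & v ~= Suc w)"
  if C: "C \<subseteq> {1..n}" "C Int W = {}" "card C <= k" and rC: "rigid R W (W Un C)" for C
 proof -
  have fC: "finite C" using C(1) finite_subset by auto
  have "\<forall>c. \<exists>j. j : {1..k + 1} & (\<forall>z\<in>C. ~ (j * \<rho> < ad z (y c) & ad z (y c) <= (j + 1) * \<rho>))"
   using ad_pigeonhole[OF fC C(3)] by blast
  then obtain j where j: "\<forall>c. j c : {1..k + 1} & (\<forall>z\<in>C. ~ (j c * \<rho> < ad z (y c) & ad z (y c) <= (j c + 1) * \<rho>))"
   by (rule choice[THEN exE])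
  define Zc where "Zc c = {z : C. ad z (y c) <= j c * \<rho>}" for c
  define Z where "Z = (\<Union>c\<in>Cs. Zc c)"
  define Q where "Q = {(u, v). (u, v) : R & u < v & u : W Un C & v : W Un C & ~ (u : W & v : W)}"
  have jb: "1 * \<rho> <= j c * \<rho>" "j c * \<rho> <= (k + 1) * \<rho>" for c
  proof -
   have "1 <= j c" "j c <= k + 1" using j by auto
   thus "1 * \<rho> <= j c * \<rho>" "j c * \<rho> <= (k + 1) * \<rho>" by (intro mult_le_mono1; simp)+
  qed
  have out: "(j c + 1) * \<rho> < ad z (y c)" if "z : C - Zc c" for c z
  proof -
   have z: "z : C" "j c * \<rho> < ad z (y c)" using that unfolding Zc_def by auto
   have "~ (j c * \<rho> < ad z (y c) & ad z (y c) <= (j c + 1) * \<rho>)" using j z(1) by blast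
   thus ?thesis using z(2) by simp
  qed
  have outW: "(j c + 1) * \<rho> < ad w (y c)" if cw: "c : Cs" "w : W - vset y T c" for c w
  proof -
   obtain d where d: "d : ?I" "w : vset y T d" using cw(2) unfolding W_def Wv_def by blast
   have "c ~= d" using cw(2) d by auto
   hence "2 * r < ad w (y c)" using outD[OF cw(1) d(1) _ d(2)] by blast
   moreover have "(j c + 1) * \<rho> <= (k + 3) * \<rho>" using j by (intro mult_le_mono1) (simp add: le_SucI)
   ultimately show ?thesis using par(2) by linarith
  qed
  have symQ: "(u, v) : symc Q \<longleftrightarrow> (u, v) : R" if "u : W Un C" "v : W Un C" "~ (u : W & v : W)" "u ~= v" for u v
   using that symmem unfolding symc_def Q_def by (cases "u < v") auto
  have cr: "cross R V l = cross (R - Id) V l" for V l unfolding cross_def by auto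
  have rQ: "rigid (symc Q) W (W Un C)"
  proof (rule rigidI)
   note f = rigidD[OF rC]
   show "finite (W Un C)" "W \<subseteq> W Un C" using f by auto
   fix l assume l: "compat (W Un C) l" "!!x. x : W ==> l x = 0" "\<exists>v\<in>W Un C. l v ~= 0"
   have "cross (symc Q) (W Un C) l = cross R (W Un C) l"
   proof (rule set_eqI, clarify)
    fix u v
    have "~ (u : W & v : W) & u ~= v" if "l u ~= l v" using that l(2) by auto
    thus "(u, v) : cross (symc Q) (W Un C) l \<longleftrightarrow> (u, v) : cross R (W Un C) l"
     using symQ[of u v] unfolding cross_def by blast
   qed
   thus "wt (symc Q) (W Un C) l < 0" using f(3)[OF l] unfolding wt_def by simp
  qed
  have desW: "des J y \<subseteq> W \<times> W"
  proof clarify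
   fix u v assume "(u, v) : des J y"
   then obtain c t d s where m: "((c, t), (d, s)) : J" "u = y c + t" "v = y d + s" unfolding des_def by blast
   hence "c : ?I" "d : ?I" "t : T c" "s : T d" using pp(5) by auto
   thus "u : W & v : W" using m(2,3) unfolding W_def Wv_def vset_def by blast
  qed
  have noedge: "~ ((j c) * \<rho> \<ge> ad a (y c) & (j c + 1) * \<rho> < ad b (y c))" if "c : Cs" "(a, b) : symc Q" for a b c
  proof
   assume h: "(j c) * \<rho> \<ge> ad a (y c) & (j c + 1) * \<rho> < ad b (y c)"
   have "Q \<subseteq> {(u, v). u < v & u : W Un C & v : W Un C} - des J y" using desW unfolding Q_def by blast
   moreover have "\<exists>c\<in>Cs. \<exists>j\<in>{1..k + 1}. \<exists>a b. (a, b) : symc Q & ad a (y c) <= j * \<rho> & (j + 1) * \<rho> < ad b (y c)"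
    using that h j by blast
   ultimately have "(C, Q) : bad k n \<rho> Cs T J y" unfolding bad_def W_def[symmetric] using C rQ by simp
   moreover have "Q \<subseteq> R" unfolding Q_def by blast
   ultimately show False using nb by blast
  qed
  have sep: "(z, w) ~: R & (w, z) ~: R & w ~= Suc z & z ~= Suc w"
   if c: "c : Cs" and z: "z : Zc c" and w: "w : (W Un C) - (vset y T c Un Zc c)" for c z w
  proof -
   have wo: "(j c + 1) * \<rho> < ad w (y c)" using w out[of w c] outW[OF c, of w] by blast
   have zi: "ad z (y c) <= j c * \<rho>" "z : C" using z unfolding Zc_def by auto
   have "ad w (y c) <= ad w z + ad z (y c)" by (rule ad_tri)
   hence "\<rho> < ad w z" using wo zi(1) by simp
   hence ns: "w ~= Suc z" "z ~= Suc w" "w ~= z" using par(1) by (auto simp: ad_def)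
   have "z ~: W" using zi(2) C(2) by blast
   hence "(z, w) : R \<longleftrightarrow> (z, w) : symc Q" using symQ[of z w] zi(2) w ns by blast
   hence "(z, w) ~: R" using noedge[OF c, of z w] zi wo by blast
   thus ?thesis using ns symmem by blast
  qed
  have buf: "ad z (y c) <= b0" if c: "c : Cs" and z: "z : Zc c" for c z
  proof -
   have "rigid R (vset y T c) (vset y T c Un Zc c)"
    by (rule rigid_part[OF rC _ _ sep[OF c] C(2)]) (use c in \<open>auto simp: W_def Wv_def Zc_def\<close>)
   moreover have "Zc c Int vset y T c = {}" using C(2) c unfolding Zc_def W_def Wv_def by blast
   moreover have "card (Zc c) <= k" using card_mono[OF fC, of "Zc c"] C(3) unfolding Zc_def by auto
   moreover have "ad z (y c) <= r" if "z : Zc c" for z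
   proof -
    have "ad z (y c) <= (k + 1) * \<rho>" using that jb(2)[of c] unfolding Zc_def by simp
    also have "... <= (k + 3) * \<rho>" by (intro mult_le_mono1) simp
    finally show ?thesis using par(2) by simp
   qed
   ultimately show ?thesis
    using conjunct2[OF wg[OF c, unfolded wgood_def], rule_format, of "Zc c" z] z unfolding vset_def by simp
  qed
  have Zno: "(z, w) ~: R" if z: "z : Z" and w: "w : W Un C" for z w
  proof
   assume e: "(z, w) : R"
   obtain c where c: "c : Cs" "z : Zc c" using z unfolding Z_def by blast
   hence wc: "w : vset y T c Un Zc c" using sep[OF c, of w] w e by blast
   have "ad w (y c) <= b0" using wc buf[OF c(1), of w] inD(1)[OF c(1), of w] par(3) by fastforce
   then obtain t s where "z = y c + t" "(t, s) : G c" using wg1[OF c(1) buf[OF c]] e by blast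
   hence "z : vset y T c" using pp(4)[OF c(1)] unfolding vset_def by blast
   hence "z : W" using c(1) unfolding W_def Wv_def by blast
   thus False using c(2) C(2) unfolding Zc_def by blast
  qed
  have ZC: "Z \<subseteq> C" unfolding Z_def Zc_def by blast
  have Zs: "w ~= Suc z & z ~= Suc w" if z: "z : Z" and w: "w : (C - Z) Un T 0" for z w
  proof -
   obtain c where c: "c : Cs" "z : Zc c" using z unfolding Z_def by blast
   have "w : (W Un C) - (vset y T c Un Zc c)"
   proof (cases "w : T 0")
    case True
    have "c ~= 0" using c(1) pp(1) by auto
    hence "w ~: vset y T c" using far[of 0 c w w] c(1) D0 True by auto
    moreover have "w : W" using True unfolding W by blast
    ultimately show ?thesis using C(2) unfolding Zc_def by blast
   next
    case False
    hence "w : C" "w ~: Z" using w by auto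
    moreover have "w ~: vset y T c" using \<open>w : C\<close> C(2) c(1) unfolding W_def Wv_def by blast
    ultimately show ?thesis using c(1) unfolding Z_def by blast
   qed
   thus ?thesis using sep[OF c] by blast
  qed
  have CD: "(v, w) ~: R & w ~= Suc v & v ~= Suc w" if v: "v : C - Z" and w: "w : DD" for v w
  proof -
   obtain c where c: "c : Cs" "w : vset y T c" using w unfolding DD_def by blast
   have "v : C - Zc c" using v c(1) unfolding Z_def by blast
   hence vo: "(j c + 1) * \<rho> < ad v (y c)" by (rule out)
   have wi: "ad w (y c) <= j c * \<rho>" using inD(1)[OF c] par(1) jb(1)[of c] by linarith
   have "ad v (y c) <= ad v w + ad w (y c)" by (rule ad_tri)
   hence "\<rho> < ad v w" using vo wi by simp
   hence ns: "w ~= Suc v" "v ~= Suc w" "w ~= v" using par(1) by (auto simp: ad_def)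
   have wW: "w : W" "v : C" "v ~: W" using c v C(2) unfolding W_def Wv_def by blast+
   have "(w, v) : R \<longleftrightarrow> (w, v) : symc Q" using symQ[of w v] wW ns by blast
   hence "(w, v) ~: R" using noedge[OF c(1), of w v] wi vo by blast
   thus ?thesis using ns symmem by blast
  qed
  show ?thesis by (intro exI[of _ Z] conjI ballI) (use ZC Zno Zs CD in simp_all)
 qed
 show ?thesis
  unfolding realizes_def Wv_def[symmetric] W_def[symmetric] DD_def[symmetric]
 proof (intro conjI ballI impI allI)
  show "y 0 = 0" by (rule y0)
  show "vset y T c \<subseteq> {1..n}" if c: "c : Cs" for c
  proof
   fix u assume u: "u : vset y T c"
   have "ad u (y c) <= N" using inD(1)[OF c u] .
   thus "u : {1..n}" using inD(2)[OF c u] g1[OF c] par(1) rr(1) by (auto simp: ad_def)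
  qed
  show "(y c + t, y c + s) : R \<longleftrightarrow> (t, s) : G c" if c: "c : Cs" and ts: "t : T c" "s : T c" for c t s
  proof -
   have "y c + t : vset y T c" "y c + s : vset y T c" using ts unfolding vset_def by auto
   hence "ad (y c + t) (y c) <= b0" "ad (y c + s) (y c) <= b0" using inD(1)[OF c] par(3) le_trans by blast+
   thus ?thesis using wg1[OF c, of "y c + t" "y c + s"] by simp
  qed
  show "(y c + t, y d + s) : R \<longleftrightarrow> ((c, t), (d, s)) : J" if "c : ?I" "d : ?I" "c ~= d" "t : T c" "s : T d" for c d t s
   using J_R R_J that by blast
  show "y c + t + k + 1 < y d + s \<or> y d + s + k + 1 < y c + t" if "c : ?I" "d : ?I" "c ~= d" "t : T c" "s : T d" for c d t s
   using far[OF that(1-3), of "y c + t" "y d + s"] that(4,5) unfolding vset_def by blast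
  show "\<exists>Z\<subseteq>C. (\<forall>z\<in>Z. \<forall>w\<in>W Un C. (z, w) ~: R) &
     (\<forall>z\<in>Z. \<forall>w\<in>(C - Z) Un T 0. w ~= Suc z & z ~= Suc w) &
     (\<forall>v\<in>C - Z. \<forall>w\<in>DD. (v, w) ~: R & w ~= Suc v & v ~= Suc w)"
   if "C \<subseteq> {1..n}" "C Int W = {}" "card C <= k" "rigid R W (W Un C)" for C
   by (rule last[OF that])
 qed
qed

end

section \<open>Counting candidate placements and what spoils them\<close>

lemma card_small_subsets:
 fixes B :: "nat set"
 assumes "finite B"
 shows "card {C. C \<subseteq> B & card C <= k} <= (card B + 1) ^ k"
proof -
 \<comment> \<open>A dummy value that pads the enumeration of sets with fewer than \<open>k\<close>
   elements.\<close>
 obtain x0 where x0: "x0 ~: B" using ex_new_if_finite[OF infinite_UNIV_nat assms] by blast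
 let ?F = "{..<k} \<rightarrow>\<^sub>E insert x0 B"
 have fin: "finite ?F" using assms by (intro finite_PiE) auto
 have "{C. C \<subseteq> B & card C <= k} \<subseteq> (%f. f ` {..<k} Int B) ` ?F"
 proof
  fix C assume "C : {C. C \<subseteq> B & card C <= k}"
  hence C: "C \<subseteq> B" "card C <= k" by auto
  have fC: "finite C" using C(1) assms finite_subset by blast
  obtain g where g: "bij_betw g {..<card C} C" using ex_bij_betw_nat_finite[OF fC] by (auto simp: atLeast0LessThan)
  define f where "f = restrict (%i. if i < card C then g i else x0) {..<k}"
  have gi: "g i : C" if "i < card C" for i using g that unfolding bij_betw_def by auto
  have "g i : B" if "i < card C" for i using gi[OF that] C(1) by blast
  hence "f : ?F" unfolding f_def by (auto simp: PiE_def)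
  moreover have "C = f ` {..<k} Int B"
  proof
   show "C \<subseteq> f ` {..<k} Int B"
   proof
    fix x assume x: "x : C"
    then obtain i where "i < card C" "x = g i" using g unfolding bij_betw_def by auto
    hence "x = f i" "i < k" using C(2) unfolding f_def by auto
    thus "x : f ` {..<k} Int B" using x C(1) by auto
   qed
   show "f ` {..<k} Int B \<subseteq> C" unfolding f_def using gi x0 by (auto split: if_splits)
  qed
  ultimately show "C : (%f. f ` {..<k} Int B) ` ?F" by blast
 qed
 hence "card {C. C \<subseteq> B & card C <= k} <= card ((%f. f ` {..<k} Int B) ` ?F)" using fin by (intro card_mono) auto
 also have "... <= card ?F" using fin by (rule card_image_le)
 also have "... = (card B + 1) ^ k" using x0 assms by (simp add: card_PiE)
 finally show ?thesis .
qed

lemma card_near: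
 assumes "finite Y" "Y ~= {}"
 shows "card {x. x <= n & nd x Y < s} <= card Y * (2 * s + 1)"
proof -
 have "{x. x <= n & nd x Y < s} \<subseteq> (\<Union>y\<in>Y. {y - s..y + s})"
 proof
  fix x assume "x : {x. x <= n & nd x Y < s}"
  then obtain y where "y : Y" "ad x y < s" using nd_attained[OF assms, of x] by auto
  thus "x : (\<Union>y\<in>Y. {y - s..y + s})" by (intro UN_I[of y]) (auto simp: ad_def)
 qed
 hence "card {x. x <= n & nd x Y < s} <= card (\<Union>y\<in>Y. {y - s..y + s})" using assms(1) by (intro card_mono) auto
 also have "... <= (\<Sum>y\<in>Y. card {y - s..y + s})" using assms(1) by (rule card_UN_le)
 also have "... <= (\<Sum>y\<in>Y. 2 * s + 1)" by (intro sum_mono) auto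
 finally show ?thesis by (simp add: mult.commute)
qed

text \<open>Candidate placements: part \<open>c\<close> has \<open>Kg\<close> possible positions,
  spaced by \<omega> so that windows of radius \<open>r\<close> are disjoint. Different parts and
  the base are more than \<open>m0\<close> apart, and \<open>m0\<close> will be a constant fraction
  of \<open>n\<close>. So all edges between parts have the same probability up to a constant, and
  only their number counts.\<close>

locale grid = irrational_exponent +
 fixes N k n r \<rho> \<omega> Kg m0 h :: nat and Cs T G J st
 assumes pat: "pat_ok N k n Cs T G J" and hT: "card (T 0) <= h" and k1: "1 <= k" and T0ne: "T 0 ~= {}"
  and inside: "!!c i. c : Cs ==> i < Kg ==> r < st c + i * \<omega> & st c + i * \<omega> + r <= n"
  and spacing: "2 * r < \<omega>"
  and apart: "!!c d i j. c : Cs ==> d : Cs ==> c ~= d ==> i < Kg ==> j < Kg ==> m0 + 3 * r < ad (st c + i * \<omega>) (st d + j * \<omega>)"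
  and apart0: "!!c v i. c : Cs ==> v : T 0 ==> i < Kg ==> m0 + 3 * r < ad v (st c + i * \<omega>)"
  and par: "N + k + 2 <= \<rho>" "(k + 3) * \<rho> <= r" "1 <= m0" "1 <= Kg"
begin

definition Idx :: "(nat => nat) set" where "Idx = Cs \<rightarrow>\<^sub>E {..<Kg}"

definition pos :: "(nat => nat) => nat => nat" where "pos i c = (if c = 0 then 0 else st c + i c * \<omega>)"

definition eL :: "nat set => nat" where
 "eL L = card {((c, t), (d, s)) : J. c : insert 0 L & d : insert 0 L}"

text \<open>The factor by which pinning the parts in \<open>L\<close> changes an expected count with
  \<open>x\<close> positions for each part: \<open>x\<close> choices are lost for each pinned part,
  and edges among the pinned parts and the base no longer cost. By the safety inequality it is small
  for nonempty \<open>L\<close> once \<open>x\<close> is close enough to \<open>n\<close>.\<close>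

abbreviation "wL x L \<equiv> real x powr - real (card L) * real m0 powr (\<alpha> / 2 * real (eL L))"

lemma pp: "Cs \<subseteq> {1..N}" "T 0 \<subseteq> {1..n}"
 "!!c. c : Cs ==> T c \<subseteq> {1..N}" "!!c. c : Cs ==> G c \<subseteq> T c \<times> T c"
 "J \<subseteq> {((c, t), (d, s)). c : insert 0 Cs & d : insert 0 Cs & c ~= d & t : T c & s : T d}" "sym J"
 using pat unfolding pat_ok_def by auto

lemma JD: "((c, t), (d, s)) : J ==> c : insert 0 Cs & d : insert 0 Cs & c ~= d & t : T c & s : T d"
 using subsetD[OF pp(5), of "((c, t), (d, s))"] by simp

lemma safeL: "L \<subseteq> Cs ==> L ~= {} ==> 0 < real (card L) - \<alpha> / 2 * real (eL L)"
 using pat unfolding pat_ok_def eL_def by simp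

lemma zero_notin: "0 ~: Cs" using pp(1) by auto

lemma finCs: "finite Cs" using pp(1) finite_subset by auto

lemma cardCs: "card Cs <= N" using card_mono[OF _ pp(1)] by simp

lemma finIdx: "finite Idx" unfolding Idx_def using finCs by (intro finite_PiE) auto

lemma pos_c: "c : Cs ==> pos i c = st c + i c * \<omega>"
 unfolding pos_def using zero_notin by (cases "c = 0") auto

lemma iK: "i : Idx ==> c : Cs ==> i c < Kg" unfolding Idx_def by auto

lemma rr: "\<rho> <= r" "3 * \<rho> <= r" "N <= r"
proof -
 have "3 * \<rho> <= (k + 3) * \<rho>" by simp
 thus "3 * \<rho> <= r" using par(2) by linarith
 thus "\<rho> <= r" by linarith
 thus "N <= r" using par(1) by linarith
qed

lemma vset0: "vset (pos i) T 0 = T 0" unfolding vset_def pos_def by simp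

lemma inD: "c : Cs ==> u : vset (pos i) T c ==> ad u (pos i c) <= N"
 unfolding vset_def using pp(3) by (force simp: ad_def)

lemma fin_vset: "c : insert 0 Cs ==> finite (vset (pos i) T c) & card (vset (pos i) T c) <= h + N"
proof -
 assume c: "c : insert 0 Cs"
 have "finite (T c) & card (T c) <= h + N"
 proof (cases "c = 0")
  case True
  thus ?thesis using hT pp(2) finite_subset by auto
 next
  case False
  hence "T c \<subseteq> {1..N}" using pp(3) c by simp
  thus ?thesis using card_mono[of "{1..N}" "T c"] finite_subset by auto
 qed
 thus ?thesis unfolding vset_def using card_image_le[of "T c"] le_trans by blast
qed

lemma fin_Wv: "finite (Wv Cs T (pos i))" "card (Wv Cs T (pos i)) <= (N + 1) * (h + N)"
proof -
 show "finite (Wv Cs T (pos i))" unfolding Wv_def using finCs fin_vset by (intro finite_UN_I) auto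
 have "card (Wv Cs T (pos i)) <= (\<Sum>c\<in>insert 0 Cs. card (vset (pos i) T c))"
  unfolding Wv_def using finCs by (intro card_UN_le) auto
 also have "... <= (\<Sum>c\<in>insert 0 Cs. h + N)" using fin_vset by (intro sum_mono) auto
 also have "... = card (insert 0 Cs) * (h + N)" by simp
 also have "... <= (N + 1) * (h + N)" using cardCs finCs by (intro mult_le_mono1) (simp add: card_insert_if)
 finally show "card (Wv Cs T (pos i)) <= (N + 1) * (h + N)" .
qed

lemma posn_far:
 assumes "i : Idx" "c : Cs" "d : insert 0 Cs" "c ~= d" "u : vset (pos i) T d"
 shows "m0 + 2 * r < ad u (pos i c)"
proof (cases "d = 0")
 case True
 thus ?thesis using apart0[of c u "i c"] assms iK vset0 pos_c by auto
next
 case False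
 hence d: "d : Cs" using assms by simp
 have "m0 + 3 * r < ad (pos i c) (pos i d)" using apart[of c d "i c" "i d"] assms d iK pos_c by simp
 moreover have "ad (pos i c) (pos i d) <= ad (pos i c) u + ad u (pos i d)" by (rule ad_tri)
 ultimately show ?thesis using inD[OF d assms(5)] rr(3) by (simp add: ad_sym)
qed

lemma uniq:
 assumes "i : Idx" "c : insert 0 Cs" "c' : insert 0 Cs" "t : T c" "t' : T c'" "pos i c + t = pos i c' + t'"
 shows "c = c' & t = t'"
proof (cases "c = c'")
 case False
 have no: False if "c : Cs" "d : insert 0 Cs" "c ~= d" "u : vset (pos i) T c" "u : vset (pos i) T d" for c d u
  using posn_far[OF assms(1) that(1-3,5)] inD[OF that(1,4)] rr(3) by simp
 have u: "pos i c + t : vset (pos i) T c" "pos i c + t : vset (pos i) T c'" using assms unfolding vset_def by (blast, metis image_eqI)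
 show ?thesis using no[of c c' "pos i c + t"] no[of c' c "pos i c + t"] u assms(2,3) False by (cases "c = 0") auto
qed (use assms in simp)

lemma edge_len:
 assumes "i : Idx" "c : insert 0 Cs" "d : insert 0 Cs" "c ~= d" "u : vset (pos i) T c" "v : vset (pos i) T d"
 shows "m0 <= ad u v"
proof -
 have one: "m0 <= ad u v" if "c : Cs" "d : insert 0 Cs" "c ~= d" "u : vset (pos i) T c" "v : vset (pos i) T d" for c d u v
 proof -
  have "m0 + 2 * r < ad v (pos i c)" using posn_far[OF assms(1) that(1-3,5)] .
  moreover have "ad v (pos i c) <= ad v u + ad u (pos i c)" by (rule ad_tri)
  ultimately show ?thesis using inD[OF that(1,4)] rr(3) by (simp add: ad_sym)
 qed
 show ?thesis using one[of c d u v] one[of d c v u] assms ad_sym[of u v] by (cases "c = 0") auto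
qed

lemma Wv_sub: "i : Idx ==> Wv Cs T (pos i) \<subseteq> {1..n}"
proof
 fix u assume i: "i : Idx" and "u : Wv Cs T (pos i)"
 then obtain c where c: "c : insert 0 Cs" "u : vset (pos i) T c" unfolding Wv_def by blast
 show "u : {1..n}"
 proof (cases "c = 0")
  case True
  thus ?thesis using c vset0 pp(2) by auto
 next
  case False
  hence "c : Cs" using c by simp
  hence "ad u (pos i c) <= r" "r < pos i c" "pos i c + r <= n"
   using inD[of c u i] c inside[of c "i c"] iK[OF i] rr(3) pos_c by auto
  thus ?thesis by (auto simp: ad_def)
 qed
qed

definition dL :: "(nat => nat) => nat set => edges" where
 "dL i L = {(u, v). u < v & (\<exists>c t d s. ((c, t), (d, s)) : J & ~ (c : insert 0 L & d : insert 0 L) & u = pos i c + t & v = pos i d + s)}"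

lemma finJ: "finite J"
proof (rule finite_subset[OF pp(5)])
 have "finite (T c)" if "c : insert 0 Cs" for c
 proof (cases "c = 0")
  case True
  thus ?thesis using finite_subset[OF pp(2)] by simp
 next
  case False
  hence "T c \<subseteq> {1..N}" using pp(3) that by simp
  thus ?thesis by (rule finite_subset) simp
 qed
 hence "finite (SIGMA c:insert 0 Cs. T c)" using finCs by (intro finite_SigmaI) auto
 hence "finite ((SIGMA c:insert 0 Cs. T c) \<times> (SIGMA c:insert 0 Cs. T c))" by simp
 thus "finite {((c, t), (d, s)). c : insert 0 Cs & d : insert 0 Cs & c ~= d & t : T c & s : T d}"
  by (rule finite_subset[rotated]) auto
qed

text \<open>\<open>J\<close> lists both directions, which gives the factor 2, and
  \<open>uniq\<close> prevents two entries from naming the same pair of vertices.\<close>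

lemma card_dL:
 assumes i: "i : Idx" and L: "L \<subseteq> Cs"
 shows "real (card (dL i L)) = (real (card J) - real (eL L)) / 2"
proof -
 define J' where "J' = {((c, t), (d, s)) : J. ~ (c : insert 0 L & d : insert 0 L)}"
 define f where "f = (%((c, t), (d, s)). (pos i c + t, pos i d + s))"
 have fJ': "finite J'" unfolding J'_def using finJ by (rule finite_subset[rotated]) auto
 have symJ': "((d, s), (c, t)) : J'" if "((c, t), (d, s)) : J'" for c t d s
  using that pp(6) unfolding J'_def sym_def by auto
 have inj: "inj_on f J'"
 proof (rule inj_onI)
  fix p p' assume a0: "p : J'" "p' : J'" "f p = f p'"
  obtain c t d s c' t' d' s' where pq: "p = ((c, t), (d, s))" "p' = ((c', t'), (d', s'))" by (metis prod.exhaust)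
  note a = a0[unfolded pq]
  have m: "((c, t), (d, s)) : J" "((c', t'), (d', s')) : J" using a(1,2) unfolding J'_def by simp_all
  show "p = p'" unfolding pq
   using uniq[OF i, of c c' t t'] uniq[OF i, of d d' s s'] a(3) JD[OF m(1)] JD[OF m(2)] unfolding f_def by simp
 qed
 have img: "f ` J' = dL i L Un (dL i L)\<inverse>"
 proof
  show "f ` J' \<subseteq> dL i L Un (dL i L)\<inverse>"
  proof (rule image_subsetI)
   fix p assume p: "p : J'"
   obtain c t d s where pq: "p = ((c, t), (d, s))" by (metis prod.exhaust)
   note a = p[unfolded pq]
   have "((c, t), (d, s)) : J" using a unfolding J'_def by simp
   note m = JD[OF this]
   have "pos i c + t ~= pos i d + s" using uniq[OF i, of c d t s] m by blast
   then consider "pos i c + t < pos i d + s" | "pos i d + s < pos i c + t" by linarith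
   thus "f p : dL i L Un (dL i L)\<inverse>"
   proof cases
    case 1
    hence "(pos i c + t, pos i d + s) : dL i L" using a unfolding dL_def J'_def by auto
    thus ?thesis unfolding f_def pq by simp
   next
    case 2
    hence "(pos i d + s, pos i c + t) : dL i L" using symJ'[OF a] unfolding dL_def J'_def by auto
    thus ?thesis unfolding f_def pq by simp
   qed
  qed
  show "dL i L Un (dL i L)\<inverse> \<subseteq> f ` J'"
  proof -
   have one: "(u, v) : f ` J' & (v, u) : f ` J'" if uv: "(u, v) : dL i L" for u v
   proof -
    obtain c t d s where m: "((c, t), (d, s)) : J" "~ (c : insert 0 L & d : insert 0 L)" "u = pos i c + t" "v = pos i d + s"
     using uv unfolding dL_def by blast
    hence "((c, t), (d, s)) : J'" unfolding J'_def by simp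
    moreover from this have "((d, s), (c, t)) : J'" by (rule symJ')
    moreover have "f ((c, t), (d, s)) = (u, v)" "f ((d, s), (c, t)) = (v, u)" using m unfolding f_def by auto
    ultimately show ?thesis by (metis image_eqI)
   qed
   show ?thesis
   proof
    fix x assume "x : dL i L Un (dL i L)\<inverse>"
    thus "x : f ` J'" using one by (cases x) auto
   qed
  qed
 qed
 have fdL: "finite (dL i L)"
 proof -
  have "finite (f ` J')" using fJ' by simp
  thus ?thesis unfolding img by simp
 qed
 have dis: "dL i L Int (dL i L)\<inverse> = {}" unfolding dL_def by auto
 have "card J' = card (f ` J')" using card_image[OF inj] by simp
 also have "... = card (dL i L) + card ((dL i L)\<inverse>)" unfolding img using fdL dis by (intro card_Un_disjoint) auto
 finally have "card J' = 2 * card (dL i L)" by (simp add: card_inverse)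
 moreover have "card J = card J' + eL L"
 proof -
  define J2 where "J2 = {((c, t), (d, s)) : J. c : insert 0 L & d : insert 0 L}"
  have 1: "J = J' Un J2" unfolding J'_def J2_def by auto
  have 2: "J' Int J2 = {}" unfolding J'_def J2_def by auto
  have "finite J2" using finJ by (rule finite_subset[rotated]) (use 1 in auto)
  from card_Un_disjoint[OF fJ' this 2, folded 1] show ?thesis unfolding J2_def eL_def .
 qed
 ultimately show ?thesis by simp
qed

lemma dL_des: "dL i L \<subseteq> des J (pos i)" unfolding dL_def des_def by blast

lemma des_pairs: "i : Idx ==> des J (pos i) \<subseteq> Wv Cs T (pos i) \<times> Wv Cs T (pos i) & des J (pos i) \<subseteq> vertex_pairs n"
proof -
 assume i: "i : Idx"
 have a: "des J (pos i) \<subseteq> Wv Cs T (pos i) \<times> Wv Cs T (pos i)"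
 proof clarify
  fix u v assume "(u, v) : des J (pos i)"
  then obtain c t d s where m: "((c, t), (d, s)) : J" "u = pos i c + t" "v = pos i d + s" unfolding des_def by blast
  hence "c : insert 0 Cs" "d : insert 0 Cs" "t : T c" "s : T d" using JD by simp_all
  thus "u : Wv Cs T (pos i) & v : Wv Cs T (pos i)" using m(2,3) unfolding Wv_def vset_def by blast
 qed
 moreover have "des J (pos i) \<subseteq> {(u, v). u < v}" unfolding des_def by auto
 ultimately have "des J (pos i) \<subseteq> vertex_pairs n" using Wv_sub[OF i] unfolding vertex_pairs_def by fastforce
 thus ?thesis using a by blast
qed

lemma pe_des:
 assumes i: "i : Idx" and e: "e : des J (pos i)"
 shows "pe \<alpha> e <= real m0 powr - \<alpha>"
proof -
 obtain c t d s where m: "((c, t), (d, s)) : J" "fst e = pos i c + t" "snd e = pos i d + s" "fst e < snd e" using e unfolding des_def by auto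
 hence "c : insert 0 Cs" "d : insert 0 Cs" "t : T c" "s : T d" "c ~= d" using JD by simp_all
 hence "m0 <= ad (fst e) (snd e)" using edge_len[OF i, of c d] m(2,3) unfolding vset_def by blast
 hence le: "m0 <= snd e - fst e" using m(4) by (simp add: ad_less)
 have "pe \<alpha> e <= real (snd e - fst e) powr - \<alpha>" 
  by (rule edge_prob_le[OF alpha(1)]) (use le par(3) in simp)
 also have "... <= real m0 powr - \<alpha>" using le par(3) alpha(1) by (intro powr_mono2') auto
 finally show ?thesis .
qed

lemma prod_subset_le:
 assumes "finite B" "A \<subseteq> B"
 shows "(\<Prod>e\<in>B. pe \<alpha> e) <= (\<Prod>e\<in>A. pe \<alpha> e)"
proof -
 have "(\<Prod>e\<in>B. pe \<alpha> e) = (\<Prod>e\<in>B - A. pe \<alpha> e) * (\<Prod>e\<in>A. pe \<alpha> e)" by (rule prod.subset_diff[OF assms(2,1)])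
 also have "... <= 1 * (\<Prod>e\<in>A. pe \<alpha> e)" using pe_bounds by (intro mult_right_mono prod_le_1 prod_nonneg) auto
 finally show ?thesis by simp
qed

lemma prod_des_le:
 assumes i: "i : Idx" and L: "L \<subseteq> Cs" and sub: "dL i L \<subseteq> B" "finite B"
 shows "(\<Prod>e\<in>B. pe \<alpha> e) <= real m0 powr (- \<alpha> / 2 * (real (card J) - real (eL L)))"
proof -
 have "(\<Prod>e\<in>B. pe \<alpha> e) <= (\<Prod>e\<in>dL i L. pe \<alpha> e)" using prod_subset_le[OF sub(2,1)] .
 also have "... <= (\<Prod>e\<in>dL i L. real m0 powr - \<alpha>)"
  using pe_des[OF i] dL_des pe_bounds by (intro prod_mono) blast
 also have "... = (real m0 powr - \<alpha>) ^ card (dL i L)" by simp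
 also have "... = real m0 powr (- \<alpha> * real (card (dL i L)))" using par(3) by (subst powr_realpow[symmetric]) (auto simp: powr_powr)
 also have "- \<alpha> * real (card (dL i L)) = - \<alpha> / 2 * (real (card J) - real (eL L))" using card_dL[OF i L] by simp
 finally show ?thesis .
qed

definition hit :: "nat set => (nat => nat) => nat set" where
 "hit F i = {c : Cs. \<exists>f\<in>F. ad f (pos i c) <= r}"

text \<open>Windows of one part at different positions are disjoint, so a vertex of \<open>F\<close>
  meets at most one of them; each part in \<open>L\<close> has at most \<open>card F\<close> choices
  left.\<close>

lemma card_hit:
 assumes F: "finite F" and L: "L \<subseteq> Cs"
 shows "card {i : Idx. hit F i = L} <= card F ^ card L * Kg ^ (card Cs - card L)"
proof -
 define Hc where "Hc c = {j. j < Kg & (\<exists>f\<in>F. ad f (st c + j * \<omega>) <= r)}" for c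
 have cH: "card (Hc c) <= card F" for c
 proof -
  have "\<forall>j\<in>Hc c. \<exists>f. f : F & ad f (st c + j * \<omega>) <= r" unfolding Hc_def by blast
  then obtain g where g: "\<forall>j\<in>Hc c. g j : F & ad (g j) (st c + j * \<omega>) <= r" by (rule bchoice[THEN exE])
  have "inj_on g (Hc c)"
  proof (rule linorder_inj_onI')
   fix i j assume ij: "i : Hc c" "j : Hc c" "i < j"
   show "g i ~= g j"
   proof
    assume eq: "g i = g j"
    have "ad (st c + i * \<omega>) (st c + j * \<omega>) <= ad (st c + i * \<omega>) (g i) + ad (g i) (st c + j * \<omega>)" by (rule ad_tri)
    also have "... <= 2 * r" using bspec[OF g ij(1)] bspec[OF g ij(2)] eq by (simp add: ad_sym)
    finally have "(j - i) * \<omega> <= 2 * r" using ij(3) by (simp add: ad_def diff_mult_distrib)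
    moreover have "1 * \<omega> <= (j - i) * \<omega>" using ij(3) by (intro mult_le_mono1) simp
    ultimately show False using spacing by linarith
   qed
  qed
  thus ?thesis using card_inj_on_le[of g "Hc c" F] g F by blast
 qed
 have sub: "{i : Idx. hit F i = L} \<subseteq> (\<Pi>\<^sub>E c\<in>Cs. if c : L then Hc c else {..<Kg})"
 proof
  fix i assume "i : {i : Idx. hit F i = L}"
  hence i: "i : Idx" "hit F i = L" by auto
  show "i : (\<Pi>\<^sub>E c\<in>Cs. if c : L then Hc c else {..<Kg})"
  proof (rule PiE_I)
   fix c assume c: "c : Cs"
   show "i c : (if c : L then Hc c else {..<Kg})"
   proof (cases "c : L")
    case True
    hence "\<exists>f\<in>F. ad f (pos i c) <= r" using i(2) unfolding hit_def by blast
    thus ?thesis using True iK[OF i(1) c] pos_c[OF c] unfolding Hc_def by simp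
   qed (use iK[OF i(1) c] in simp)
  qed (use i(1) in \<open>auto simp: Idx_def\<close>)
 qed
 have finH: "finite (if c : L then Hc c else {..<Kg})" for c unfolding Hc_def by simp
 have "card {i : Idx. hit F i = L} <= card (\<Pi>\<^sub>E c\<in>Cs. if c : L then Hc c else {..<Kg})"
  using sub finCs finH by (intro card_mono finite_PiE) auto
 also have "... = (\<Prod>c\<in>Cs. card (if c : L then Hc c else {..<Kg}))" using finCs by (rule card_PiE)
 also have "... <= (\<Prod>c\<in>Cs. if c : L then card F else Kg)" using cH by (intro prod_mono) auto
 also have "... = card F ^ card L * Kg ^ card (Cs - L)" using finCs L by (simp add: prod.If_cases Int_absorb1 Diff_eq)
 also have "card (Cs - L) = card Cs - card L" using L finCs finite_subset by (intro card_Diff_subset) auto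
 finally show ?thesis .
qed

end

text \<open>Counts items by splitting each into a component from the bounded set \<open>A\<close>
  and one from \<open>B\<close> that carries the estimate.\<close>

lemma sum_le_image:
 fixes g :: "'x => real" and gb :: "'b => real"
 assumes "finite X" "inj_on \<Phi> X" "\<Phi> ` X \<subseteq> A \<times> B" "finite A" "finite B"
  and "!!x. x : X ==> g x <= gb (snd (\<Phi> x))" "!!b. b : B ==> 0 <= gb b"
 shows "(\<Sum>x\<in>X. g x) <= real (card A) * (\<Sum>b\<in>B. gb b)"
proof -
 have "(\<Sum>x\<in>X. g x) <= (\<Sum>x\<in>X. gb (snd (\<Phi> x)))" using assms(6) by (rule sum_mono)
 also have "... = (\<Sum>z\<in>\<Phi> ` X. gb (snd z))" using assms(2) by (simp add: sum.reindex)
 also have "... <= (\<Sum>z\<in>A \<times> B. gb (snd z))" using assms by (intro sum_mono2) auto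
 also have "... = (\<Sum>a\<in>A. \<Sum>b\<in>B. gb b)" unfolding sum.cartesian_product by (rule sum.cong) auto
 finally show ?thesis by simp
qed

context irrational_exponent
begin

lemma rigid_symc_new:
 assumes r: "rigid (symc Q) W (W Un C)" and Q: "Q \<subseteq> {(u, v). u : W Un C & v : W Un C}"
  and Y: "W \<subseteq> Y" "finite Y"
 shows "rigid (symc (Q - Y \<times> Y)) Y (Y Un (C - Y))"
proof -
 have "rigid (symc Q) Y (W Un C Un Y)" using rigid_base[OF r Y] .
 moreover have "W Un C Un Y = Y Un (C - Y)" using Y(1) by blast
 ultimately have "rigid (symc Q) Y (Y Un (C - Y))" by simp
 thus ?thesis by (rule rigid_edges_cong) (auto simp: symc_def)
qed

end

context grid
begin

definition Near :: "nat set => nat => (nat set \<times> edges) set" where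
 "Near Y s = {(C, Q). C \<subseteq> {x. x <= n & nd x Y < s} & card C <= k & Q \<subseteq> econf k Y C}"

lemma card_Near:
 assumes "finite Y" "Y ~= {}" "card Y <= b"
 shows "finite (Near Y s)" "card (Near Y s) <= (b * (2 * s + 1) + 1) ^ k * 2 ^ ((b + k) * (b + k))"
proof -
 let ?B = "{x. x <= n & nd x Y < s}"
 let ?S = "{C. C \<subseteq> ?B & card C <= k}"
 have fB: "finite ?B" by simp
 have fS: "finite ?S" by (rule finite_subset[of _ "Pow ?B"]) auto
 have fC: "finite C" if C: "C : ?S" for C
 proof (rule finite_subset[OF _ fB])
  show "C \<subseteq> ?B" using C by blast
 qed
 have fE: "finite (Pow (econf k Y C))" if C: "C : ?S" for C
  unfolding finite_Pow_iff by (rule finite_econf[OF assms(1) fC[OF C]])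
 have eq: "Near Y s = (SIGMA C:?S. Pow (econf k Y C))" unfolding Near_def by auto
 show "finite (Near Y s)" unfolding eq by (rule finite_SigmaI[OF fS fE])
 have "card (Near Y s) = (\<Sum>C\<in>?S. card (Pow (econf k Y C)))"
  unfolding eq by (rule card_SigmaI[OF fS]) (rule ballI, rule fE)
 also have "... <= (\<Sum>C\<in>?S. 2 ^ ((b + k) * (b + k)))"
 proof (rule sum_mono)
  fix C assume C: "C : ?S"
  have "econf k Y C \<subseteq> (Y Un C) \<times> (Y Un C)" unfolding econf_def by auto
  hence "card (econf k Y C) <= card ((Y Un C) \<times> (Y Un C))" using assms(1) fC[OF C] by (intro card_mono) auto
  also have "... <= (b + k) * (b + k)"
  proof -
   have "card (Y Un C) <= b + k" using card_Un_le[of Y C] assms(3) C by auto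
   thus ?thesis unfolding card_cartesian_product by (intro mult_le_mono)
  qed
  finally show "card (Pow (econf k Y C)) <= 2 ^ ((b + k) * (b + k))"
   using finite_econf[OF assms(1) fC[OF C]] by (simp add: card_Pow power_increasing)
 qed
 also have "... = card ?S * 2 ^ ((b + k) * (b + k))" by simp
 also have "card ?S <= (b * (2 * s + 1) + 1) ^ k"
 proof -
  have "card ?B <= b * (2 * s + 1)" using card_near[OF assms(1,2), of n s] assms(3) by (meson le_trans mult_le_mono1)
  hence "(card ?B + 1) ^ k <= (b * (2 * s + 1) + 1) ^ k" by (intro power_mono) auto
  thus ?thesis using card_small_subsets[OF fB, of k] by linarith
 qed
 finally show "card (Near Y s) <= (b * (2 * s + 1) + 1) ^ k * 2 ^ ((b + k) * (b + k))" by simp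
qed

abbreviation "badi i \<equiv> bad k n \<rho> Cs T J (pos i)"

lemma finite_badi: "i : Idx ==> finite (badi i)"
proof -
 assume i: "i : Idx"
 have "badi i \<subseteq> Pow {1..n} \<times> Pow ({1..n} \<times> {1..n})"
  unfolding bad_def using Wv_sub[OF i] by blast
 thus ?thesis by (rule finite_subset) auto
qed

text \<open>Edges inside the conditioned set \<open>F\<close> count as given, so only what a bad
  configuration adds outside \<open>Y\<close> is estimated. In general \<open>small_sums\<close>
  makes this a bounded sum. If no window meets \<open>F\<close>, more is gained: either the
  extension goes far, or it is one of the few near ones, and then it still contains an edge longer
  than \<rho> with an end outside \<open>F\<close>.\<close>

lemma inner_sum:
 assumes i: "i : Idx" and F: "finite F" "T 0 \<subseteq> F" and b: "card F + (N + 1) * (h + N) <= b"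
  and MS: "small_sums k b K \<epsilon>"
  and \<rho>0: "1 <= \<rho>0"
 shows "(\<Sum>(C, Q)\<in>badi i. \<Prod>e\<in>Q - F \<times> F. pe \<alpha> e) <= 2 ^ b * 2 ^ (b * b) * (K + 1)"
  and "hit F i = {} ==> (\<Sum>(C, Q)\<in>badi i. \<Prod>e\<in>Q - F \<times> F. pe \<alpha> e) <=
   2 ^ b * 2 ^ (b * b) * (K * real \<rho>0 powr - \<epsilon> + real ((b * (2 * (k * \<rho>0) + 1) + 1) ^ k * 2 ^ ((b + k) * (b + k))) * real \<rho> powr - \<alpha>)"
proof -
 note MS' = small_sumsD[OF MS, where n = n]
 define W where "W = Wv Cs T (pos i)"
 define Y where "Y = F Un W"
 have fY: "finite Y" "Y ~= {}" unfolding Y_def W_def using F fin_Wv(1) T0ne by auto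
 have cY: "card Y <= b" unfolding Y_def W_def using card_Un_le[of F "Wv Cs T (pos i)"] fin_Wv(2)[of i] b by linarith
 have cF: "card F <= b" using b by linarith
 \<comment> \<open>The part inside \<open>Y\<close> takes at most \<open>2 ^ b * 2 ^ (b * b)\<close>
   values; the rest is a rigid extension of \<open>Y\<close>.\<close>
 define \<Phi> where "\<Phi> = (%(C, Q). ((C Int Y :: nat set, Q Int Y \<times> Y :: edges), (C - Y, Q - Y \<times> Y)))"
 let ?A = "Pow Y \<times> Pow (Y \<times> Y)"
 have cA: "real (card ?A) <= 2 ^ b * 2 ^ (b * b)"
 proof -
  have "card ?A = 2 ^ card Y * 2 ^ (card Y * card Y)" using fY by (simp add: card_cartesian_product card_Pow)
  also have "... <= 2 ^ b * 2 ^ (b * b)" using cY by (intro mult_le_mono power_increasing) auto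
  finally have "real (card ?A) <= real (2 ^ b * 2 ^ (b * b))" by (rule of_nat_mono)
  thus ?thesis by simp
 qed
 have inj: "inj_on \<Phi> (badi i)"
 proof (rule inj_onI)
  fix x x' assume eq: "\<Phi> x = \<Phi> x'"
  obtain C Q C' Q' where xe: "x = (C, Q)" "x' = (C', Q')" by (metis prod.exhaust)
  have "\<Phi> (C, Q) = \<Phi> (C', Q')" using eq xe by simp
  hence "C Int Y = C' Int Y" "C - Y = C' - Y" "Q Int Y \<times> Y = Q' Int Y \<times> Y" "Q - Y \<times> Y = Q' - Y \<times> Y" unfolding \<Phi>_def by auto
  hence "C = C' & Q = Q'" by (metis Int_Diff_Un)
  thus "x = x'" using xe by simp
 qed
 have badD: "C \<subseteq> {1..n}" "card C <= k" "finite C" "Q \<subseteq> {(u, v). u < v & u : W Un C & v : W Un C}" "rigid (symc Q) W (W Un C)" "finite Q"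
   "\<exists>c\<in>Cs. \<exists>j\<in>{1..k + 1}. \<exists>a b. (a, b) : symc Q & ad a (pos i c) <= j * \<rho> & (j + 1) * \<rho> < ad b (pos i c)"
  if CQ: "(C, Q) : badi i" for C Q
 proof -
  show C: "C \<subseteq> {1..n}" "card C <= k" "Q \<subseteq> {(u, v). u < v & u : W Un C & v : W Un C}" "rigid (symc Q) W (W Un C)"
   "\<exists>c\<in>Cs. \<exists>j\<in>{1..k + 1}. \<exists>a b. (a, b) : symc Q & ad a (pos i c) <= j * \<rho> & (j + 1) * \<rho> < ad b (pos i c)"
   using CQ unfolding bad_def W_def by auto
  show fC: "finite C" using C(1) finite_subset by auto
  have "finite ((W Un C) \<times> (W Un C))" using fC fin_Wv(1)[of i] unfolding W_def by simp
  thus "finite Q" by (rule finite_subset[rotated]) (use C(3) in auto)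
 qed
 have new: "C - Y \<subseteq> {1..n} & (C - Y) Int Y = {} & card (C - Y) <= k & Q - Y \<times> Y \<subseteq> econf k Y (C - Y) & rigid (symc (Q - Y \<times> Y)) Y (Y Un (C - Y))"
  if CQ: "(C, Q) : badi i" for C Q
 proof (intro conjI)
  note d = badD[OF CQ]
  show "C - Y \<subseteq> {1..n}" "(C - Y) Int Y = {}" using d(1) by auto
  show "card (C - Y) <= k" using card_mono[OF d(3), of "C - Y"] d(2) by auto
  have WY: "W \<subseteq> Y" unfolding Y_def by blast
  show "Q - Y \<times> Y \<subseteq> econf k Y (C - Y)" unfolding econf_def using d(4) WY by auto
  show "rigid (symc (Q - Y \<times> Y)) Y (Y Un (C - Y))"
   by (rule rigid_symc_new[OF d(5) _ WY fY(1)]) (use d(4) in auto)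
 qed
 have prodQ: "(\<Prod>e\<in>Q - F \<times> F. pe \<alpha> e) <= (\<Prod>e\<in>Q - Y \<times> Y. pe \<alpha> e)" if "(C, Q) : badi i" for C Q
  by (rule prod_subset_le) (use badD(6)[OF that] in \<open>auto simp: Y_def\<close>)
 have pe_case: "(\<Prod>e\<in>Q. pe \<alpha> e) = (\<Prod>(u, v)\<in>Q. edge_prob \<alpha> (v - u))" for Q
  by (simp add: case_prod_beta)
 have Q0: "0 <= (\<Prod>e\<in>Q. pe \<alpha> e)" for Q using pe_bounds by (intro prod_nonneg) auto
 show "(\<Sum>(C, Q)\<in>badi i. \<Prod>e\<in>Q - F \<times> F. pe \<alpha> e) <= 2 ^ b * 2 ^ (b * b) * (K + 1)"
 proof -
  let ?B = "insert ({}, {}) (rconf n k Y 1)"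
  have "(\<Sum>x\<in>badi i. (case x of (C, Q) => \<Prod>e\<in>Q - F \<times> F. pe \<alpha> e)) <= real (card ?A) * (\<Sum>x\<in>?B. \<Prod>e\<in>snd x. pe \<alpha> e)"
  proof (rule sum_le_image[OF finite_badi[OF i] inj])
   show "\<Phi> ` badi i \<subseteq> ?A \<times> ?B"
   proof (rule image_subsetI)
    fix x assume x: "x : badi i"
    obtain C Q where xe: "x = (C, Q)" by (cases x)
    have CQ: "(C, Q) : badi i" using x xe by simp
    have "(C - Y, Q - Y \<times> Y) : ?B"
    proof (cases "C - Y = {}")
     case True
     hence "Q - Y \<times> Y \<subseteq> {}" using new[OF CQ] unfolding econf_def by auto
     thus ?thesis using True by simp
    next
     case False
     thus ?thesis using new[OF CQ] unfolding rconf_def by simp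
    qed
    moreover have "(C Int Y, Q Int Y \<times> Y) : ?A" by blast
    ultimately show "\<Phi> x : ?A \<times> ?B" unfolding xe \<Phi>_def prod.case by (rule SigmaI[rotated])
   qed
   show "finite ?A" "finite ?B" using fY finite_rconf by auto
   show "(case x of (C, Q) => \<Prod>e\<in>Q - F \<times> F. pe \<alpha> e) <= (\<Prod>e\<in>snd (snd (\<Phi> x)). pe \<alpha> e)" if "x : badi i" for x
    using prodQ[of "fst x" "snd x"] that unfolding \<Phi>_def by (simp add: case_prod_beta)
  qed (use Q0 in auto)
  also have "(\<Sum>x\<in>?B. \<Prod>e\<in>snd x. pe \<alpha> e) <= (\<Sum>x\<in>rconf n k Y 1. \<Prod>e\<in>snd x. pe \<alpha> e) + 1"
   using finite_rconf[OF fY(1), of n k 1] by (simp add: sum.insert_if)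
  also have "(\<Sum>x\<in>rconf n k Y 1. \<Prod>e\<in>snd x. pe \<alpha> e) <= K"
   using MS'[OF fY cY, of 1] by (simp add: case_prod_beta)
  finally have "(\<Sum>(C, Q)\<in>badi i. \<Prod>e\<in>Q - F \<times> F. pe \<alpha> e) <= real (card ?A) * (K + 1)"
   by (simp add: mult_left_mono)
  also have "... <= 2 ^ b * 2 ^ (b * b) * (K + 1)"
  proof (rule mult_right_mono[OF cA])
   have "0 <= rsum n k Y 1"
    using Q0 by (intro sum_nonneg) (auto simp: pe_case[symmetric])
   thus "0 <= K + 1" using MS'[OF fY cY, of 1] by simp
  qed
  finally show ?thesis .
 qed
 show "(\<Sum>(C, Q)\<in>badi i. \<Prod>e\<in>Q - F \<times> F. pe \<alpha> e) <=
   2 ^ b * 2 ^ (b * b) * (K * real \<rho>0 powr - \<epsilon> + real ((b * (2 * (k * \<rho>0) + 1) + 1) ^ k * 2 ^ ((b + k) * (b + k))) * real \<rho> powr - \<alpha>)"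
  if nohit: "hit F i = {}"
 proof -
  let ?R = "rconf n k Y \<rho>0" and ?N = "Near Y (k * \<rho>0)"
  define gb where "gb x = (if x : ?R then (\<Prod>e\<in>snd x. pe \<alpha> e) else real \<rho> powr - \<alpha>)" for x
  have gb0: "0 <= gb x" for x unfolding gb_def using Q0 by simp
  \<comment> \<open>The edge jumping across an annulus starts in a window, hence outside
    \<open>F\<close>. So it is not among the edges already given, and its length exceeds
    \<rho>.\<close>
  have edge: "(\<Prod>e\<in>Q - F \<times> F. pe \<alpha> e) <= real \<rho> powr - \<alpha>" if CQ: "(C, Q) : badi i" for C Q
  proof -
   note d = badD[OF CQ]
   obtain c j x z where cj: "c : Cs" "j : {1..k + 1}" "(x, z) : symc Q" "ad x (pos i c) <= j * \<rho>" "(j + 1) * \<rho> < ad z (pos i c)" using d(7) by blast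
   have "j * \<rho> <= (k + 3) * \<rho>" using cj(2) by (intro mult_le_mono1) simp
   hence "ad x (pos i c) <= r" using cj(4) par(2) by linarith
   hence xF: "x ~: F" using nohit cj(1) unfolding hit_def by blast
   have "ad z (pos i c) <= ad z x + ad x (pos i c)" by (rule ad_tri)
   hence len: "\<rho> < ad z x" using cj(4,5) by simp
   define e where "e = (min x z, max x z)"
   have eQ: "e : Q - F \<times> F" using cj(3) xF d(4) unfolding symc_def e_def by (auto simp: min_def max_def)
   have diff: "snd e - fst e = ad z x" unfolding e_def ad_def by auto
   have "(\<Prod>e\<in>Q - F \<times> F. pe \<alpha> e) <= (\<Prod>e\<in>{e}. pe \<alpha> e)" by (rule prod_subset_le) (use d(6) eQ in auto)
   also have "... = edge_prob \<alpha> (ad z x)" using diff by simp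
   also have "... <= real (ad z x) powr - \<alpha>" by (rule edge_prob_le[OF alpha(1)]) (use len in simp)
   also have "... <= real \<rho> powr - \<alpha>" using len par(1) alpha(1) by (intro powr_mono2') auto
   finally show ?thesis .
  qed
  have "(\<Sum>x\<in>badi i. (case x of (C, Q) => \<Prod>e\<in>Q - F \<times> F. pe \<alpha> e)) <= real (card ?A) * (\<Sum>x\<in>?R Un ?N. gb x)"
  proof (rule sum_le_image[OF finite_badi[OF i] inj])
   show "\<Phi> ` badi i \<subseteq> ?A \<times> (?R Un ?N)"
   proof (rule image_subsetI)
    fix x assume x: "x : badi i"
    obtain C Q where xe: "x = (C, Q)" by (cases x)
    have CQ: "(C, Q) : badi i" using x xe by simp
    have "(C - Y, Q - Y \<times> Y) : ?R Un ?N"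
    proof (cases "\<exists>c\<in>C - Y. k * \<rho>0 <= nd c Y")
     case True
     hence "(C - Y, Q - Y \<times> Y) : ?R" using new[OF CQ] unfolding rconf_def by auto
     thus ?thesis by blast
    next
     case False
     have s: "C - Y \<subseteq> {1..n}" using new[OF CQ] by (rule conjunct1)
     have "C - Y \<subseteq> {x. x <= n & nd x Y < k * \<rho>0}"
     proof
      fix x assume x: "x : C - Y"
      hence "nd x Y < k * \<rho>0" using False not_le by blast
      thus "x : {x. x <= n & nd x Y < k * \<rho>0}" using subsetD[OF s x] by simp
     qed
     hence "(C - Y, Q - Y \<times> Y) : ?N" using new[OF CQ] unfolding Near_def by simp
     thus ?thesis by blast
    qed
    moreover have "(C Int Y, Q Int Y \<times> Y) : ?A" by blast
    ultimately show "\<Phi> x : ?A \<times> (?R Un ?N)" unfolding xe \<Phi>_def prod.case by (rule SigmaI[rotated])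
   qed
   show "finite ?A" "finite (?R Un ?N)" using fY finite_rconf card_Near(1)[OF fY cY] by auto
   show "(case x of (C, Q) => \<Prod>e\<in>Q - F \<times> F. pe \<alpha> e) <= gb (snd (\<Phi> x))" if x: "x : badi i" for x
   proof -
    obtain C Q where CQ: "x = (C, Q)" by fastforce
    show ?thesis using prodQ[of C Q] edge[of C Q] x unfolding CQ gb_def \<Phi>_def by simp
   qed
  qed (use gb0 in auto)
  also have "... <= 2 ^ b * 2 ^ (b * b) * (\<Sum>x\<in>?R Un ?N. gb x)"
   using gb0 by (intro mult_right_mono[OF cA] sum_nonneg) auto
  also have "(\<Sum>x\<in>?R Un ?N. gb x) <= K * real \<rho>0 powr - \<epsilon> + real ((b * (2 * (k * \<rho>0) + 1) + 1) ^ k * 2 ^ ((b + k) * (b + k))) * real \<rho> powr - \<alpha>"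
  proof -
   have "(\<Sum>x\<in>?R Un ?N. gb x) = (\<Sum>x\<in>?R. gb x) + (\<Sum>x\<in>?N - ?R. gb x)"
    using finite_rconf[OF fY(1)] card_Near(1)[OF fY cY] by (subst sum.union_disjoint[symmetric]) auto
   also have "(\<Sum>x\<in>?R. gb x) = (\<Sum>(C, Q)\<in>?R. \<Prod>(u, v)\<in>Q. edge_prob \<alpha> (v - u))"
    unfolding gb_def by (intro sum.cong) (auto simp: case_prod_beta)
   also have "... <= K * real \<rho>0 powr - \<epsilon>" using MS'[OF fY cY \<rho>0] .
   also have "(\<Sum>x\<in>?N - ?R. gb x) = real (card (?N - ?R)) * real \<rho> powr - \<alpha>" unfolding gb_def by simp
   also have "... <= real ((b * (2 * (k * \<rho>0) + 1) + 1) ^ k * 2 ^ ((b + k) * (b + k))) * real \<rho> powr - \<alpha>"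
   proof (intro mult_right_mono of_nat_mono)
    have "card (?N - ?R) <= card ?N" using card_Near(1)[OF fY cY] by (intro card_mono) auto
    thus "card (?N - ?R) <= (b * (2 * (k * \<rho>0) + 1) + 1) ^ k * 2 ^ ((b + k) * (b + k))"
     using card_Near(2)[OF fY cY, of "k * \<rho>0"] by linarith
   qed simp
   finally show ?thesis by simp
  qed
  finally show ?thesis by (simp add: mult_left_mono)
 qed
qed

definition HH :: "((nat => nat) \<times> nat set \<times> edges) set" where
 "HH = (SIGMA i:Idx. badi i)"

definition es :: "(nat => nat) \<times> nat set \<times> edges => edges" where
 "es = (%(i, C, Q). des J (pos i) Un Q)"

text \<open>Placements are sorted by the set \<open>L\<close> of parts whose window meets the
  conditioned set. For nonempty \<open>L\<close> few placements remain, which the safety inequality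
  weighs against the edges that are given; for empty \<open>L\<close> the second bound of
  \<open>inner_sum\<close> applies. Both are stated relative to the expected number of placements
  with all intended edges.\<close>

lemma bad_sum:
 assumes F: "finite F" "card F <= f0" and b: "f0 + h + (N + 1) * (h + N) <= b"
  and MS: "small_sums k b K \<epsilon>"
  and \<rho>0: "1 <= \<rho>0" and K: "0 <= K"
 shows "(\<Sum>x\<in>HH. \<Prod>e\<in>es x - F \<times> F. pe \<alpha> e) <= 2 ^ b * 2 ^ (b * b) * real (Kg ^ card Cs) * real m0 powr (- \<alpha> / 2 * real (card J)) *
  ((\<Sum>L\<in>Pow Cs - {{}}. real b ^ card L * (wL Kg L)) * (K + 1) +
   (K * real \<rho>0 powr - \<epsilon> + real ((b * (2 * (k * \<rho>0) + 1) + 1) ^ k * 2 ^ ((b + k) * (b + k))) * real \<rho> powr - \<alpha>))"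
proof -
 define F' where "F' = F Un T 0"
 have fT0: "finite (T 0)" using pp(2) finite_subset by auto
 have F': "finite F'" "T 0 \<subseteq> F'" "card F' <= f0 + h" unfolding F'_def using F hT fT0 card_Un_le[of F "T 0"] by auto
 have b': "card F' + (N + 1) * (h + N) <= b" using b F'(3) by linarith
 define M where "M = (2::real) ^ b * 2 ^ (b * b)"
 define I1 where "I1 = M * (K + 1)"
 define I2 where "I2 = M * (K * real \<rho>0 powr - \<epsilon> + real ((b * (2 * (k * \<rho>0) + 1) + 1) ^ k * 2 ^ ((b + k) * (b + k))) * real \<rho> powr - \<alpha>)"
 have M0: "0 <= M" unfolding M_def by simp
 have I0: "0 <= I1" "0 <= I2" unfolding I1_def I2_def using M0 K by (auto intro!: mult_nonneg_nonneg add_nonneg_nonneg)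
 note in1 = inner_sum(1)[OF _ F'(1,2) b' MS \<rho>0, folded M_def, folded I1_def]
 note in2 = inner_sum(2)[OF _ F'(1,2) b' MS \<rho>0, folded M_def, folded I2_def]
 define dd where "dd L = real m0 powr (- \<alpha> / 2 * (real (card J) - real (eL L)))" for L
 have fdes: "finite (des J (pos i))" if "i : Idx" for i
  using des_pairs[OF that] finite_subset[OF _ finite_vertex_pairs] by blast
 have fQ: "finite Q & des J (pos i) Int Q = {}" if "i : Idx" "(C, Q) : badi i" for i C Q
 proof -
  have "Q \<subseteq> {1..n} \<times> {1..n}" "Q Int des J (pos i) = {}" using that Wv_sub[OF that(1)] unfolding bad_def by auto
  thus ?thesis using finite_subset[of Q "{1..n} \<times> {1..n}"] by auto
 qed
 have "(\<Sum>x\<in>HH. \<Prod>e\<in>es x - F \<times> F. pe \<alpha> e) <= (\<Sum>x\<in>HH. \<Prod>e\<in>es x - F' \<times> F'. pe \<alpha> e)"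
 proof (rule sum_mono, rule prod_subset_le)
  fix x assume "x : HH"
  then obtain i C Q where x: "x = (i, C, Q)" "i : Idx" "(C, Q) : badi i" unfolding HH_def by auto
  thus "finite (es x - F \<times> F)" using fdes fQ unfolding es_def by auto
  show "es x - F' \<times> F' \<subseteq> es x - F \<times> F" unfolding F'_def by auto
 qed
 also have "... = (\<Sum>i\<in>Idx. \<Sum>(C, Q)\<in>badi i. (\<Prod>e\<in>des J (pos i) - F' \<times> F'. pe \<alpha> e) * (\<Prod>e\<in>Q - F' \<times> F'. pe \<alpha> e))"
 proof -
  have "(\<Sum>x\<in>HH. \<Prod>e\<in>es x - F' \<times> F'. pe \<alpha> e) = (\<Sum>i\<in>Idx. \<Sum>x\<in>badi i. \<Prod>e\<in>es (i, x) - F' \<times> F'. pe \<alpha> e)"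
   unfolding HH_def using finIdx finite_badi by (subst sum.Sigma) (auto simp: case_prod_beta)
  also have "... = (\<Sum>i\<in>Idx. \<Sum>(C, Q)\<in>badi i. (\<Prod>e\<in>des J (pos i) - F' \<times> F'. pe \<alpha> e) * (\<Prod>e\<in>Q - F' \<times> F'. pe \<alpha> e))"
  proof (intro sum.cong refl)
   fix i x assume i: "i : Idx" and x: "x : badi i"
   obtain C Q where CQ: "x = (C, Q)" by fastforce
   have f: "finite Q" "des J (pos i) Int Q = {}" using fQ[of i C Q] i x CQ by auto
   have "es (i, x) - F' \<times> F' = (des J (pos i) - F' \<times> F') Un (Q - F' \<times> F')" unfolding es_def CQ by auto
   thus "(\<Prod>e\<in>es (i, x) - F' \<times> F'. pe \<alpha> e) = (case x of (C, Q) => (\<Prod>e\<in>des J (pos i) - F' \<times> F'. pe \<alpha> e) * (\<Prod>e\<in>Q - F' \<times> F'. pe \<alpha> e))"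
    unfolding CQ using f fdes[OF i] by (simp, subst prod.union_disjoint) auto
  qed
  finally show ?thesis .
 qed
 also have "... = (\<Sum>i\<in>Idx. (\<Prod>e\<in>des J (pos i) - F' \<times> F'. pe \<alpha> e) * (\<Sum>(C, Q)\<in>badi i. (\<Prod>e\<in>Q - F' \<times> F'. pe \<alpha> e)))"
  by (simp add: sum_distrib_left case_prod_beta)
 also have "... <= (\<Sum>i\<in>Idx. dd (hit F' i) * (if hit F' i = {} then I2 else I1))"
 proof (rule sum_mono)
  fix i assume i: "i : Idx"
  have hs: "hit F' i \<subseteq> Cs" unfolding hit_def by blast
  have "dL i (hit F' i) \<subseteq> des J (pos i) - F' \<times> F'"
  proof
   fix e assume e: "e : dL i (hit F' i)"
   then obtain c t d s where m: "((c, t), (d, s)) : J" "~ (c : insert 0 (hit F' i) & d : insert 0 (hit F' i))" "e = (pos i c + t, pos i d + s)"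
    unfolding dL_def by blast
   note jd = JD[OF m(1)]
   have out: "pos i c + t ~: F'" if "c : Cs" "c ~: hit F' i" "t : T c" for c t
   proof
    assume f: "pos i c + t : F'"
    have "pos i c + t : vset (pos i) T c" using that unfolding vset_def by blast
    hence "ad (pos i c + t) (pos i c) <= r" using inD[OF that(1)] rr(3) le_trans by blast
    thus False using that f unfolding hit_def by blast
   qed
   have "e ~: F' \<times> F'" using m(2,3) out[of c t] out[of d s] jd by auto
   thus "e : des J (pos i) - F' \<times> F'" using e dL_des by blast
  qed
  hence 1: "(\<Prod>e\<in>des J (pos i) - F' \<times> F'. pe \<alpha> e) <= dd (hit F' i)"
   unfolding dd_def by (rule prod_des_le[OF i hs]) (use fdes[OF i] in auto)
  have 2: "(\<Sum>(C, Q)\<in>badi i. \<Prod>e\<in>Q - F' \<times> F'. pe \<alpha> e) <= (if hit F' i = {} then I2 else I1)"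
   using in1[OF i] in2[OF i] by simp
  show "(\<Prod>e\<in>des J (pos i) - F' \<times> F'. pe \<alpha> e) * (\<Sum>(C, Q)\<in>badi i. (\<Prod>e\<in>Q - F' \<times> F'. pe \<alpha> e)) <=
   dd (hit F' i) * (if hit F' i = {} then I2 else I1)"
   by (rule mult_mono[OF 1 2]) (use pe_bounds in \<open>auto simp: dd_def intro!: sum_nonneg prod_nonneg\<close>)
 qed
 also have "... = (\<Sum>L\<in>Pow Cs. \<Sum>i\<in>{i : Idx. hit F' i = L}. dd (hit F' i) * (if hit F' i = {} then I2 else I1))"
  by (rule sum.group[symmetric]) (use finIdx finCs in \<open>auto simp: hit_def\<close>)
 also have "... = (\<Sum>L\<in>Pow Cs. real (card {i : Idx. hit F' i = L}) * (dd L * (if L = {} then I2 else I1)))"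
  by (rule sum.cong) auto
 also have "... <= (\<Sum>L\<in>Pow Cs. real (b ^ card L * Kg ^ (card Cs - card L)) * (dd L * (if L = {} then I2 else I1)))"
 proof (rule sum_mono, rule mult_right_mono)
  fix L assume L: "L : Pow Cs"
  have "card {i : Idx. hit F' i = L} <= card F' ^ card L * Kg ^ (card Cs - card L)" using card_hit[OF F'(1)] L by blast
  also have "... <= b ^ card L * Kg ^ (card Cs - card L)" using b' by (intro mult_le_mono1 power_mono) auto
  finally show "real (card {i : Idx. hit F' i = L}) <= real (b ^ card L * Kg ^ (card Cs - card L))" by (rule of_nat_mono)
  show "0 <= dd L * (if L = {} then I2 else I1)" using I0 unfolding dd_def by simp
 qed
 also have "... = (\<Sum>L\<in>Pow Cs. real (Kg ^ card Cs) * real m0 powr (- \<alpha> / 2 * real (card J)) *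
   (real b ^ card L * (wL Kg L) * (if L = {} then I2 else I1)))"
 proof (rule sum.cong[OF refl])
  fix L assume L: "L : Pow Cs"
  have cL: "card L <= card Cs" using L finCs card_mono by blast
  have Kp: "real (Kg ^ (card Cs - card L)) = real (Kg ^ card Cs) * real Kg powr - real (card L)"
   unfolding of_nat_power using par(4) cL by (simp add: power_diff powr_minus powr_realpow divide_inverse)
  have dp: "dd L = real m0 powr (- \<alpha> / 2 * real (card J)) * real m0 powr (\<alpha> / 2 * real (eL L))"
   unfolding dd_def powr_add[symmetric] by (simp add: algebra_simps)
  show "real (b ^ card L * Kg ^ (card Cs - card L)) * (dd L * (if L = {} then I2 else I1)) =
   real (Kg ^ card Cs) * real m0 powr (- \<alpha> / 2 * real (card J)) *
   (real b ^ card L * (wL Kg L) * (if L = {} then I2 else I1))"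
   unfolding of_nat_mult Kp dp by (simp add: mult_ac)
 qed
 also have "... = real (Kg ^ card Cs) * real m0 powr (- \<alpha> / 2 * real (card J)) *
   (\<Sum>L\<in>Pow Cs. real b ^ card L * (wL Kg L) * (if L = {} then I2 else I1))"
  by (simp add: sum_distrib_left)
 also have "(\<Sum>L\<in>Pow Cs. real b ^ card L * (wL Kg L) * (if L = {} then I2 else I1)) =
   I2 + (\<Sum>L\<in>Pow Cs - {{}}. real b ^ card L * (wL Kg L) * I1)"
 proof -
  have fp: "finite (Pow Cs)" using finCs by simp
  have e0: "eL {} = 0"
  proof -
   have "{((c, t), (d, s)) : J. c : insert 0 {} & d : insert 0 {}} = {}" using JD by fastforce
   thus ?thesis unfolding eL_def by (simp only: card.empty)
  qed
  show ?thesis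
   by (subst sum.remove[OF fp, of "{}"]) (use par(3,4) e0 in auto)
 qed
 also have "... = M * ((\<Sum>L\<in>Pow Cs - {{}}. real b ^ card L * (wL Kg L)) * (K + 1) +
   (K * real \<rho>0 powr - \<epsilon> + real ((b * (2 * (k * \<rho>0) + 1) + 1) ^ k * 2 ^ ((b + k) * (b + k))) * real \<rho> powr - \<alpha>))"
  unfolding I1_def I2_def sum_distrib_right[symmetric] by (simp add: algebra_simps)
 finally show ?thesis unfolding M_def by (simp add: mult_ac)
qed

end

section \<open>Events in windows of the random graph\<close>

context irrational_exponent
begin

definition RR :: "nat => (nat \<times> nat => bool) => edges" where
 "RR n w = symc {e : vertex_pairs n. w e}"

lemma RR_iff: "(a, b) : RR n w \<longleftrightarrow> (a, b) : vertex_pairs n & w (a, b) \<or> (b, a) : vertex_pairs n & w (b, a)"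
 unfolding RR_def symc_def by auto

lemma sym_RR: "sym (RR n w)"
 unfolding sym_def RR_iff by blast

lemma RR_less: "u < v ==> (u, v) : RR n w \<longleftrightarrow> (u, v) : vertex_pairs n & w (u, v)"
 unfolding RR_iff vertex_pairs_def by auto

definition ballp :: "nat => nat => nat => edges" where
 "ballp n x r = {e : vertex_pairs n. ad (fst e) x <= r & ad (snd e) x <= r}"

lemma RR_cong_ball:
 assumes "!!e. e : ballp n x r ==> w e = w' e" "ad a x <= r" "ad b x <= r"
 shows "(a, b) : RR n w \<longleftrightarrow> (a, b) : RR n w'"
 using assms unfolding RR_iff ballp_def by auto

lemma dep_wgood:
 assumes b0: "b0 <= r" and T: "Tc \<subseteq> {..r}"
 shows "dep {w. wgood k r b0 Tc Gc x (RR n w)} (ballp n x r)"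
proof (rule depI)
 fix w w' assume e: "!!e. e : ballp n x r ==> w e = w' e" and "w : {w. wgood k r b0 Tc Gc x (RR n w)}"
 hence g: "wgood k r b0 Tc Gc x (RR n w)" by simp
 note g1 = g[unfolded wgood_def, THEN conjunct1, rule_format] and g2 = g[unfolded wgood_def, THEN conjunct2, rule_format]
 have c: "(a, b) : RR n w \<longleftrightarrow> (a, b) : RR n w'" if "ad a x <= r" "ad b x <= r" for a b
  by (rule RR_cong_ball[OF _ that]) (rule e)
 have "wgood k r b0 Tc Gc x (RR n w')"
  unfolding wgood_def
 proof (rule conjI, intro allI impI)
  fix a b assume "ad a x <= b0" "ad b x <= b0"
  thus "(a, b) : RR n w' \<longleftrightarrow> (\<exists>t s. a = x + t & b = x + s & (t, s) : Gc)"
   using g1[of a b] c[of a b] b0 by simp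
 next
  show "\<forall>Z. (\<forall>z\<in>Z. ad z x <= r) --> Z Int (%t. x + t) ` Tc = {} --> card Z <= k -->
    rigid (RR n w') ((%t. x + t) ` Tc) ((%t. x + t) ` Tc Un Z) --> (\<forall>z\<in>Z. ad z x <= b0)"
  proof (intro allI impI)
   fix Z assume Z: "\<forall>z\<in>Z. ad z x <= r" "Z Int (%t. x + t) ` Tc = {}" "card Z <= k"
    "rigid (RR n w') ((%t. x + t) ` Tc) ((%t. x + t) ` Tc Un Z)"
   have in_r: "ad u x <= r" if "u : (%t. x + t) ` Tc Un Z" for u
    using that Z(1) T by (auto simp: ad_def)
   have "rigid (RR n w) ((%t. x + t) ` Tc) ((%t. x + t) ` Tc Un Z)"
    by (rule rigid_edges_cong[OF Z(4)]) (use c in_r in blast)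
   thus "\<forall>z\<in>Z. ad z x <= b0" using g2[of Z] Z(1-3) by blast
  qed
 qed
 thus "w' : {w. wgood k r b0 Tc Gc x (RR n w)}" by simp
qed

lemma Pr_UN_le: "finite I ==> Pr n (\<Union>i\<in>I. A i) <= (\<Sum>i\<in>I. Pr n (A i))"
 by (rule measure_pmf.finite_measure_subadditive_finite) auto

lemma Pr_mono: "A \<subseteq> B ==> Pr n A <= Pr n B"
 by (rule measure_pmf.finite_measure_mono) auto

lemma Pr_Un_le: "Pr n (A Un B) <= Pr n A + Pr n B"
 by (rule measure_Un_le) auto

lemma prob_pattern_eq:
 assumes BP: "BP \<subseteq> vertex_pairs n"
 shows "Pr n {w. \<forall>e\<in>BP. w e \<longleftrightarrow> e : H} = (\<Prod>e\<in>BP. if e : H then pe \<alpha> e else 1 - pe \<alpha> e)"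
proof -
 have fBP: "finite BP" by (rule finite_subset[OF BP]) simp
 have one: "Pr n {w. w e \<longleftrightarrow> e : H} = (if e : H then pe \<alpha> e else 1 - pe \<alpha> e)" if e: "e : BP" for e
 proof -
  have eq: "Pr n {w. w e} = pe \<alpha> e" using prob_edges[of "{e}" n] subsetD[OF BP e] by simp
  moreover have "Pr n {w. ~ w e} = 1 - Pr n {w. w e}"
   using measure_pmf.prob_compl[of "{w. w e}" "EI n"] by (simp add: Compl_eq_Diff_UNIV[symmetric] Collect_neg_eq)
  ultimately show ?thesis by simp
 qed
 have "{w. \<forall>e\<in>BP. w e \<longleftrightarrow> e : H} = (\<Inter>e\<in>BP. {w. w e \<longleftrightarrow> e : H})" by auto
 hence "Pr n {w. \<forall>e\<in>BP. w e \<longleftrightarrow> e : H} = Pr n (\<Inter>e\<in>BP. {w. w e \<longleftrightarrow> e : H})" by (rule arg_cong)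
 also have "... = (\<Prod>e\<in>BP. Pr n {w. w e \<longleftrightarrow> e : H})"
  by (rule prob_indep[where S = "%e. {e}"]) (use BP fBP in \<open>auto intro: depI\<close>)
 also have "... = (\<Prod>e\<in>BP. if e : H then pe \<alpha> e else 1 - pe \<alpha> e)" using one by (rule prod.cong[OF refl])
 finally show ?thesis .
qed

text \<open>The edge probability is at most \<open>2 powr - \<alpha>\<close>, attained at lengths 1
  and 2, so absent edges have a chance bounded below as well. \<open>d + 2\<close> instead of
  \<open>d\<close> keeps the lower bound valid at length 1.\<close>

lemma prob_pattern:
 assumes BP: "BP \<subseteq> vertex_pairs n" and short: "!!e. e : BP ==> snd e - fst e <= d" and card: "card BP <= m"
 shows "(min (real (d + 2) powr - \<alpha>) (1 - 2 powr - \<alpha>)) ^ m <= Pr n {w. \<forall>e\<in>BP. w e \<longleftrightarrow> e : H}"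
  and "0 < min (real (d + 2) powr - \<alpha>) (1 - 2 powr - \<alpha>)"
proof -
 let ?\<beta> = "min (real (d + 2) powr - \<alpha>) (1 - 2 powr - \<alpha>)"
 have two: "(2::real) powr - \<alpha> < 1" using alpha(1) powr_less_mono[of "- \<alpha>" 0 2] by simp
 thus b0: "0 < ?\<beta>" by simp
 have b1: "?\<beta> <= 1" by (simp add: min.coboundedI2)
 have one: "?\<beta> <= (if e : H then pe \<alpha> e else 1 - pe \<alpha> e)" if e: "e : BP" for e
 proof -
  have lt: "fst e < snd e" using BP e unfolding vertex_pairs_def by auto
  have "real (d + 2) powr - \<alpha> <= pe \<alpha> e"
   unfolding edge_prob_def using lt short[OF e] alpha(1) by (auto intro!: powr_mono2')
  moreover have "pe \<alpha> e <= 2 powr - \<alpha>"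
   unfolding edge_prob_def using lt alpha(1) by (auto intro!: powr_mono2')
  ultimately show ?thesis by (auto simp: min_le_iff_disj)
 qed
 have "?\<beta> ^ m <= ?\<beta> ^ card BP" using card b0 b1 by (intro power_decreasing) auto
 also have "... = (\<Prod>e\<in>BP. ?\<beta>)" by (rule prod_constant[symmetric])
 also have "... <= Pr n {w. \<forall>e\<in>BP. w e \<longleftrightarrow> e : H}"
  unfolding prob_pattern_eq[OF BP] using one b0 by (intro prod_mono) (auto intro: less_imp_le)
 finally show "?\<beta> ^ m <= Pr n {w. \<forall>e\<in>BP. w e \<longleftrightarrow> e : H}" .
qed

lemma rigid_econf:
 fixes k :: nat
 assumes r: "rigid (RR n w) X (X Un C)"
 defines "Q \<equiv> {(u, v) : econf k X C. (u, v) : RR n w}"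
 shows "rigid (symc Q) X (X Un C)" "Q \<subseteq> vertex_pairs n" "\<forall>e\<in>Q. w e" "Q \<subseteq> econf k X C"
proof -
 show "rigid (symc Q) X (X Un C)"
 proof (rule rigid_edges_cong[OF r])
  fix u v assume uv: "u : X Un C" "v : X Un C" "~ (u : X & v : X)"
  have s: "(u, v) : RR n w \<longleftrightarrow> (v, u) : RR n w" using sym_RR[of n w] by (meson symD)
  have "u ~= v" if "(u, v) : RR n w" using that unfolding RR_iff vertex_pairs_def by auto
  thus "(u, v) : RR n w \<longleftrightarrow> (u, v) : symc Q"
   using uv s unfolding symc_def Q_def econf_def by (auto simp: neq_iff)
 qed
 show "Q \<subseteq> vertex_pairs n" "\<forall>e\<in>Q. w e" "Q \<subseteq> econf k X C" unfolding Q_def econf_def using RR_less by auto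
qed

lemma powr_small:
 fixes K \<epsilon> t :: real
 assumes "0 < K" "0 < \<epsilon>" "0 < t"
 shows "\<exists>s0::nat. 1 <= s0 & K * real s0 powr - \<epsilon> <= t"
proof -
 define s0 where "s0 = nat \<lceil>(K / t) powr (1 / \<epsilon>)\<rceil> + 1"
 have ge: "(K / t) powr (1 / \<epsilon>) <= real s0" unfolding s0_def by linarith
 have "real s0 powr - \<epsilon> <= ((K / t) powr (1 / \<epsilon>)) powr - \<epsilon>" using ge assms by (intro powr_mono2') auto
 also have "... = t / K" using assms by (simp add: powr_powr powr_minus)
 finally show ?thesis using assms by (intro exI[of _ s0]) (auto simp: s0_def field_simps)
qed

text \<open>Prescribe all pairs in the ball of radius \<open>b0\<close>, at constant cost. A rigid
  extension leaving the ball then relies on pairs outside it only; these are independent of the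
  prescription, and by \<open>multi_scale\<close> such extensions occur with probability at most one
  half. The bound \<gamma> is the same for all windows, however large \<open>r\<close> is.\<close>

lemma window_prob:
 assumes k: "1 <= k"
 shows "\<exists>\<gamma>>0. \<exists>b0\<ge>N. \<forall>n r x Tc Gc. Tc \<subseteq> {1..N} --> Gc \<subseteq> Tc \<times> Tc --> sym Gc --> irrefl Gc -->
  b0 <= r --> r < x --> x + r <= n --> \<gamma> <= Pr n {w. wgood k r b0 Tc Gc x (RR n w)}"
proof -
 obtain \<epsilon> where eps: "\<epsilon> > 0" and "\<forall>b. \<exists>K>0. small_sums k b K \<epsilon>"
  using multi_scale[OF k] by blast
 from this(2)[THEN spec, of "N + 1"] obtain K where K: "K > 0" and SS: "small_sums k (N + 1) K \<epsilon>" by blast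
 note MS = small_sumsD[OF SS]
 obtain s0 :: nat where s0: "1 <= s0" "K * real s0 powr - \<epsilon> <= 1 / 2" using powr_small[OF K eps, of "1 / 2"] by auto
 \<comment> \<open>The base lies within distance \<open>N\<close> of \<open>x\<close>, so a vertex
   outside the ball has distance at least \<open>k * s0\<close> from it.\<close>
 define b0 where "b0 = N + k * s0"
 define \<beta> where "\<beta> = min (real (2 * b0 + 2) powr - \<alpha>) (1 - 2 powr - \<alpha>)"
 define m where "m = (2 * b0 + 1) * (2 * b0 + 1)"
 have \<beta>0: "0 < \<beta>" unfolding \<beta>_def by (rule prob_pattern(2)[of "{}" 0]) auto
 have main: "\<beta> ^ m / 2 <= Pr n {w. wgood k r b0 Tc Gc x (RR n w)}"
  if T: "Tc \<subseteq> {1..N}" and G: "Gc \<subseteq> Tc \<times> Tc" "sym Gc" "irrefl Gc" and r: "b0 <= r" "r < x" "x + r <= n" for n r x Tc Gc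
 proof -
  let ?BP = "ballp n x b0"
  define H where "H = {(u, v). \<exists>t s. u = x + t & v = x + s & (t, s) : Gc}"
  define G1 where "G1 = {w. \<forall>e\<in>?BP. w e \<longleftrightarrow> e : H}"
  \<comment> \<open>The point \<open>x\<close> is added since \<open>small_sums\<close> asks for a
    nonempty base and \<open>Tc\<close> may be empty.\<close>
  define X where "X = (%t. x + t) ` insert 0 Tc"
  have fT: "finite Tc" using T finite_subset by auto
  have cT: "card Tc <= N" using card_mono[OF _ T] by simp
  have X: "finite X" "X ~= {}" "card X <= N + 1"
   unfolding X_def using fT cT card_image_le[of "insert 0 Tc" "%t. x + t"] by (auto simp: card_insert_if split: if_splits)
  have HX: "H \<subseteq> X \<times> X" unfolding H_def X_def using G(1) by auto
  have cB: "card ?BP <= m"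
  proof -
   have "?BP \<subseteq> {x - b0..x + b0} \<times> {x - b0..x + b0}" unfolding ballp_def by (auto simp: ad_def)
   hence "card ?BP <= card ({x - b0..x + b0} \<times> {x - b0..x + b0})" by (intro card_mono) auto
   also have "... <= m" unfolding card_cartesian_product m_def by (intro mult_le_mono) auto
   finally show ?thesis .
  qed
  have G1p: "\<beta> ^ m <= Pr n G1" unfolding \<beta>_def G1_def
  proof (rule prob_pattern(1)[OF _ _ cB])
   show "?BP \<subseteq> vertex_pairs n" unfolding ballp_def by blast
   show "snd e - fst e <= 2 * b0" if "e : ?BP" for e using that unfolding ballp_def by (auto simp: ad_def)
  qed
  let ?I = "{z : rconf n k X s0. snd z Int ?BP = {} & snd z \<subseteq> vertex_pairs n}"
  have fI: "finite ?I" using finite_rconf[OF X(1), of n k s0] by simp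
  have sub: "G1 - {w. wgood k r b0 Tc Gc x (RR n w)} \<subseteq> (\<Union>z\<in>?I. G1 Int {w. \<forall>e\<in>snd z. w e})"
  proof
   fix w assume w: "w : G1 - {w. wgood k r b0 Tc Gc x (RR n w)}"
   have first: "(a, b) : RR n w \<longleftrightarrow> (\<exists>t s. a = x + t & b = x + s & (t, s) : Gc)" if ab: "ad a x <= b0" "ad b x <= b0" for a b
   proof -
    have H_iff: "(\<exists>t s. a = x + t & b = x + s & (t, s) : Gc) \<longleftrightarrow> (a, b) : H" unfolding H_def by simp
    have Hs: "(a, b) : H \<longleftrightarrow> (b, a) : H" unfolding H_def using G(2) by (auto dest: symD)
    have range: "1 <= a" "a <= n" "1 <= b" "b <= n" using ab r by (auto simp: ad_def split: if_splits)
    consider "a = b" | "a < b" | "b < a" by linarith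
    thus ?thesis unfolding H_iff
    proof cases
     case 1
     have "(a, a) ~: H" unfolding H_def using G(3) by (auto simp: irrefl_def)
     thus "(a, b) : RR n w \<longleftrightarrow> (a, b) : H" using 1 unfolding RR_iff vertex_pairs_def by simp
    next
     case 2
     hence "(a, b) : ?BP" using ab range unfolding ballp_def vertex_pairs_def by simp
     thus "(a, b) : RR n w \<longleftrightarrow> (a, b) : H" using w 2 unfolding G1_def RR_iff ballp_def vertex_pairs_def by auto
    next
     case 3
     hence "(b, a) : ?BP" using ab range unfolding ballp_def vertex_pairs_def by simp
     thus "(a, b) : RR n w \<longleftrightarrow> (a, b) : H" using w 3 Hs unfolding G1_def RR_iff ballp_def vertex_pairs_def by auto
    qed
   qed
   have "~ wgood k r b0 Tc Gc x (RR n w)" using w by simp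
   hence "\<exists>Z. (\<forall>z\<in>Z. ad z x <= r) & Z Int (%t. x + t) ` Tc = {} & card Z <= k &
     rigid (RR n w) ((%t. x + t) ` Tc) ((%t. x + t) ` Tc Un Z) & (\<exists>z\<in>Z. ~ ad z x <= b0)"
    unfolding wgood_def using first by blast
   then obtain Z z where Z: "\<forall>z\<in>Z. ad z x <= r" "card Z <= k" "rigid (RR n w) ((%t. x + t) ` Tc) ((%t. x + t) ` Tc Un Z)" "z : Z" "~ ad z x <= b0"
    by blast
   define C where "C = Z - X"
   define Q where "Q = {(u, v) : econf k X C. (u, v) : RR n w}"
   have fZ: "finite Z" using rigidD(1)[OF Z(3)] by simp
   have r1: "rigid (RR n w) X (X Un C)"
   proof -
    have "rigid (RR n w) X ((%t. x + t) ` Tc Un Z Un X)" by (rule rigid_base[OF Z(3) _ X(1)]) (auto simp: X_def)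
    moreover have "(%t. x + t) ` Tc Un Z Un X = X Un C" unfolding C_def X_def by auto
    ultimately show ?thesis by simp
   qed
   note r2 = rigid_econf[OF r1, of k, folded Q_def]
   note Qv = r2(2,3)
   have adX: "ad y x <= N" if "y : X" for y using that T unfolding X_def by (auto simp: ad_def)
   have zC: "z : C" using Z(4,5) adX[of z] unfolding C_def b0_def by auto
   have "k * s0 <= nd z X"
   proof -
    obtain y where y: "y : X" "nd z X = ad z y" using nd_attained[OF X(1,2), of z] by blast
    have "ad z x <= ad z y + ad y x" by (rule ad_tri)
    thus ?thesis using y adX[of y] Z(5) unfolding b0_def by linarith
   qed
   moreover have "C \<subseteq> {1..n}" unfolding C_def using Z(1) r by (force simp: ad_def split: if_splits)
   moreover have "card C <= k" unfolding C_def using card_mono[OF fZ, of "Z - X"] Z(2) by auto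
   ultimately have rc: "(C, Q) : rconf n k X s0" unfolding rconf_def using zC r2(1,4) unfolding C_def by auto
   \<comment> \<open>Inside the ball the only edges are those of \<open>H\<close>, which have both
     ends in \<open>X\<close>, whereas the edges of \<open>Q\<close> have a new end.\<close>
   have "Q Int ?BP = {}"
   proof -
    have "e ~: Q" if e: "e : ?BP" for e
    proof
     assume eQ: "e : Q"
     hence "e : H" using e w Qv(2) unfolding G1_def by auto
     thus False using eQ HX unfolding Q_def econf_def by auto
    qed
    thus ?thesis by blast
   qed
   hence "(C, Q) : ?I" using rc Qv(1) by simp
   thus "w : (\<Union>z\<in>?I. G1 Int {w. \<forall>e\<in>snd z. w e})" using w Qv(2) by (intro UN_I[of "(C, Q)"]) auto
  qed
  have "Pr n (G1 - {w. wgood k r b0 Tc Gc x (RR n w)}) <= Pr n (\<Union>z\<in>?I. G1 Int {w. \<forall>e\<in>snd z. w e})" by (rule Pr_mono[OF sub])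
  also have "... <= (\<Sum>z\<in>?I. Pr n (G1 Int {w. \<forall>e\<in>snd z. w e}))" by (rule Pr_UN_le[OF fI])
  also have "... = (\<Sum>z\<in>?I. Pr n G1 * (\<Prod>e\<in>snd z. pe \<alpha> e))"
  proof (rule sum.cong[OF refl])
   fix z assume z: "z : ?I"
   have "Pr n (G1 Int {w. \<forall>e\<in>snd z. w e}) = Pr n G1 * Pr n {w. \<forall>e\<in>snd z. w e}"
    by (rule prob_indep2[of ?BP n "snd z"]) (use z in \<open>auto simp: ballp_def G1_def intro!: dep_all depI\<close>)
   thus "Pr n (G1 Int {w. \<forall>e\<in>snd z. w e}) = Pr n G1 * (\<Prod>e\<in>snd z. pe \<alpha> e)" using prob_edges[of "snd z" n] z by simp
  qed
  also have "... = Pr n G1 * (\<Sum>z\<in>?I. \<Prod>e\<in>snd z. pe \<alpha> e)" by (simp add: sum_distrib_left)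
  also have "... <= Pr n G1 * (1 / 2)"
  proof (rule mult_left_mono)
   have "(\<Sum>z\<in>?I. \<Prod>e\<in>snd z. pe \<alpha> e) <= (\<Sum>z\<in>rconf n k X s0. \<Prod>e\<in>snd z. pe \<alpha> e)"
    using finite_rconf[OF X(1)] pe_bounds by (intro sum_mono2 prod_nonneg) auto
   also have "... = rsum n k X s0" by (simp add: case_prod_beta)
   also have "... <= 1 / 2" using MS[OF X s0(1)] s0(2) by (rule order_trans)
   finally show "(\<Sum>z\<in>?I. \<Prod>e\<in>snd z. pe \<alpha> e) <= 1 / 2" .
  qed simp
  finally have half: "Pr n (G1 - {w. wgood k r b0 Tc Gc x (RR n w)}) <= Pr n G1 * (1 / 2)" .
  have "Pr n G1 <= Pr n ({w. wgood k r b0 Tc Gc x (RR n w)} Un (G1 - {w. wgood k r b0 Tc Gc x (RR n w)}))" by (rule Pr_mono) blast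
  also have "... <= Pr n {w. wgood k r b0 Tc Gc x (RR n w)} + Pr n (G1 - {w. wgood k r b0 Tc Gc x (RR n w)})" by (rule Pr_Un_le)
  finally show ?thesis using half G1p by simp
 qed
 show ?thesis
  by (rule exI[of _ "\<beta> ^ m / 2"], rule conjI, use \<beta>0 in simp, rule exI[of _ b0], rule conjI, simp add: b0_def)
   (intro allI impI, rule main)
qed

end

section \<open>Good placements: moments and independence\<close>

context grid
begin

lemma ball_uniq:
 assumes "c : Cs" "d : Cs" "i < Kg" "j < Kg" "ad u (st c + i * \<omega>) <= r" "ad u (st d + j * \<omega>) <= r"
 shows "c = d & i = j"
proof -
 have tri: "ad (st c + i * \<omega>) (st d + j * \<omega>) <= ad u (st c + i * \<omega>) + ad u (st d + j * \<omega>)"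
  using ad_tri[of "st c + i * \<omega>" "st d + j * \<omega>" u] by (simp add: ad_sym)
 have cd: "c = d"
 proof (rule ccontr)
  assume "c ~= d"
  thus False using apart[OF assms(1,2) _ assms(3,4)] tri assms(5,6) by linarith
 qed
 have far: "\<omega> <= ad (x + i * \<omega>) (x + j * \<omega>)" if "i ~= j" for x i j :: nat
 proof -
  have "\<omega> <= ad (x + i * \<omega>) (x + j * \<omega>)" if "i < j" for i j
  proof -
   have "Suc i * \<omega> <= j * \<omega>" using that by (intro mult_le_mono1) simp
   thus ?thesis by (auto simp: ad_def)
  qed
  thus ?thesis using \<open>i ~= j\<close> ad_sym by (metis neq_iff)
 qed
 have "i = j"
 proof (rule ccontr)
  assume "i ~= j"
  hence "\<omega> <= ad (st c + i * \<omega>) (st d + j * \<omega>)" using far[of i j "st c"] cd by simp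
  thus False using tri assms(5,6) spacing by linarith
 qed
 thus ?thesis using cd by simp
qed

lemma ball_T0: "c : Cs ==> j < Kg ==> v : T 0 ==> ~ ad v (st c + j * \<omega>) <= r"
 using apart0[of c v j] by linarith

lemma eL0: "eL {} = 0"
proof -
 have "{((c, t), (d, s)) : J. c : insert 0 {} & d : insert 0 {}} = {}" using JD by fastforce
 thus ?thesis unfolding eL_def by (simp only: card.empty)
qed

lemma dL0: "dL i {} = des J (pos i)"
proof
 show "des J (pos i) \<subseteq> dL i {}"
 proof
  fix e assume "e : des J (pos i)"
  then obtain c t d s where m: "((c, t), (d, s)) : J" "fst e < snd e" "e = (pos i c + t, pos i d + s)" unfolding des_def by auto
  have "~ (c : insert 0 {} & d : insert 0 {})" using JD[OF m(1)] by auto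
  thus "e : dL i {}" using m unfolding dL_def by auto
 qed
qed (rule dL_des)

lemma card_des: "i : Idx ==> real (card (des J (pos i))) = real (card J) / 2"
 using card_dL[of i "{}"] eL0 dL0 by simp

lemma dL_ends:
 assumes i: "i : Idx" and e: "e : dL i L"
 shows "\<exists>c\<in>insert 0 Cs. \<exists>d\<in>insert 0 Cs. c ~= d & ~ (c : insert 0 L & d : insert 0 L) &
  fst e : vset (pos i) T c & snd e : vset (pos i) T d"
proof -
 obtain c t d s where m: "((c, t), (d, s)) : J" "~ (c : insert 0 L & d : insert 0 L)" "e = (pos i c + t, pos i d + s)"
  using e unfolding dL_def by blast
 note j = JD[OF m(1)]
 have "fst e : vset (pos i) T c" "snd e : vset (pos i) T d" using m(3) j unfolding vset_def by auto
 thus ?thesis using m(2) j by blast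
qed

lemma vset_ball: "c : Cs ==> u : vset (pos i) T c ==> ad u (st c + i c * \<omega>) <= r"
 using inD[of c u i] rr(3) pos_c by simp

definition goodi :: "nat => (nat => nat) => (nat \<times> nat => bool) set" where
 "goodi b0 i = {w. (\<forall>c\<in>Cs. wgood k r b0 (T c) (G c) (pos i c) (RR n w)) & (\<forall>e\<in>des J (pos i). w e)}"

lemma Tr: "c : Cs ==> T c \<subseteq> {..r}"
 using pp(3)[of c] rr(3) by auto

text \<open>Windows and intended edges involve disjoint sets of pairs. Lengths are bounded above by
  \<open>n\<close> here and below by \<open>m0\<close> in \<open>good_pair\<close>; the two agree up
  to the factor \<kappa> fixed later.\<close>

lemma good_prob:
 assumes i: "i : Idx" and b0: "b0 <= r" and \<gamma>: "0 <= \<gamma>" "\<gamma> <= 1"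
  and WP: "!!c. c : Cs ==> \<gamma> <= Pr n {w. wgood k r b0 (T c) (G c) (pos i c) (RR n w)}"
 shows "\<gamma> ^ N * real n powr (- \<alpha> / 2 * real (card J)) <= Pr n (goodi b0 i)"
proof -
 let ?A = "%c. {w. wgood k r b0 (T c) (G c) (pos i c) (RR n w)}"
 let ?S = "\<Union>c\<in>Cs. ballp n (pos i c) r"
 let ?D = "des J (pos i)"
 have D: "?D \<subseteq> vertex_pairs n" using des_pairs[OF i] by blast
 have dA: "dep (?A c) (ballp n (pos i c) r)" if "c : Cs" for c by (rule dep_wgood[OF b0 Tr[OF that]])
 have balls: "c = d" if "c : Cs" "d : Cs" "ad u (pos i c) <= r" "ad u (pos i d) <= r" for c d u
  using ball_uniq[of c d "i c" "i d" u] that iK[OF i] pos_c by simp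
 have dis: "?S Int ?D = {}"
 proof -
  have False if c: "c : Cs" and e: "e : ballp n (pos i c) r" "e : ?D" for c e
  proof -
   obtain a b where ab: "a : insert 0 Cs" "b : insert 0 Cs" "a ~= b" "fst e : vset (pos i) T a" "snd e : vset (pos i) T b"
    using dL_ends[OF i, of e "{}"] e(2) dL0 by blast
   have n: "a = c" if "a : insert 0 Cs" "u : vset (pos i) T a" "ad u (pos i c) <= r" for a u
    using posn_far[OF i c, of a u] that by (metis add_leD2 le_add2 linorder_not_le mult_2 order_trans)
   show False using n[OF ab(1,4)] n[OF ab(2,5)] ab(3) e(1) unfolding ballp_def by simp
  qed
  thus ?thesis by blast
 qed
 have "goodi b0 i = (\<Inter>c\<in>Cs. ?A c) Int {w. \<forall>e\<in>?D. w e}" unfolding goodi_def by auto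
 hence "Pr n (goodi b0 i) = Pr n ((\<Inter>c\<in>Cs. ?A c) Int {w. \<forall>e\<in>?D. w e})" by (rule arg_cong)
 also have "... = Pr n (\<Inter>c\<in>Cs. ?A c) * Pr n {w. \<forall>e\<in>?D. w e}"
  by (rule prob_indep2[OF _ D dis]) (use dep_INT[of Cs ?A, OF dA] in \<open>auto simp: ballp_def intro: dep_all\<close>)
 also have "Pr n (\<Inter>c\<in>Cs. ?A c) = (\<Prod>c\<in>Cs. Pr n (?A c))"
 proof (rule prob_indep[OF finCs _ _ dA])
  show "ballp n (pos i c) r Int ballp n (pos i d) r = {}" if "c : Cs" "d : Cs" "c ~= d" for c d
   using balls[OF that(1,2)] that(3) unfolding ballp_def by auto
 qed (auto simp: ballp_def)
 also have "Pr n {w. \<forall>e\<in>?D. w e} = (\<Prod>e\<in>?D. pe \<alpha> e)" by (rule prob_edges[OF D])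
 finally have eq: "Pr n (goodi b0 i) = (\<Prod>c\<in>Cs. Pr n (?A c)) * (\<Prod>e\<in>?D. pe \<alpha> e)" .
 have "\<gamma> ^ N <= \<gamma> ^ card Cs" using \<gamma> cardCs by (intro power_decreasing) auto
 also have "... = (\<Prod>c\<in>Cs. \<gamma>)" by simp
 also have "... <= (\<Prod>c\<in>Cs. Pr n (?A c))" using WP \<gamma> by (intro prod_mono) auto
 finally have 1: "\<gamma> ^ N <= (\<Prod>c\<in>Cs. Pr n (?A c))" .
 have "real n powr (- \<alpha> / 2 * real (card J)) = (\<Prod>e\<in>?D. real n powr - \<alpha>)"
 proof (cases "n = 0")
  case True
  thus ?thesis using T0ne pp(2) by auto
 next
  case False
  have "(real n powr - \<alpha>) ^ card ?D = (real n powr - \<alpha>) powr real (card ?D)" using False by (simp add: powr_realpow)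
  also have "... = real n powr (- \<alpha> / 2 * real (card J))" unfolding card_des[OF i] powr_powr by (simp add: algebra_simps)
  finally show ?thesis by simp
 qed
 also have "... <= (\<Prod>e\<in>?D. pe \<alpha> e)"
 proof (rule prod_mono)
  fix e assume "e : ?D"
  hence "fst e < snd e" "snd e <= n" "1 <= fst e" using D unfolding vertex_pairs_def by auto
  thus "0 <= real n powr - \<alpha> & real n powr - \<alpha> <= pe \<alpha> e" unfolding edge_prob_def using alpha(1) by (auto intro!: powr_mono2')
 qed
 finally have 2: "real n powr (- \<alpha> / 2 * real (card J)) <= (\<Prod>e\<in>?D. pe \<alpha> e)" .
 show ?thesis unfolding eq by (rule mult_mono[OF 1 2]) (auto intro!: prod_nonneg)
qed

text \<open>Only the intended edges are used. Those of the second placement that are not confined to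
  shared parts and the base are new, because windows at different positions are disjoint.\<close>

lemma good_pair:
 assumes i: "i : Idx" and i': "i' : Idx" and L: "L = {c : Cs. i c = i' c}"
 shows "Pr n (goodi b0 i Int goodi b0 i') <= real m0 powr (- \<alpha> * real (card J)) * real m0 powr (\<alpha> / 2 * real (eL L))"
proof -
 let ?D = "des J (pos i)" and ?D' = "dL i' L"
 have LC: "L \<subseteq> Cs" using L by blast
 have D: "?D \<subseteq> vertex_pairs n" "?D' \<subseteq> vertex_pairs n" using des_pairs[OF i] des_pairs[OF i'] dL_des[of i' L] by blast+
 have fD: "finite ?D" "finite ?D'" using D finite_subset[OF _ finite_vertex_pairs] by blast+
 have dis: "?D Int ?D' = {}"
 proof -
  have False if e: "e : ?D" "e : ?D'" for e
  proof -
   obtain a b where ab: "a : insert 0 Cs" "b : insert 0 Cs" "fst e : vset (pos i) T a" "snd e : vset (pos i) T b"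
    using dL_ends[OF i, of e "{}"] e(1) dL0 by blast
   obtain a' b' where ab': "a' : insert 0 Cs" "b' : insert 0 Cs" "~ (a' : insert 0 L & b' : insert 0 L)" "fst e : vset (pos i') T a'" "snd e : vset (pos i') T b'"
    using dL_ends[OF i' e(2)] by blast
   have one: "a' : insert 0 L" if "a : insert 0 Cs" "a' : insert 0 Cs" "u : vset (pos i) T a" "u : vset (pos i') T a'" for a a' u
   proof (cases "a' = 0")
    case False
    hence a': "a' : Cs" using that by simp
    have b': "ad u (st a' + i' a' * \<omega>) <= r" using vset_ball[OF a' that(4)] .
    show ?thesis
    proof (cases "a = 0")
     case True
     thus ?thesis using that(3) vset0 ball_T0[OF a' iK[OF i' a']] b' by blast
    next
     case False
     hence a: "a : Cs" using that by simp
     have "a = a' & i a = i' a'" using ball_uniq[OF a a' iK[OF i a] iK[OF i' a'] vset_ball[OF a that(3)] b'] .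
     thus ?thesis using L a by force
    qed
   qed simp
   show False using one[OF ab(1) ab'(1) ab(3) ab'(4)] one[OF ab(2) ab'(2) ab(4) ab'(5)] ab'(3) by blast
  qed
  thus ?thesis by blast
 qed
 have "Pr n (goodi b0 i Int goodi b0 i') <= Pr n {w. \<forall>e\<in>?D Un ?D'. w e}"
  using dL_des[of i' L] by (intro Pr_mono) (auto simp: goodi_def)
 also have "... = (\<Prod>e\<in>?D Un ?D'. pe \<alpha> e)" using D by (intro prob_edges) blast
 also have "... = (\<Prod>e\<in>?D. pe \<alpha> e) * (\<Prod>e\<in>?D'. pe \<alpha> e)" by (rule prod.union_disjoint[OF fD dis])
 also have "... <= real m0 powr (- \<alpha> / 2 * (real (card J) - real (eL {}))) * real m0 powr (- \<alpha> / 2 * (real (card J) - real (eL L)))"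
  using prod_des_le[OF i, of "{}" ?D] prod_des_le[OF i' LC, of ?D'] fD dL0 pe_bounds by (intro mult_mono) (auto intro!: prod_nonneg)
 also have "... = real m0 powr (- \<alpha> * real (card J)) * real m0 powr (\<alpha> / 2 * real (eL L))"
  unfolding powr_add[symmetric] eL0 by (rule arg_cong) (simp add: algebra_simps)
 finally show ?thesis .
qed

definition Blk :: "nat => nat => (nat => nat) set" where
 "Blk kb b = Cs \<rightarrow>\<^sub>E {b * kb..<(b + 1) * kb}"

lemma Blk_Idx: "B * kb <= Kg ==> b < B ==> Blk kb b \<subseteq> Idx"
proof -
 assume "B * kb <= Kg" "b < B"
 moreover from this have "(b + 1) * kb <= B * kb" by (intro mult_le_mono1) simp
 ultimately have "{b * kb..<(b + 1) * kb} \<subseteq> {..<Kg}" by auto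
 thus ?thesis unfolding Blk_def Idx_def by (intro PiE_mono)
qed

lemma card_agree:
 assumes "L \<subseteq> Cs"
 shows "card {i' : Blk kb b. {c : Cs. i c = i' c} = L} <= kb ^ (card Cs - card L)"
proof -
 let ?S = "{i' : Blk kb b. {c : Cs. i c = i' c} = L}" and ?I = "{b * kb..<(b + 1) * kb}"
 have "card ?S <= card ((Cs - L) \<rightarrow>\<^sub>E ?I)"
 proof (rule card_inj_on_le[where f = "%i'. restrict i' (Cs - L)"])
  show "finite ((Cs - L) \<rightarrow>\<^sub>E ?I)" using finCs by (intro finite_PiE) auto
  show "(%i'. restrict i' (Cs - L)) ` ?S \<subseteq> (Cs - L) \<rightarrow>\<^sub>E ?I"
  proof (rule image_subsetI)
   fix x assume "x : ?S"
   hence "x : Cs \<rightarrow>\<^sub>E ?I" unfolding Blk_def by blast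
   thus "restrict x (Cs - L) : (Cs - L) \<rightarrow>\<^sub>E ?I" by (intro restrict_PiE_iff[THEN iffD2] ballI) (auto dest: PiE_mem)
  qed
  show "inj_on (%i'. restrict i' (Cs - L)) ?S"
  proof (rule inj_onI)
   fix x y assume x: "x : ?S" and y: "y : ?S" and eq: "restrict x (Cs - L) = restrict y (Cs - L)"
   show "x = y"
   proof (rule PiE_ext[of x Cs "%_. ?I" y])
    show "x : Cs \<rightarrow>\<^sub>E ?I" "y : Cs \<rightarrow>\<^sub>E ?I" using x y unfolding Blk_def by auto
    fix c assume c: "c : Cs"
    show "x c = y c"
    proof (cases "c : L")
     case True
     hence "i c = x c" "i c = y c" using x y by auto
     thus ?thesis by simp
    next
     case False
     thus ?thesis using fun_cong[OF eq, of c] c by simp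
    qed
   qed
  qed
 qed
 also have "... = kb ^ card (Cs - L)" using finCs by (simp add: card_PiE)
 also have "card (Cs - L) = card Cs - card L" using assms finCs by (meson card_Diff_subset finite_subset)
 finally show ?thesis .
qed

section \<open>Independent blocks of positions\<close>

context
 fixes kb B b0 :: nat and \<gamma> \<sigma> \<kappa> :: real
 assumes BK: "B * kb <= Kg" and kb: "1 <= kb" and b0: "N <= b0" "b0 <= r" and \<gamma>: "0 < \<gamma>" "\<gamma> <= 1"
  and WP: "!!c j. c : Cs ==> j < Kg ==> \<gamma> <= Pr n {w. wgood k r b0 (T c) (G c) (st c + j * \<omega>) (RR n w)}"
  and \<sigma>: "(\<Sum>L\<in>Pow Cs. wL kb L) <= \<sigma>" "0 < \<sigma>"
  and \<kappa>: "0 < \<kappa>" "real n <= \<kappa> * real m0"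
begin

definition \<mu> :: real where "\<mu> = \<gamma> ^ N * real (kb ^ card Cs) * real n powr (- \<alpha> / 2 * real (card J))"

text \<open>Bounds the ratio of second moment to squared mean: \<sigma> accounts for pairs of
  placements sharing parts, the power of \<kappa> for \<open>n\<close> against \<open>m0\<close>,
  and \<gamma> for the windows being good.\<close>

definition cc :: real where "cc = \<sigma> * \<kappa> powr (\<alpha> * real (card J)) / \<gamma> ^ (2 * N)"

definition cnt :: "nat => (nat \<times> nat => bool) => nat" where "cnt b w = card {i : Blk kb b. w : goodi b0 i}"

lemma n0: "0 < n" using T0ne pp(2) by fastforce

lemma mu0: "0 < \<mu>" unfolding \<mu>_def using \<gamma> kb n0 by simp

lemma cc0: "0 < cc" unfolding cc_def using \<sigma> \<kappa> \<gamma> by simp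

lemma finBlk: "finite (Blk kb b)" unfolding Blk_def using finCs by (intro finite_PiE) auto

lemma cardBlk: "card (Blk kb b) = kb ^ card Cs" unfolding Blk_def using finCs by (simp add: card_PiE)

lemma block_prob:
 assumes b: "b < B"
 shows "1 / (4 * cc) <= Pr n {w. \<mu> / 2 <= real (cnt b w)}"
proof (rule second_moment[OF _ mu0 _ _ cc0])
 note sub = Blk_Idx[OF BK b]
 have X: "real (cnt b w) = (\<Sum>i\<in>Blk kb b. indicator (goodi b0 i) w)" for w
 proof -
  have "(\<Sum>i\<in>Blk kb b. indicator (goodi b0 i) w :: real) = (\<Sum>i\<in>Blk kb b. if w : goodi b0 i then 1 else 0)"
   by (rule sum.cong) auto
  thus ?thesis unfolding cnt_def using finBlk by (simp add: sum.If_cases Int_def)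
 qed
 show "\<mu> <= measure_pmf.expectation (EI n) (%w. real (cnt b w))"
 proof -
  have "\<mu> = (\<Sum>i\<in>Blk kb b. \<gamma> ^ N * real n powr (- \<alpha> / 2 * real (card J)))" unfolding \<mu>_def by (simp add: cardBlk)
  also have "... <= (\<Sum>i\<in>Blk kb b. Pr n (goodi b0 i))"
  proof (rule sum_mono)
   fix i assume "i : Blk kb b"
   hence i: "i : Idx" using sub by blast
   show "\<gamma> ^ N * real n powr (- \<alpha> / 2 * real (card J)) <= Pr n (goodi b0 i)"
    by (rule good_prob[OF i b0(2)]) (use \<gamma> WP iK[OF i] pos_c in auto)
  qed
  also have "... = measure_pmf.expectation (EI n) (%w. real (cnt b w))" unfolding X by (subst Bochner_Integration.integral_sum) auto
  finally show ?thesis .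
 qed
 show "measure_pmf.expectation (EI n) (%w. real (cnt b w) ^ 2) <= cc * \<mu> ^ 2"
 proof -
  have "real (cnt b w) ^ 2 = (\<Sum>i\<in>Blk kb b. \<Sum>i'\<in>Blk kb b. indicator (goodi b0 i Int goodi b0 i') w)" for w
   unfolding X power2_eq_square sum_product by (simp add: indicator_inter_arith)
  hence "measure_pmf.expectation (EI n) (%w. real (cnt b w) ^ 2) = (\<Sum>i\<in>Blk kb b. \<Sum>i'\<in>Blk kb b. Pr n (goodi b0 i Int goodi b0 i'))"
   by (simp add: Bochner_Integration.integral_sum)
  also have "... <= (\<Sum>i\<in>Blk kb b. real (kb ^ card Cs) * real m0 powr (- \<alpha> * real (card J)) * \<sigma>)"
  proof (rule sum_mono)
   fix i assume iB: "i : Blk kb b"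
   define g where "g L = real m0 powr (- \<alpha> * real (card J)) * real m0 powr (\<alpha> / 2 * real (eL L))" for L
   have "(\<Sum>i'\<in>Blk kb b. Pr n (goodi b0 i Int goodi b0 i')) <= (\<Sum>i'\<in>Blk kb b. g {c : Cs. i c = i' c})"
    unfolding g_def by (rule sum_mono, rule good_pair) (use iB sub in auto)
   also have "... = (\<Sum>L\<in>Pow Cs. \<Sum>i'\<in>{i' : Blk kb b. {c : Cs. i c = i' c} = L}. g {c : Cs. i c = i' c})"
    by (rule sum.group[symmetric]) (use finBlk finCs in auto)
   also have "... = (\<Sum>L\<in>Pow Cs. real (card {i' : Blk kb b. {c : Cs. i c = i' c} = L}) * g L)"
    by (rule sum.cong) auto
   also have "... <= (\<Sum>L\<in>Pow Cs. real (kb ^ (card Cs - card L)) * g L)"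
    by (intro sum_mono mult_right_mono of_nat_mono card_agree) (auto simp: g_def)
   also have "... = (\<Sum>L\<in>Pow Cs. real (kb ^ card Cs) * real m0 powr (- \<alpha> * real (card J)) * (wL kb L))"
   proof (rule sum.cong[OF refl])
    fix L assume "L : Pow Cs"
    hence cL: "card L <= card Cs" using finCs card_mono by blast
    have "real (kb ^ (card Cs - card L)) = real (kb ^ card Cs) * real kb powr - real (card L)"
     unfolding of_nat_power using kb cL by (simp add: power_diff powr_minus powr_realpow divide_inverse)
    thus "real (kb ^ (card Cs - card L)) * g L = real (kb ^ card Cs) * real m0 powr (- \<alpha> * real (card J)) * (wL kb L)"
     unfolding g_def by simp
   qed
   also have "... = real (kb ^ card Cs) * real m0 powr (- \<alpha> * real (card J)) * (\<Sum>L\<in>Pow Cs. wL kb L)"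
    by (rule sum_distrib_left[symmetric])
   also have "... <= real (kb ^ card Cs) * real m0 powr (- \<alpha> * real (card J)) * \<sigma>"
    by (rule mult_left_mono[OF \<sigma>(1)]) simp
   finally show "(\<Sum>i'\<in>Blk kb b. Pr n (goodi b0 i Int goodi b0 i')) <= real (kb ^ card Cs) * real m0 powr (- \<alpha> * real (card J)) * \<sigma>" .
  qed
  also have "... = real (kb ^ card Cs) ^ 2 * real m0 powr (- \<alpha> * real (card J)) * \<sigma>"
   by (simp add: cardBlk power2_eq_square)
  also have "... <= real (kb ^ card Cs) ^ 2 * (\<kappa> powr (\<alpha> * real (card J)) * real n powr (- \<alpha> * real (card J))) * \<sigma>"
  proof (intro mult_right_mono mult_left_mono)
   have "real m0 powr (- \<alpha> * real (card J)) <= (real n / \<kappa>) powr (- \<alpha> * real (card J))"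
    using \<kappa> alpha(1) n0 by (intro powr_mono2') (auto simp: field_simps)
   also have "... = \<kappa> powr (\<alpha> * real (card J)) * real n powr (- \<alpha> * real (card J))"
    using \<kappa>(1) n0 by (simp add: powr_divide powr_minus field_simps)
   finally show "real m0 powr (- \<alpha> * real (card J)) <= \<kappa> powr (\<alpha> * real (card J)) * real n powr (- \<alpha> * real (card J))" .
  qed (use \<sigma> in auto)
  also have "... = cc * \<mu> ^ 2"
  proof -
   have "(real n powr (- \<alpha> / 2 * real (card J))) ^ 2 = real n powr (- \<alpha> * real (card J))"
    unfolding power2_eq_square powr_add[symmetric] by (rule arg_cong) simp
   thus ?thesis unfolding cc_def \<mu>_def power_mult_distrib using \<gamma> by (simp add: power_mult[symmetric] mult.commute[of N 2])
  qed
  finally show ?thesis .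
 qed
qed simp

definition Bset :: "nat => nat set" where
 "Bset b = {u. \<exists>c\<in>Cs. \<exists>j\<in>{b * kb..<(b + 1) * kb}. ad u (st c + j * \<omega>) <= r}"

text \<open>The pairs on which block \<open>b\<close> depends. Pairs inside the base are left out,
  so different blocks use disjoint sets of pairs although all of them attach to the same
  base.\<close>

definition DB :: "nat => edges" where
 "DB b = {e : vertex_pairs n. fst e : Bset b Un T 0 & snd e : Bset b Un T 0 & (fst e : Bset b \<or> snd e : Bset b)}"

lemma block_range: "b < B ==> j : {b * kb..<(b + 1) * kb} ==> j < Kg"
proof -
 assume "b < B" "j : {b * kb..<(b + 1) * kb}"
 moreover from this have "(b + 1) * kb <= B * kb" by (intro mult_le_mono1) simp
 ultimately show ?thesis using BK by auto
qed

lemma Bset_disj: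
 assumes "b < B" "b' < B" "b ~= b'"
 shows "Bset b Int Bset b' = {}" "Bset b Int T 0 = {}"
proof -
 have dj: False if "j : {b * kb..<(b + 1) * kb}" "j : {b' * kb..<(b' + 1) * kb}" for j
 proof -
  have "j div kb = b" "j div kb = b'" using that kb by (auto intro!: div_nat_eqI simp: mult.commute)
  thus False using assms(3) by simp
 qed
 show "Bset b Int Bset b' = {}"
 proof -
  have False if u: "u : Bset b" "u : Bset b'" for u
  proof -
   obtain c j where c: "c : Cs" "j : {b * kb..<(b + 1) * kb}" "ad u (st c + j * \<omega>) <= r" using u(1) unfolding Bset_def by blast
   obtain c' j' where c': "c' : Cs" "j' : {b' * kb..<(b' + 1) * kb}" "ad u (st c' + j' * \<omega>) <= r" using u(2) unfolding Bset_def by blast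
   have "j = j'" using ball_uniq[OF c(1) c'(1) block_range[OF assms(1) c(2)] block_range[OF assms(2) c'(2)] c(3) c'(3)] by simp
   thus False using dj c(2) c'(2) by blast
  qed
  thus ?thesis by blast
 qed
 show "Bset b Int T 0 = {}"
 proof -
  have False if u: "u : Bset b" "u : T 0" for u
  proof -
   obtain c j where c: "c : Cs" "j : {b * kb..<(b + 1) * kb}" "ad u (st c + j * \<omega>) <= r" using u(1) unfolding Bset_def by blast
   show False using ball_T0[OF c(1) block_range[OF assms(1) c(2)] u(2)] c(3) by simp
  qed
  thus ?thesis by blast
 qed
qed

lemma dep_good:
 assumes b: "b < B" and i: "i : Blk kb b"
 shows "dep (goodi b0 i) (DB b)"
proof -
 have iI: "i : Idx" using Blk_Idx[OF BK b] i by blast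
 have ic: "i c : {b * kb..<(b + 1) * kb}" if "c : Cs" for c using i that unfolding Blk_def by blast
 have inB: "u : Bset b" if "c : Cs" "ad u (st c + i c * \<omega>) <= r" for c u
  using that ic[OF that(1)] unfolding Bset_def by blast
 have 1: "dep {w. wgood k r b0 (T c) (G c) (pos i c) (RR n w)} (DB b)" if c: "c : Cs" for c
 proof (rule dep_mono[OF dep_wgood[OF b0(2) Tr[OF c]]])
  show "ballp n (pos i c) r \<subseteq> DB b"
   using inB[OF c] pos_c[OF c] unfolding ballp_def DB_def by auto
 qed
 have 2: "des J (pos i) \<subseteq> DB b"
 proof
  fix e assume e: "e : des J (pos i)"
  obtain a d where ab: "a : insert 0 Cs" "d : insert 0 Cs" "a ~= d" "fst e : vset (pos i) T a" "snd e : vset (pos i) T d"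
   using dL_ends[OF iI, of e "{}"] e dL0 by blast
  have v: "if a = 0 then u : T 0 else u : Bset b" if "a : insert 0 Cs" "u : vset (pos i) T a" for a u
   using that vset0 inB[of a u] vset_ball[of a u i] by auto
  have "e : vertex_pairs n" using des_pairs[OF iI] e by blast
  thus "e : DB b" using v[OF ab(1,4)] v[OF ab(2,5)] ab(3) unfolding DB_def by (auto split: if_splits)
 qed
 show ?thesis
 proof (rule depI)
  fix w w' assume e: "!!e. e : DB b ==> w e = w' e" and w: "w : goodi b0 i"
  have "wgood k r b0 (T c) (G c) (pos i c) (RR n w')" if c: "c : Cs" for c
   using depD[OF 1[OF c], of w w'] e w c unfolding goodi_def by blast
  moreover have "w' x" if "x : des J (pos i)" for x using e[OF subsetD[OF 2 that]] w that unfolding goodi_def by blast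
  ultimately show "w' : goodi b0 i" unfolding goodi_def by blast
 qed
qed

lemma all_fail: "Pr n {w. \<forall>b<B. real (cnt b w) < \<mu> / 2} <= (1 - 1 / (4 * cc)) ^ B"
proof -
 let ?A = "%b. - {w. \<mu> / 2 <= real (cnt b w)}"
 have "{w. \<forall>b<B. real (cnt b w) < \<mu> / 2} = (\<Inter>b\<in>{..<B}. ?A b)" by (force simp: not_le)
 hence "Pr n {w. \<forall>b<B. real (cnt b w) < \<mu> / 2} = Pr n (\<Inter>b\<in>{..<B}. ?A b)" by (rule arg_cong)
 also have "... = (\<Prod>b\<in>{..<B}. Pr n (?A b))"
 proof (rule prob_indep[where S = DB])
  show "DB b Int DB b' = {}" if "b : {..<B}" "b' : {..<B}" "b ~= b'" for b b'
   using Bset_disj[of b b'] Bset_disj(2)[of b' b] that unfolding DB_def by auto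
  show "dep (?A b) (DB b)" if b: "b : {..<B}" for b
  proof (rule dep_Compl, rule depI)
   fix w w' assume e: "!!e. e : DB b ==> w e = w' e" and w: "w : {w. \<mu> / 2 <= real (cnt b w)}"
   have "{i : Blk kb b. w : goodi b0 i} = {i : Blk kb b. w' : goodi b0 i}"
    using depD[OF dep_good, of b _ w w'] e b by blast
   thus "w' : {w. \<mu> / 2 <= real (cnt b w)}" using w unfolding cnt_def by simp
  qed
 qed (auto simp: DB_def)
 also have "... <= (\<Prod>b\<in>{..<B}. 1 - 1 / (4 * cc))"
 proof (rule prod_mono, rule conjI)
  fix b assume "b : {..<B}"
  hence "1 / (4 * cc) <= Pr n {w. \<mu> / 2 <= real (cnt b w)}" using block_prob by simp
  moreover have "Pr n (?A b) = 1 - Pr n {w. \<mu> / 2 <= real (cnt b w)}"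
   using measure_pmf.prob_compl[of "{w. \<mu> / 2 <= real (cnt b w)}" "EI n"] by (simp add: Compl_eq_Diff_UNIV)
  ultimately show "Pr n (?A b) <= 1 - 1 / (4 * cc)" by simp
 qed simp
 finally show ?thesis by simp
qed

text \<open>Failure means that no block has \<open>\<mu> / 2\<close> good placements, or that every
  good placement of such a block is spoilt. In the second case each of them yields its own bad
  configuration present in the graph, so there are at least \<open>\<mu> / 2\<close> of these, and
  \<open>moment_bound\<close> applies.\<close>

lemma fail_prob:
 assumes \<Lambda>: "0 <= \<Lambda>" "!!F. finite F ==> card F <= p * ((N + 1) * (h + N) + k) ==> (\<Sum>x\<in>HH. \<Prod>e\<in>es x - F \<times> F. pe \<alpha> e) <= \<Lambda>"
 shows "Pr n {w. ~ (\<exists>y. realizes k n (RR n w) Cs T G J y)} <= (1 - 1 / (4 * cc)) ^ B + (\<Lambda> / (\<mu> / 2)) ^ p"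
proof -
 let ?bad = "{w. \<mu> / 2 <= real (card {x : HH. \<forall>e\<in>es x. w e})}"
 have fHH: "finite HH" unfolding HH_def using finIdx finite_badi by (intro finite_SigmaI)
 have badD: "C \<subseteq> {1..n}" "card C <= k" "Q \<subseteq> {(u, v). u < v & u : Wv Cs T (pos i) Un C & v : Wv Cs T (pos i) Un C}"
  if "(C, Q) : badi i" for i C Q using that unfolding bad_def by auto
 have Qv: "Q \<subseteq> vertex_pairs n" if i: "i : Idx" and CQ: "(C, Q) : badi i" for i C Q
  using badD[OF CQ] Wv_sub[OF i] unfolding vertex_pairs_def by fastforce
 have pbad: "Pr n ?bad <= (\<Lambda> / (\<mu> / 2)) ^ p"
 proof (rule moment_bound[where vs = "%(i, C, Q). Wv Cs T (pos i) Un C" and v = "(N + 1) * (h + N) + k", OF fHH _ _ _ \<Lambda>])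
  fix x assume "x : HH"
  then obtain i C Q where x: "x = (i, C, Q)" "i : Idx" "(C, Q) : badi i" unfolding HH_def by auto
  note d = badD[OF x(3)]
  show "es x \<subseteq> vertex_pairs n" unfolding es_def x(1) using des_pairs[OF x(2)] Qv[OF x(2,3)] by simp
  show "es x \<subseteq> (case x of (i, C, Q) => Wv Cs T (pos i) Un C) \<times> (case x of (i, C, Q) => Wv Cs T (pos i) Un C)"
   unfolding es_def x(1) prod.case using des_pairs[OF x(2)] d(3) by blast
  have "finite C" using d(1) finite_subset by auto
  thus "finite (case x of (i, C, Q) => Wv Cs T (pos i) Un C) & card (case x of (i, C, Q) => Wv Cs T (pos i) Un C) <= (N + 1) * (h + N) + k"
   unfolding x(1) prod.case using fin_Wv[of i] card_Un_le[of "Wv Cs T (pos i)" C] d(2) by auto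
 qed (use mu0 in auto)
 have "{w. ~ (\<exists>y. realizes k n (RR n w) Cs T G J y)} \<subseteq> {w. \<forall>b<B. real (cnt b w) < \<mu> / 2} Un ?bad"
 proof (rule subsetI, rule ccontr)
  fix w assume w: "w : {w. ~ (\<exists>y. realizes k n (RR n w) Cs T G J y)}"
   and no: "w ~: {w. \<forall>b<B. real (cnt b w) < \<mu> / 2} Un ?bad"
  then obtain b where b: "b < B" "\<mu> / 2 <= real (cnt b w)" by (auto simp: not_less)
  let ?H = "{x : HH. \<forall>e\<in>es x. w e}" and ?S = "{i : Blk kb b. w : goodi b0 i}"
  have lt: "card ?H < card ?S" using b(2) no unfolding cnt_def by auto
  have "~ ?S \<subseteq> fst ` ?H"
  proof
   assume "?S \<subseteq> fst ` ?H"
   hence "card ?S <= card (fst ` ?H)" using fHH by (intro card_mono) auto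
   also have "... <= card ?H" using fHH by (intro card_image_le) auto
   finally show False using lt by simp
  qed
  then obtain i where i: "i : Blk kb b" "w : goodi b0 i" "i ~: fst ` ?H" by blast
  have iI: "i : Idx" using i(1) Blk_Idx[OF BK b(1)] by blast
  have D: "\<forall>e\<in>des J (pos i). w e" using i(2) unfolding goodi_def by blast
  have "realizes k n (RR n w) Cs T G J (pos i)"
  proof (rule realizes_if_good[OF pat sym_RR])
   show "pos i 0 = 0" unfolding pos_def by simp
   show "r < pos i c & pos i c + r <= n" if "c : Cs" for c using inside[of c "i c"] that iK[OF iI] pos_c by simp
   show "3 * r < ad (pos i c) (pos i d)" if "c : Cs" "d : Cs" "c ~= d" for c d
    using apart[of c d "i c" "i d"] that iK[OF iI] pos_c by simp
   show "3 * r < ad v (pos i c)" if "c : Cs" "v : T 0" for c v using apart0[of c v "i c"] that iK[OF iI] pos_c by simp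
   show "N + k + 2 <= \<rho>" "(k + 3) * \<rho> <= r" "N <= b0" using par b0 by auto
   show "wgood k r b0 (T c) (G c) (pos i c) (RR n w)" if "c : Cs" for c using i(2) that unfolding goodi_def by blast
   show "des J (pos i) \<subseteq> RR n w"
   proof
    fix e assume e: "e : des J (pos i)"
    hence "e : vertex_pairs n" "w e" using des_pairs[OF iI] D by blast+
    thus "e : RR n w" unfolding RR_def symc_def by blast
   qed
   show "~ Q \<subseteq> RR n w" if CQ: "(C, Q) : badi i" for C Q
   proof
    assume Q: "Q \<subseteq> RR n w"
    have "w e" if e: "e : Q" for e
    proof -
     have "fst e < snd e" using badD(3)[OF CQ] e by auto
     thus ?thesis using RR_less[of "fst e" "snd e" n w] subsetD[OF Q e] by simp
    qed
    hence "(i, C, Q) : ?H" using CQ iI D unfolding HH_def es_def by auto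
    from imageI[OF this, of fst] show False using i(3) unfolding fst_conv by contradiction
   qed
  qed
  thus False using w by blast
 qed
 hence "Pr n {w. ~ (\<exists>y. realizes k n (RR n w) Cs T G J y)} <= Pr n ({w. \<forall>b<B. real (cnt b w) < \<mu> / 2} Un ?bad)" by (rule Pr_mono)
 also have "... <= Pr n {w. \<forall>b<B. real (cnt b w) < \<mu> / 2} + Pr n ?bad" by (rule Pr_Un_le)
 finally show ?thesis using all_fail pbad by linarith
qed

lemmas fail_prob_explicit = fail_prob[unfolded \<mu>_def cc_def]

end

end

section \<open>Choice of the parameters\<close>

lemma floor_powr:
 fixes x :: real
 assumes "1 <= x"
 shows "real (nat \<lfloor>x\<rfloor>) <= x" "x / 2 <= real (nat \<lfloor>x\<rfloor>)" "1 <= nat \<lfloor>x\<rfloor>"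
proof -
 have 1: "1 <= \<lfloor>x\<rfloor>" using assms by linarith
 hence eq: "real (nat \<lfloor>x\<rfloor>) = of_int \<lfloor>x\<rfloor>" by simp
 show "real (nat \<lfloor>x\<rfloor>) <= x" "x / 2 <= real (nat \<lfloor>x\<rfloor>)" "1 <= nat \<lfloor>x\<rfloor>" unfolding eq using 1 by linarith+
qed

lemma ev_powr: "0 < c ==> \<forall>\<^sub>F n in sequentially. C <= real n powr c"
proof -
 assume "0 < c"
 hence "filterlim (%n::nat. real n powr c) at_top sequentially" by real_asymp
 thus ?thesis by (simp add: filterlim_at_top)
qed

lemma powr_half: "(0::real) < y ==> (y / 2) powr - a = 2 powr a * y powr - a"
 by (simp add: powr_divide powr_minus field_simps)

text \<open>Having \<open>x powr (1 - 3 * \<delta>)\<close> positions instead of \<open>x\<close>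
  loses a power of at most \<open>3 * \<delta> * N\<close>, which is at most half of the safety
  margin \<theta>.\<close>

lemma powr_term_bound:
 fixes x kb m0 \<delta> \<theta> \<alpha> :: real and a e N :: nat
 assumes "1 <= x" "x powr (1 - 3 * \<delta>) / 2 <= kb" "0 <= m0" "m0 <= x" "a <= N" "\<theta> <= real a - \<alpha> / 2 * real e"
  "3 * \<delta> * real N <= \<theta> / 2" "0 < \<delta>" "0 < \<alpha>"
 shows "kb powr - real a * m0 powr (\<alpha> / 2 * real e) <= 2 ^ N * x powr (- \<theta> / 2)"
proof -
 have x0: "0 < x powr (1 - 3 * \<delta>) / 2" using assms(1) by simp
 have "kb powr - real a <= (x powr (1 - 3 * \<delta>) / 2) powr - real a" using x0 assms(2) by (intro powr_mono2') auto
 also have "... = 2 powr real a * x powr ((1 - 3 * \<delta>) * - real a)"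
  using assms(1) by (simp add: powr_half powr_powr)
 also have "... <= 2 ^ N * x powr ((1 - 3 * \<delta>) * - real a)"
  using assms(5) by (intro mult_right_mono) (auto simp: powr_realpow power_increasing)
 finally have 1: "kb powr - real a <= 2 ^ N * x powr ((1 - 3 * \<delta>) * - real a)" .
 have 2: "m0 powr (\<alpha> / 2 * real e) <= x powr (\<alpha> / 2 * real e)" using assms by (intro powr_mono2) auto
 have "kb powr - real a * m0 powr (\<alpha> / 2 * real e) <= 2 ^ N * x powr ((1 - 3 * \<delta>) * - real a) * x powr (\<alpha> / 2 * real e)"
  by (rule mult_mono[OF 1 2]) auto
 also have "... = 2 ^ N * x powr ((1 - 3 * \<delta>) * - real a + \<alpha> / 2 * real e)" by (simp only: powr_add mult.assoc)
 also have "... <= 2 ^ N * x powr (- \<theta> / 2)"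
 proof (intro mult_left_mono powr_mono)
  have "3 * \<delta> * real a <= 3 * \<delta> * real N" using assms(5,8) by simp
  thus "(1 - 3 * \<delta>) * - real a + \<alpha> / 2 * real e <= - \<theta> / 2" using assms(6,7) by (simp add: algebra_simps)
 qed (use assms(1) in auto)
 finally show ?thesis .
qed

text \<open>Each base vertex rules out at most two multiples of \<open>3 * m0\<close>; among
  \<open>2 * h + N\<close> cells enough remain to give every part its own.\<close>

lemma far_cells:
 fixes V :: "nat set" and m0 :: nat
 assumes V: "finite V" "card V <= h" and Cs: "finite Cs" "card Cs <= N" and m0: "1 <= m0"
 shows "\<exists>f. f ` Cs \<subseteq> {1..2 * h + N} & inj_on f Cs & (\<forall>c\<in>Cs. \<forall>v\<in>V. v + 2 * m0 <= 3 * f c * m0 \<or> 3 * f c * m0 + 3 * m0 <= v)"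
proof -
 define Bl where "Bl = (\<Union>v\<in>V. {v div (3 * m0), v div (3 * m0) + 1})"
 have "card Bl <= (\<Sum>v\<in>V. card {v div (3 * m0), v div (3 * m0) + 1})" unfolding Bl_def using V(1) by (rule card_UN_le)
 also have "... <= (\<Sum>v\<in>V. 2)" by (intro sum_mono) simp
 also have "... <= 2 * h" using V(2) by simp
 finally have cB: "card Bl <= 2 * h" .
 have fB: "finite Bl" unfolding Bl_def using V(1) by auto
 have "card Cs <= card ({1..2 * h + N} - Bl)"
 proof -
  have "card {1..2 * h + N} - card Bl <= card ({1..2 * h + N} - Bl)" by (rule diff_card_le_card_Diff[OF fB])
  thus ?thesis using cB Cs(2) by simp
 qed
 then obtain f where f: "f ` Cs \<subseteq> {1..2 * h + N} - Bl" "inj_on f Cs" using card_le_inj[OF Cs(1), of "{1..2 * h + N} - Bl"] by auto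
 have "v + 2 * m0 <= 3 * f c * m0 \<or> 3 * f c * m0 + 3 * m0 <= v" if c: "c : Cs" and v: "v : V" for c v
 proof (rule ccontr)
  assume "~ ?thesis"
  hence a: "v < (f c + 1) * (3 * m0)" "f c * (3 * m0) < v + 2 * m0" by (auto simp: algebra_simps)
  have "v div (3 * m0) < f c + 1" using a(1) m0 by (simp add: less_mult_imp_div_less)
  moreover have "f c <= v div (3 * m0) + 1"
  proof -
   have "f c = f c * (3 * m0) div (3 * m0)" using m0 by simp
   also have "... <= (v + 3 * m0) div (3 * m0)" using a(2) by (intro div_le_mono) simp
   also have "... = v div (3 * m0) + 1" using m0 by simp
   finally show ?thesis .
  qed
  ultimately have "f c = v div (3 * m0) \<or> f c = v div (3 * m0) + 1" by linarith
  hence "f c : Bl" unfolding Bl_def using v by blast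
  thus False using f(1) c by blast
 qed
 thus ?thesis using f by blast
qed

context irrational_exponent
begin

lemma pos_gap: "\<exists>\<theta>>0. \<theta> <= 1 & (\<forall>a\<le>N. \<forall>e\<le>E. 0 < real a - \<alpha> / 2 * real e --> \<theta> <= real a - \<alpha> / 2 * real e)"
proof -
 define S where "S = insert 1 {y : (%(a, e). real a - \<alpha> / 2 * real e) ` ({..N} \<times> {..E}). 0 < y}"
 have f: "finite S" unfolding S_def by auto
 have "Min S : S" using f by (intro Min_in) (auto simp: S_def)
 hence "0 < Min S" unfolding S_def by auto
 moreover have "Min S <= 1" using f by (intro Min_le) (auto simp: S_def)
 moreover have "Min S <= real a - \<alpha> / 2 * real e" if "a <= N" "e <= E" "0 < real a - \<alpha> / 2 * real e" for a e
 proof (rule Min_le[OF f])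
  have "real a - \<alpha> / 2 * real e : (%(a, e). real a - \<alpha> / 2 * real e) ` ({..N} \<times> {..E})"
   using that(1,2) by (intro image_eqI[of _ _ "(a, e)"]) auto
  thus "real a - \<alpha> / 2 * real e : S" using that(3) unfolding S_def by blast
 qed
 ultimately show ?thesis by blast
qed

text \<open>The exponent \<open>h + 1\<close> exceeds the number of vertices in a base, so the union
  over all bases still tends to 0. \<open>D\<close> does not depend on the pattern.\<close>

lemma pattern_fail:
 assumes k: "1 <= k"
 shows "\<exists>D. \<forall>\<^sub>F n in sequentially. \<forall>Cs T G J. pat_ok N k n Cs T G J --> card (T 0) <= h --> T 0 ~= {} -->
  Pr n {w. ~ (\<exists>y. realizes k n (RR n w) Cs T G J y)} <= D * real n powr - real (h + 1)"
proof -
 obtain \<gamma>' b0 where \<gamma>': "\<gamma>' > 0" and b0: "N <= b0" and WP': "!!n r x Tc Gc. Tc \<subseteq> {1..N} ==> Gc \<subseteq> Tc \<times> Tc ==> sym Gc ==> irrefl Gc ==>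
  b0 <= r ==> r < x ==> x + r <= n ==> \<gamma>' <= Pr n {w. wgood k r b0 Tc Gc x (RR n w)}"
  using window_prob[OF k, of N] by blast
 define \<gamma> where "\<gamma> = min \<gamma>' 1"
 have \<gamma>: "0 < \<gamma>" "\<gamma> <= 1" "\<gamma> <= \<gamma>'" unfolding \<gamma>_def using \<gamma>' by auto
 obtain \<epsilon> where eps: "\<epsilon> > 0" and MS0: "\<forall>b. \<exists>K>0. small_sums k b K \<epsilon>"
  using multi_scale[OF k] by blast
 \<comment> \<open>\<open>vv\<close> bounds the number of vertices of a placed pattern, and
   \<open>E\<close> the size of \<open>J\<close>.\<close>
 define vv where "vv = (N + 1) * (h + N)"
 define E where "E = vv * vv"
 obtain \<theta> where \<theta>: "\<theta> > 0" "\<theta> <= 1" "!!a e. a <= N ==> e <= E ==> 0 < real a - \<alpha> / 2 * real e ==> \<theta> <= real a - \<alpha> / 2 * real e"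
  using pos_gap[of N E] by blast
 \<comment> \<open>Windows grow like \<open>n powr \<delta>\<close>. With
   \<open>n powr (1 - 3 * \<delta>)\<close> positions in a block, up to \<open>N\<close> parts lose
   at most half of the margin \<theta>.\<close>
 define \<delta> where "\<delta> = \<theta> / (8 * (real N + 1))"
 \<comment> \<open>Near extensions reach about \<open>n powr \<delta>'\<close>. Their number is of
   order \<open>n powr (\<delta>' * k)\<close>, the square root of the gain
   \<open>n powr (\<alpha> * \<delta>)\<close> from one edge longer than \<rho>.\<close>
 define \<delta>' where "\<delta>' = \<alpha> * \<delta> / (2 * real k)"
 \<comment> \<open>The three gains in \<open>bad_sum\<close>: pinned parts, far rigid extensions,
   and near ones with a long edge.\<close>
 define \<eta> where "\<eta> = min (\<theta> / 2) (min (\<delta>' * \<epsilon>) (\<alpha> * \<delta> / 2))"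
 \<comment> \<open>There are about \<open>n powr \<delta>3\<close> blocks. With up to
   \<open>N\<close> parts they enlarge the set of placements by at most
   \<open>n powr (\<eta> / 2)\<close> over a single block, which leaves half of \<eta>.\<close>
 define \<delta>3 where "\<delta>3 = min \<delta> (\<eta> / (2 * (real N + 1)))"
 have \<delta>: "0 < \<delta>" "\<delta> <= 1 / 8" "3 * \<delta> * real N <= \<theta> / 2" unfolding \<delta>_def using \<theta>(1,2) by (auto simp: field_simps)
 have \<delta>': "0 < \<delta>'" "\<delta>' * real k = \<alpha> * \<delta> / 2" unfolding \<delta>'_def using \<delta>(1) alpha(1) k by auto
 have \<eta>: "0 < \<eta>" "\<eta> <= \<theta> / 2" "\<eta> <= \<delta>' * \<epsilon>" "\<eta> <= \<alpha> * \<delta> / 2" unfolding \<eta>_def using \<theta>(1) \<delta>(1) \<delta>'(1) alpha(1) eps by auto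
 have \<delta>3: "0 < \<delta>3" "\<delta>3 <= \<delta>" "\<delta>3 * real N <= \<eta> / 2"
 proof -
  show "0 < \<delta>3" "\<delta>3 <= \<delta>" unfolding \<delta>3_def using \<delta>(1) \<eta>(1) by auto
  have "\<delta>3 * real N <= \<eta> / (2 * (real N + 1)) * real N" unfolding \<delta>3_def by (intro mult_right_mono) auto
  also have "... <= \<eta> / 2" using \<eta>(1) by (simp add: field_simps)
  finally show "\<delta>3 * real N <= \<eta> / 2" .
 qed
 \<comment> \<open>Each further power gains \<open>n powr (\<eta> / 2)\<close>, so \<open>p\<close>
   of them give \<open>n powr (h + 1)\<close>.\<close>
 define p where "p = nat \<lceil>2 * real (h + 1) / \<eta>\<rceil>"
 have p: "real (h + 1) <= \<eta> / 2 * real p"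
 proof -
  have "2 * real (h + 1) / \<eta> <= real p" unfolding p_def by linarith
  thus ?thesis using \<eta>(1) by (simp add: field_simps)
 qed
 \<comment> \<open>Room for conditioning on up to \<open>p\<close> configurations at once. As
   \<open>p\<close> depends on \<epsilon>, the bounds for all \<open>b\<close> must share one
   \<epsilon>.\<close>
 define b where "b = p * (vv + k) + h + vv"
 obtain K where K: "K > 0" and MS: "small_sums k b K \<epsilon>"
  using MS0[THEN spec, of b] by blast
 \<comment> \<open>The last cell starts at most at \<open>3 * (2 * h + N) * m0\<close>; one more
   \<open>m0\<close> each holds the range of positions and the last window.\<close>
 define q where "q = 3 * (2 * h + N) + 2"
 define \<kappa> where "\<kappa> = 2 * real q"
 have \<kappa>1: "1 <= \<kappa>" unfolding \<kappa>_def q_def by simp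
 define \<sigma> where "\<sigma> = (2::real) ^ N * 2 ^ N"
 define M2 where "M2 = (2::real) ^ b * 2 ^ (b * b)"
 define D0 where "D0 = real ((b * (2 * k + 1) + 1) ^ k * 2 ^ ((b + k) * (b + k))) * 2"
 define D1 where "D1 = 2 ^ N * (real (b + 1) ^ N * 2 ^ N) * (K + 1) + (K * 2 powr \<epsilon> + D0)"
 define D2 where "D2 = 2 * M2 * \<kappa> powr real E * D1 / \<gamma> ^ N"
 define cm where "cm = \<sigma> * \<kappa> powr real E / \<gamma> ^ (2 * N)"
 have "0 <= D0" unfolding D0_def by simp
 hence D1: "0 < D1" unfolding D1_def using K by (intro add_nonneg_pos add_pos_nonneg mult_nonneg_nonneg) auto
 have cm: "0 < cm" unfolding cm_def \<sigma>_def using \<kappa>1 \<gamma> by simp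
 have ev_exp: "\<forall>\<^sub>F n in sequentially. exp (- (real n powr \<delta>3 / (8 * cm))) <= real n powr - real (h + 1)"
 proof -
  have "((%n::nat. exp (- (real n powr \<delta>3 / (8 * cm))) * real n powr real (h + 1)) \<longlongrightarrow> 0) sequentially"
   using cm \<delta>3(1) by real_asymp
  hence "\<forall>\<^sub>F n::nat in sequentially. exp (- (real n powr \<delta>3 / (8 * cm))) * real n powr real (h + 1) < 1"
   by (rule order_tendstoD) simp
  thus ?thesis using eventually_gt_at_top[of 0]
  proof eventually_elim
   case (elim n)
   have inv: "X <= inverse Y" if "X * Y < 1" "0 < Y" for X Y :: real using that by (simp add: field_simps)
   show ?case unfolding powr_minus by (rule inv[OF elim(1)]) (use elim(2) in simp)
  qed
 qed
 have "\<forall>\<^sub>F n in sequentially. \<forall>Cs T G J. pat_ok N k n Cs T G J --> card (T 0) <= h --> T 0 ~= {} -->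
  Pr n {w. ~ (\<exists>y. realizes k n (RR n w) Cs T G J y)} <= (1 + D2 ^ p) * real n powr - real (h + 1)"
  using ev_exp ev_powr[OF \<delta>(1), of "2 * real q * (3 * real k + 10)"] ev_powr[OF \<delta>(1), of "2 * real (b0 + N + k + 2)"]
   eventually_ge_at_top[of "2 * q"]
 proof eventually_elim
  case (elim n)
  show ?case
  proof (intro allI impI)
   fix Cs T G J assume pat: "pat_ok N k n Cs T G J" and hT: "card (T 0) <= h" and T0: "T 0 ~= {}"
   define x where "x = real n"
   have n2q: "2 * q <= n" using elim(4) .
   have x1: "1 <= x" unfolding x_def using n2q unfolding q_def by simp
   note pw = ge_one_powr_ge_zero[OF x1]
   define \<rho> where "\<rho> = nat \<lfloor>x powr \<delta>\<rfloor>"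
   define \<rho>0 where "\<rho>0 = nat \<lfloor>x powr \<delta>'\<rfloor>"
   define B where "B = nat \<lfloor>x powr \<delta>3\<rfloor>"
   define kb where "kb = nat \<lfloor>x powr (1 - 3 * \<delta>)\<rfloor>"
   define r where "r = (k + 3) * \<rho>"
   define \<omega> where "\<omega> = 2 * r + 1"
   define Kg where "Kg = B * kb"
   define m0 where "m0 = n div q"
   note f\<rho> = floor_powr[OF pw, of \<delta>, folded \<rho>_def] and f\<rho>0 = floor_powr[OF pw, of \<delta>', folded \<rho>0_def]
    and fB = floor_powr[OF pw, of \<delta>3, folded B_def] and fkb = floor_powr[OF pw, of "1 - 3 * \<delta>", folded kb_def]
   have d0: "0 <= \<delta>" "0 <= \<delta>'" "0 <= \<delta>3" "0 <= 1 - 3 * \<delta>" using \<delta> \<delta>' \<delta>3 by auto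
   have xsplit: "x powr (1 - \<delta>) * x powr \<delta> = x" using x1 by (simp add: powr_add[symmetric])
   have x\<delta>: "x powr \<delta> <= x powr (1 - \<delta>)" using x1 \<delta> by (intro powr_mono) auto
   have m0: "x <= \<kappa> * real m0" "1 <= m0" "m0 * q <= n" "real m0 <= x"
   proof -
    have q: "0 < q" unfolding q_def by simp
    have "n < (m0 + 1) * q" unfolding m0_def using q by (metis Suc_eq_plus1 dividend_less_div_times mult.commute mult_Suc add.commute)
    moreover have "2 <= m0" unfolding m0_def using n2q q by (simp add: less_eq_div_iff_mult_less_eq)
    ultimately have "n <= 2 * q * m0" "1 <= m0" by (auto simp: algebra_simps intro: order_trans[of n "m0 * q + q"])
    hence "real n <= real (2 * q * m0)" by (intro of_nat_mono)
    thus "x <= \<kappa> * real m0" unfolding x_def \<kappa>_def by simp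
    show "1 <= m0" by fact
    show "m0 * q <= n" unfolding m0_def by simp
    thus "real m0 <= x" unfolding x_def m0_def by simp
   qed
   have big: "real (3 * k + 10) * x powr (1 - \<delta>) <= real m0"
   proof -
    have "\<kappa> * (real (3 * k + 10) * x powr (1 - \<delta>)) = (2 * real q * (3 * real k + 10)) * x powr (1 - \<delta>)" unfolding \<kappa>_def by simp
    also have "... <= x powr \<delta> * x powr (1 - \<delta>)" using elim(2) unfolding x_def by (intro mult_right_mono) auto
    also have "... = x" using xsplit by (simp add: mult.commute)
    finally show ?thesis using m0(1) \<kappa>1 by (meson mult_le_cancel_left_pos less_le_trans zero_less_one order_trans)
   qed
   have r3: "3 * r < m0"
   proof -
    have "real (3 * r) = real (3 * k + 9) * real \<rho>" unfolding r_def by (simp add: algebra_simps)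
    also have "... <= real (3 * k + 9) * x powr (1 - \<delta>)" using f\<rho>(1)[OF d0(1)] x\<delta> by (intro mult_left_mono) auto
    also have "... < real (3 * k + 10) * x powr (1 - \<delta>)" using x1 by (intro mult_strict_right_mono) auto
    finally have "real (3 * r) < real m0" using big by linarith
    thus ?thesis by linarith
   qed
   \<comment> \<open>The exponents add up: at most \<delta> for the number of blocks,
     \<open>1 - 3 * \<delta>\<close> for their size and \<delta> for the spacing give
     \<open>1 - \<delta>\<close>, below the order of \<open>m0\<close>.\<close>
   have Kw: "Kg * \<omega> <= m0"
   proof -
    have "real (Kg * \<omega>) = real B * real kb * real \<omega>" unfolding Kg_def by simp
    also have "... <= x powr \<delta> * x powr (1 - 3 * \<delta>) * (real (2 * k + 7) * x powr \<delta>)"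
    proof (intro mult_mono)
     show "real B <= x powr \<delta>" using fB(1)[OF d0(3)] powr_mono[OF \<delta>3(2) x1] by linarith
     show "real kb <= x powr (1 - 3 * \<delta>)" using fkb(1)[OF d0(4)] .
     have "real \<omega> = real (2 * k + 6) * real \<rho> + 1" unfolding \<omega>_def r_def by (simp add: algebra_simps)
     also have "... <= real (2 * k + 6) * x powr \<delta> + x powr \<delta>"
      using f\<rho>(1)[OF d0(1)] pw[OF d0(1)] by (intro add_mono mult_left_mono) auto
     finally show "real \<omega> <= real (2 * k + 7) * x powr \<delta>" by (simp add: algebra_simps)
    qed auto
    also have "... = real (2 * k + 7) * x powr (1 - \<delta>)"
    proof -
     have "x powr \<delta> * x powr (1 - 3 * \<delta>) * x powr \<delta> = x powr (1 - \<delta>)" unfolding powr_add[symmetric] by (rule arg_cong) simp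
     thus ?thesis by (simp add: mult_ac)
    qed
    also have "... <= real (3 * k + 10) * x powr (1 - \<delta>)" by (intro mult_right_mono) auto
    finally show ?thesis using big by linarith
   qed
   have \<rho>b: "b0 + N + k + 2 <= \<rho>" 
   proof -
    have tr: "A <= C" if "2 * A <= X" "X / 2 <= C" for A C X :: real using that by simp
    have "real (b0 + N + k + 2) <= real \<rho>" by (rule tr[OF elim(3) f\<rho>(2)[OF d0(1), unfolded x_def]])
    thus ?thesis by (rule of_nat_le_iff[THEN iffD1])
   qed
   have \<rho>r: "\<rho> <= r" unfolding r_def by simp
   have pats: "Cs \<subseteq> {1..N}" "T 0 \<subseteq> {1..n}" "!!c. c : Cs ==> T c \<subseteq> {1..N} & G c \<subseteq> T c \<times> T c & sym (G c) & irrefl (G c)"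
    using pat unfolding pat_ok_def by auto
   have fCs: "finite Cs" "card Cs <= N" using pats(1) finite_subset card_mono[OF _ pats(1)] by auto
   have fT0: "finite (T 0)" using pats(2) finite_subset by auto
   obtain f where f: "f ` Cs \<subseteq> {1..2 * h + N}" "inj_on f Cs"
    "!!c v. c : Cs ==> v : T 0 ==> v + 2 * m0 <= 3 * f c * m0 \<or> 3 * f c * m0 + 3 * m0 <= v"
    using far_cells[OF fT0 hT fCs m0(2)] by blast
   define st where "st c = 3 * f c * m0" for c
   have off: "j * \<omega> <= m0" if "j < Kg" for j
    using Kw that mult_le_mono1[of j Kg \<omega>] by linarith
   interpret g: grid \<alpha> N k n r \<rho> \<omega> Kg m0 h Cs T G J st
   proof (unfold_locales)
    show "pat_ok N k n Cs T G J" "card (T 0) <= h" "1 <= k" "T 0 ~= {}" by fact+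
    show "r < st c + j * \<omega> & st c + j * \<omega> + r <= n" if c: "c : Cs" "j < Kg" for c j
    proof
     have fc: "1 <= f c" "f c <= 2 * h + N" using f(1) c(1) by auto
     have "1 * m0 <= 3 * f c * m0" using fc by (intro mult_le_mono1) simp
     thus "r < st c + j * \<omega>" unfolding st_def using r3 by linarith
     have "3 * f c * m0 <= 3 * (2 * h + N) * m0" using fc(2) by simp
     hence "st c + j * \<omega> + r <= 3 * (2 * h + N) * m0 + m0 + m0" unfolding st_def using off[OF c(2)] r3 by linarith
     also have "... = m0 * q" unfolding q_def by (simp add: algebra_simps)
     finally show "st c + j * \<omega> + r <= n" using m0(3) by linarith
    qed
    show "2 * r < \<omega>" unfolding \<omega>_def by simp
    show "m0 + 3 * r < ad (st c + i * \<omega>) (st d + j * \<omega>)" if cd: "c : Cs" "d : Cs" "c ~= d" "i < Kg" "j < Kg" for c d i j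
    proof -
     have one: "m0 + 3 * r < ad (st c + i * \<omega>) (st d + j * \<omega>)" if "f c < f d" "i < Kg" "j < Kg" for c d i j
     proof -
      have "(3 * (f c + 1)) * m0 <= 3 * f d * m0" using that(1) by (intro mult_le_mono1) simp
      hence "st c + 3 * m0 <= st d" unfolding st_def by (simp add: algebra_simps)
      thus ?thesis using off[OF that(2)] r3 m0(2) by (auto simp: ad_def)
     qed
     have "f c ~= f d" using f(2) cd(1-3) by (auto dest: inj_onD)
     thus ?thesis using one[of c d i j] one[of d c j i] cd(4,5) ad_sym[of "st c + i * \<omega>"] by (cases "f c < f d") auto
    qed
    show "m0 + 3 * r < ad v (st c + j * \<omega>)" if "c : Cs" "v : T 0" "j < Kg" for c v j
     using f(3)[OF that(1,2)] off[OF that(3)] r3 m0(2) unfolding st_def by (auto simp: ad_def)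
    show "N + k + 2 <= \<rho>" "(k + 3) * \<rho> <= r" "1 <= m0" "1 <= Kg"
     using \<rho>b m0(2) fB(3)[OF d0(3)] fkb(3)[OF d0(4)] unfolding r_def Kg_def by (auto simp: Suc_le_eq)
   qed
   have cJ: "card J <= E"
   proof -
    let ?P = "SIGMA c:insert 0 Cs. T c"
    have fTc: "finite (T c) & card (T c) <= h + N" if "c : insert 0 Cs" for c
    proof (cases "c = 0")
     case True
     thus ?thesis using fT0 hT by simp
    next
     case False
     hence "T c \<subseteq> {1..N}" using pats(3) that by simp
     thus ?thesis using card_mono[of "{1..N}" "T c"] finite_subset by auto
    qed
    have "card ?P = (\<Sum>c\<in>insert 0 Cs. card (T c))" by (rule card_SigmaI) (use fCs fTc in auto)
    also have "... <= (\<Sum>c\<in>insert 0 Cs. h + N)" using fTc by (intro sum_mono) auto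
    also have "... = card (insert 0 Cs) * (h + N)" by simp
    also have "... <= vv" unfolding vv_def using fCs by (intro mult_le_mono1) (simp add: card_insert_if)
    finally have P: "card ?P <= vv" .
    have fP: "finite ?P" using fCs fTc by (intro finite_SigmaI) auto
    have "J \<subseteq> ?P \<times> ?P" using g.pp(5) by auto
    hence "card J <= card (?P \<times> ?P)" using fP by (intro card_mono) auto
    also have "... <= E" unfolding card_cartesian_product E_def using P by (intro mult_le_mono)
    finally show ?thesis .
   qed
   have eLE: "g.eL L <= E" for L
   proof -
    have "g.eL L <= card J" unfolding g.eL_def by (rule card_mono[OF g.finJ]) auto
    thus ?thesis using cJ by simp
   qed
   have gap: "\<theta> <= real (card L) - \<alpha> / 2 * real (g.eL L)" if "L \<subseteq> Cs" "L ~= {}" for L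
    using \<theta>(3)[OF _ eLE[of L] g.safeL[OF that]] card_mono[OF fCs(1) that(1)] fCs(2) by simp
   have cL: "card L <= N" if "L \<subseteq> Cs" for L using card_mono[OF fCs(1) that] fCs(2) by simp
   have tkb: "g.wL kb L <= 2 ^ N * x powr (- \<theta> / 2)" if "L \<subseteq> Cs" "L ~= {}" for L
    by (rule powr_term_bound[OF x1 fkb(2)[OF d0(4)] _ m0(4) cL[OF that(1)] gap[OF that] \<delta>(3,1) alpha(1)]) simp
   have KB: "kb <= Kg" unfolding Kg_def using fB(3)[OF d0(3)] by simp
   have tKg: "g.wL Kg L <= 2 ^ N * x powr (- \<theta> / 2)" if "L \<subseteq> Cs" "L ~= {}" for L
   proof (rule powr_term_bound[OF x1 _ _ m0(4) cL[OF that(1)] gap[OF that] \<delta>(3,1) alpha(1)])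
    show "x powr (1 - 3 * \<delta>) / 2 <= real Kg" using fkb(2)[OF d0(4)] KB by linarith
   qed simp
   have cP: "real (card (Pow Cs)) <= 2 ^ N" using fCs by (simp add: card_Pow power_increasing)
   have \<sigma>b: "(\<Sum>L\<in>Pow Cs. g.wL kb L) <= \<sigma>"
   proof -
    have "(\<Sum>L\<in>Pow Cs. g.wL kb L) <= (\<Sum>L\<in>Pow Cs. 2 ^ N)"
    proof (rule sum_mono)
     fix L assume L: "L : Pow Cs"
     show "g.wL kb L <= 2 ^ N"
     proof (cases "L = {}")
      case True
      thus ?thesis using g.eL0 m0(2) fkb(3)[OF d0(4)] by simp
     next
      case False
      have "x powr (- \<theta> / 2) <= 1" using x1 \<theta>(1) powr_mono[of "- \<theta> / 2" 0 x] by simp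
      hence "2 ^ N * x powr (- \<theta> / 2) <= 2 ^ N" by simp
      with tkb[of L] L False show ?thesis by (intro order_trans[OF tkb]) auto
     qed
    qed
    also have "... = real (card (Pow Cs)) * 2 ^ N" by simp
    also have "... <= \<sigma>" unfolding \<sigma>_def using cP by (intro mult_right_mono) auto
    finally show ?thesis .
   qed
   define br where "br = (\<Sum>L\<in>Pow Cs - {{}}. real b ^ card L * (g.wL Kg L)) * (K + 1) +
    (K * real \<rho>0 powr - \<epsilon> + real ((b * (2 * (k * \<rho>0) + 1) + 1) ^ k * 2 ^ ((b + k) * (b + k))) * real \<rho> powr - \<alpha>)"
   define \<Lambda> where "\<Lambda> = M2 * real (Kg ^ card Cs) * real m0 powr (- \<alpha> / 2 * real (card J)) * br"
   have br0: "0 <= br" unfolding br_def using K by (intro add_nonneg_nonneg mult_nonneg_nonneg sum_nonneg) auto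
   have brD: "br <= D1 * x powr - \<eta>"
   proof -
    have "(\<Sum>L\<in>Pow Cs - {{}}. real b ^ card L * (g.wL Kg L)) <=
      (\<Sum>L\<in>Pow Cs - {{}}. real (b + 1) ^ N * (2 ^ N * x powr - \<eta>))"
    proof (rule sum_mono, rule mult_mono)
     fix L assume L: "L : Pow Cs - {{}}"
     have "real b ^ card L <= real (b + 1) ^ card L" by (intro power_mono) auto
     also have "... <= real (b + 1) ^ N" using cL[of L] L by (intro power_increasing) auto
     finally show "real b ^ card L <= real (b + 1) ^ N" .
     have "g.wL Kg L <= 2 ^ N * x powr (- \<theta> / 2)" using tKg L by blast
     also have "... <= 2 ^ N * x powr - \<eta>" using x1 \<eta>(2) by (intro mult_left_mono powr_mono) auto
     finally show "g.wL Kg L <= 2 ^ N * x powr - \<eta>" .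
    qed auto
    also have "... = real (card (Pow Cs - {{}})) * (real (b + 1) ^ N * (2 ^ N * x powr - \<eta>))" by simp
    also have "... <= 2 ^ N * (real (b + 1) ^ N * (2 ^ N * x powr - \<eta>))"
    proof (rule mult_right_mono)
     have "card (Pow Cs - {{}}) <= card (Pow Cs)" using fCs(1) by (intro card_mono) auto
     thus "real (card (Pow Cs - {{}})) <= 2 ^ N" using cP by linarith
    qed auto
    finally have 1: "(\<Sum>L\<in>Pow Cs - {{}}. real b ^ card L * (g.wL Kg L)) <=
      2 ^ N * (real (b + 1) ^ N * 2 ^ N) * x powr - \<eta>" by (simp add: mult_ac)
    have 2: "real \<rho>0 powr - \<epsilon> <= 2 powr \<epsilon> * x powr - \<eta>"
    proof -
     have "real \<rho>0 powr - \<epsilon> <= (x powr \<delta>' / 2) powr - \<epsilon>" using f\<rho>0(2)[OF d0(2)] x1 eps by (intro powr_mono2') auto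
     also have "... = 2 powr \<epsilon> * x powr (- (\<delta>' * \<epsilon>))" using x1 by (simp add: powr_half powr_powr)
     also have "... <= 2 powr \<epsilon> * x powr - \<eta>" using x1 \<eta>(3) by (intro mult_left_mono powr_mono) auto
     finally show ?thesis .
    qed
    have 3: "real ((b * (2 * (k * \<rho>0) + 1) + 1) ^ k * 2 ^ ((b + k) * (b + k))) * real \<rho> powr - \<alpha> <= D0 * x powr - \<eta>"
    proof -
     have "real (b * (2 * (k * \<rho>0) + 1) + 1) <= real (b * (2 * k + 1) + 1) * x powr \<delta>'"
     proof -
      have "real (b * (2 * (k * \<rho>0) + 1) + 1) = real b * (2 * real k * real \<rho>0 + 1) + 1" by (simp add: algebra_simps)
      also have "... <= real b * (2 * real k * x powr \<delta>' + x powr \<delta>') + x powr \<delta>'"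
       using f\<rho>0(1)[OF d0(2)] pw[OF d0(2)] by (intro add_mono mult_left_mono) auto
      finally show ?thesis by (simp add: algebra_simps)
     qed
     hence "real (b * (2 * (k * \<rho>0) + 1) + 1) ^ k <= (real (b * (2 * k + 1) + 1) * x powr \<delta>') ^ k" by (intro power_mono) auto
     also have "... = real (b * (2 * k + 1) + 1) ^ k * x powr (\<alpha> * \<delta> / 2)"
      unfolding power_mult_distrib \<delta>'(2)[symmetric] powr_powr[symmetric] using x1 by (simp add: powr_realpow)
     finally have a: "real (b * (2 * (k * \<rho>0) + 1) + 1) ^ k <= real (b * (2 * k + 1) + 1) ^ k * x powr (\<alpha> * \<delta> / 2)" .
     have "real \<rho> powr - \<alpha> <= (x powr \<delta> / 2) powr - \<alpha>" using f\<rho>(2)[OF d0(1)] x1 alpha(1) by (intro powr_mono2') auto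
     also have "... = 2 powr \<alpha> * x powr (- (\<alpha> * \<delta>))" using x1 by (simp add: powr_half powr_powr mult.commute)
     also have "... <= 2 * x powr (- (\<alpha> * \<delta>))" using powr_mono[of \<alpha> 1 2] alpha by (intro mult_right_mono) auto
     finally have c: "real \<rho> powr - \<alpha> <= 2 * x powr (- (\<alpha> * \<delta>))" .
     have "real ((b * (2 * (k * \<rho>0) + 1) + 1) ^ k * 2 ^ ((b + k) * (b + k))) * real \<rho> powr - \<alpha> =
       real (b * (2 * (k * \<rho>0) + 1) + 1) ^ k * real (2 ^ ((b + k) * (b + k))) * real \<rho> powr - \<alpha>" by simp
     also have "... <= real (b * (2 * k + 1) + 1) ^ k * x powr (\<alpha> * \<delta> / 2) * real (2 ^ ((b + k) * (b + k))) * (2 * x powr (- (\<alpha> * \<delta>)))"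
      by (intro mult_mono a c order_refl) auto
     also have "... = D0 * (x powr (\<alpha> * \<delta> / 2) * x powr (- (\<alpha> * \<delta>)))" unfolding D0_def by (simp add: mult_ac)
     also have "x powr (\<alpha> * \<delta> / 2) * x powr (- (\<alpha> * \<delta>)) = x powr (- (\<alpha> * \<delta> / 2))" unfolding powr_add[symmetric] by (rule arg_cong) simp
     also have "D0 * x powr (- (\<alpha> * \<delta> / 2)) <= D0 * x powr - \<eta>"
      using x1 \<eta>(4) by (intro mult_left_mono powr_mono) (auto simp: D0_def)
     finally show ?thesis .
    qed
    have "br <= 2 ^ N * (real (b + 1) ^ N * 2 ^ N) * x powr - \<eta> * (K + 1) + (K * (2 powr \<epsilon> * x powr - \<eta>) + D0 * x powr - \<eta>)"
     unfolding br_def by (intro add_mono mult_right_mono[OF 1] mult_left_mono[OF 2] 3) (use K in auto)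
    also have "... = D1 * x powr - \<eta>" unfolding D1_def by (simp add: algebra_simps)
    finally show ?thesis .
   qed
   define \<mu> where "\<mu> = \<gamma> ^ N * real (kb ^ card Cs) * real n powr (- \<alpha> / 2 * real (card J))"
   define cc where "cc = \<sigma> * \<kappa> powr (\<alpha> * real (card J)) / \<gamma> ^ (2 * N)"
   have fail: "Pr n {w. ~ (\<exists>y. realizes k n (RR n w) Cs T G J y)} <= (1 - 1 / (4 * cc)) ^ B + (\<Lambda> / (\<mu> / 2)) ^ p"
    unfolding cc_def \<mu>_def
   proof (rule g.fail_prob_explicit)
    show "B * kb <= Kg" unfolding Kg_def by simp
    show "1 <= kb" using fkb(3)[OF d0(4)] .
    show "N <= b0" "b0 <= r" using b0 \<rho>b \<rho>r by auto
    show "0 < \<gamma>" "\<gamma> <= 1" "0 < \<kappa>" using \<gamma> \<kappa>1 by auto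
    show "\<gamma> <= Pr n {w. wgood k r b0 (T c) (G c) (st c + j * \<omega>) (RR n w)}" if "c : Cs" "j < Kg" for c j
     using WP'[of "T c" "G c" r "st c + j * \<omega>" n] pats(3)[OF that(1)] g.inside[OF that] \<rho>b \<rho>r \<gamma>(3) by force
    show "(\<Sum>L\<in>Pow Cs. g.wL kb L) <= \<sigma>" by (rule \<sigma>b)
    show "0 < \<sigma>" unfolding \<sigma>_def by simp
    show "real n <= \<kappa> * real m0" using m0(1) unfolding x_def .
    show "0 <= \<Lambda>" unfolding \<Lambda>_def M2_def using br0 by (intro mult_nonneg_nonneg) auto
    show "(\<Sum>x\<in>g.HH. \<Prod>e\<in>g.es x - F \<times> F. pe \<alpha> e) <= \<Lambda>" if "finite F" "card F <= p * ((N + 1) * (h + N) + k)" for F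
     unfolding \<Lambda>_def M2_def br_def
     by (rule g.bad_sum[OF that _ MS]) (use K f\<rho>0(3)[OF d0(2)] in \<open>auto simp: b_def vv_def\<close>)
   qed
   have J\<alpha>: "\<alpha> * real (card J) <= real E" "\<alpha> / 2 * real (card J) <= real E"
   proof -
    have "\<alpha> * real (card J) <= 1 * real E" using alpha cJ by (intro mult_mono) auto
    thus "\<alpha> * real (card J) <= real E" by simp
    thus "\<alpha> / 2 * real (card J) <= real E" using alpha(1) by (simp add: field_simps)
   qed
   have first: "(1 - 1 / (4 * cc)) ^ B <= x powr - real (h + 1)"
   proof -
    have cc1: "1 <= cc"
    proof -
     have "1 <= \<sigma>" unfolding \<sigma>_def using one_le_power[of "2::real" N] mult_mono[of 1 "2 ^ N" 1 "2 ^ N :: real"] by simp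
     moreover have "1 <= \<kappa> powr (\<alpha> * real (card J))" using \<kappa>1 alpha(1) by (intro ge_one_powr_ge_zero) auto
     ultimately have "1 * 1 <= \<sigma> * \<kappa> powr (\<alpha> * real (card J))" by (intro mult_mono) auto
     moreover have "\<gamma> ^ (2 * N) <= 1" "0 < \<gamma> ^ (2 * N)" using \<gamma> by (auto intro: power_le_one)
     ultimately show ?thesis unfolding cc_def by (simp add: le_divide_eq)
    qed
    have ccm: "cc <= cm" unfolding cc_def cm_def
     using \<kappa>1 J\<alpha>(1) \<gamma> by (intro divide_right_mono mult_left_mono powr_mono) (auto simp: \<sigma>_def)
    have "1 / (4 * cm) <= 1 / (4 * cc)" using ccm cc1 by (intro divide_left_mono) auto
    hence "1 - 1 / (4 * cc) <= 1 + - (1 / (4 * cm))" by simp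
    also have "... <= exp (- (1 / (4 * cm)))" by (rule exp_ge_add_one_self)
    finally have "(1 - 1 / (4 * cc)) ^ B <= exp (- (1 / (4 * cm))) ^ B" using cc1 by (intro power_mono) (auto simp: field_simps)
    also have "... = exp (- (real B / (4 * cm)))" by (simp add: exp_of_nat_mult[symmetric])
    also have "... <= exp (- (x powr \<delta>3 / (8 * cm)))" using fB(2)[OF d0(3)] cm by (simp add: field_simps)
    also have "... <= x powr - real (h + 1)" using elim(1) unfolding x_def .
    finally show ?thesis .
   qed
   have kb0: "0 < real kb" using fkb(3)[OF d0(4)] by simp
   have \<mu>0: "0 < \<mu>" unfolding \<mu>_def using \<gamma> kb0 x1 unfolding x_def by simp
   have ratio: "\<Lambda> <= D2 * x powr (- \<eta> / 2) * (\<mu> / 2)"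
   proof -
    have a: "real (Kg ^ card Cs) <= x powr (\<eta> / 2) * real (kb ^ card Cs)"
    proof -
     have "real B ^ card Cs <= (x powr \<delta>3) ^ card Cs" using fB(1)[OF d0(3)] by (intro power_mono) auto
     also have "... = x powr (\<delta>3 * real (card Cs))" using x1 by (simp add: powr_realpow[symmetric] powr_powr)
     also have "... <= x powr (\<eta> / 2)"
     proof (rule powr_mono[OF _ x1])
      have "\<delta>3 * real (card Cs) <= \<delta>3 * real N" using fCs(2) \<delta>3(1) by simp
      thus "\<delta>3 * real (card Cs) <= \<eta> / 2" using \<delta>3(3) by linarith
     qed
     finally have "real B ^ card Cs * real kb ^ card Cs <= x powr (\<eta> / 2) * real kb ^ card Cs" by (intro mult_right_mono) auto
     thus ?thesis unfolding Kg_def by (simp add: power_mult_distrib)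
    qed
    have c: "real m0 powr (- \<alpha> / 2 * real (card J)) <= \<kappa> powr real E * real n powr (- \<alpha> / 2 * real (card J))"
    proof -
     have "real m0 powr (- \<alpha> / 2 * real (card J)) <= (x / \<kappa>) powr (- \<alpha> / 2 * real (card J))"
      using m0(1) \<kappa>1 alpha(1) x1 by (intro powr_mono2') (auto simp: field_simps)
     also have "... = \<kappa> powr (\<alpha> / 2 * real (card J)) * x powr (- \<alpha> / 2 * real (card J))"
      using \<kappa>1 x1 by (simp add: powr_divide powr_minus field_simps)
     also have "... <= \<kappa> powr real E * x powr (- \<alpha> / 2 * real (card J))"
      using \<kappa>1 J\<alpha>(2) by (intro mult_right_mono powr_mono) auto
     finally show ?thesis unfolding x_def .
    qed
    have "\<Lambda> <= M2 * (x powr (\<eta> / 2) * real (kb ^ card Cs)) * (\<kappa> powr real E * real n powr (- \<alpha> / 2 * real (card J))) * (D1 * x powr - \<eta>)"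
     unfolding \<Lambda>_def using br0 by (intro mult_mono a c brD order_refl) (auto simp: M2_def)
    also have "... = M2 * \<kappa> powr real E * D1 * (x powr (\<eta> / 2) * x powr - \<eta>) * (real (kb ^ card Cs) * real n powr (- \<alpha> / 2 * real (card J)))"
     by (simp add: mult_ac)
    also have "x powr (\<eta> / 2) * x powr - \<eta> = x powr (- \<eta> / 2)" unfolding powr_add[symmetric] by (rule arg_cong) simp
    also have "M2 * \<kappa> powr real E * D1 * x powr (- \<eta> / 2) * (real (kb ^ card Cs) * real n powr (- \<alpha> / 2 * real (card J))) = D2 * x powr (- \<eta> / 2) * (\<mu> / 2)"
     unfolding D2_def \<mu>_def using \<gamma>(1) by (simp add: field_simps)
    finally show ?thesis .
   qed
   have D20: "0 <= D2" unfolding D2_def M2_def using D1 \<gamma> by simp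
   have second: "(\<Lambda> / (\<mu> / 2)) ^ p <= D2 ^ p * x powr - real (h + 1)"
   proof -
    have "\<Lambda> / (\<mu> / 2) <= D2 * x powr (- \<eta> / 2)" using ratio \<mu>0 by (simp add: field_simps)
    moreover have "0 <= \<Lambda> / (\<mu> / 2)" using \<mu>0 br0 unfolding \<Lambda>_def M2_def by simp
    ultimately have "(\<Lambda> / (\<mu> / 2)) ^ p <= (D2 * x powr (- \<eta> / 2)) ^ p" by (intro power_mono)
    also have "... = D2 ^ p * x powr (- \<eta> / 2 * real p)" unfolding power_mult_distrib using x1 by (simp add: powr_realpow[symmetric] powr_powr)
    also have "... <= D2 ^ p * x powr - real (h + 1)" using p x1 D20 by (intro mult_left_mono powr_mono) auto
    finally show ?thesis .
   qed
   show "Pr n {w. ~ (\<exists>y. realizes k n (RR n w) Cs T G J y)} <= (1 + D2 ^ p) * real n powr - real (h + 1)"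
    using fail first second unfolding x_def by (simp add: algebra_simps)
  qed
 qed
 thus ?thesis by blast
qed

end

section \<open>The closure of the two end points\<close>

context irrational_exponent
begin

lemma pat_ok_cong:
 assumes pat: "pat_ok N k n Cs T G J" and T: "!!c. c : insert 0 Cs ==> T' c = T c" and G: "!!c. c : Cs ==> G' c = G c"
 shows "pat_ok N k n Cs T' G' J"
proof -
 have "T' 0 = T 0" using T by simp
 moreover have "{((c, t), (d, s)). c : insert 0 Cs & d : insert 0 Cs & c ~= d & t : T' c & s : T' d} =
   {((c, t), (d, s)). c : insert 0 Cs & d : insert 0 Cs & c ~= d & t : T c & s : T d}"
  using T by auto
 moreover have "(\<forall>c\<in>Cs. T' c \<subseteq> {1..N} & gapped (k + 1) (T' c) & G' c \<subseteq> T' c \<times> T' c & sym (G' c) & irrefl (G' c)) \<longleftrightarrow>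
   (\<forall>c\<in>Cs. T c \<subseteq> {1..N} & gapped (k + 1) (T c) & G c \<subseteq> T c \<times> T c & sym (G c) & irrefl (G c))"
  using T G by (intro ball_cong) auto
 ultimately show ?thesis using pat unfolding pat_ok_def by simp
qed

lemma realizes_cong:
 assumes re: "realizes k n R Cs T' G' J y" and T: "!!c. c : insert 0 Cs ==> T' c = T c" and G: "!!c. c : Cs ==> G' c = G c"
 shows "realizes k n R Cs T G J y"
proof -
 have v: "vset y T' c = vset y T c" if "c : insert 0 Cs" for c unfolding vset_def using T[OF that] by simp
 have u: "(\<Union>c\<in>insert 0 Cs. vset y T' c) = (\<Union>c\<in>insert 0 Cs. vset y T c)" using v by (intro SUP_cong) auto
 have u': "(\<Union>c\<in>Cs. vset y T' c) = (\<Union>c\<in>Cs. vset y T c)" using v by (intro SUP_cong) auto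
 have T0: "T' 0 = T 0" using T by simp
 note re' = re[unfolded realizes_def u u' T0]
 have "\<forall>c\<in>Cs. vset y T c \<subseteq> {1..n} & (\<forall>t\<in>T c. \<forall>s\<in>T c. (y c + t, y c + s) : R \<longleftrightarrow> (t, s) : G c)"
 proof
  fix c assume c: "c : Cs"
  show "vset y T c \<subseteq> {1..n} & (\<forall>t\<in>T c. \<forall>s\<in>T c. (y c + t, y c + s) : R \<longleftrightarrow> (t, s) : G c)"
   using re'[THEN conjunct2, THEN conjunct1, THEN bspec, OF c] T[of c] G[OF c] v[of c] c by simp
 qed
 moreover have "\<forall>c\<in>insert 0 Cs. \<forall>d\<in>insert 0 Cs. c ~= d --> (\<forall>t\<in>T c. \<forall>s\<in>T d.
    ((y c + t, y d + s) : R \<longleftrightarrow> ((c, t), (d, s)) : J) & (y c + t + k + 1 < y d + s \<or> y d + s + k + 1 < y c + t))"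
 proof (rule ballI, rule ballI)
  fix c d assume c: "c : insert 0 Cs" and d: "d : insert 0 Cs"
  show "c ~= d --> (\<forall>t\<in>T c. \<forall>s\<in>T d.
    ((y c + t, y d + s) : R \<longleftrightarrow> ((c, t), (d, s)) : J) & (y c + t + k + 1 < y d + s \<or> y d + s + k + 1 < y c + t))"
   using re'[THEN conjunct2, THEN conjunct2, THEN conjunct1, THEN bspec, OF c, THEN bspec, OF d] unfolding T[OF c] T[OF d] .
 qed
 ultimately show ?thesis unfolding realizes_def using re'[THEN conjunct1] re'[THEN conjunct2, THEN conjunct2, THEN conjunct2] by (intro conjI)
qed

text \<open>A union bound: about \<open>n ^ h\<close> bases and a bounded number of patterns over
  each, against a failure probability of order \<open>n powr - (h + 1)\<close>.\<close>

lemma ext_ax_whp: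
 assumes k: "1 <= k"
 shows "(%n. Pr n {w. ~ ext_ax h k N n (RR n w)}) \<longlonglongrightarrow> 0"
proof -
 obtain D0 where D0: "\<forall>\<^sub>F n in sequentially. \<forall>Cs T G J. pat_ok N k n Cs T G J --> card (T 0) <= h --> T 0 ~= {} -->
  Pr n {w. ~ (\<exists>y. realizes k n (RR n w) Cs T G J y)} <= D0 * real n powr - real (h + 1)"
  using pattern_fail[OF k, of N h] by blast
 define D where "D = max D0 0"
 define pts where "pts V = {0::nat} \<times> V Un {1..N} \<times> {1..N}" for V :: "nat set"
 define Cp where "Cp = 2 ^ N * ((2 ^ N) ^ N * ((2 ^ (N * N)) ^ N * 2 ^ ((h + N * N) * (h + N * N))) :: nat)"
 define Vn where "Vn n = {V. V \<subseteq> {1..n} & card V <= h}" for n :: nat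
 define Om where "Om n = (SIGMA V:Vn n. Pow {1..N} \<times> ({1..N} \<rightarrow>\<^sub>E Pow {1..N}) \<times> ({1..N} \<rightarrow>\<^sub>E Pow ({1..N} \<times> {1..N})) \<times> Pow (pts V \<times> pts V))" for n
 \<comment> \<open>Patterns involve functions on all numbers. To count them, the base is listed
   separately and the other values are kept on \<open>{1..N}\<close> only; these determine whether a
   pattern is admissible and realised.\<close>
 define TT where "TT V T = (%c::nat. if c = 0 then V else T c)" for V :: "nat set" and T :: "nat => nat set"
 define F where "F n = (%(V, Cs, T, G, J). if pat_ok N k n Cs (TT V T) G J & V ~= {} then
   {w. ~ (\<exists>y. realizes k n (RR n w) Cs (TT V T) G J y)} else {})" for n
 have finV: "finite V" if "V : Vn n" for V n using that finite_subset[of V "{1..n}"] unfolding Vn_def by auto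
 have finVn: "finite (Vn n)" for n unfolding Vn_def by (rule finite_subset[of _ "Pow {1..n}"]) auto
 have fin: "finite (Pow {1..N} \<times> ({1..N} \<rightarrow>\<^sub>E Pow {1..N}) \<times> ({1..N} \<rightarrow>\<^sub>E Pow ({1..N} \<times> {1..N})) \<times> Pow (pts V \<times> pts V))"
  if "V : Vn n" for V n
  using finV[OF that] unfolding pts_def by (intro finite_cartesian_product finite_PiE) auto
 have finOm: "finite (Om n)" for n unfolding Om_def by (rule finite_SigmaI[OF finVn fin])
 have cardOm: "card (Om n) <= (n + 1) ^ h * Cp" for n
 proof -
  have "card (Om n) = (\<Sum>V\<in>Vn n. card (Pow {1..N} \<times> ({1..N} \<rightarrow>\<^sub>E Pow {1..N}) \<times> ({1..N} \<rightarrow>\<^sub>E Pow ({1..N} \<times> {1..N})) \<times> Pow (pts V \<times> pts V)))"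
   unfolding Om_def by (rule card_SigmaI[OF finVn]) (rule ballI, rule fin)
  also have "... <= (\<Sum>V\<in>Vn n. Cp)"
  proof (rule sum_mono)
   fix V assume V: "V : Vn n"
   have "card (pts V) <= card ({0::nat} \<times> V) + card ({1..N} \<times> {1..N})" unfolding pts_def by (rule card_Un_le)
   also have "... <= h + N * N" using V unfolding Vn_def by (simp add: card_cartesian_product)
   finally have p: "card (pts V \<times> pts V) <= (h + N * N) * (h + N * N)" unfolding card_cartesian_product by (intro mult_le_mono)
   have "finite (pts V \<times> pts V)" unfolding pts_def using finV[OF V] by auto
   hence "card (Pow (pts V \<times> pts V)) <= 2 ^ ((h + N * N) * (h + N * N))" using p by (simp add: card_Pow power_increasing)
   thus "card (Pow {1..N} \<times> ({1..N} \<rightarrow>\<^sub>E Pow {1..N}) \<times> ({1..N} \<rightarrow>\<^sub>E Pow ({1..N} \<times> {1..N})) \<times> Pow (pts V \<times> pts V)) <= Cp"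
    unfolding Cp_def card_cartesian_product by (intro mult_le_mono) (simp_all add: card_PiE card_Pow)
  qed
  also have "... = card (Vn n) * Cp" by simp
  also have "... <= (n + 1) ^ h * Cp" using card_small_subsets[of "{1..n}" h] unfolding Vn_def by (intro mult_le_mono1) simp
  finally show ?thesis .
 qed
 have sub: "{w. ~ ext_ax h k N n (RR n w)} \<subseteq> (\<Union>z\<in>Om n. F n z)" for n
 proof
  fix w assume "w : {w. ~ ext_ax h k N n (RR n w)}"
  then obtain Cs T G J where p: "pat_ok N k n Cs T G J" "card (T 0) <= h" "{1, n} \<subseteq> T 0" and no: "~ (\<exists>y. realizes k n (RR n w) Cs T G J y)"
   unfolding ext_ax_def by blast
  have pp: "Cs \<subseteq> {1..N}" "T 0 \<subseteq> {1..n}" "!!c. c : Cs ==> T c \<subseteq> {1..N} & G c \<subseteq> T c \<times> T c"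
   "J \<subseteq> {((c, t), (d, s)). c : insert 0 Cs & d : insert 0 Cs & c ~= d & t : T c & s : T d}"
   using p(1) unfolding pat_ok_def by auto
  define T' where "T' = (\<lambda>c\<in>{1..N}. T c Int {1..N})"
  define G' where "G' = (\<lambda>c\<in>{1..N}. G c Int {1..N} \<times> {1..N})"
  have T': "TT (T 0) T' c = T c" if "c : insert 0 Cs" for c
  proof (cases "c = 0")
   case False
   hence "c : Cs" "c : {1..N}" using that pp(1) by auto
   thus ?thesis using False pp(3)[of c] unfolding TT_def T'_def by auto
  qed (simp add: TT_def)
  have G': "G' c = G c" if "c : Cs" for c
  proof -
   have "c : {1..N}" "G c \<subseteq> {1..N} \<times> {1..N}" using that pp(1,3) by blast+
   thus ?thesis unfolding G'_def by auto
  qed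
  have "J \<subseteq> pts (T 0) \<times> pts (T 0)"
  proof
   fix e assume e: "e : J"
   obtain c t d s where eq: "e = ((c, t), (d, s))" by (metis prod.exhaust)
   have m: "c : insert 0 Cs" "d : insert 0 Cs" "t : T c" "s : T d" using subsetD[OF pp(4) e] unfolding eq by auto
   have "(c, t) : pts (T 0)" if "c : insert 0 Cs" "t : T c" for c t
    using that pp(1) pp(3)[of c] unfolding pts_def by (cases "c = 0") auto
   thus "e : pts (T 0) \<times> pts (T 0)" using m unfolding eq by simp
  qed
  moreover have "T' : {1..N} \<rightarrow>\<^sub>E Pow {1..N}" "G' : {1..N} \<rightarrow>\<^sub>E Pow ({1..N} \<times> {1..N})" unfolding T'_def G'_def by auto
  ultimately have mem: "(T 0, Cs, T', G', J) : Om n" unfolding Om_def Vn_def using pp(1,2) p(2) by simp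
  have "~ (\<exists>y. realizes k n (RR n w) Cs (TT (T 0) T') G' J y)"
  proof
   assume "\<exists>y. realizes k n (RR n w) Cs (TT (T 0) T') G' J y"
   then obtain y where y: "realizes k n (RR n w) Cs (TT (T 0) T') G' J y" by (rule exE)
   have "realizes k n (RR n w) Cs T G J y" by (rule realizes_cong[OF y T' G'])
   thus False using no by blast
  qed
  moreover have "pat_ok N k n Cs (TT (T 0) T') G' J" by (rule pat_ok_cong[OF p(1) T' G'])
  ultimately have "w : F n (T 0, Cs, T', G', J)" unfolding F_def using p(3) by auto
  thus "w : (\<Union>z\<in>Om n. F n z)" using mem by blast
 qed
 have bound: "\<forall>\<^sub>F n in sequentially. Pr n {w. ~ ext_ax h k N n (RR n w)} <= 2 ^ h * real Cp * D / real n"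
  using D0 eventually_ge_at_top[of 1]
 proof eventually_elim
  case (elim n)
  have FD: "Pr n (F n z) <= D * real n powr - real (h + 1)" if z: "z : Om n" for z
  proof -
   obtain V Cs T G J where zz: "z = (V, Cs, T, G, J)" by (metis prod.exhaust)
   have V: "card (TT V T 0) <= h" using z unfolding zz Om_def Vn_def TT_def by simp
   show ?thesis
   proof (cases "pat_ok N k n Cs (TT V T) G J & V ~= {}")
    case True
    hence "Pr n {w. ~ (\<exists>y. realizes k n (RR n w) Cs (TT V T) G J y)} <= D0 * real n powr - real (h + 1)"
     using elim(1) V by (auto simp: TT_def)
    also have "... <= D * real n powr - real (h + 1)" unfolding D_def by (intro mult_right_mono) auto
    finally show ?thesis using True unfolding zz F_def by simp
   next
    case False
    hence "F n z = {}" unfolding zz F_def by auto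
    thus ?thesis by (simp add: D_def)
   qed
  qed
  have "Pr n {w. ~ ext_ax h k N n (RR n w)} <= Pr n (\<Union>z\<in>Om n. F n z)" by (rule Pr_mono[OF sub])
  also have "... <= (\<Sum>z\<in>Om n. Pr n (F n z))" by (rule Pr_UN_le[OF finOm])
  also have "... <= (\<Sum>z\<in>Om n. D * real n powr - real (h + 1))" by (rule sum_mono[OF FD])
  also have "... = real (card (Om n)) * (D * real n powr - real (h + 1))" by simp
  also have "... <= ((2 * real n) ^ h * real Cp) * (D * real n powr - real (h + 1))"
  proof (rule mult_right_mono)
   have "real (card (Om n)) <= real ((n + 1) ^ h * Cp)" by (rule of_nat_mono[OF cardOm])
   also have "... = (real n + 1) ^ h * real Cp" by (simp add: add.commute)
   also have "... <= (2 * real n) ^ h * real Cp" using elim(2) by (intro mult_right_mono power_mono) auto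
   finally show "real (card (Om n)) <= (2 * real n) ^ h * real Cp" .
  qed (simp add: D_def)
  also have "... = 2 ^ h * real Cp * D * (real n ^ h * real n powr - real (h + 1))" by (simp add: power_mult_distrib)
  also have "real n ^ h * real n powr - real (h + 1) = 1 / real n"
   using elim(2) by (simp add: powr_minus powr_add powr_realpow divide_inverse powr_diff)
  finally show ?case by simp
 qed
 show ?thesis
 proof (rule real_tendsto_sandwich[OF _ bound tendsto_const])
  show "\<forall>\<^sub>F n in sequentially. 0 <= Pr n {w. ~ ext_ax h k N n (RR n w)}" by simp
  show "(%n. 2 ^ h * real Cp * D / real n) \<longlonglongrightarrow> 0" by (rule lim_const_over_n)
 qed
qed

definition ends :: "nat => nat => nat set" where "ends l n = {1..l} Un {n - l + 1..n}"

text \<open>The edges witnessing a rigid extension that leaves the ends form a far configuration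
  over \<open>{1, n}\<close>; the expected number of these is small by \<open>multi_scale\<close>,
  uniformly in \<open>n\<close>.\<close>

lemma closure_of_ends:
 assumes m: "1 <= m" and \<eta>: "0 < \<eta>"
 shows "\<exists>l\<ge>1. \<forall>n. Pr n {w. ~ cl (RR n w) {1..n} m {1, n} \<subseteq> ends l n} <= \<eta>"
proof -
 obtain \<epsilon> where eps: "\<epsilon> > 0" and "\<forall>b. \<exists>K>0. small_sums m b K \<epsilon>"
  using multi_scale[OF m] by blast
 from this(2)[THEN spec, of 2] obtain K where K: "K > 0" and SS: "small_sums m 2 K \<epsilon>" by blast
 note MS = small_sumsD[OF SS]
 obtain s0 :: nat where s0: "1 <= s0" "K * real s0 powr - \<epsilon> <= \<eta>" using powr_small[OF K eps \<eta>] by auto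
 \<comment> \<open>A vertex outside \<open>ends l n\<close> is at distance at least
   \<open>m * s0\<close> from both end points; the summand 1 puts the end points themselves into
   \<open>ends\<close>.\<close>
 define l where "l = m * s0 + 1"
 have "Pr n {w. ~ cl (RR n w) {1..n} m {1, n} \<subseteq> ends l n} <= \<eta>" for n
 proof -
  let ?X = "{1, n}"
  let ?I = "{z : rconf n m ?X s0. snd z \<subseteq> vertex_pairs n}"
  have fI: "finite ?I" using finite_rconf[of ?X n m s0] by simp
  have cX: "card ?X <= 2" by (simp add: card_insert_if)
  have "{w. ~ cl (RR n w) {1..n} m ?X \<subseteq> ends l n} \<subseteq> (\<Union>z\<in>?I. {w. \<forall>e\<in>snd z. w e})"
  proof
   fix w assume "w : {w. ~ cl (RR n w) {1..n} m ?X \<subseteq> ends l n}"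
   then obtain u V where u: "u ~: ends l n" "u : V" and V: "V \<subseteq> {1..n}" "rigid (RR n w) ?X V" "card (V - ?X) <= m"
    unfolding cl_def by blast
   define C where "C = V - ?X"
   define Q where "Q = {(u, v) : econf m ?X C. (u, v) : RR n w}"
   have XV: "?X Un C = V" using rigidD(2)[OF V(2)] unfolding C_def by blast
   have un: "1 <= u" "u <= n" using u(2) V(1) by auto
   hence far: "l < u" "u + l <= n" using u(1) unfolding ends_def by auto
   hence uC: "u : C" using u(2) unfolding C_def l_def by auto
   have "rigid (RR n w) ?X (?X Un C)" using V(2) unfolding XV .
   note re = rigid_econf[OF this, of m, folded Q_def]
   note re(1)
   moreover have "m * s0 <= nd u ?X"
   proof -
    obtain y where y: "y : ?X" "nd u ?X = ad u y" using nd_attained[of ?X u] by auto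
    thus ?thesis using far un unfolding l_def by (auto simp: ad_def)
   qed
   moreover have "C \<subseteq> {1..n}" "C Int ?X = {}" "C ~= {}" "card C <= m"
    using V(1,3) uC unfolding C_def by auto
   moreover note re(4)
   ultimately have rc: "(C, Q) : rconf n m ?X s0" unfolding rconf_def using uC by blast
   show "w : (\<Union>z\<in>?I. {w. \<forall>e\<in>snd z. w e})" using rc re(2,3) by (intro UN_I[of "(C, Q)"]) auto
  qed
  hence "Pr n {w. ~ cl (RR n w) {1..n} m ?X \<subseteq> ends l n} <= Pr n (\<Union>z\<in>?I. {w. \<forall>e\<in>snd z. w e})" by (rule Pr_mono)
  also have "... <= (\<Sum>z\<in>?I. Pr n {w. \<forall>e\<in>snd z. w e})" by (rule Pr_UN_le[OF fI])
  also have "... = (\<Sum>z\<in>?I. \<Prod>e\<in>snd z. pe \<alpha> e)" by (intro sum.cong[OF refl] prob_edges) auto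
  also have "... <= (\<Sum>z\<in>rconf n m ?X s0. \<Prod>e\<in>snd z. pe \<alpha> e)"
   using finite_rconf[of ?X n m s0] pe_bounds by (intro sum_mono2 prod_nonneg) auto
  also have "... = rsum n m ?X s0" by (simp add: case_prod_beta)
  also have "... <= \<eta>" using MS[OF _ _ cX s0(1), of n] s0(2) by simp
  finally show ?thesis .
 qed
 thus ?thesis by (intro exI[of _ l]) (auto simp: l_def)
qed

text \<open>There are at most \<open>l * l\<close> such pairs, each longer than
  \<open>n - 2 * l\<close>.\<close>

lemma links_vanish: "(%n. Pr n {w. \<exists>u\<in>{1..l}. \<exists>v\<in>{n - l + 1..n}. (u, v) : vertex_pairs n & w (u, v)}) \<longlonglongrightarrow> 0"
proof -
 have bound: "\<forall>\<^sub>F n in sequentially. Pr n {w. \<exists>u\<in>{1..l}. \<exists>v\<in>{n - l + 1..n}. (u, v) : vertex_pairs n & w (u, v)} <= real (l * l) * real (n - 2 * l) powr - \<alpha>"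
  using eventually_gt_at_top[of "2 * l"]
 proof eventually_elim
  case (elim n)
  let ?I = "({1..l} \<times> {n - l + 1..n}) Int vertex_pairs n"
  have fI: "finite ?I" by simp
  have "Pr n {w. \<exists>u\<in>{1..l}. \<exists>v\<in>{n - l + 1..n}. (u, v) : vertex_pairs n & w (u, v)} <= Pr n (\<Union>e\<in>?I. {w. w e})"
   by (rule Pr_mono) auto
  also have "... <= (\<Sum>e\<in>?I. Pr n {w. w e})" by (rule Pr_UN_le[OF fI])
  also have "... <= (\<Sum>e\<in>?I. real (n - 2 * l) powr - \<alpha>)"
  proof (rule sum_mono)
   fix e assume e: "e : ?I"
   have "Pr n {w. w e} = pe \<alpha> e" using prob_edges[of "{e}" n] e by simp
   also have "... <= real (snd e - fst e) powr - \<alpha>" by (rule edge_prob_le[OF alpha(1)]) (use e in \<open>auto simp: vertex_pairs_def\<close>)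
   also have "... <= real (n - 2 * l) powr - \<alpha>" using e elim alpha(1) by (intro powr_mono2') auto
   finally show "Pr n {w. w e} <= real (n - 2 * l) powr - \<alpha>" .
  qed
  also have "... = real (card ?I) * real (n - 2 * l) powr - \<alpha>" by simp
  also have "... <= real (l * l) * real (n - 2 * l) powr - \<alpha>"
  proof (intro mult_right_mono of_nat_mono)
   have "card ?I <= card ({1..l} \<times> {n - l + 1..n})" by (intro card_mono) auto
   also have "... <= l * l" unfolding card_cartesian_product by (intro mult_le_mono) auto
   finally show "card ?I <= l * l" .
  qed simp
  finally show ?case .
 qed
 show ?thesis
 proof (rule real_tendsto_sandwich[OF _ bound tendsto_const])
  have "(%n. real (n + 2 * l - 2 * l) powr - \<alpha>) \<longlonglongrightarrow> 0" using alpha(1) by simp real_asymp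
  hence "(%n. real (n - 2 * l) powr - \<alpha>) \<longlonglongrightarrow> 0" by (rule LIMSEQ_offset[where k = "2 * l"])
  thus "(%n. real (l * l) * real (n - 2 * l) powr - \<alpha>) \<longlonglongrightarrow> 0" by (rule tendsto_mult_right_zero)
 qed simp
qed

lemma graph_on_RR: "1 <= n ==> graph_on n (RR n w)"
 unfolding graph_on_def using sym_RR by (auto simp: RR_iff vertex_pairs_def irrefl_def)

definition shp :: "nat => nat => nat \<times> nat => nat \<times> nat" where
 "shp l n e = (n - l + fst e, n - l + snd e)"

text \<open>The graphs on the first and the last \<open>l\<close> vertices, the latter moved to
  \<open>{1..l}\<close> so that codes for different \<open>n\<close> are comparable.\<close>

definition code :: "nat => nat => (nat \<times> nat => bool) => edges \<times> edges" where
 "code l n w = ({e : vertex_pairs l. w e}, {e : vertex_pairs l. w (shp l n e)})"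

text \<open>Edge probabilities depend on the distance only, so the shift preserves them, and the two
  ends involve disjoint pairs. What matters is that the right-hand side is free of
  \<open>n\<close>.\<close>

lemma code_prob:
 assumes n: "2 * l < n" and g: "g1 \<subseteq> vertex_pairs l" "g2 \<subseteq> vertex_pairs l"
 shows "Pr n {w. code l n w = (g1, g2)} = (\<Prod>e\<in>vertex_pairs l. if e : g1 then pe \<alpha> e else 1 - pe \<alpha> e) *
  (\<Prod>e\<in>vertex_pairs l. if e : g2 then pe \<alpha> e else 1 - pe \<alpha> e)"
proof -
 let ?P = "vertex_pairs l" and ?s = "shp l n"
 have inj: "inj_on ?s ?P" unfolding shp_def by (auto intro: inj_onI)
 have dis: "?P Int ?s ` ?P = {}" using n unfolding shp_def vertex_pairs_def by auto
 have sub: "?P Un ?s ` ?P \<subseteq> vertex_pairs n" using n unfolding shp_def vertex_pairs_def by auto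
 let ?H = "g1 Un ?s ` g2"
 have H1: "e : ?H \<longleftrightarrow> e : g1" if "e : ?P" for e using that dis g by blast
 have H2: "?s e : ?H \<longleftrightarrow> e : g2" if "e : ?P" for e using that dis g inj by (auto dest: inj_onD)
 have im: "(\<forall>e\<in>?s ` ?P. Q e) = (\<forall>e\<in>?P. Q (?s e))" for Q by blast
 have "{w. code l n w = (g1, g2)} = {w. \<forall>e\<in>?P Un ?s ` ?P. w e \<longleftrightarrow> e : ?H}"
 proof (rule set_eqI)
  fix w
  have "code l n w = (g1, g2) \<longleftrightarrow> (\<forall>e\<in>?P. w e \<longleftrightarrow> e : g1) & (\<forall>e\<in>?P. w (?s e) \<longleftrightarrow> e : g2)"
   unfolding code_def using g by auto
  also have "... \<longleftrightarrow> (\<forall>e\<in>?P. w e \<longleftrightarrow> e : ?H) & (\<forall>e\<in>?P. w (?s e) \<longleftrightarrow> ?s e : ?H)"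
   using H1 H2 by (intro conj_cong ball_cong) auto
  also have "... \<longleftrightarrow> (\<forall>e\<in>?P Un ?s ` ?P. w e \<longleftrightarrow> e : ?H)" by (simp only: ball_Un im)
  finally show "w : {w. code l n w = (g1, g2)} \<longleftrightarrow> w : {w. \<forall>e\<in>?P Un ?s ` ?P. w e \<longleftrightarrow> e : ?H}" unfolding mem_Collect_eq .
 qed
 hence "Pr n {w. code l n w = (g1, g2)} = (\<Prod>e\<in>?P Un ?s ` ?P. if e : ?H then pe \<alpha> e else 1 - pe \<alpha> e)"
  using prob_pattern_eq[OF sub, of ?H] by (simp only:)
 also have "... = (\<Prod>e\<in>?P. if e : ?H then pe \<alpha> e else 1 - pe \<alpha> e) * (\<Prod>e\<in>?s ` ?P. if e : ?H then pe \<alpha> e else 1 - pe \<alpha> e)"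
  by (rule prod.union_disjoint[OF _ _ dis]) auto
 also have "(\<Prod>e\<in>?s ` ?P. if e : ?H then pe \<alpha> e else 1 - pe \<alpha> e) = (\<Prod>e\<in>?P. if ?s e : ?H then pe \<alpha> (?s e) else 1 - pe \<alpha> (?s e))"
  by (simp add: prod.reindex[OF inj])
 also have "... = (\<Prod>e\<in>?P. if e : g2 then pe \<alpha> e else 1 - pe \<alpha> e)"
  using H2 by (intro prod.cong refl) (auto simp: shp_def)
 also have "(\<Prod>e\<in>?P. if e : ?H then pe \<alpha> e else 1 - pe \<alpha> e) = (\<Prod>e\<in>?P. if e : g1 then pe \<alpha> e else 1 - pe \<alpha> e)"
  using H1 by (intro prod.cong refl) auto
 finally show ?thesis .
qed

text \<open>Without links between the ends, equal codes give an isomorphism that shifts the right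
  end, so any number of rounds is won.\<close>

lemma ends_ef:
 assumes n: "2 * l < n" "2 * l < n'" and l: "1 <= l" and c: "code l n w = code l n' w'"
  and no: "~ (\<exists>u\<in>{1..l}. \<exists>v\<in>{n - l + 1..n}. (u, v) : vertex_pairs n & w (u, v))"
   "~ (\<exists>u\<in>{1..l}. \<exists>v\<in>{n' - l + 1..n'}. (u, v) : vertex_pairs n' & w' (u, v))"
 shows "ef q (ends l n) (RR n w) (ends l n') (RR n' w') {(1, 1), (n, n')}"
proof -
 define f where "f a = (if a <= l then a else a + n' - n)" for a
 have shape: "(1 <= a & a <= l & f a = a) \<or> (\<exists>i. 1 <= i & i <= l & a = n - l + i & f a = n' - l + i)" if "a : ends l n" for a
 proof (cases "a <= l")
  case True
  thus ?thesis using that unfolding ends_def f_def by auto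
 next
  case False
  hence "n - l + 1 <= a" "a <= n" using that unfolding ends_def by auto
  thus ?thesis using False n unfolding f_def by (intro disjI2 exI[of _ "a - (n - l)"]) auto
 qed
 have less: "(a, b) : RR n w \<longleftrightarrow> (f a, f b) : RR n' w'" if a: "a : ends l n" and b: "b : ends l n" and ab: "a < b" for a b
 proof -
  consider (ll) "1 <= a" "a <= l" "f a = a" "1 <= b" "b <= l" "f b = b"
   | (lr) i where "1 <= a" "a <= l" "f a = a" "1 <= i" "i <= l" "b = n - l + i" "f b = n' - l + i"
   | (rl) "b <= l" "n - l < a"
   | (rr) i j where "1 <= i" "i <= l" "a = n - l + i" "f a = n' - l + i" "1 <= j" "j <= l" "b = n - l + j" "f b = n' - l + j"
   using shape[OF a] shape[OF b] by fastforce
  thus ?thesis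
  proof cases
   case ll
   hence e: "(a, b) : vertex_pairs l" using ab unfolding vertex_pairs_def by simp
   hence "w (a, b) \<longleftrightarrow> w' (a, b)" using c unfolding code_def by blast
   thus ?thesis using ll ab n RR_less[of a b] unfolding vertex_pairs_def by simp
  next
   case lr
   have m: "a : {1..l}" "b : {n - l + 1..n}" "f a : {1..l}" "f b : {n' - l + 1..n'}" using lr n by auto
   have "(a, b) ~: RR n w" using no(1) m(1,2) RR_less[OF ab, of n w] by blast
   moreover have "f a < f b" using lr n by simp
   moreover have "(f a, f b) ~: RR n' w'" using no(2) m(3,4) RR_less[OF \<open>f a < f b\<close>, of n' w'] by blast
   ultimately show ?thesis by simp
  next
   case rl
   thus ?thesis using ab n by simp
  next
   case rr
   have ij: "i < j" using ab rr by simp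
   have e: "(i, j) : vertex_pairs l" using rr ij unfolding vertex_pairs_def by simp
   have "w (shp l n (i, j)) \<longleftrightarrow> w' (shp l n' (i, j))" using c e unfolding code_def by blast
   hence "w (a, b) \<longleftrightarrow> w' (f a, f b)" using rr unfolding shp_def by simp
   moreover have "f a < f b" using rr ij by simp
   moreover have "(a, b) : vertex_pairs n" "(f a, f b) : vertex_pairs n'" using rr ij n unfolding vertex_pairs_def by auto
   ultimately show ?thesis using RR_less[OF ab] RR_less[of "f a" "f b"] by simp
  qed
 qed
 define p p' where "p = n - l" and "p' = n' - l"
 have pl: "l < p" "l < p'" using n unfolding p_def p'_def by auto
 have fp: "f a = (if a <= l then a else a - p + p')" and pa: "a <= l \<or> p < a" if "a : ends l n" for a
  using that n unfolding f_def p_def p'_def ends_def by auto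
 have inj: "f a = f b \<longleftrightarrow> a = b" if "a : ends l n" "b : ends l n" for a b
  using fp[OF that(1)] fp[OF that(2)] pa[OF that(1)] pa[OF that(2)] pl by (cases "a <= l"; cases "b <= l"; simp only: if_True if_False; arith)
 show ?thesis
 proof (rule ef_of_iso[where f = f])
  show "bij_betw f (ends l n) (ends l n')"
   unfolding bij_betw_def
  proof
   show "inj_on f (ends l n)" using inj by (auto intro: inj_onI)
   show "f ` ends l n = ends l n'"
   proof
    show "f ` ends l n \<subseteq> ends l n'"
    proof (rule image_subsetI)
     fix a assume "a : ends l n"
     from shape[OF this] show "f a : ends l n'" using n unfolding ends_def by auto
    qed
    show "ends l n' \<subseteq> f ` ends l n"
    proof
     fix b assume b: "b : ends l n'"
     show "b : f ` ends l n"
     proof (cases "b <= l")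
      case True
      thus ?thesis using b n unfolding ends_def f_def by (intro image_eqI[of _ _ b]) auto
     next
      case False
      thus ?thesis using b n unfolding ends_def f_def by (intro image_eqI[of _ _ "b + n - n'"]) auto
     qed
    qed
   qed
  qed
  show "(a, b) : RR n w \<longleftrightarrow> (f a, f b) : RR n' w'" if ab: "a : ends l n" "b : ends l n" for a b
  proof -
   have s: "(u, v) : RR n w \<longleftrightarrow> (v, u) : RR n w" for u v n w using sym_RR[of n w] by (meson symD)
   have irr: "(u, u) ~: RR n w" for u n w unfolding RR_iff vertex_pairs_def by simp
   consider "a < b" | "b < a" | "a = b" by linarith
   thus ?thesis using less[OF ab] less[OF ab(2,1)] s irr by cases metis+
  qed
  show "b = Suc a \<longleftrightarrow> f b = Suc (f a)" if "a : ends l n" "b : ends l n" for a b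
   using fp[OF that(1)] fp[OF that(2)] pa[OF that(1)] pa[OF that(2)] pl by (cases "a <= l"; cases "b <= l"; simp only: if_True if_False; arith)
  have "f 1 = 1" "f n = n'" using l n unfolding f_def by auto
  moreover have "1 : ends l n" "n : ends l n" using l n unfolding ends_def by auto
  ultimately show "{(1, 1), (n, n')} \<subseteq> (%a. (a, f a)) ` ends l n" by force
 qed
qed

text \<open>The exceptional event \<open>bd\<close> collects closures leaving the ends, links
  between the ends and failing axioms, each eventually of probability at most \<eta>. Off this event
  \<open>same\<close> makes the truth of \<phi> a function of the code.\<close>

lemma convergence:
 assumes \<phi>: "sentence \<phi>"
 shows "convergent (%n. Pr n {w. struct_of n w \<Turnstile> \<phi>})"
proof -
 define t where "t n = Pr n {w. struct_of n w \<Turnstile> \<phi>}" for n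
 obtain A m q' where A: "finite A" "1 <= m" "\<forall>(h, k, N)\<in>A. 1 <= k" and
  st: "!!n R n' R' P. graph_on n R ==> graph_on n' R' ==> (\<forall>(h, k, N)\<in>A. ext_ax h k N n R & ext_ax h k N n' R') ==>
   finite P ==> card (fst ` P) <= 2 ==> (1, 1) : P ==> (n, n') : P ==>
   ef q' (cl R {1..n} m (fst ` P)) R (cl R' {1..n'} m (snd ` P)) R' P ==> ef (qrank \<phi>) {1..n} R {1..n'} R' P"
  using strategy[of 2 "qrank \<phi>"] by blast
 have key: "\<exists>c. \<forall>\<^sub>F n in sequentially. \<bar>t n - c\<bar> <= 3 * \<eta>" if \<eta>: "0 < \<eta>" for \<eta>
 proof -
  obtain l where l: "1 <= l" and out: "!!n. Pr n {w. ~ cl (RR n w) {1..n} m {1, n} \<subseteq> ends l n} <= \<eta>"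
   using closure_of_ends[OF A(2) \<eta>] by blast
  define Out where "Out n = {w. ~ cl (RR n w) {1..n} m {1, n} \<subseteq> ends l n}" for n
  define Lk where "Lk n = {w. \<exists>u\<in>{1..l}. \<exists>v\<in>{n - l + 1..n}. (u, v) : vertex_pairs n & w (u, v)}" for n
  define Ex where "Ex n = (\<Union>z\<in>A. {w. ~ (case z of (h, k, N) => ext_ax h k N n (RR n w))})" for n
  define bd where "bd n = Out n Un (Lk n Un Ex n)" for n
  have exl: "(%n. \<Sum>z\<in>A. Pr n {w. ~ (case z of (h, k, N) => ext_ax h k N n (RR n w))}) \<longlonglongrightarrow> 0"
  proof (rule tendsto_null_sum)
   fix z assume z: "z : A"
   obtain h k N where zz: "z = (h, k, N)" by (metis prod.exhaust)
   have "1 <= k" using A(3) z unfolding zz by auto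
   from ext_ax_whp[OF this, of h N] show "(%n. Pr n {w. ~ (case z of (h, k, N) => ext_ax h k N n (RR n w))}) \<longlonglongrightarrow> 0" unfolding zz by simp
  qed
  have "\<forall>\<^sub>F n in sequentially. (\<Sum>z\<in>A. Pr n {w. ~ (case z of (h, k, N) => ext_ax h k N n (RR n w))}) < \<eta>"
   using order_tendstoD(2)[OF exl \<eta>] .
  moreover have "\<forall>\<^sub>F n in sequentially. Pr n (Lk n) < \<eta>"
   unfolding Lk_def using order_tendstoD(2)[OF links_vanish \<eta>] .
  ultimately have bdp: "\<forall>\<^sub>F n in sequentially. Pr n (bd n) <= 3 * \<eta>"
  proof eventually_elim
   case (elim n)
   have "Pr n (Ex n) <= (\<Sum>z\<in>A. Pr n {w. ~ (case z of (h, k, N) => ext_ax h k N n (RR n w))})"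
    unfolding Ex_def by (rule Pr_UN_le[OF A(1)])
   moreover have "Pr n (bd n) <= Pr n (Out n) + Pr n (Lk n Un Ex n)" unfolding bd_def by (rule Pr_Un_le)
   moreover have "Pr n (Lk n Un Ex n) <= Pr n (Lk n) + Pr n (Ex n)" by (rule Pr_Un_le)
   ultimately show ?case using elim out[of n] unfolding Out_def by linarith
  qed
  have same: "struct_of n w \<Turnstile> \<phi> \<longleftrightarrow> struct_of n' w' \<Turnstile> \<phi>"
   if n: "2 * l < n" "2 * l < n'" and w: "w ~: bd n" "w' ~: bd n'" and c: "code l n w = code l n' w'" for n n' w w'
  proof -
   let ?P = "{(1, 1), (n, n')}"
   have n1: "1 <= n" "1 <= n'" using n by auto
   have sub: "cl (RR n w) {1..n} m {1, n} \<subseteq> ends l n" "cl (RR n' w') {1..n'} m {1, n'} \<subseteq> ends l n'"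
    using w unfolding bd_def Out_def by auto
   have eU: "ends l n \<subseteq> {1..n}" "ends l n' \<subseteq> {1..n'}" using n unfolding ends_def by auto
   \<comment> \<open>The \<open>m\<close> extra rounds serve to pass from the ends to the closure of
     depth \<open>m\<close> inside them, which is the closure in the whole graph by
     \<open>cl_restrict\<close>.\<close>
   have e1: "ef (q' + m) (ends l n) (RR n w) (ends l n') (RR n' w') ?P"
    by (rule ends_ef[OF n l c]) (use w in \<open>auto simp: bd_def Lk_def\<close>)
   have im: "?P `` {1, n} = {1, n'}" using n by auto
   have b: "1 : cl (RR n w) (ends l n) m {1, n} & n : cl (RR n w) (ends l n) m {1, n}" if "2 * l < n" for n w
    using base_sub_cl[of "{1, n}" "ends l n" "RR n w" m] that l unfolding ends_def by auto
   have "ef q' (cl (RR n w) (ends l n) m {1, n}) (RR n w) (cl (RR n' w') (ends l n') m (?P `` {1, n})) (RR n' w') ?P"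
    by (rule ef_cl[OF e1]) (use b[OF n(1)] b[OF n(2)] im in auto)
   hence e2: "ef q' (cl (RR n w) {1..n} m {1, n}) (RR n w) (cl (RR n' w') {1..n'} m {1, n'}) (RR n' w') ?P"
    unfolding im cl_restrict[OF sub(1) eU(1)] cl_restrict[OF sub(2) eU(2)] .
   have ax: "\<forall>(h, k, N)\<in>A. ext_ax h k N n (RR n w) & ext_ax h k N n' (RR n' w')"
   proof
    fix z assume z: "z : A"
    have "case z of (h, k, N) => ext_ax h k N n (RR n w)" "case z of (h, k, N) => ext_ax h k N n' (RR n' w')"
     using w z unfolding bd_def Ex_def by blast+
    thus "case z of (h, k, N) => ext_ax h k N n (RR n w) & ext_ax h k N n' (RR n' w')" by (simp add: case_prod_beta)
   qed
   have e3: "ef (qrank \<phi>) {1..n} (RR n w) {1..n'} (RR n' w') ?P"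
    by (rule st[OF graph_on_RR[OF n1(1)] graph_on_RR[OF n1(2)] ax]) (use e2 in \<open>auto simp: card_insert_if\<close>)
   have rel: "univ (struct_of n w) = {1..n}" "rel_R (struct_of n w) = RR n w" for n w
    unfolding struct_of_def by (auto simp: RR_iff)
   have suc: "(a, b) : rel_S (struct_of n w) \<longleftrightarrow> b = Suc a" if "a : univ (struct_of n w)" "b : univ (struct_of n w)" for a b n w
    using that unfolding struct_of_def by auto
   have sat: "sat (struct_of n w) v \<phi> \<longleftrightarrow> sat (struct_of n' w') v' \<phi>" for v v'
    by (rule ef_sat[where q = "qrank \<phi>" and P = ?P]) (use e3 rel suc \<phi> in \<open>auto simp: sentence_def\<close>)
   have ne: "\<exists>v :: nat => nat. range v \<subseteq> univ (struct_of n w)" if "1 <= n" for n w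
    by (rule exI[of _ "%_. 1"]) (use that rel in auto)
   obtain v v' :: "nat => nat" where v: "range v \<subseteq> univ (struct_of n w)" "range v' \<subseteq> univ (struct_of n' w')"
    using ne[OF n1(1), of w] ne[OF n1(2), of w'] by blast
   show ?thesis unfolding models_def using sat v by blast
  qed
  define Gs where "Gs = Pow (vertex_pairs l) \<times> Pow (vertex_pairs l)"
  \<comment> \<open>The codes of unexceptional graphs satisfying \<phi>, for any \<open>n\<close>;
    so \<open>S\<close> does not depend on \<open>n\<close>, and by \<open>same\<close> membership
    in it decides \<phi> for every unexceptional graph.\<close>
  define S where "S = {g : Gs. \<exists>n>2 * l. \<exists>w. w ~: bd n & code l n w = g & struct_of n w \<Turnstile> \<phi>}"
  define pg where "pg g = (\<Prod>e\<in>vertex_pairs l. if e : fst g then pe \<alpha> e else 1 - pe \<alpha> e) *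
   (\<Prod>e\<in>vertex_pairs l. if e : snd g then pe \<alpha> e else 1 - pe \<alpha> e)" for g
  have fS: "finite S" unfolding S_def Gs_def by simp
  have codeS: "Pr n {w. code l n w : S} = (\<Sum>g\<in>S. pg g)" if n: "2 * l < n" for n
  proof -
   have "{w. code l n w : S} = (\<Union>g\<in>S. {w. code l n w = g})" by auto
   hence "Pr n {w. code l n w : S} = Pr n (\<Union>g\<in>S. {w. code l n w = g})" by (rule arg_cong)
   also have "... = (\<Sum>g\<in>S. Pr n {w. code l n w = g})"
    by (rule measure_pmf.finite_measure_finite_Union[OF fS]) (auto simp: disjoint_family_on_def)
   also have "... = (\<Sum>g\<in>S. pg g)"
   proof (rule sum.cong[OF refl])
    fix g assume "g : S"
    hence "fst g \<subseteq> vertex_pairs l" "snd g \<subseteq> vertex_pairs l" unfolding S_def Gs_def by auto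
    from code_prob[OF n this] show "Pr n {w. code l n w = g} = pg g" unfolding pg_def by simp
   qed
   finally show ?thesis .
  qed
  have "\<forall>\<^sub>F n in sequentially. \<bar>t n - (\<Sum>g\<in>S. pg g)\<bar> <= 3 * \<eta>"
   using bdp eventually_gt_at_top[of "2 * l"]
  proof eventually_elim
   case (elim n)
   have inG: "code l n w : Gs" for w unfolding code_def Gs_def by auto
   have iff: "struct_of n w \<Turnstile> \<phi> \<longleftrightarrow> code l n w : S" if w: "w ~: bd n" for w
   proof
    assume "struct_of n w \<Turnstile> \<phi>"
    thus "code l n w : S" unfolding S_def using inG elim(2) w by blast
   next
    assume "code l n w : S"
    then obtain n' w' where "2 * l < n'" "w' ~: bd n'" "code l n' w' = code l n w" "struct_of n' w' \<Turnstile> \<phi>" unfolding S_def by blast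
    thus "struct_of n w \<Turnstile> \<phi>" using same[OF elim(2) _ w] by metis
   qed
   have "t n <= Pr n ({w. code l n w : S} Un bd n)" unfolding t_def using iff by (intro Pr_mono) auto
   also have "... <= Pr n {w. code l n w : S} + Pr n (bd n)" by (rule Pr_Un_le)
   finally have 1: "t n <= (\<Sum>g\<in>S. pg g) + 3 * \<eta>" using codeS[OF elim(2)] elim(1) by simp
   have "Pr n {w. code l n w : S} <= Pr n ({w. struct_of n w \<Turnstile> \<phi>} Un bd n)" using iff by (intro Pr_mono) auto
   also have "... <= t n + Pr n (bd n)" unfolding t_def by (rule Pr_Un_le)
   finally have 2: "(\<Sum>g\<in>S. pg g) <= t n + 3 * \<eta>" using codeS[OF elim(2)] elim(1) by simp
   show ?case using 1 2 by linarith
  qed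
  thus ?thesis by blast
 qed
 have "Cauchy t"
 proof (rule metric_CauchyI)
  fix e :: real assume e: "0 < e"
  obtain c where "\<forall>\<^sub>F n in sequentially. \<bar>t n - c\<bar> <= 3 * (e / 8)" using key[of "e / 8"] e by auto
  then obtain M where M: "!!n. n \<ge> M ==> \<bar>t n - c\<bar> <= 3 * (e / 8)" by (auto simp: eventually_sequentially)
  have "dist (t a) (t b) < e" if "M <= a" "M <= b" for a b
   using M[OF that(1)] M[OF that(2)] e unfolding dist_real_def by linarith
  thus "\<exists>M. \<forall>a\<ge>M. \<forall>b\<ge>M. dist (t a) (t b) < e" by blast
 qed
 thus ?thesis using Cauchy_convergent unfolding t_def by blast
qed

end

theorem theorem4p1:
  fixes \<alpha> :: real
  assumes "0 < \<alpha>" and "\<alpha> < 1" and "\<alpha> \<notin> \<rat>"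
  shows "\<forall>\<phi>. sentence \<phi> \<longrightarrow>
           convergent (\<lambda>n. measure_pmf.prob (random_M1 \<alpha> n) {M. M \<Turnstile> \<phi>})"
proof (intro allI impI)
  fix \<phi> assume \<phi>: "sentence \<phi>"
  interpret irrational_exponent \<alpha> using assms by unfold_locales auto
  have "measure_pmf.prob (random_M1 \<alpha> n) {M. M \<Turnstile> \<phi>} = Pr n {w. struct_of n w \<Turnstile> \<phi>}" for n
    unfolding random_M1_def measure_map_pmf by (simp add: vimage_def)
  then show "convergent (\<lambda>n. measure_pmf.prob (random_M1 \<alpha> n) {M. M \<Turnstile> \<phi>})"
    using convergence[OF \<phi>] by simp
qed

end
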